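(* Assume (E1) and (E2), and let $v>0$ be the speed, i.e. the almost sure limit of $|X_n|/n$ under $\mathbb{P}^e$. Then there exists $\sigma^2>0$ such that, under the annealed law $\mathbb{P}^e$, \[ \sqrt{n}\left(\frac{|X_n|}{n}-v\right)\xrightarrow{d} Z,\qquad Z\sim \mathrm{Normal}(0,\sigma^2). \]
   Context: **Group and tree.** Let $k,r\ge 0$ be integers with $d:=2k+r\ge 3$. Let $G$ be the free product of $k$ copies of $\mathbb{Z}$, generated by $a_1,\dots,a_k$, and $r$ copies of $\mathbb{Z}_2$, generated by $b_1,\dots,b_r$ with $b_j^2=e$. Put $S=\{a_1,\dots,a_k,a_1^{-1},\dots,a_k^{-1},b_1,\dots,b_r\}$, so $|S|=d$ and $S$ is symmetric. The (left) Cayley graph of $G$ has vertex set $G$ and edges $\{x,y\}$ with $yx^{-1}\in S$. It is the $d$-regular tree $\mathbb{T}_d$, rooted at the identity $e$. The neighbours of $x$ are $N(x)=\{sx:s\in S\}$, and $|x|$ is the graph distance from $e$ to $x$. For $x\in G$, the translation $\theta_x(y)=yx$ is a tree automorphism. **Environment.** An environment is $\omega=(\omega(x,\cdot))_{x\in G}$, where each $\omega(x,\cdot)$ is a probability measure on $N(x)$. The environment law $\mathbb{P}$ satisfies: - (E1) $\mathbb{P}$ is a product measure invariant under all translations, $\mathbb{P}\circ\theta_x^{-1}=\mathbb{P}$. Equivalently, the random vectors $(\omega(x,sx))_{s\in S}$, $x\in G$, are independent and identically distributed. - (E2) There is $\epsilon>0$ with $\mathbb{P}(\omega(e,s)>\epsilon\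 \forall s\in S)=1$. **Walk.** Given $\omega$, $(X_n)_{n\ge0}$ is the Markov chain on $G$ with transition probabilities $\omega(x,y)$. Its quenched law started at $x$ is $\mathbf{P}^x_\omega$. The annealed law is $\mathbb{P}^x(\cdot)=\int \mathbf{P}^x_\omega(\cdot)\,\mathbb{P}(d\omega)$. *)

theory Defs
  imports "HOL-Probability.Probability"
begin

section \<open>The group G = Z^{*k} * Z_2^{*r} as reduced words\<close>

text \<open>Letters: A i True = a_(i+1), A i False = a_(i+1)^-1, B j = b_(j+1) (indices from 0).\<close>
datatype letter = A nat bool | B nat

fun linv :: "letter \<Rightarrow> letter" where
  "linv (A i b) = A i (\<not> b)"
| "linv (B j) = B j"

text \<open>Fixed enumeration of the generating set S (used to realise the random choice of a step).\<close>
definition Slist :: "nat \<Rightarrow> nat \<Rightarrow> letter list" where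
  "Slist k r = map (\<lambda>i. A i True) [0..<k] @ map (\<lambda>i. A i False) [0..<k] @ map B [0..<r]"

definition Sgen :: "nat \<Rightarrow> nat \<Rightarrow> letter set" where
  "Sgen k r = set (Slist k r)"

definition reduced :: "letter list \<Rightarrow> bool" where
  "reduced w \<longleftrightarrow> (\<forall>i. Suc i < length w \<longrightarrow> w ! Suc i \<noteq> linv (w ! i))"

text \<open>Elements of G: reduced words over S; the identity e is the empty word.\<close>
definition Gset :: "nat \<Rightarrow> nat \<Rightarrow> letter list set" where
  "Gset k r = {w. set w \<subseteq> Sgen k r \<and> reduced w}"

text \<open>Left multiplication x \<mapsto> s x by a generator s.  |x| is the word length.\<close>
fun lmul :: "letter \<Rightarrow> letter list \<Rightarrow> letter list" where
  "lmul s [] = [s]"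
| "lmul s (t # w) = (if t = linv s then w else s # t # w)"

section \<open>Environments\<close>

text \<open>An environment is \<omega> :: letter list \<Rightarrow> letter \<Rightarrow> real with \<omega> x s = \<omega>(x, s x).
  The law of a single vector (\<omega>(x, s x))_{s \<in> S} is a measure \<mu> on letter \<Rightarrow> real;
  the environment law (E1) is the i.i.d. product over G.\<close>
definition env_law :: "nat \<Rightarrow> nat \<Rightarrow> (letter \<Rightarrow> real) measure \<Rightarrow> (letter list \<Rightarrow> letter \<Rightarrow> real) measure" where
  "env_law k r \<mu> = PiM (Gset k r) (\<lambda>_. \<mu>)"

section \<open>The walk, realised by i.i.d. uniform random variables\<close>

text \<open>Given weights p on the letters (listed in a fixed order) and u \<in> [0,1], pick the letter
  whose cumulative interval contains u; if u is uniform and the weights sum to 1 then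
  letter s is picked with probability p s.\<close>
fun pick :: "(letter \<Rightarrow> real) \<Rightarrow> letter list \<Rightarrow> real \<Rightarrow> letter" where
  "pick p [] u = undefined"
| "pick p (s # rest) u = (if rest = [] \<or> u < p s then s else pick p rest (u - p s))"

text \<open>X_0 = e, X_{n+1} = s X_n where s is chosen with probability \<omega>(X_n, s X_n) using U_n.\<close>
fun walk :: "nat \<Rightarrow> nat \<Rightarrow> (letter list \<Rightarrow> letter \<Rightarrow> real) \<Rightarrow> (nat \<Rightarrow> real) \<Rightarrow> nat \<Rightarrow> letter list" where
  "walk k r \<omega> U 0 = []"
| "walk k r \<omega> U (Suc n) = lmul (pick (\<omega> (walk k r \<omega> U n)) (Slist k r) (U n)) (walk k r \<omega> U n)"

definition unif_seq :: "(nat \<Rightarrow> real) measure" where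
  "unif_seq = PiM UNIV (\<lambda>_::nat. uniform_measure lborel {0..1::real})"

text \<open>Annealed law P^e: joint law of environment and driving uniforms; under it the
  process walk k r \<omega> U has the annealed law of (X_n) started at e.\<close>
definition annealed :: "nat \<Rightarrow> nat \<Rightarrow> (letter \<Rightarrow> real) measure \<Rightarrow> ((letter list \<Rightarrow> letter \<Rightarrow> real) \<times> (nat \<Rightarrow> real)) measure" where
  "annealed k r \<mu> = env_law k r \<mu> \<Otimes>\<^sub>M unif_seq"

end

theory Submission
  imports Defs "HOL-Library.Sublist" "HOL-Real_Asymp.Real_Asymp"
begin

text \<open>
  Fix a generator \<open>s0\<close>. A regeneration is a time at which the walk enters the cone of a vertex \<open>s0 x\<close>
  for the first time and never leaves it again. The environment of a fresh cone is independent of the past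
  and has the same law for all cones of the same type, so the path segments between successive regenerations
  are independent and identically distributed.

  A small escape probability of a cone forces small escape probabilities in two disjoint subcones, so the
  escape probabilities have all negative moments; hence the probability to return from height \<open>h\<close> decays
  exponentially in \<open>h\<close>. Together with a count of the vertices visited on each level and of the visits to
  each vertex this bounds the tail of the regeneration times by a multiple of \<open>n\<^sup>-\<^sup>4\<close>.

  The reward of a segment is its height minus \<open>v\<close> times its duration. Its mean is zero since \<open>v\<close> is the
  speed, and its variance is positive. The central limit theorem for the sum of the first \<open>n / mT\<close> rewards,
  with \<open>mT\<close> the mean duration, carries over to the random number of segments up to time \<open>n\<close>, because the
  difference of the two sums is a martingale transform with small second moment, and from there to
  \<open>|X\<^sub>n| - v n\<close> by Slutsky's lemma.
\<close>

text \<open>The annealed walk is not Markov, and in a fixed environment the cones all differ. Each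
  estimate is therefore made in two stages: first in a fixed environment, in terms of escape
  probabilities of branches, then in the mean, where a branch not yet seen by the path is
  independent of it. These escape probabilities are positive, a fact extracted from the positive
  speed, but no uniform lower bound is at hand; only their moments are controlled, so the tail of
  the regeneration times is polynomial. Order 4 gives the durations a second moment and makes the
  longest of \<open>n\<close> of them negligible against \<open>sqrt n\<close>, because
  \<open>n / (sqrt n) ^ 4\<close> tends to 0.

  A regeneration looks into the future and cannot serve as a stopping time. Attempts at widely
  spaced levels replace it, each judged as soon as the next level is reached. Walks are recorded by
  their letters: these do not change under translation, and their finite initial pieces are
  countable, so that conditioning on a random time is a countable sum.\<close>

instance letter :: countable
  by countable_datatype

section \<open>Reduced words and paths\<close>

lemma linv_linv [simp]: "linv (linv s) = s"
  by (cases s) auto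

lemma linv_eq_iff: "linv s = t \<longleftrightarrow> s = linv t"
  by auto

lemma reduced_Cons2: "reduced (s # t # w) \<longleftrightarrow> t \<noteq> linv s \<and> reduced (t # w)"
proof
  assume a: "reduced (s # t # w)"
  have "t \<noteq> linv s" using a[unfolded reduced_def, rule_format, of 0] by simp
  moreover have "reduced (t # w)"
    unfolding reduced_def
  proof (intro allI impI)
    fix i assume "Suc i < length (t # w)"
    then show "(t # w) ! Suc i \<noteq> linv ((t # w) ! i)"
      using a[unfolded reduced_def, rule_format, of "Suc i"] by simp
  qed
  ultimately show "t \<noteq> linv s \<and> reduced (t # w)" by simp
next
  assume a: "t \<noteq> linv s \<and> reduced (t # w)"
  show "reduced (s # t # w)"
    unfolding reduced_def
  proof (intro allI impI)
    fix i assume "Suc i < length (s # t # w)"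
    then show "(s # t # w) ! Suc i \<noteq> linv ((s # t # w) ! i)"
      using a unfolding reduced_def by (cases i) auto
  qed
qed

lemma reduced_Nil [simp]: "reduced []" and reduced_single [simp]: "reduced [s]"
  by (auto simp: reduced_def)

lemma reduced_ConsD: "reduced (s # w) \<Longrightarrow> reduced w"
  by (cases w) (auto simp: reduced_Cons2)

lemma reduced_appendD: "reduced (u @ w) \<Longrightarrow> reduced u \<and> reduced w"
proof (induction u)
  case (Cons s u)
  then show ?case by (cases u) (auto simp: reduced_Cons2 dest: reduced_ConsD)
qed simp

text \<open>Reducedness only compares neighbouring letters, so an overlap of one letter is enough
  for gluing. This is why a cone can be moved by exchanging the base word.\<close>

lemma reduced_glue: "reduced (u @ [t]) \<Longrightarrow> reduced (t # w) \<Longrightarrow> reduced (u @ t # w)"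
proof (induction u)
  case (Cons s u)
  then show ?case by (cases u) (auto simp: reduced_Cons2)
qed simp

lemma lmul_cases: "(\<exists>w. x = linv s # w \<and> lmul s x = w) \<or> (lmul s x = s # x \<and> (x = [] \<or> hd x \<noteq> linv s))"
  by (cases x) auto

lemma lmul_append: "u \<noteq> [] \<Longrightarrow> lmul s (u @ w) = lmul s u @ w"
  by (cases u) auto

lemma last_lmul: "u \<noteq> [] \<Longrightarrow> lmul s u \<noteq> [] \<Longrightarrow> last (lmul s u) = last u"
  by (cases u) auto

lemma length_lmul_le: "length (lmul s x) \<le> Suc (length x)"
  and length_le_lmul: "length x \<le> Suc (length (lmul s x))"
  by (cases x; auto)+

section \<open>Walks as successive left multiplications\<close>

definition run :: "letter list \<Rightarrow> letter list \<Rightarrow> letter list" where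
  "run x \<pi> = foldl (\<lambda>y s. lmul s y) x \<pi>"

lemma run_Nil [simp]: "run x [] = x"
  and run_Cons [simp]: "run x (s # \<pi>) = run (lmul s x) \<pi>"
  by (simp_all add: run_def)

lemma run_append: "run x (\<pi> @ \<rho>) = run (run x \<pi>) \<rho>"
  by (simp add: run_def)

lemma run_snoc: "run x (\<pi> @ [s]) = lmul s (run x \<pi>)"
  by (simp add: run_append)

lemma run_take_Suc: "m < length \<pi> \<Longrightarrow> run x (take (Suc m) \<pi>) = lmul (\<pi> ! m) (run x (take m \<pi>))"
  by (simp add: take_Suc_conv_app_nth run_snoc)

lemma run_stake_Suc: "run x (stake (Suc n) \<sigma>) = lmul (\<sigma> !! n) (run x (stake n \<sigma>))"
  by (simp only: stake_Suc run_snoc)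

lemma stake_add_run: "run x (stake (m + n) \<sigma>) = run (run x (stake m \<sigma>)) (stake n (sdrop m \<sigma>))"
  by (simp only: stake_add[symmetric] run_append)

lemma length_run_le: "length (run x \<pi>) \<le> length x + length \<pi>"
  and length_le_run: "length x \<le> length (run x \<pi>) + length \<pi>"
proof (induction \<pi> rule: rev_induct)
  case (snoc s \<pi>)
  { case 1 show ?case using snoc(1) length_lmul_le[of s "run x \<pi>"] by (simp add: run_snoc) }
  { case 2 show ?case using snoc(2) length_le_lmul[of "run x \<pi>" s] by (simp add: run_snoc) }
qed simp_all

text \<open>Left multiplication touches only the front of the word, so the base \<open>w\<close>
  matters only after \<open>u\<close> has been used up. Nonemptiness is asked strictly before the
  end; the identity thus still covers the moment of exit.\<close>

lemma run_app_base:
  assumes "\<And>m. m < length \<pi> \<Longrightarrow> run u (take m \<pi>) \<noteq> []"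
  shows "run (u @ w) \<pi> = run u \<pi> @ w"
  using assms
proof (induction \<pi> rule: rev_induct)
  case (snoc s \<pi>)
  have "run u \<pi> \<noteq> []" using snoc(2)[of "length \<pi>"] by simp
  moreover have "run (u @ w) \<pi> = run u \<pi> @ w"
  proof (rule snoc(1))
    fix m assume "m < length \<pi>"
    then show "run u (take m \<pi>) \<noteq> []" using snoc(2)[of m] by simp
  qed
  ultimately show ?case by (simp add: run_snoc lmul_append)
qed simp

lemma run_stake_app_base:
  assumes "\<And>m. m < n \<Longrightarrow> run u (stake m \<sigma>) \<noteq> []"
  shows "run (u @ w) (stake n \<sigma>) = run u (stake n \<sigma>) @ w"
  by (rule run_app_base) (use assms in \<open>simp add: take_stake min_def\<close>)

lemma last_run:
  assumes "\<And>m. m \<le> length \<pi> \<Longrightarrow> run u (take m \<pi>) \<noteq> []"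
  shows "last (run u \<pi>) = last u"
  using assms
proof (induction \<pi> rule: rev_induct)
  case (snoc s \<pi>)
  have a: "run u (take m \<pi>) \<noteq> []" if "m \<le> length \<pi>" for m
    using snoc(2)[of m] that by simp
  have "run u \<pi> \<noteq> []" "run u (\<pi> @ [s]) \<noteq> []" using a[of "length \<pi>"] snoc(2)[of "Suc (length \<pi>)"] by auto
  then show ?case using snoc(1)[OF a] by (simp add: run_snoc last_lmul)
qed simp

text \<open>Words are multiplied from the left, so the vertices of the subtree (cone) below \<open>x\<close> are the words
  with suffix \<open>x\<close>.\<close>

lemma suffix_enter:
  assumes "\<not> suffix x y" "suffix x (lmul s y)"
  shows "lmul s y = x"
proof -
  consider w where "y = linv s # w" "lmul s y = w" | "lmul s y = s # y"
    using lmul_cases[of y s] by blast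
  then show ?thesis
  proof cases
    case 1
    then show ?thesis using assms by (auto simp: suffix_Cons)
  next
    case 2
    then show ?thesis using assms by (auto simp: suffix_Cons)
  qed
qed

text \<open>A walk in the cone of \<open>t # w\<close> is, up to translation, a walk started at the
  one-letter word \<open>[t]\<close>; reaching the empty word means leaving the cone.\<close>

definition stay :: "letter \<Rightarrow> letter stream set" where
  "stay t = {\<sigma>. \<forall>n. run [t] (stake n \<sigma>) \<noteq> []}"

text \<open>\<open>cone_local t D\<close>: membership in \<open>D\<close> is decided by the path up to its exit from the cone.\<close>

definition cone_local :: "letter \<Rightarrow> letter stream set \<Rightarrow> bool" where
  "cone_local t D \<longleftrightarrow> (\<forall>\<sigma> \<sigma>'. (\<forall>n. (\<forall>m<n. run [t] (stake m \<sigma>) \<noteq> []) \<longrightarrow> stake n \<sigma> = stake n \<sigma>') \<longrightarrow> \<sigma> \<in> D \<longrightarrow> \<sigma>' \<in> D)"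

lemma stream_eqI_stake: "(\<And>n. stake n \<sigma> = stake n \<sigma>') \<Longrightarrow> \<sigma> = \<sigma>'"
proof -
  assume a: "\<And>n. stake n \<sigma> = stake n \<sigma>'"
  have "\<sigma> !! n = \<sigma>' !! n" for n
    using arg_cong[OF a[of "Suc n"], of "\<lambda>xs. xs ! n"] by (simp only: stake_nth lessI)
  then show ?thesis using smap_alt[of id \<sigma> \<sigma>'] by (simp add: stream.map_id0)
qed

text \<open>A path in \<open>stay t\<close> never exits, so agreement up to the exit is agreement of
  the whole streams.\<close>

lemma cone_local_subset_stay:
  assumes "D \<subseteq> stay t"
  shows "cone_local t D"
  unfolding cone_local_def
proof (intro allI impI)
  fix \<sigma> \<sigma>' assume a: "\<forall>n. (\<forall>m<n. run [t] (stake m \<sigma>) \<noteq> []) \<longrightarrow> stake n \<sigma> = stake n \<sigma>'" and b: "\<sigma> \<in> D"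
  have "\<forall>n. run [t] (stake n \<sigma>) \<noteq> []" using b assms by (auto simp: stay_def)
  then have "stake n \<sigma> = stake n \<sigma>'" for n using a by blast
  then have "\<sigma> = \<sigma>'" by (rule stream_eqI_stake)
  with b show "\<sigma>' \<in> D" by simp
qed

lemma stay_suffix_iff:
  assumes "x = t # w"
  shows "\<sigma> \<in> stay t \<longleftrightarrow> (\<forall>n. suffix x (run x (stake n \<sigma>)))"
proof
  assume a: "\<sigma> \<in> stay t"
  show "\<forall>n. suffix x (run x (stake n \<sigma>))"
  proof
    fix n
    have nz: "\<And>m. run [t] (stake m \<sigma>) \<noteq> []" using a by (simp add: stay_def)
    have "run ([t] @ w) (stake n \<sigma>) = run [t] (stake n \<sigma>) @ w"
      by (rule run_stake_app_base) (use nz in auto)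
    moreover have "last (run [t] (stake n \<sigma>)) = t"
      using last_run[of "stake n \<sigma>" "[t]"] nz by (simp add: take_stake)
    then have "run [t] (stake n \<sigma>) = butlast (run [t] (stake n \<sigma>)) @ [t]"
      using nz[of n] by (metis append_butlast_last_id)
    ultimately have "run x (stake n \<sigma>) = butlast (run [t] (stake n \<sigma>)) @ x"
      by (simp add: assms)
    then show "suffix x (run x (stake n \<sigma>))" by (metis suffixI)
  qed
next
  assume a: "\<forall>n. suffix x (run x (stake n \<sigma>))"
  have "run [t] (stake n \<sigma>) \<noteq> []" for n
  \<comment> \<open>Had the walk left for the first time at time \<open>n\<close>, it would stand at
    \<open>w\<close>, which is too short to have the suffix \<open>x\<close>.\<close>
  proof (induction n rule: less_induct)
    case (less n)
    have "run ([t] @ w) (stake n \<sigma>) = run [t] (stake n \<sigma>) @ w"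
      by (rule run_stake_app_base) (use less in auto)
    then show ?case using a[rule_format, of n] by (auto simp: assms dest: suffix_length_le)
  qed
  then show "\<sigma> \<in> stay t" by (simp add: stay_def)
qed

section \<open>The law of the sequence of steps\<close>

lemma stream_eqI_nth: "(\<And>n. \<sigma> !! n = \<sigma>' !! n) \<Longrightarrow> \<sigma> = \<sigma>'"
  using smap_alt[of id \<sigma> \<sigma>'] by (simp add: stream.map_id0)

lemma pick_in_set: "xs \<noteq> [] \<Longrightarrow> pick p xs u \<in> set xs"
  by (induction xs arbitrary: u) auto

lemma pick_measurable:
  assumes "\<And>s. s \<in> set xs \<Longrightarrow> (\<lambda>z. f z s) \<in> borel_measurable M" "g \<in> borel_measurable M"
  shows "(\<lambda>z. pick (f z) xs (g z)) \<in> measurable M (count_space UNIV)"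
  using assms
proof (induction xs arbitrary: g)
  case (Cons s xs)
  have [measurable]: "(\<lambda>z. f z s) \<in> borel_measurable M" "g \<in> borel_measurable M" using Cons by auto
  have "(\<lambda>z. pick (f z) xs (g z - f z s)) \<in> measurable M (count_space UNIV)"
    by (rule Cons.IH) (use Cons.prems in auto)
  note [measurable] = this
  show ?case by simp
qed simp

lemma plus_image_eq: "(+) (a::real) ` R = {u. u - a \<in> R}"
proof (intro set_eqI iffI)
  fix u assume "u \<in> {u. u - a \<in> R}"
  then show "u \<in> (+) a ` R" by (intro image_eqI[of _ _ "u - a"]) auto
qed auto

text \<open>\<open>pick\<close> falls back on the last letter once the weights are exhausted;
  keeping \<open>u\<close> below the total weight avoids that case. The set for a letter of
  \<open>rest\<close> is the set belonging to \<open>rest\<close> alone, shifted by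
  \<open>p a\<close>, so translation invariance of \<open>lborel\<close> drives the
  induction.\<close>

lemma pick_emeasure_aux:
  fixes p :: "letter \<Rightarrow> real"
  assumes "distinct xs" "\<And>s. s \<in> set xs \<Longrightarrow> 0 \<le> p s" "s \<in> set xs"
  shows "emeasure lborel {u. 0 \<le> u \<and> u < sum p (set xs) \<and> pick p xs u = s} = ennreal (p s)"
  using assms
proof (induction xs)
  case (Cons a rest)
  show ?case
  proof (cases "rest = []")
    case True
    then have "{u. 0 \<le> u \<and> u < sum p (set (a # rest)) \<and> pick p (a # rest) u = s} = {0..<p a}"
      using Cons.prems(3) by auto
    then show ?thesis using Cons.prems True by simp
  next
    case False
    let ?R = "{u. 0 \<le> u \<and> u < sum p (set rest) \<and> pick p rest u = s}"
    have pos: "0 \<le> p a" "0 \<le> sum p (set rest)" using Cons.prems by (auto intro: sum_nonneg)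
    have an: "a \<notin> set rest" using Cons.prems by simp
    show ?thesis
    proof (cases "s = a")
      case True
      have "pick p rest u \<noteq> a" for u using pick_in_set[OF False, of p u] an by metis
      then have "{u. 0 \<le> u \<and> u < sum p (set (a # rest)) \<and> pick p (a # rest) u = s} = {0..<p a}"
        using False True pos an by auto
      then show ?thesis using pos True by simp
    next
      case sa: False
      then have "{u. 0 \<le> u \<and> u < sum p (set (a # rest)) \<and> pick p (a # rest) u = s} = (+) (p a) ` ?R"
        unfolding plus_image_eq using False pos an by auto
      moreover have "emeasure lborel ((+) (p a) ` ?R) = emeasure lborel ?R"
      proof -
        have m: "?R \<in> sets lborel" by measurable (rule pick_measurable; simp)
        have "emeasure lborel ?R = emeasure (distr lborel borel ((+) (- p a))) ?R"
          by (simp add: lborel_distr_plus)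
        also have "\<dots> = emeasure lborel ((+) (- p a) -` ?R \<inter> space lborel)"
          by (rule emeasure_distr) (use m in auto)
        also have "(+) (- p a) -` ?R \<inter> space lborel = (+) (p a) ` ?R"
          unfolding plus_image_eq by auto
        finally show ?thesis by simp
      qed
      moreover have "emeasure lborel ?R = ennreal (p s)"
        by (rule Cons.IH) (use Cons.prems sa in auto)
      ultimately show ?thesis by simp
    qed
  qed
qed simp

abbreviation unif :: "real measure" where
  "unif \<equiv> uniform_measure lborel {0..1}"

lemma prob_space_unif: "prob_space unif"
  by (rule prob_space_uniform_measure) auto

interpretation unif_seq: sequence_space unif
  using prob_space_unif by (simp add: sequence_space_def product_prob_space_def product_prob_space_axioms_def
      product_sigma_finite_def prob_space_imp_sigma_finite)

lemma pick_emeasure: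
  fixes p :: "letter \<Rightarrow> real"
  assumes "distinct xs" "\<And>s. s \<in> set xs \<Longrightarrow> 0 \<le> p s" "s \<in> set xs" "sum p (set xs) = 1"
  shows "emeasure unif {u. pick p xs u = s} = ennreal (p s)"
proof -
  have m: "{u. pick p xs u = s} \<in> sets lborel" by measurable (rule pick_measurable; simp)
  have "emeasure unif {u. pick p xs u = s} = emeasure lborel ({0..1} \<inter> {u. pick p xs u = s})"
    using m by (subst emeasure_uniform_measure) (auto simp: divide_ennreal_def)
  also have "\<dots> = emeasure lborel {u. 0 \<le> u \<and> u < sum p (set xs) \<and> pick p xs u = s}"
  proof (rule emeasure_eq_AE)
    \<comment> \<open>The closed unit interval and the half-open range differ only in the endpoint
      1.\<close>
    have "AE u in lborel. u \<noteq> (1::real)" by (rule AE_lborel_singleton)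
    then show "AE x in lborel. (x \<in> {0..1} \<inter> {u. pick p xs u = s}) = (x \<in> {u. 0 \<le> u \<and> u < sum p (set xs) \<and> pick p xs u = s})"
      by eventually_elim (use assms(4) in auto)
    show "{u. 0 \<le> u \<and> u < sum p (set xs) \<and> pick p xs u = s} \<in> sets lborel"
      by measurable (rule pick_measurable; simp)
    show "{0..1} \<inter> {u. pick p xs u = s} \<in> sets lborel" using m by auto
  qed
  also have "\<dots> = ennreal (p s)" by (rule pick_emeasure_aux) (use assms in auto)
  finally show ?thesis .
qed

section \<open>The measurable space of step sequences\<close>

abbreviation SS :: "letter stream measure" where
  "SS \<equiv> stream_space (count_space UNIV)"

lemma space_SS [simp]: "space SS = UNIV"
  by (simp add: space_stream_space)

lemma UNIV_SS [simp]: "UNIV \<in> sets SS"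
  using sets.top[of SS] by simp

lemma stake_measurable_SS [measurable]: "stake n \<in> measurable SS (count_space UNIV)"
  by (rule measurable_stake)

lemma stake_pred_sets: "{\<sigma>. P (stake n \<sigma>)} \<in> sets SS"
  using measurable_sets[OF stake_measurable_SS[of n], of "{x. P x}"] by (simp add: vimage_def)

lemma stake_sdrop_sets:
  assumes "D \<in> sets SS"
  shows "{\<sigma>. P (stake n \<sigma>) \<and> sdrop n \<sigma> \<in> D} \<in> sets SS"
proof -
  have "{\<sigma>. P (stake n \<sigma>) \<and> sdrop n \<sigma> \<in> D} = {\<sigma>. P (stake n \<sigma>)} \<inter> (sdrop n -` D \<inter> space SS)" by auto
  then show ?thesis using stake_pred_sets[of P n] measurable_sets[OF measurable_sdrop[of n] assms] by auto
qed

lemma stay_sets [measurable]: "stay t \<in> sets SS"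
proof -
  have "stay t = (\<Inter>n. {\<sigma>. run [t] (stake n \<sigma>) \<noteq> []})" by (auto simp: stay_def)
  then show ?thesis using stake_pred_sets[of "\<lambda>\<pi>. run [t] \<pi> \<noteq> []"] by auto
qed

lemma distinct_Slist: "distinct (Slist k r)"
  by (auto simp: Slist_def distinct_map inj_on_def)

lemma set_Slist: "set (Slist k r) = Sgen k r"
  by (simp add: Sgen_def)

lemma card_Sgen: "card (Sgen k r) = 2 * k + r"
  using distinct_card[OF distinct_Slist[of k r]] by (simp add: Sgen_def) (simp add: Slist_def)

lemma finite_Sgen [simp]: "finite (Sgen k r)"
  by (simp add: Sgen_def)

lemma linv_Sgen [simp]: "linv s \<in> Sgen k r \<longleftrightarrow> s \<in> Sgen k r"
  by (cases s) (auto simp: Sgen_def Slist_def)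

lemma lmul_Gset: "s \<in> Sgen k r \<Longrightarrow> x \<in> Gset k r \<Longrightarrow> lmul s x \<in> Gset k r"
  by (cases x) (auto simp: Gset_def reduced_Cons2 dest: reduced_ConsD)

lemma run_Gset: "set \<pi> \<subseteq> Sgen k r \<Longrightarrow> x \<in> Gset k r \<Longrightarrow> run x \<pi> \<in> Gset k r"
  by (induction \<pi> arbitrary: x) (auto simp: lmul_Gset)

lemma Nil_Gset [simp]: "[] \<in> Gset k r"
  by (simp add: Gset_def)

lemma single_Gset [simp]: "[t] \<in> Gset k r \<longleftrightarrow> t \<in> Sgen k r"
  by (simp add: Gset_def)

lemma Cons_Gset: "s # t # w \<in> Gset k r \<longleftrightarrow> s \<in> Sgen k r \<and> t \<noteq> linv s \<and> t # w \<in> Gset k r"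
  by (auto simp: Gset_def reduced_Cons2)

lemma Gset_suffix: "u @ w \<in> Gset k r \<Longrightarrow> u \<in> Gset k r \<and> w \<in> Gset k r"
  using reduced_appendD[of u w] by (simp add: Gset_def)

lemma countable_Gset: "countable (Gset k r)"
  by simp

section \<open>The model, and the walk from an arbitrary vertex\<close>

locale rwre =
  fixes k r :: nat and \<mu> :: "(letter \<Rightarrow> real) measure" and \<epsilon> :: real
  assumes d3: "2 * k + r \<ge> 3"
    and mu_prob: "prob_space \<mu>"
    and mu_sets: "sets \<mu> = sets (PiM (Sgen k r) (\<lambda>_. borel))"
    and mu_stoch: "AE p in \<mu>. (\<forall>s\<in>Sgen k r. 0 \<le> p s) \<and> (\<Sum>s\<in>Sgen k r. p s) = 1"
    and eps_pos: "\<epsilon> > 0"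
    and mu_ell: "AE p in \<mu>. \<forall>s\<in>Sgen k r. p s > \<epsilon>"
begin

abbreviation "S \<equiv> Sgen k r"
abbreviation "G \<equiv> Gset k r"
abbreviation "E \<equiv> env_law k r \<mu>"

lemma S_nonempty: "S \<noteq> {}"
  using card_Sgen[of k r] d3 by (intro notI) simp

lemma Slist_nonempty: "Slist k r \<noteq> []"
  using S_nonempty by (auto simp: Sgen_def)

text \<open>Branching of the tree: besides the way back and one more excluded direction there is
  always a way on. With only two generators this would fail.\<close>

lemma S_avoid2: "\<exists>s\<in>S. s \<noteq> a \<and> s \<noteq> b"
proof (rule ccontr)
  assume "\<not> ?thesis"
  then have "S \<subseteq> {a, b}" by auto
  then have "card S \<le> card {a, b}" by (intro card_mono) auto
  also have "\<dots> \<le> 2" by (simp add: card_insert_if)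
  finally show False using card_Sgen[of k r] d3 by simp
qed

sublocale mu: prob_space \<mu> by (rule mu_prob)

sublocale envp: product_prob_space "\<lambda>_::letter list. \<mu>" G
  by unfold_locales

sublocale env: prob_space E
  unfolding env_law_def by (rule envp.prob_space_axioms)

sublocale us: prob_space unif_seq
  unfolding unif_seq_def by (rule unif_seq.prob_space_axioms)

lemma mu_comp [measurable]: "s \<in> S \<Longrightarrow> (\<lambda>p. p s) \<in> borel_measurable \<mu>"
  by (subst measurable_cong_sets[OF mu_sets refl]) (rule measurable_component_singleton)

lemma env_coord: "x \<in> G \<Longrightarrow> (\<lambda>\<omega>. \<omega> x) \<in> measurable E \<mu>"
  unfolding env_law_def by (rule measurable_component_singleton)

lemma env_comp [measurable]: "x \<in> G \<Longrightarrow> s \<in> S \<Longrightarrow> (\<lambda>\<omega>. \<omega> x s) \<in> borel_measurable E"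
  using measurable_compose[OF env_coord mu_comp] by simp

text \<open>Quenched statements are proved for every such environment, so the exceptional null sets
  are disposed of once, in \<open>AE_good\<close>.\<close>

definition good :: "(letter list \<Rightarrow> letter \<Rightarrow> real) \<Rightarrow> bool" where
  "good \<omega> \<longleftrightarrow> \<omega> \<in> space E \<and> (\<forall>x\<in>G. (\<forall>s\<in>S. \<epsilon> < \<omega> x s) \<and> (\<Sum>s\<in>S. \<omega> x s) = 1)"

lemma AE_good: "AE \<omega> in E. good \<omega>"
proof -
  have "AE \<omega> in E. \<forall>x\<in>G. (\<forall>s\<in>S. \<epsilon> < \<omega> x s) \<and> (\<Sum>s\<in>S. \<omega> x s) = 1"
  proof (subst AE_ball_countable[OF countable_Gset], rule ballI)
    fix x assume x: "x \<in> G"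
    have "AE p in \<mu>. (\<forall>s\<in>S. \<epsilon> < p s) \<and> (\<Sum>s\<in>S. p s) = 1"
      using mu_ell mu_stoch by eventually_elim auto
    then show "AE \<omega> in E. (\<forall>s\<in>S. \<epsilon> < \<omega> x s) \<and> (\<Sum>s\<in>S. \<omega> x s) = 1"
      unfolding env_law_def using AE_PiM_component[of G "\<lambda>_. \<mu>" x "\<lambda>p. (\<forall>s\<in>S. \<epsilon> < p s) \<and> (\<Sum>s\<in>S. p s) = 1"] x mu_prob by blast
  qed
  then show ?thesis unfolding good_def by (auto intro: AE_mp)
qed

lemma goodD:
  assumes "good \<omega>" "x \<in> G"
  shows "s \<in> S \<Longrightarrow> \<epsilon> < \<omega> x s" "s \<in> S \<Longrightarrow> 0 \<le> \<omega> x s" "(\<Sum>s\<in>S. \<omega> x s) = 1" "s \<in> S \<Longrightarrow> \<omega> x s \<le> 1" "\<omega> \<in> space E"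
proof -
  show a: "s \<in> S \<Longrightarrow> \<epsilon> < \<omega> x s" for s using assms by (auto simp: good_def)
  show b: "s \<in> S \<Longrightarrow> 0 \<le> \<omega> x s" for s using a[of s] eps_pos by auto
  show c: "(\<Sum>s\<in>S. \<omega> x s) = 1" "\<omega> \<in> space E" using assms by (auto simp: good_def)
  show "s \<in> S \<Longrightarrow> \<omega> x s \<le> 1"
    using member_le_sum[of s S "\<omega> x"] b c by auto
qed

text \<open>\<open>walk\<close> starts at the identity, but the Markov property needs all starting
  points, with the same choice rule and the same uniforms.\<close>

primrec gwalk :: "(letter list \<Rightarrow> letter \<Rightarrow> real) \<Rightarrow> letter list \<Rightarrow> (nat \<Rightarrow> real) \<Rightarrow> nat \<Rightarrow> letter list" where
  "gwalk \<omega> x U 0 = x"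
| "gwalk \<omega> x U (Suc n) = lmul (pick (\<omega> (gwalk \<omega> x U n)) (Slist k r) (U n)) (gwalk \<omega> x U n)"

text \<open>The walk is recorded by its letters and not by its vertices: letters do not change when
  a cone is translated, and \<open>run\<close> recovers the vertices.\<close>

definition steps :: "(letter list \<Rightarrow> letter \<Rightarrow> real) \<Rightarrow> letter list \<Rightarrow> (nat \<Rightarrow> real) \<Rightarrow> letter stream" where
  "steps \<omega> x U = to_stream (\<lambda>n. pick (\<omega> (gwalk \<omega> x U n)) (Slist k r) (U n))"

lemma pick_S: "pick p (Slist k r) u \<in> S"
  using pick_in_set[OF Slist_nonempty] by (simp add: set_Slist)

lemma steps_nth: "steps \<omega> x U !! n = pick (\<omega> (gwalk \<omega> x U n)) (Slist k r) (U n)"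
  by (simp add: steps_def to_stream_def)

lemma run_steps: "run x (stake n (steps \<omega> x U)) = gwalk \<omega> x U n"
  by (induction n) (simp_all only: run_stake_Suc steps_nth gwalk.simps stake.simps(1) run_Nil)

lemma steps_in_S: "steps \<omega> x U !! n \<in> S"
  by (simp add: steps_nth pick_S)

lemma gwalk_Nil: "gwalk \<omega> [] U n = walk k r \<omega> U n"
  by (induction n) auto

lemma gwalk_shift: "gwalk \<omega> x U (Suc n) = gwalk \<omega> (lmul (pick (\<omega> x) (Slist k r) (U 0)) x) (\<lambda>n. U (Suc n)) n"
  by (induction n) auto

lemma steps_Cons: "steps \<omega> x U = pick (\<omega> x) (Slist k r) (U 0) ## steps \<omega> (lmul (pick (\<omega> x) (Slist k r) (U 0)) x) (\<lambda>n. U (Suc n))"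
proof -
  have "steps \<omega> x U !! n = (pick (\<omega> x) (Slist k r) (U 0) ## steps \<omega> (lmul (pick (\<omega> x) (Slist k r) (U 0)) x) (\<lambda>n. U (Suc n))) !! n" for n
  proof (cases n)
    case 0
    show ?thesis unfolding 0 steps_nth by simp
  next
    case (Suc m)
    show ?thesis unfolding Suc steps_nth gwalk_shift by (simp add: steps_nth)
  qed
  then show ?thesis by (rule stream_eqI_nth)
qed

lemma U_meas [measurable]: "(\<lambda>U. U n) \<in> borel_measurable unif_seq"
  unfolding unif_seq_def using measurable_component_singleton[of n UNIV "\<lambda>_. unif"]
  by (subst measurable_cong_sets[OF refl, of borel unif]) auto

lemma space_unif_seq [simp]: "space unif_seq = UNIV"
  by (simp add: unif_seq_def space_PiM)

lemma pick_joint_measurable: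
  assumes "x \<in> G"
  shows "(\<lambda>z. pick (fst z x) (Slist k r) (snd z n)) \<in> measurable (E \<Otimes>\<^sub>M unif_seq) (count_space UNIV)"
  by (rule pick_measurable) (use assms in \<open>auto simp: set_Slist intro!: measurable_compose[OF measurable_fst env_comp] measurable_compose[OF measurable_snd U_meas]\<close>)

lemma gwalk_measurable:
  assumes "x \<in> G"
  shows "(\<lambda>z. gwalk (fst z) x (snd z) n) \<in> measurable (E \<Otimes>\<^sub>M unif_seq) (count_space G)"
proof (induction n)
  case 0
  then show ?case using assms by simp
next
  case (Suc n)
  show ?case
  proof (simp, rule measurable_compose_countable'[OF _ Suc countable_Gset])
    fix y assume y: "y \<in> G"
    have "(\<lambda>z. lmul (pick (fst z y) (Slist k r) (snd z n)) y) \<in> measurable (E \<Otimes>\<^sub>M unif_seq) (count_space UNIV)"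
      by (rule measurable_compose[OF pick_joint_measurable[OF y]]) simp
    then show "(\<lambda>z. lmul (pick (fst z y) (Slist k r) (snd z n)) y) \<in> measurable (E \<Otimes>\<^sub>M unif_seq) (count_space G)"
      using y by (subst measurable_count_space_eq_countable) (auto simp: lmul_Gset pick_S measurable_count_space_eq_countable[of UNIV] countableI_type)
  qed
qed

lemma steps_measurable:
  assumes "x \<in> G"
  shows "(\<lambda>z. steps (fst z) x (snd z)) \<in> measurable (E \<Otimes>\<^sub>M unif_seq) SS"
proof (rule measurable_stream_space2)
  fix n
  show "(\<lambda>z. steps (fst z) x (snd z) !! n) \<in> measurable (E \<Otimes>\<^sub>M unif_seq) (count_space UNIV)"
    unfolding steps_nth
    by (rule measurable_compose_countable'[OF _ gwalk_measurable[OF assms] countable_Gset]) (rule pick_joint_measurable)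
qed

lemma steps_measurable_U:
  assumes "x \<in> G" "\<omega> \<in> space E"
  shows "steps \<omega> x \<in> measurable unif_seq SS"
  using measurable_compose[OF measurable_Pair1'[OF assms(2)] steps_measurable[OF assms(1)]] by simp

text \<open>\<open>qp \<omega> x\<close> and \<open>Aw x\<close> are the quenched and the annealed law of the sequence of steps \<open>X\<^sub>n\<^sub>+\<^sub>1 X\<^sub>n\<inverse>\<close> of the walk started at \<open>x\<close>.\<close>

definition qp :: "(letter list \<Rightarrow> letter \<Rightarrow> real) \<Rightarrow> letter list \<Rightarrow> letter stream set \<Rightarrow> real" where
  "qp \<omega> x D = measure unif_seq {U. steps \<omega> x U \<in> D}"

definition Aw :: "letter list \<Rightarrow> letter stream measure" where
  "Aw x = distr (E \<Otimes>\<^sub>M unif_seq) SS (\<lambda>z. steps (fst z) x (snd z))"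

lemma steps_vimage_sets:
  assumes "x \<in> G" "\<omega> \<in> space E" "D \<in> sets SS"
  shows "{U. steps \<omega> x U \<in> D} \<in> sets unif_seq"
  using measurable_sets[OF steps_measurable_U[OF assms(1,2)] assms(3)] by (simp add: vimage_def)

sublocale envU: pair_prob_space E unif_seq ..

lemma prob_space_Aw: "x \<in> G \<Longrightarrow> prob_space (Aw x)"
  unfolding Aw_def by (rule envU.prob_space_distr[OF steps_measurable])

lemma sets_Aw [simp]: "sets (Aw x) = sets SS" and space_Aw [simp]: "space (Aw x) = UNIV"
  by (simp_all add: Aw_def)

lemma qp_nonneg [simp]: "0 \<le> qp \<omega> x D" and qp_le_1 [simp]: "qp \<omega> x D \<le> 1"
  by (simp_all add: qp_def)

lemma qp_measurable [measurable]:
  assumes "x \<in> G" "D \<in> sets SS"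
  shows "(\<lambda>\<omega>. qp \<omega> x D) \<in> borel_measurable E"
proof -
  let ?V = "(\<lambda>z. steps (fst z) x (snd z)) -` D \<inter> space (E \<Otimes>\<^sub>M unif_seq)"
  have "?V \<in> sets (E \<Otimes>\<^sub>M unif_seq)"
    using measurable_sets[OF steps_measurable[OF assms(1)] assms(2)] .
  then have "(\<lambda>\<omega>. emeasure unif_seq (Pair \<omega> -` ?V)) \<in> borel_measurable E"
    by (rule us.measurable_emeasure_Pair)
  then have m: "(\<lambda>\<omega>. measure unif_seq (Pair \<omega> -` ?V)) \<in> borel_measurable E"
    unfolding measure_def by measurable
  have "measure unif_seq (Pair \<omega> -` ?V) = qp \<omega> x D" if "\<omega> \<in> space E" for \<omega>
    unfolding qp_def using that by (intro arg_cong[where f="measure unif_seq"]) (auto simp: space_pair_measure)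
  then show ?thesis using m by (subst measurable_cong[where g="\<lambda>\<omega>. measure unif_seq (Pair \<omega> -` ?V)"]) auto
qed

lemma qp_integrable: "x \<in> G \<Longrightarrow> D \<in> sets SS \<Longrightarrow> integrable E (\<lambda>\<omega>. qp \<omega> x D)"
  by (rule env.integrable_const_bound[where B=1]) auto

lemma Aw_eq:
  assumes "x \<in> G" "D \<in> sets SS"
  shows "measure (Aw x) D = (\<integral>\<omega>. qp \<omega> x D \<partial>E)"
proof -
  let ?V = "(\<lambda>z. steps (fst z) x (snd z)) -` D \<inter> space (E \<Otimes>\<^sub>M unif_seq)"
  have V: "?V \<in> sets (E \<Otimes>\<^sub>M unif_seq)"
    using measurable_sets[OF steps_measurable[OF assms(1)] assms(2)] .
  have "emeasure (Aw x) D = emeasure (E \<Otimes>\<^sub>M unif_seq) ?V"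
    unfolding Aw_def by (rule emeasure_distr[OF steps_measurable[OF assms(1)] assms(2)])
  also have "\<dots> = (\<integral>\<^sup>+\<omega>. emeasure unif_seq (Pair \<omega> -` ?V) \<partial>E)"
    by (rule us.emeasure_pair_measure_alt[OF V])
  also have "\<dots> = (\<integral>\<^sup>+\<omega>. ennreal (qp \<omega> x D) \<partial>E)"
  proof (rule nn_integral_cong)
    fix \<omega> assume w: "\<omega> \<in> space E"
    have "Pair \<omega> -` ?V = {U. steps \<omega> x U \<in> D}" using w by (auto simp: space_pair_measure)
    then show "emeasure unif_seq (Pair \<omega> -` ?V) = ennreal (qp \<omega> x D)"
      by (simp add: qp_def us.emeasure_eq_measure)
  qed
  also have "\<dots> = ennreal (\<integral>\<omega>. qp \<omega> x D \<partial>E)"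
    by (rule nn_integral_eq_integral[OF qp_integrable[OF assms]]) simp
  finally show ?thesis
    by (simp add: measure_def integral_nonneg_AE)
qed

text \<open>Markov property at time 1. \<open>unif_seq\<close> is the product of its first
  coordinate and a copy of itself, and the event becomes a rectangle whose first side is the set of
  \<open>u\<close> for which \<open>pick\<close> chooses \<open>s\<close>.\<close>

lemma qp_Cons:
  assumes w: "good \<omega>" and x: "x \<in> G" and s: "s \<in> S" and D: "D \<in> sets SS"
  shows "qp \<omega> x {\<sigma>. shd \<sigma> = s \<and> stl \<sigma> \<in> D} = \<omega> x s * qp \<omega> (lmul s x) D"
proof -
  have we: "\<omega> \<in> space E" using w by (simp add: good_def)
  have y: "lmul s x \<in> G" using lmul_Gset[OF s x] .
  have mf: "(\<lambda>(u, U). case_nat u U) \<in> measurable (unif \<Otimes>\<^sub>M unif_seq) unif_seq"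
    unfolding unif_seq_def by measurable
  have Dm: "{\<sigma>. shd \<sigma> = s \<and> stl \<sigma> \<in> D} \<in> sets SS"
    using stake_sdrop_sets[OF D, of "\<lambda>\<pi>. \<pi> = [s]" 1] by simp
  have "emeasure unif_seq {U. steps \<omega> x U \<in> {\<sigma>. shd \<sigma> = s \<and> stl \<sigma> \<in> D}}
      = emeasure (distr (unif \<Otimes>\<^sub>M unif_seq) unif_seq (\<lambda>(u, U). case_nat u U)) {U. steps \<omega> x U \<in> {\<sigma>. shd \<sigma> = s \<and> stl \<sigma> \<in> D}}"
    using unif_seq.PiM_iter by (simp add: unif_seq_def)
  also have "\<dots> = emeasure (unif \<Otimes>\<^sub>M unif_seq) ((\<lambda>(u, U). case_nat u U) -` {U. steps \<omega> x U \<in> {\<sigma>. shd \<sigma> = s \<and> stl \<sigma> \<in> D}} \<inter> space (unif \<Otimes>\<^sub>M unif_seq))"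
    by (rule emeasure_distr[OF mf steps_vimage_sets[OF x we Dm]])
  also have "(\<lambda>(u, U). case_nat u U) -` {U. steps \<omega> x U \<in> {\<sigma>. shd \<sigma> = s \<and> stl \<sigma> \<in> D}} \<inter> space (unif \<Otimes>\<^sub>M unif_seq)
     = {u. pick (\<omega> x) (Slist k r) u = s} \<times> {U. steps \<omega> (lmul s x) U \<in> D}"
    by (subst steps_Cons) (auto simp: space_pair_measure)
  also have "emeasure (unif \<Otimes>\<^sub>M unif_seq) \<dots> = emeasure unif {u. pick (\<omega> x) (Slist k r) u = s} * emeasure unif_seq {U. steps \<omega> (lmul s x) U \<in> D}"
  proof (rule us.emeasure_pair_measure_Times)
    have "{u. pick (\<omega> x) (Slist k r) u = s} \<in> sets lborel" by measurable (rule pick_measurable; simp)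
    then show "{u. pick (\<omega> x) (Slist k r) u = s} \<in> sets unif" by simp
  qed (rule steps_vimage_sets[OF y we D])
  also have "emeasure unif {u. pick (\<omega> x) (Slist k r) u = s} = ennreal (\<omega> x s)"
    by (rule pick_emeasure) (use distinct_Slist goodD[OF w x] s in \<open>auto simp: set_Slist\<close>)
  finally have "ennreal (qp \<omega> x {\<sigma>. shd \<sigma> = s \<and> stl \<sigma> \<in> D}) = ennreal (\<omega> x s) * ennreal (qp \<omega> (lmul s x) D)"
    by (simp add: qp_def us.emeasure_eq_measure)
  then have "ennreal (qp \<omega> x {\<sigma>. shd \<sigma> = s \<and> stl \<sigma> \<in> D}) = ennreal (\<omega> x s * qp \<omega> (lmul s x) D)"
    using goodD[OF w x] s by (simp add: ennreal_mult)
  then show ?thesis using goodD[OF w x] s by (subst (asm) ennreal_inj) auto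
qed

lemma qp_mono:
  assumes "x \<in> G" "\<omega> \<in> space E" "D' \<in> sets SS" "\<And>\<sigma>. \<sigma> \<in> D \<Longrightarrow> (\<And>n. \<sigma> !! n \<in> S) \<Longrightarrow> \<sigma> \<in> D'"
  shows "qp \<omega> x D \<le> qp \<omega> x D'"
  unfolding qp_def using assms(4) steps_in_S
  by (intro us.finite_measure_mono[OF _ steps_vimage_sets[OF assms(1,2,3)]]) auto

lemma qp_cong:
  assumes "\<And>\<sigma>. (\<And>n. \<sigma> !! n \<in> S) \<Longrightarrow> \<sigma> \<in> D \<longleftrightarrow> \<sigma> \<in> D'"
  shows "qp \<omega> x D = qp \<omega> x D'"
proof -
  have "{U. steps \<omega> x U \<in> D} = {U. steps \<omega> x U \<in> D'}" using assms steps_in_S by auto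
  then show ?thesis by (simp add: qp_def)
qed

lemma Stream_sets: "D \<in> sets SS \<Longrightarrow> {\<sigma>. s ## \<sigma> \<in> D} \<in> sets SS"
proof -
  assume "D \<in> sets SS"
  moreover have "(\<lambda>\<sigma>. s ## \<sigma>) \<in> measurable SS SS" by measurable
  ultimately show ?thesis using measurable_sets[of "\<lambda>\<sigma>. s ## \<sigma>" SS SS D] by (simp add: vimage_def)
qed

lemma qp_first_step:
  assumes w: "good \<omega>" and x: "x \<in> G" and D: "D \<in> sets SS"
  shows "qp \<omega> x D = (\<Sum>s\<in>S. \<omega> x s * qp \<omega> (lmul s x) {\<sigma>. s ## \<sigma> \<in> D})"
proof -
  have we: "\<omega> \<in> space E" using w by (simp add: good_def)
  let ?D = "\<lambda>s. {\<sigma>. shd \<sigma> = s \<and> stl \<sigma> \<in> {\<sigma>. s ## \<sigma> \<in> D}}"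
  have Dm: "?D s \<in> sets SS" for s
    using stake_sdrop_sets[OF Stream_sets[OF D, of s], of "\<lambda>\<pi>. \<pi> = [s]" 1] by simp
  have "{U. steps \<omega> x U \<in> D} = (\<Union>s\<in>S. {U. steps \<omega> x U \<in> ?D s})"
    using steps_in_S[of \<omega> x _ 0] by auto
  then have "qp \<omega> x D = measure unif_seq (\<Union>s\<in>S. {U. steps \<omega> x U \<in> ?D s})" by (simp add: qp_def)
  also have "\<dots> = (\<Sum>s\<in>S. measure unif_seq {U. steps \<omega> x U \<in> ?D s})"
    by (rule us.finite_measure_finite_Union) (use steps_vimage_sets[OF x we Dm] in \<open>auto simp: disjoint_family_on_def\<close>)
  also have "\<dots> = (\<Sum>s\<in>S. \<omega> x s * qp \<omega> (lmul s x) {\<sigma>. s ## \<sigma> \<in> D})"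
    by (rule sum.cong[OF refl]) (use qp_Cons[OF w x _ Stream_sets[OF D]] in \<open>simp add: qp_def\<close>)
  finally show ?thesis .
qed

primrec wt :: "(letter list \<Rightarrow> letter \<Rightarrow> real) \<Rightarrow> letter list \<Rightarrow> letter list \<Rightarrow> real" where
  "wt \<omega> x [] = 1"
| "wt \<omega> x (s # \<pi>) = \<omega> x s * wt \<omega> (lmul s x) \<pi>"

lemma stake_Cons_eq: "{\<sigma>. stake (length (s # \<pi>)) \<sigma> = s # \<pi> \<and> sdrop (length (s # \<pi>)) \<sigma> \<in> D}
   = {\<sigma>. shd \<sigma> = s \<and> stl \<sigma> \<in> {\<sigma>. stake (length \<pi>) \<sigma> = \<pi> \<and> sdrop (length \<pi>) \<sigma> \<in> D}}"
  by auto

lemma qp_prefix: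
  assumes w: "good \<omega>" and x: "x \<in> G" and p: "set \<pi> \<subseteq> S" and D: "D \<in> sets SS"
  shows "qp \<omega> x {\<sigma>. stake (length \<pi>) \<sigma> = \<pi> \<and> sdrop (length \<pi>) \<sigma> \<in> D} = wt \<omega> x \<pi> * qp \<omega> (run x \<pi>) D"
  using x p
proof (induction \<pi> arbitrary: x)
  case (Cons s \<pi>)
  have "qp \<omega> x {\<sigma>. stake (length (s # \<pi>)) \<sigma> = s # \<pi> \<and> sdrop (length (s # \<pi>)) \<sigma> \<in> D}
    = \<omega> x s * qp \<omega> (lmul s x) {\<sigma>. stake (length \<pi>) \<sigma> = \<pi> \<and> sdrop (length \<pi>) \<sigma> \<in> D}"
    unfolding stake_Cons_eq
    by (rule qp_Cons[OF w Cons.prems(1) _ stake_sdrop_sets[OF D]]) (use Cons.prems in auto)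
  then show ?case using Cons.IH[of "lmul s x"] Cons.prems by (simp add: lmul_Gset)
qed simp

lemma qp_UNIV [simp]: "qp \<omega> x UNIV = 1"
  using us.prob_space by (simp add: qp_def)

lemma qp_stake:
  assumes w: "good \<omega>" and x: "x \<in> G" and p: "set \<pi> \<subseteq> S"
  shows "qp \<omega> x {\<sigma>. stake (length \<pi>) \<sigma> = \<pi>} = wt \<omega> x \<pi>"
  using qp_prefix[OF w x p UNIV_SS] by simp

lemma wt_bounds:
  assumes w: "good \<omega>" and x: "x \<in> G" and p: "set \<pi> \<subseteq> S"
  shows "\<epsilon> ^ length \<pi> \<le> wt \<omega> x \<pi>" "0 \<le> wt \<omega> x \<pi>" "wt \<omega> x \<pi> \<le> 1"
proof -
  show "\<epsilon> ^ length \<pi> \<le> wt \<omega> x \<pi>"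
    using x p
  proof (induction \<pi> arbitrary: x)
    case (Cons s \<pi>)
    show ?case using Cons.IH[of "lmul s x"] Cons.prems goodD(1,2)[OF w, of x s] eps_pos
      by (auto simp: lmul_Gset intro!: mult_mono)
  qed simp
  then show "0 \<le> wt \<omega> x \<pi>" using eps_pos by (meson order_trans zero_le_power less_imp_le)
  show "wt \<omega> x \<pi> \<le> 1" using qp_stake[OF assms] qp_le_1 by metis
qed

lemma wt_measurable [measurable]:
  "x \<in> G \<Longrightarrow> set \<pi> \<subseteq> S \<Longrightarrow> (\<lambda>\<omega>. wt \<omega> x \<pi>) \<in> borel_measurable E"
  by (induction \<pi> arbitrary: x) (auto simp: lmul_Gset intro!: borel_measurable_times)

lemma wt_cong:
  "(\<And>m. m < length \<pi> \<Longrightarrow> \<omega> (run x (take m \<pi>)) = \<omega>' (run x (take m \<pi>))) \<Longrightarrow> wt \<omega> x \<pi> = wt \<omega>' x \<pi>"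
proof (induction \<pi> arbitrary: x)
  case (Cons s \<pi>)
  have "wt \<omega> (lmul s x) \<pi> = wt \<omega>' (lmul s x) \<pi>"
    by (rule Cons.IH) (use Cons.prems[of "Suc _"] in simp)
  then show ?case using Cons.prems[of 0] by simp
qed simp

text \<open>Both walks use the same uniforms and, as long as the first one is in its cone, read the
  same transition vectors. By induction they pick the same letters, up to and including the step of
  exit.\<close>

lemma steps_couple:
  assumes eq: "\<And>u. u \<noteq> [] \<Longrightarrow> last u = t \<Longrightarrow> u \<in> G \<Longrightarrow> \<omega>' (u @ w') = \<omega> (u @ w)"
    and t: "t \<in> S"
    and nz: "\<And>m. m < n \<Longrightarrow> run [t] (stake m (steps \<omega> (t # w) U)) \<noteq> []"
  shows "stake n (steps \<omega> (t # w) U) = stake n (steps \<omega>' (t # w') U)"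
  using nz
proof (induction n)
  case (Suc n)
  let ?a = "steps \<omega> (t # w) U" and ?b = "steps \<omega>' (t # w') U"
  have e: "stake n ?a = stake n ?b" using Suc by simp
  let ?u = "run [t] (stake n ?a)"
  have a: "run ([t] @ w) (stake n ?a) = ?u @ w"
    by (rule run_stake_app_base) (use Suc in auto)
  have b: "run ([t] @ w') (stake n ?b) = ?u @ w'"
    unfolding e[symmetric] by (rule run_stake_app_base) (use Suc in auto)
  have u: "?u \<noteq> []" "last ?u = t"
    using Suc(2) last_run[of "stake n ?a" "[t]"] by (auto simp: take_stake min_def)
  have uG: "?u \<in> G"
    by (rule run_Gset) (use t steps_in_S in \<open>auto simp: set_conv_nth\<close>)
  have "?a !! n = ?b !! n"
    using a b eq[OF u uG] by (simp add: steps_nth run_steps[symmetric])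
  then show ?case using e by (simp only: stake_Suc)
qed simp

lemma qp_cone:
  assumes eq: "\<And>u. u \<noteq> [] \<Longrightarrow> last u = t \<Longrightarrow> u \<in> G \<Longrightarrow> \<omega>' (u @ w') = \<omega> (u @ w)"
    and t: "t \<in> S" and D: "cone_local t D"
  shows "qp \<omega> (t # w) D = qp \<omega>' (t # w') D"
proof -
  have "steps \<omega> (t # w) U \<in> D \<longleftrightarrow> steps \<omega>' (t # w') U \<in> D" for U
  proof
    assume "steps \<omega> (t # w) U \<in> D"
    then show "steps \<omega>' (t # w') U \<in> D"
      using D[unfolded cone_local_def] steps_couple[of t \<omega>' w' \<omega> w _ U, OF eq t] by blast
  next
    have eq': "\<And>u. u \<noteq> [] \<Longrightarrow> last u = t \<Longrightarrow> u \<in> G \<Longrightarrow> \<omega> (u @ w) = \<omega>' (u @ w')" using eq by simp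
    assume "steps \<omega>' (t # w') U \<in> D"
    then show "steps \<omega> (t # w) U \<in> D"
      using D[unfolded cone_local_def] steps_couple[of t \<omega> w \<omega>' w' _ U, OF eq' t] by blast
  qed
  then show ?thesis by (simp add: qp_def)
qed

end

section \<open>Independence and translation invariance of the environment\<close>

text \<open>A stopping time is represented by the finite paths at which it occurs. These are
  countably many, so conditioning on the path up to that time becomes a countable sum.\<close>

definition first_at :: "(letter list \<Rightarrow> bool) \<Rightarrow> letter list \<Rightarrow> bool" where
  "first_at P \<pi> \<longleftrightarrow> P \<pi> \<and> (\<forall>m<length \<pi>. \<not> P (take m \<pi>))"

lemma set_stake_subset: "(\<And>n. \<sigma> !! n \<in> V) \<Longrightarrow> set (stake n \<sigma>) \<subseteq> V"
  by (auto simp: in_set_conv_nth)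

lemma ex_first_at: "(\<exists>n. P (stake n \<sigma>)) \<longleftrightarrow> (\<exists>n. first_at P (stake n \<sigma>))"
proof
  assume "\<exists>n. P (stake n \<sigma>)"
  then have "P (stake (LEAST n. P (stake n \<sigma>)) \<sigma>)" by (rule LeastI_ex)
  moreover have "\<not> P (stake m \<sigma>)" if "m < (LEAST n. P (stake n \<sigma>))" for m
    using not_less_Least[OF that] .
  ultimately have "first_at P (stake (LEAST n. P (stake n \<sigma>)) \<sigma>)"
    by (auto simp: first_at_def take_stake min_def)
  then show "\<exists>n. first_at P (stake n \<sigma>)" ..
qed (auto simp: first_at_def)

lemma first_at_unique:
  assumes "first_at P (stake n \<sigma>)" "first_at P (stake m \<sigma>)"
  shows "n = m"
proof (rule ccontr)
  have no: "\<not> (first_at P (stake a \<sigma>) \<and> first_at P (stake b \<sigma>))" if "a < b" for a b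
  proof -
    have "take a (stake b \<sigma>) = stake a \<sigma>" using that by (simp add: take_stake min_def)
    then show ?thesis using that unfolding first_at_def by (metis length_stake)
  qed
  assume "n \<noteq> m"
  then have "n < m \<or> m < n" by linarith
  then show False using no[of n m] no[of m n] assms by blast
qed

context rwre
begin

text \<open>A pointwise form of measurability with respect to the coordinates in \<open>V\<close>;
  \<open>extend_from\<close> turns it into a function of the restricted environment.\<close>

definition dep :: "letter list set \<Rightarrow> ((letter list \<Rightarrow> letter \<Rightarrow> real) \<Rightarrow> real) \<Rightarrow> bool" where
  "dep V f \<longleftrightarrow> (\<forall>\<omega>\<in>space E. \<forall>\<omega>'\<in>space E. (\<forall>x\<in>V. \<omega> x = \<omega>' x) \<longrightarrow> f \<omega> = f \<omega>')"

lemma depD: "dep V f \<Longrightarrow> \<omega> \<in> space E \<Longrightarrow> \<omega>' \<in> space E \<Longrightarrow> (\<And>x. x \<in> V \<Longrightarrow> \<omega> x = \<omega>' x) \<Longrightarrow> f \<omega> = f \<omega>'"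
  unfolding dep_def by blast

lemma env_indep_vars: "env.indep_vars (\<lambda>_. \<mu>) (\<lambda>x \<omega>. \<omega> x) G"
proof (subst env.indep_vars_iff_distr_eq_PiM')
  show "G \<noteq> {}" using Nil_Gset by blast
  show "\<And>x. x \<in> G \<Longrightarrow> env.random_variable \<mu> (\<lambda>\<omega>. \<omega> x)" by (rule env_coord)
  have "distr E (PiM G (\<lambda>_. \<mu>)) (\<lambda>\<omega>. restrict \<omega> G) = distr E E (\<lambda>\<omega>. \<omega>)"
    by (intro distr_cong) (auto simp: env_law_def space_PiM PiE_iff extensional_restrict)
  also have "\<dots> = PiM G (\<lambda>_. \<mu>)" by (simp add: env_law_def)
  also have "\<dots> = PiM G (\<lambda>x. distr E \<mu> (\<lambda>\<omega>. \<omega> x))"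
    unfolding env_law_def by (intro PiM_cong refl distr_PiM_component[symmetric] mu_prob)
  finally show "distr E (PiM G (\<lambda>_. \<mu>)) (\<lambda>\<omega>. \<lambda>x\<in>G. \<omega> x) = PiM G (\<lambda>x. distr E \<mu> (\<lambda>\<omega>. \<omega> x))" .
qed

text \<open>The missing coordinates are filled with a fixed point of \<open>space \<mu>\<close>, so
  that a function with \<open>dep V\<close> can be evaluated on an environment known only on
  \<open>V\<close>.\<close>

lemma extend_from:
  assumes "V \<subseteq> G"
  obtains e where "e \<in> measurable (PiM V (\<lambda>_. \<mu>)) E" "\<And>\<rho> x. \<rho> \<in> space (PiM V (\<lambda>_. \<mu>)) \<Longrightarrow> x \<in> V \<Longrightarrow> e \<rho> x = \<rho> x"
proof -
  obtain p where p: "p \<in> space \<mu>" using mu.not_empty by blast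
  let ?e = "\<lambda>\<rho>. \<lambda>x\<in>G. if x \<in> V then \<rho> x else p"
  have "?e \<in> measurable (PiM V (\<lambda>_. \<mu>)) E"
    unfolding env_law_def
  proof (rule measurable_restrict)
    fix x assume "x \<in> G"
    show "(\<lambda>\<rho>. if x \<in> V then \<rho> x else p) \<in> measurable (PiM V (\<lambda>_. \<mu>)) \<mu>"
      by (cases "x \<in> V") (use p measurable_component_singleton[of x V "\<lambda>_. \<mu>"] in auto)
  qed
  then show ?thesis using assms by (intro that[of ?e]) auto
qed

lemma env_restrict_measurable: "V \<subseteq> G \<Longrightarrow> (\<lambda>\<omega>. restrict \<omega> V) \<in> measurable E (PiM V (\<lambda>_. \<mu>))"
  unfolding env_law_def by (rule measurable_restrict_subset)

lemma dep_indep: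
  assumes "V \<subseteq> G" "W \<subseteq> G" "V \<inter> W = {}"
    and f: "f \<in> borel_measurable E" "dep V f" "integrable E f"
    and g: "g \<in> borel_measurable E" "dep W g" "integrable E g"
  shows "(\<integral>\<omega>. f \<omega> * g \<omega> \<partial>E) = (\<integral>\<omega>. f \<omega> \<partial>E) * (\<integral>\<omega>. g \<omega> \<partial>E)"
proof -
  obtain e where e: "e \<in> measurable (PiM V (\<lambda>_. \<mu>)) E" "\<And>\<rho> x. \<rho> \<in> space (PiM V (\<lambda>_. \<mu>)) \<Longrightarrow> x \<in> V \<Longrightarrow> e \<rho> x = \<rho> x"
    using extend_from[OF assms(1)] by blast
  obtain e' where e': "e' \<in> measurable (PiM W (\<lambda>_. \<mu>)) E" "\<And>\<rho> x. \<rho> \<in> space (PiM W (\<lambda>_. \<mu>)) \<Longrightarrow> x \<in> W \<Longrightarrow> e' \<rho> x = \<rho> x"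
    using extend_from[OF assms(2)] by blast
  note rV = measurable_space[OF env_restrict_measurable[OF assms(1)]]
  note rW = measurable_space[OF env_restrict_measurable[OF assms(2)]]
  have fe: "f \<omega> = (f \<circ> e) (restrict \<omega> V)" if "\<omega> \<in> space E" for \<omega>
    unfolding comp_def by (rule depD[OF f(2) that]) (use e rV that measurable_space[OF e(1)] in auto)
  have ge: "g \<omega> = (g \<circ> e') (restrict \<omega> W)" if "\<omega> \<in> space E" for \<omega>
    unfolding comp_def by (rule depD[OF g(2) that]) (use e' rW that measurable_space[OF e'(1)] in auto)
  have ind: "env.indep_var borel ((f \<circ> e) \<circ> (\<lambda>\<omega>. restrict \<omega> V)) borel ((g \<circ> e') \<circ> (\<lambda>\<omega>. restrict \<omega> W))"
    by (rule env.indep_var_compose[OF env.indep_var_restrict[OF env_indep_vars assms(3,1,2)]])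
      (auto simp: comp_def intro!: measurable_compose[OF e(1) f(1)] measurable_compose[OF e'(1) g(1)])
  have "(\<integral>\<omega>. f \<omega> * g \<omega> \<partial>E) = (\<integral>\<omega>. ((f \<circ> e) \<circ> (\<lambda>\<omega>. restrict \<omega> V)) \<omega> * ((g \<circ> e') \<circ> (\<lambda>\<omega>. restrict \<omega> W)) \<omega> \<partial>E)"
    by (rule Bochner_Integration.integral_cong[OF refl]) (simp add: fe ge)
  also have "\<dots> = (\<integral>\<omega>. ((f \<circ> e) \<circ> (\<lambda>\<omega>. restrict \<omega> V)) \<omega> \<partial>E) * (\<integral>\<omega>. ((g \<circ> e') \<circ> (\<lambda>\<omega>. restrict \<omega> W)) \<omega> \<partial>E)"
  proof (rule env.indep_var_lebesgue_integral[OF ind])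
    show "integrable E ((f \<circ> e) \<circ> (\<lambda>\<omega>. restrict \<omega> V))"
      using f(3) by (rule Bochner_Integration.integrable_cong[THEN iffD1, rotated 2]) (simp_all add: fe)
    show "integrable E ((g \<circ> e') \<circ> (\<lambda>\<omega>. restrict \<omega> W))"
      using g(3) by (rule Bochner_Integration.integrable_cong[THEN iffD1, rotated 2]) (simp_all add: ge)
  qed
  also have "\<dots> = (\<integral>\<omega>. f \<omega> \<partial>E) * (\<integral>\<omega>. g \<omega> \<partial>E)"
    by (intro arg_cong2[where f="(*)"] Bochner_Integration.integral_cong[OF refl]) (simp_all add: fe ge)
  finally show ?thesis .
qed

lemma env_reindex_aux:
  fixes f :: "(letter list \<Rightarrow> letter \<Rightarrow> real) \<Rightarrow> real"
  assumes V: "V \<subseteq> G" and j: "inj_on j V" "j \<in> V \<rightarrow> G"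
    and f: "f \<in> borel_measurable E"
    and e: "e \<in> measurable (PiM V (\<lambda>_. \<mu>)) E" "\<And>\<rho> x. \<rho> \<in> space (PiM V (\<lambda>_. \<mu>)) \<Longrightarrow> x \<in> V \<Longrightarrow> e \<rho> x = \<rho> x"
    and f': "\<And>\<omega> \<omega>'. \<omega> \<in> space E \<Longrightarrow> \<omega>' \<in> space E \<Longrightarrow> (\<And>x. x \<in> V \<Longrightarrow> \<omega>' x = \<omega> (j x)) \<Longrightarrow> f \<omega>' = f' \<omega>"
  shows "(\<integral>\<omega>. f' \<omega> \<partial>E) = (\<integral>\<rho>. f (e \<rho>) \<partial>PiM V (\<lambda>_. \<mu>))"
proof -
  let ?t = "\<lambda>\<omega>. \<lambda>n\<in>V. \<omega> (j n)"
  have tm: "?t \<in> measurable E (PiM V (\<lambda>_. \<mu>))"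
    by (rule measurable_restrict) (use j in \<open>auto intro: env_coord\<close>)
  have d: "distr E (PiM V (\<lambda>_. \<mu>)) ?t = PiM V (\<lambda>_. \<mu>)"
    using distr_PiM_reindex[of G "\<lambda>_. \<mu>" j V, OF mu_prob j] by (simp add: env_law_def)
  have "(\<integral>\<omega>. f' \<omega> \<partial>E) = (\<integral>\<omega>. f (e (?t \<omega>)) \<partial>E)"
  proof (rule Bochner_Integration.integral_cong[OF refl])
    fix \<omega> assume w: "\<omega> \<in> space E"
    show "f' \<omega> = f (e (?t \<omega>))"
      by (rule f'[symmetric, OF w]) (use e measurable_space[OF tm w] measurable_space[OF e(1)] in auto)
  qed
  also have "\<dots> = (\<integral>\<rho>. f (e \<rho>) \<partial>distr E (PiM V (\<lambda>_. \<mu>)) ?t)"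
    by (subst integral_distr[OF tm measurable_compose[OF e(1) f]]) simp
  finally show ?thesis by (simp add: d)
qed

text \<open>Both integrals equal one over the coordinates in \<open>V\<close> alone, because
  \<open>j\<close> maps these injectively to coordinates with the same product law. The auxiliary
  lemma is applied to \<open>j\<close> and to the identity.\<close>

lemma env_reindex:
  assumes V: "V \<subseteq> G" and j: "inj_on j V" "j \<in> V \<rightarrow> G"
    and f: "f \<in> borel_measurable E" "dep V f"
    and f': "\<And>\<omega> \<omega>'. \<omega> \<in> space E \<Longrightarrow> \<omega>' \<in> space E \<Longrightarrow> (\<And>x. x \<in> V \<Longrightarrow> \<omega>' x = \<omega> (j x)) \<Longrightarrow> f \<omega>' = f' \<omega>"
  shows "(\<integral>\<omega>. f' \<omega> \<partial>E) = (\<integral>\<omega>. f \<omega> \<partial>E)"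
proof -
  obtain e where e: "e \<in> measurable (PiM V (\<lambda>_. \<mu>)) E" "\<And>\<rho> x. \<rho> \<in> space (PiM V (\<lambda>_. \<mu>)) \<Longrightarrow> x \<in> V \<Longrightarrow> e \<rho> x = \<rho> x"
    using extend_from[OF V] by blast
  have "(\<integral>\<omega>. f \<omega> \<partial>E) = (\<integral>\<rho>. f (e \<rho>) \<partial>PiM V (\<lambda>_. \<mu>))"
    by (rule env_reindex_aux[where j="\<lambda>x. x", OF V _ _ f(1) e]) (use V f(2) in \<open>auto dest: depD\<close>)
  moreover have "(\<integral>\<omega>. f' \<omega> \<partial>E) = (\<integral>\<rho>. f (e \<rho>) \<partial>PiM V (\<lambda>_. \<mu>))"
    by (rule env_reindex_aux[OF V j f(1) e f'])
  ultimately show ?thesis by simp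
qed

text \<open>Parametrised by the part \<open>u\<close> in front of the base, so that exchanging the
  base word is visibly a translation. The letter \<open>t\<close> belongs to \<open>u\<close>, not
  to \<open>w\<close>.\<close>

definition cone :: "letter \<Rightarrow> letter list \<Rightarrow> letter list set" where
  "cone t w = {u @ w | u. u \<in> G \<and> u \<noteq> [] \<and> last u = t}"

lemma cone_glue:
  assumes "t # w \<in> G" "u \<in> G" "u \<noteq> []" "last u = t"
  shows "u @ w \<in> G"
proof -
  have u: "u = butlast u @ [t]" using assms by (metis append_butlast_last_id)
  have "reduced (butlast u @ t # w)"
    by (rule reduced_glue) (use assms u in \<open>auto simp: Gset_def\<close>)
  moreover have "u @ w = butlast u @ t # w" using u by (metis append.assoc append_Cons append_Nil)
  ultimately have "reduced (u @ w)" by metis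
  then show ?thesis using assms by (simp add: Gset_def)
qed

lemma cone_subset: "t # w \<in> G \<Longrightarrow> cone t w \<subseteq> G"
  using cone_glue by (auto simp: cone_def)

lemma cone_suffix: "x \<in> cone t w \<Longrightarrow> suffix (t # w) x"
proof -
  assume "x \<in> cone t w"
  then obtain u where u: "x = u @ w" "u \<noteq> []" "last u = t" by (auto simp: cone_def)
  then have "x = butlast u @ t # w" by (metis append.assoc append_Cons append_Nil append_butlast_last_id)
  then show ?thesis by (metis suffixI)
qed

lemma cone_disjoint:
  assumes "t \<noteq> t'"
  shows "cone t w \<inter> cone t' w = {}"
  using assms by (auto simp: cone_def)

lemma cone_child: "s # t # w \<in> G \<Longrightarrow> cone s (t # w) \<subseteq> cone t w"
proof
  fix x assume "s # t # w \<in> G" "x \<in> cone s (t # w)"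
  then obtain u where u: "x = u @ t # w" "u \<in> G" "u \<noteq> []" "last u = s" by (auto simp: cone_def)
  have "u @ t # w \<in> G" using cone_glue[of s "t # w" u] u \<open>s # t # w \<in> G\<close> by simp
  then have "(u @ [t]) \<in> G" using Gset_suffix[of "u @ [t]" w k r] by simp
  then show "x \<in> cone t w" using u by (auto simp: cone_def intro!: exI[of _ "u @ [t]"])
qed

lemma dep_mono: "dep V f \<Longrightarrow> V \<subseteq> V' \<Longrightarrow> dep V' f"
  unfolding dep_def by blast

lemma dep_qp:
  assumes "t \<in> S" "cone_local t D"
  shows "dep (cone t w) (\<lambda>\<omega>. qp \<omega> (t # w) D)"
  unfolding dep_def
proof (intro ballI impI)
  fix \<omega> \<omega>' :: "letter list \<Rightarrow> letter \<Rightarrow> real"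
  assume "\<forall>x\<in>cone t w. \<omega> x = \<omega>' x"
  then show "qp \<omega> (t # w) D = qp \<omega>' (t # w) D"
    by (intro qp_cone[OF _ assms]) (auto simp: cone_def)
qed

lemma cone_translate:
  assumes tw: "t # w \<in> G" and f: "f \<in> borel_measurable E" "dep (cone t []) f"
    and f': "\<And>\<omega> \<omega>'. \<omega> \<in> space E \<Longrightarrow> \<omega>' \<in> space E \<Longrightarrow> (\<And>u. u \<in> cone t [] \<Longrightarrow> \<omega>' u = \<omega> (u @ w)) \<Longrightarrow> f \<omega>' = f' \<omega>"
  shows "(\<integral>\<omega>. f' \<omega> \<partial>E) = (\<integral>\<omega>. f \<omega> \<partial>E)"
proof (rule env_reindex[OF _ _ _ f f'])
  show "cone t [] \<subseteq> G" by (auto simp: cone_def)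
  show "inj_on (\<lambda>u. u @ w) (cone t [])" by (auto simp: inj_on_def)
  show "(\<lambda>u. u @ w) \<in> cone t [] \<rightarrow> G" using cone_glue[OF tw] by (auto simp: cone_def)
qed

lemma qp_translate:
  assumes tw: "t # w \<in> G" and D: "D \<in> sets SS" "cone_local t D" and h: "h \<in> borel_measurable borel"
  shows "(\<integral>\<omega>. h (qp \<omega> (t # w) D) \<partial>E) = (\<integral>\<omega>. (h (qp \<omega> [t] D) :: real) \<partial>E)"
proof (rule cone_translate[OF tw])
  have t: "t \<in> S" using tw by (auto simp: Gset_def)
  show "(\<lambda>\<omega>. h (qp \<omega> [t] D)) \<in> borel_measurable E"
    by (rule measurable_compose[OF qp_measurable[OF _ D(1)] h]) (simp add: t)
  show "dep (cone t []) (\<lambda>\<omega>. h (qp \<omega> [t] D))"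
    using dep_qp[OF t D(2), of "[]"] unfolding dep_def by metis
  fix \<omega> \<omega>' :: "letter list \<Rightarrow> letter \<Rightarrow> real"
  assume "\<And>u. u \<in> cone t [] \<Longrightarrow> \<omega>' u = \<omega> (u @ w)"
  then have "qp \<omega> (t # w) D = qp \<omega>' (t # []) D"
    by (intro qp_cone[OF _ t D(2)]) (auto simp: cone_def)
  then show "h (qp \<omega>' [t] D) = h (qp \<omega> (t # w) D)" by simp
qed

lemma Aw_cone:
  assumes "t # w \<in> G" "D \<in> sets SS" "cone_local t D"
  shows "(\<integral>\<omega>. qp \<omega> (t # w) D \<partial>E) = measure (Aw [t]) D"
proof -
  have "[t] \<in> G" using assms(1) by (auto simp: Gset_def)
  then show ?thesis using qp_translate[OF assms, of "\<lambda>x. x"] Aw_eq[OF _ assms(2)] by simp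
qed

lemma Aw_prefix:
  assumes x: "x \<in> G" and p: "set \<pi> \<subseteq> S" and D: "D \<in> sets SS"
  shows "measure (Aw x) {\<sigma>. stake (length \<pi>) \<sigma> = \<pi> \<and> sdrop (length \<pi>) \<sigma> \<in> D} = (\<integral>\<omega>. wt \<omega> x \<pi> * qp \<omega> (run x \<pi>) D \<partial>E)"
proof -
  have m: "{\<sigma>. stake (length \<pi>) \<sigma> = \<pi> \<and> sdrop (length \<pi>) \<sigma> \<in> D} \<in> sets SS"
    using stake_sdrop_sets[OF D, of "\<lambda>\<rho>. \<rho> = \<pi>"] by simp
  show ?thesis
    unfolding Aw_eq[OF x m]
  proof (rule integral_cong_AE)
    show "AE \<omega> in E. qp \<omega> x {\<sigma>. stake (length \<pi>) \<sigma> = \<pi> \<and> sdrop (length \<pi>) \<sigma> \<in> D} = wt \<omega> x \<pi> * qp \<omega> (run x \<pi>) D"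
      using AE_good by eventually_elim (rule qp_prefix[OF _ x p D])
  qed (use x p D m in \<open>auto intro!: borel_measurable_times qp_measurable wt_measurable run_Gset\<close>)
qed

lemma Aw_stake:
  assumes x: "x \<in> G" and p: "set \<pi> \<subseteq> S"
  shows "measure (Aw x) {\<sigma>. stake (length \<pi>) \<sigma> = \<pi>} = (\<integral>\<omega>. wt \<omega> x \<pi> \<partial>E)"
  using Aw_prefix[OF x p UNIV_SS] by simp

lemma Aw_support:
  assumes x: "x \<in> G" and "\<And>\<sigma>. \<sigma> \<in> D \<Longrightarrow> (\<And>n. \<sigma> !! n \<in> S) \<Longrightarrow> False" and D: "D \<in> sets SS"
  shows "measure (Aw x) D = 0"
proof -
  have "qp \<omega> x D = qp \<omega> x {}" for \<omega> by (rule qp_cong) (use assms in auto)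
  then show ?thesis using Aw_eq[OF x D] by (simp add: qp_def)
qed

definition fresh :: "letter list \<Rightarrow> letter list \<Rightarrow> bool" where
  "fresh x \<pi> \<longleftrightarrow> run x \<pi> \<noteq> [] \<and> (\<forall>m<length \<pi>. \<not> suffix (run x \<pi>) (run x (take m \<pi>)))"

lemma wt_integrable: "x \<in> G \<Longrightarrow> set \<pi> \<subseteq> S \<Longrightarrow> integrable E (\<lambda>\<omega>. wt \<omega> x \<pi>)"
  by (rule env.integrable_const_bound[where B=1])
    (use AE_good in \<open>auto elim!: eventually_mono simp: wt_bounds abs_of_nonneg\<close>)

text \<open>The weight of a path up to its first entrance to a cone only involves the environment outside of it.\<close>

lemma fresh_factor:
  assumes x: "x \<in> G" and p: "set \<pi> \<subseteq> S" and fr: "fresh x \<pi>" and tw: "run x \<pi> = t # w"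
    and f: "f \<in> borel_measurable E" "dep (cone t w) f" "integrable E f"
  shows "(\<integral>\<omega>. wt \<omega> x \<pi> * f \<omega> \<partial>E) = (\<integral>\<omega>. wt \<omega> x \<pi> \<partial>E) * (\<integral>\<omega>. f \<omega> \<partial>E)"
proof -
  let ?V = "{run x (take m \<pi>) | m. m < length \<pi>}"
  show ?thesis
  proof (rule dep_indep[where V="?V" and W="cone t w", OF _ _ _ _ _ _ f])
  have "run x \<pi> \<in> G" using run_Gset[OF p x] .
  then show "cone t w \<subseteq> G" using cone_subset tw by simp
  show "?V \<subseteq> G" using run_Gset[OF _ x] p set_take_subset by fastforce
  show "?V \<inter> cone t w = {}" using fr cone_suffix tw by (fastforce simp: fresh_def)
  show "dep ?V (\<lambda>\<omega>. wt \<omega> x \<pi>)" unfolding dep_def by (auto intro!: wt_cong)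
  qed (use x p in \<open>auto intro: wt_integrable\<close>)
qed

text \<open>The annealed walk restarts at a first entrance to a cone if \<open>D\<close> is decided
  before the exit: the path so far has read the environment outside of the cone only,
  \<open>D\<close> reads the inside only, and the inside can be translated to the cone of a
  one-letter word.\<close>

lemma Aw_fresh:
  assumes x: "x \<in> G" and p: "set \<pi> \<subseteq> S" and fr: "fresh x \<pi>" and D: "D \<in> sets SS" "cone_local (hd (run x \<pi>)) D"
  shows "measure (Aw x) {\<sigma>. stake (length \<pi>) \<sigma> = \<pi> \<and> sdrop (length \<pi>) \<sigma> \<in> D}
    = measure (Aw x) {\<sigma>. stake (length \<pi>) \<sigma> = \<pi>} * measure (Aw [hd (run x \<pi>)]) D"
proof -
  obtain t w where tw: "run x \<pi> = t # w" using fr by (cases "run x \<pi>") (auto simp: fresh_def)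
  have g: "t # w \<in> G" using run_Gset[OF p x] tw by simp
  then have t: "t \<in> S" by (auto simp: Gset_def)
  have D2: "cone_local t D" using D(2) tw by simp
  show ?thesis
    unfolding Aw_prefix[OF x p D(1)] Aw_stake[OF x p] tw list.sel
      Aw_cone[OF g D(1) D2, symmetric]
    by (rule fresh_factor[OF x p fr tw]) (use g D(1) D2 t in \<open>auto intro: dep_qp qp_integrable\<close>)
qed

section \<open>Decomposition over first passage paths\<close>

lemma first_set_sets:
  assumes "\<And>\<pi>. D \<pi> \<in> sets SS"
  shows "{\<sigma>. \<exists>n. first_at P (stake n \<sigma>) \<and> sdrop n \<sigma> \<in> D (stake n \<sigma>)} \<in> sets SS"
proof -
  have "{\<sigma>. \<exists>n. first_at P (stake n \<sigma>) \<and> sdrop n \<sigma> \<in> D (stake n \<sigma>)}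
     = (\<Union>\<pi>\<in>{\<pi>. first_at P \<pi>}. {\<sigma>. stake (length \<pi>) \<sigma> = \<pi> \<and> sdrop (length \<pi>) \<sigma> \<in> D \<pi>})" (is "?L = ?R")
  proof (intro set_eqI iffI)
    fix \<sigma> assume "\<sigma> \<in> ?L"
    then obtain n where "first_at P (stake n \<sigma>)" "sdrop n \<sigma> \<in> D (stake n \<sigma>)" by auto
    then show "\<sigma> \<in> ?R" by (auto intro!: bexI[of _ "stake n \<sigma>"])
  next
    fix \<sigma> assume "\<sigma> \<in> ?R"
    then show "\<sigma> \<in> ?L" by (smt (verit) UN_E mem_Collect_eq)
  qed
  moreover have "{\<sigma>. stake (length \<pi>) \<sigma> = \<pi> \<and> sdrop (length \<pi>) \<sigma> \<in> D \<pi>} \<in> sets SS" for \<pi>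
    using stake_sdrop_sets[OF assms, of "\<lambda>\<rho>. \<rho> = \<pi>"] by simp
  ultimately show ?thesis by (auto intro!: sets.countable_UN')
qed

lemma ex_stake_sets: "{\<sigma>. \<exists>n. P (stake n \<sigma>)} \<in> sets SS"
  using first_set_sets[of "\<lambda>_. UNIV" P] by (simp add: ex_first_at[symmetric])

lemma first_emeasure:
  assumes "\<And>\<pi>. D \<pi> \<in> sets SS"
  shows "emeasure (Aw x) {\<sigma>. \<exists>n. first_at P (stake n \<sigma>) \<and> sdrop n \<sigma> \<in> D (stake n \<sigma>)}
    = (\<integral>\<^sup>+\<pi>. emeasure (Aw x) {\<sigma>. stake (length \<pi>) \<sigma> = \<pi> \<and> sdrop (length \<pi>) \<sigma> \<in> D \<pi>} \<partial>count_space {\<pi>. first_at P \<pi>})"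
proof -
  have "{\<sigma>. \<exists>n. first_at P (stake n \<sigma>) \<and> sdrop n \<sigma> \<in> D (stake n \<sigma>)}
     = (\<Union>\<pi>\<in>{\<pi>. first_at P \<pi>}. {\<sigma>. stake (length \<pi>) \<sigma> = \<pi> \<and> sdrop (length \<pi>) \<sigma> \<in> D \<pi>})" (is "?L = ?R")
  proof (intro set_eqI iffI)
    fix \<sigma> assume "\<sigma> \<in> ?L"
    then obtain n where "first_at P (stake n \<sigma>)" "sdrop n \<sigma> \<in> D (stake n \<sigma>)" by auto
    then show "\<sigma> \<in> ?R" by (auto intro!: bexI[of _ "stake n \<sigma>"])
  next
    fix \<sigma> assume "\<sigma> \<in> ?R"
    then show "\<sigma> \<in> ?L" by (smt (verit) UN_E mem_Collect_eq)
  qed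
  moreover have "{\<sigma>. stake (length \<pi>) \<sigma> = \<pi> \<and> sdrop (length \<pi>) \<sigma> \<in> D \<pi>} \<in> sets SS" for \<pi>
    using stake_sdrop_sets[OF assms, of "\<lambda>\<rho>. \<rho> = \<pi>"] by simp
  moreover have "disjoint_family_on (\<lambda>\<pi>. {\<sigma>. stake (length \<pi>) \<sigma> = \<pi> \<and> sdrop (length \<pi>) \<sigma> \<in> D \<pi>}) {\<pi>. first_at P \<pi>}"
    unfolding disjoint_family_on_def
  proof (intro ballI impI, rule ccontr)
    fix \<pi> \<rho> assume a: "\<pi> \<in> {\<pi>. first_at P \<pi>}" "\<rho> \<in> {\<pi>. first_at P \<pi>}" "\<pi> \<noteq> \<rho>"
      and "{\<sigma>. stake (length \<pi>) \<sigma> = \<pi> \<and> sdrop (length \<pi>) \<sigma> \<in> D \<pi>} \<inter> {\<sigma>. stake (length \<rho>) \<sigma> = \<rho> \<and> sdrop (length \<rho>) \<sigma> \<in> D \<rho>} \<noteq> {}"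
    then obtain \<sigma> where s: "stake (length \<pi>) \<sigma> = \<pi>" "stake (length \<rho>) \<sigma> = \<rho>" by auto
    then have "length \<pi> = length \<rho>" using first_at_unique[of P "length \<pi>" \<sigma> "length \<rho>"] a by simp
    then show False using s a by metis
  qed
  ultimately show ?thesis by (subst emeasure_UN_countable[symmetric]) auto
qed

text \<open>Summation over the disjoint events that the stopped path is \<open>\<pi>\<close>. Only
  paths with letters in \<open>S\<close> have to be estimated, the others have probability
  zero.\<close>

lemma first_le:
  assumes x: "x \<in> G" and D: "\<And>\<pi>. D \<pi> \<in> sets SS" and c: "0 \<le> c"
    and le: "\<And>\<pi>. set \<pi> \<subseteq> S \<Longrightarrow> first_at P \<pi> \<Longrightarrow> measure (Aw x) {\<sigma>. stake (length \<pi>) \<sigma> = \<pi> \<and> sdrop (length \<pi>) \<sigma> \<in> D \<pi>}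
      \<le> c * measure (Aw x) {\<sigma>. stake (length \<pi>) \<sigma> = \<pi>}"
  shows "measure (Aw x) {\<sigma>. \<exists>n. first_at P (stake n \<sigma>) \<and> sdrop n \<sigma> \<in> D (stake n \<sigma>)} \<le> c * measure (Aw x) {\<sigma>. \<exists>n. P (stake n \<sigma>)}"
proof -
  interpret A: prob_space "Aw x" by (rule prob_space_Aw[OF x])
  have "emeasure (Aw x) {\<sigma>. \<exists>n. first_at P (stake n \<sigma>) \<and> sdrop n \<sigma> \<in> D (stake n \<sigma>)}
     \<le> (\<integral>\<^sup>+\<pi>. ennreal c * emeasure (Aw x) {\<sigma>. stake (length \<pi>) \<sigma> = \<pi> \<and> sdrop (length \<pi>) \<sigma> \<in> UNIV} \<partial>count_space {\<pi>. first_at P \<pi>})"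
    unfolding first_emeasure[where D=D and x=x and P=P, OF D]
  proof (rule nn_integral_mono)
    fix \<pi> assume f: "\<pi> \<in> space (count_space {\<pi>. first_at P \<pi>})"
    have "measure (Aw x) {\<sigma>. stake (length \<pi>) \<sigma> = \<pi> \<and> sdrop (length \<pi>) \<sigma> \<in> D \<pi>}
      \<le> c * measure (Aw x) {\<sigma>. stake (length \<pi>) \<sigma> = \<pi>}"
    proof (cases "set \<pi> \<subseteq> S")
      case True
      then show ?thesis using le f by simp
    next
      case False
      have "measure (Aw x) {\<sigma>. stake (length \<pi>) \<sigma> = \<pi> \<and> sdrop (length \<pi>) \<sigma> \<in> D \<pi>} = 0"
      proof (rule Aw_support[OF x])
        fix \<sigma> assume a: "\<sigma> \<in> {\<sigma>. stake (length \<pi>) \<sigma> = \<pi> \<and> sdrop (length \<pi>) \<sigma> \<in> D \<pi>}" "\<And>n. \<sigma> !! n \<in> S"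
        then have "set \<pi> \<subseteq> S" using set_stake_subset[of \<sigma> S "length \<pi>"] by simp
        then show False using False by simp
      qed (use stake_sdrop_sets[OF D, of "\<lambda>\<rho>. \<rho> = \<pi>"] in simp)
      then show ?thesis using c by simp
    qed
    then show "emeasure (Aw x) {\<sigma>. stake (length \<pi>) \<sigma> = \<pi> \<and> sdrop (length \<pi>) \<sigma> \<in> D \<pi>}
      \<le> ennreal c * emeasure (Aw x) {\<sigma>. stake (length \<pi>) \<sigma> = \<pi> \<and> sdrop (length \<pi>) \<sigma> \<in> UNIV}"
      using c by (simp add: A.emeasure_eq_measure ennreal_mult[symmetric])
  qed
  also have "\<dots> = ennreal c * (\<integral>\<^sup>+\<pi>. emeasure (Aw x) {\<sigma>. stake (length \<pi>) \<sigma> = \<pi> \<and> sdrop (length \<pi>) \<sigma> \<in> UNIV} \<partial>count_space {\<pi>. first_at P \<pi>})"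
    by (rule nn_integral_cmult) simp
  also have "\<dots> = ennreal c * emeasure (Aw x) {\<sigma>. \<exists>n. P (stake n \<sigma>)}"
    using first_emeasure[of "\<lambda>_. UNIV" x P] by (simp add: ex_first_at[symmetric])
  finally show ?thesis using c by (simp add: A.emeasure_eq_measure ennreal_mult[symmetric])
qed

lemma first_ge:
  assumes x: "x \<in> G" and D: "\<And>\<pi>. D \<pi> \<in> sets SS" and c: "0 \<le> c"
    and ge: "\<And>\<pi>. set \<pi> \<subseteq> S \<Longrightarrow> first_at P \<pi> \<Longrightarrow> c * measure (Aw x) {\<sigma>. stake (length \<pi>) \<sigma> = \<pi>}
      \<le> measure (Aw x) {\<sigma>. stake (length \<pi>) \<sigma> = \<pi> \<and> sdrop (length \<pi>) \<sigma> \<in> D \<pi>}"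
  shows "c * measure (Aw x) {\<sigma>. \<exists>n. P (stake n \<sigma>)} \<le> measure (Aw x) {\<sigma>. \<exists>n. first_at P (stake n \<sigma>) \<and> sdrop n \<sigma> \<in> D (stake n \<sigma>)}"
proof -
  interpret A: prob_space "Aw x" by (rule prob_space_Aw[OF x])
  have "ennreal c * emeasure (Aw x) {\<sigma>. \<exists>n. P (stake n \<sigma>)} = ennreal c * (\<integral>\<^sup>+\<pi>. emeasure (Aw x) {\<sigma>. stake (length \<pi>) \<sigma> = \<pi> \<and> sdrop (length \<pi>) \<sigma> \<in> UNIV} \<partial>count_space {\<pi>. first_at P \<pi>})"
    using first_emeasure[of "\<lambda>_. UNIV" x P] by (simp add: ex_first_at[symmetric])
  also have "\<dots> = (\<integral>\<^sup>+\<pi>. ennreal c * emeasure (Aw x) {\<sigma>. stake (length \<pi>) \<sigma> = \<pi> \<and> sdrop (length \<pi>) \<sigma> \<in> UNIV} \<partial>count_space {\<pi>. first_at P \<pi>})"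
    by (rule nn_integral_cmult[symmetric]) simp
  also have "\<dots> \<le> emeasure (Aw x) {\<sigma>. \<exists>n. first_at P (stake n \<sigma>) \<and> sdrop n \<sigma> \<in> D (stake n \<sigma>)}"
    unfolding first_emeasure[where D=D and x=x and P=P, OF D]
  proof (rule nn_integral_mono)
    fix \<pi> assume f: "\<pi> \<in> space (count_space {\<pi>. first_at P \<pi>})"
    have "c * measure (Aw x) {\<sigma>. stake (length \<pi>) \<sigma> = \<pi>} \<le> measure (Aw x) {\<sigma>. stake (length \<pi>) \<sigma> = \<pi> \<and> sdrop (length \<pi>) \<sigma> \<in> D \<pi>}"
    proof (cases "set \<pi> \<subseteq> S")
      case True
      then show ?thesis using ge f by simp
    next
      case False
      have "measure (Aw x) {\<sigma>. stake (length \<pi>) \<sigma> = \<pi>} = 0"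
      proof (rule Aw_support[OF x])
        fix \<sigma> assume a: "\<sigma> \<in> {\<sigma>. stake (length \<pi>) \<sigma> = \<pi>}" "\<And>n. \<sigma> !! n \<in> S"
        then have "set \<pi> \<subseteq> S" using set_stake_subset[of \<sigma> S "length \<pi>"] by simp
        then show False using False by simp
      qed (use stake_pred_sets[of "\<lambda>\<rho>. \<rho> = \<pi>"] in simp)
      then show ?thesis by simp
    qed
    then show "ennreal c * emeasure (Aw x) {\<sigma>. stake (length \<pi>) \<sigma> = \<pi> \<and> sdrop (length \<pi>) \<sigma> \<in> UNIV}
      \<le> emeasure (Aw x) {\<sigma>. stake (length \<pi>) \<sigma> = \<pi> \<and> sdrop (length \<pi>) \<sigma> \<in> D \<pi>}"
      using c by (simp add: A.emeasure_eq_measure ennreal_mult[symmetric])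
  qed
  finally show ?thesis using c by (simp add: A.emeasure_eq_measure ennreal_mult[symmetric])
qed

end

section \<open>Quenched estimates\<close>

text \<open>In this and the next two definitions the finite horizon \<open>n\<close> permits
  induction over the first step; the bounds obtained are uniform in \<open>n\<close>.\<close>

definition hitn :: "nat \<Rightarrow> letter list \<Rightarrow> letter stream set" where
  "hitn n u = {\<sigma>. \<exists>m\<le>n. run u (stake m \<sigma>) = []}"

definition visits :: "letter list \<Rightarrow> letter list \<Rightarrow> nat \<Rightarrow> nat \<Rightarrow> letter stream set" where
  "visits x z n y = {\<sigma>. y \<le> card {m \<in> {1..n}. run z (stake m \<sigma>) = x}}"

definition retn :: "nat \<Rightarrow> nat \<Rightarrow> letter list \<Rightarrow> letter stream set" where
  "retn h n u = {\<sigma>. \<exists>m'\<le>n. run u (stake m' \<sigma>) = [] \<and> (\<forall>i<m'. run u (stake i \<sigma>) \<noteq> []) \<and> (\<exists>m\<le>m'. h \<le> length (run u (stake m \<sigma>)))}"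

lemma stake_finite_sets:
  assumes "\<And>\<sigma> \<sigma>'. stake n \<sigma> = stake n \<sigma>' \<Longrightarrow> \<sigma> \<in> D \<Longrightarrow> \<sigma>' \<in> D"
  shows "D \<in> sets SS"
proof -
  have "D = {\<sigma>. stake n \<sigma> \<in> stake n ` D}"
  proof (intro set_eqI iffI)
    fix \<sigma> assume "\<sigma> \<in> {\<sigma>. stake n \<sigma> \<in> stake n ` D}"
    then obtain \<tau> where "\<tau> \<in> D" "stake n \<tau> = stake n \<sigma>" by auto
    then show "\<sigma> \<in> D" using assms by blast
  qed simp
  then show ?thesis using stake_pred_sets[of "\<lambda>\<pi>. \<pi> \<in> stake n ` D" n] by simp
qed

lemma stake_le_eq: "stake n \<sigma> = stake n \<sigma>' \<Longrightarrow> m \<le> n \<Longrightarrow> stake m \<sigma> = stake m \<sigma>'"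
  by (metis min_def take_stake)

lemma hitn_sets [simp]: "hitn n u \<in> sets SS"
proof (rule stake_finite_sets[of n])
  fix \<sigma> \<sigma>' :: "letter stream" assume a: "stake n \<sigma> = stake n \<sigma>'" "\<sigma> \<in> hitn n u"
  then obtain m where "m \<le> n" "run u (stake m \<sigma>) = []" by (auto simp: hitn_def)
  moreover have "stake m \<sigma> = stake m \<sigma>'" using stake_le_eq[OF a(1)] calculation by simp
  ultimately show "\<sigma>' \<in> hitn n u" by (auto simp: hitn_def)
qed

lemma visits_sets [simp]: "visits x z n y \<in> sets SS"
proof (rule stake_finite_sets[of n])
  fix \<sigma> \<sigma>' :: "letter stream" assume a: "stake n \<sigma> = stake n \<sigma>'" "\<sigma> \<in> visits x z n y"
  have "{m \<in> {1..n}. run z (stake m \<sigma>) = x} = {m \<in> {1..n}. run z (stake m \<sigma>') = x}"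
    using stake_le_eq[OF a(1)] by auto
  then show "\<sigma>' \<in> visits x z n y" using a(2) by (simp add: visits_def)
qed

lemma retn_sets [simp]: "retn h n u \<in> sets SS"
proof (rule stake_finite_sets[of n])
  fix \<sigma> \<sigma>' :: "letter stream" assume a: "stake n \<sigma> = stake n \<sigma>'" "\<sigma> \<in> retn h n u"
  from a(2) obtain m' m where m: "m' \<le> n" "run u (stake m' \<sigma>) = []" "\<forall>i<m'. run u (stake i \<sigma>) \<noteq> []" "m \<le> m'" "h \<le> length (run u (stake m \<sigma>))"
    by (auto simp: retn_def)
  have e: "stake i \<sigma>' = stake i \<sigma>" if "i \<le> m'" for i using stake_le_eq[OF a(1), of i] m(1) that by simp
  have "\<exists>i\<le>m'. h \<le> length (run u (stake i \<sigma>'))" using m e by (intro exI[of _ m]) simp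
  then show "\<sigma>' \<in> retn h n u" unfolding retn_def
    using m e by (intro CollectI exI[of _ m']) simp
qed

lemma hitn_Suc: "u \<noteq> [] \<Longrightarrow> s ## \<sigma> \<in> hitn (Suc n) u \<longleftrightarrow> \<sigma> \<in> hitn n (lmul s u)"
proof
  assume u: "u \<noteq> []" and "s ## \<sigma> \<in> hitn (Suc n) u"
  then obtain m where m: "m \<le> Suc n" "run u (stake m (s ## \<sigma>)) = []" by (auto simp: hitn_def)
  then obtain m' where "m = Suc m'" using u by (cases m) auto
  then show "\<sigma> \<in> hitn n (lmul s u)" using m by (auto simp: hitn_def)
next
  assume "\<sigma> \<in> hitn n (lmul s u)"
  then obtain m where "m \<le> n" "run (lmul s u) (stake m \<sigma>) = []" by (auto simp: hitn_def)
  then show "s ## \<sigma> \<in> hitn (Suc n) u" by (auto simp: hitn_def intro!: exI[of _ "Suc m"])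
qed

lemma card_visits_Suc:
  "card {m \<in> {1..Suc n}. run z (stake m (s ## \<sigma>)) = x}
    = (if lmul s z = x then 1 else 0) + card {m \<in> {1..n}. run (lmul s z) (stake m \<sigma>) = x}"
proof -
  have e: "{m \<in> {1..Suc n}. run z (stake m (s ## \<sigma>)) = x}
     = (if lmul s z = x then {1} else {}) \<union> Suc ` {m \<in> {1..n}. run (lmul s z) (stake m \<sigma>) = x}" (is "?L = ?R")
  proof (intro set_eqI iffI)
    fix m assume "m \<in> ?L"
    then obtain m' where "m = Suc m'" "m' \<le> n" "run (lmul s z) (stake m' \<sigma>) = x" by (cases m) auto
    then show "m \<in> ?R" by (cases m') auto
  qed (auto split: if_splits)
  have "card ?R = card (if lmul s z = x then {1::nat} else {}) + card (Suc ` {m \<in> {1..n}. run (lmul s z) (stake m \<sigma>) = x})"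
    by (rule card_Un_disjoint) (auto split: if_splits)
  also have "card (Suc ` {m \<in> {1..n}. run (lmul s z) (stake m \<sigma>) = x}) = card {m \<in> {1..n}. run (lmul s z) (stake m \<sigma>) = x}"
    by (rule card_image) simp
  finally show ?thesis unfolding e by simp
qed

lemma stay_Cons:
  assumes "s \<noteq> linv t" "\<sigma> \<in> stay s"
  shows "s ## \<sigma> \<in> stay t"
proof -
  have "run [t] (stake n (s ## \<sigma>)) \<noteq> []" for n
  proof (cases n)
    case (Suc m)
    have "run ([s] @ [t]) (stake m \<sigma>) = run [s] (stake m \<sigma>) @ [t]"
      by (rule run_stake_app_base) (use assms(2) in \<open>simp add: stay_def\<close>)
    then show ?thesis using Suc assms(1) by (auto simp: linv_eq_iff)
  qed simp
  then show ?thesis by (simp add: stay_def)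
qed

lemma child_Gset: "t # w \<in> Gset k r \<Longrightarrow> s \<in> Sgen k r \<Longrightarrow> s \<noteq> linv t \<Longrightarrow> s # t # w \<in> Gset k r"
  using Cons_Gset[of s t w k r] by auto

context rwre
begin

section \<open>Escape, descent and number of visits in a fixed environment\<close>

lemma eps_lt_1: "\<epsilon> < 1"
proof -
  obtain \<omega> where "good \<omega>"
    using AE_good env.AE_False by (metis (mono_tags, lifting) AE_mp eventually_mono)
  moreover obtain s where "s \<in> S" using S_nonempty by blast
  ultimately show ?thesis using goodD(1,4)[of \<omega> "[]" s] by simp
qed

text \<open>\<open>hd x\<close> is the generator multiplied last, so this is the quenched
  probability of never stepping from the cone of \<open>x\<close> to the parent of
  \<open>x\<close>.\<close>

definition q :: "(letter list \<Rightarrow> letter \<Rightarrow> real) \<Rightarrow> letter list \<Rightarrow> real" where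
  "q \<omega> x = qp \<omega> x (stay (hd x))"

lemma q_bounds [simp]: "0 \<le> q \<omega> x" "q \<omega> x \<le> 1"
  by (simp_all add: q_def)

lemma q_pow_bounds [simp]: "0 \<le> (1 - \<epsilon> * q \<omega> x) ^ y" "(1 - \<epsilon> * q \<omega> x) ^ y \<le> 1" "0 \<le> 1 - \<epsilon> * q \<omega> x" "1 - \<epsilon> * q \<omega> x \<le> 1"
proof -
  have "0 \<le> \<epsilon> * q \<omega> x" "\<epsilon> * q \<omega> x \<le> 1 * 1" using eps_pos eps_lt_1 q_bounds[of \<omega> x]
    by (simp, intro mult_mono) auto
  then show "0 \<le> (1 - \<epsilon> * q \<omega> x) ^ y" "(1 - \<epsilon> * q \<omega> x) ^ y \<le> 1" "0 \<le> 1 - \<epsilon> * q \<omega> x" "1 - \<epsilon> * q \<omega> x \<le> 1"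
    by (auto intro!: power_le_one)
qed

lemma q_measurable [measurable]: "x \<in> G \<Longrightarrow> (\<lambda>\<omega>. q \<omega> x) \<in> borel_measurable E"
  by (simp add: q_def qp_measurable)

lemma stay_local: "cone_local t (stay t)"
  by (rule cone_local_subset_stay) simp

lemma dep_q: "t \<in> S \<Longrightarrow> dep (cone t w) (\<lambda>\<omega>. h (q \<omega> (t # w)))"
  using dep_qp[OF _ stay_local, of t w] unfolding q_def dep_def by (metis list.sel(1))

lemma q_translate:
  assumes "t # w \<in> G" "h \<in> borel_measurable borel"
  shows "(\<integral>\<omega>. h (q \<omega> (t # w)) \<partial>E) = (\<integral>\<omega>. (h (q \<omega> [t]) :: real) \<partial>E)"
  using qp_translate[OF assms(1) stay_sets stay_local assms(2)] by (simp add: q_def)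

text \<open>One way to stay in a cone forever is to step to a given child and to stay in its
  cone.\<close>

lemma q_child:
  assumes w: "good \<omega>" and x: "s # t # x \<in> G"
  shows "\<omega> (t # x) s * q \<omega> (s # t # x) \<le> q \<omega> (t # x)"
proof -
  have st: "s \<noteq> linv t" "s \<in> S" "t # x \<in> G" using x by (auto simp: Cons_Gset linv_eq_iff)
  have "\<omega> (t # x) s * qp \<omega> (lmul s (t # x)) (stay s) = qp \<omega> (t # x) {\<sigma>. shd \<sigma> = s \<and> stl \<sigma> \<in> stay s}"
    by (rule qp_Cons[symmetric]) (use w st in auto)
  also have "\<dots> \<le> qp \<omega> (t # x) (stay t)"
  proof (rule qp_mono)
    fix \<sigma> assume "\<sigma> \<in> {\<sigma>. shd \<sigma> = s \<and> stl \<sigma> \<in> stay s}"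
    then show "\<sigma> \<in> stay t" using stay_Cons[OF st(1), of "stl \<sigma>"] by (metis (mono_tags, lifting) mem_Collect_eq stream.collapse)
  qed (use w st in \<open>auto simp: good_def\<close>)
  finally show ?thesis using st(1) by (auto simp: q_def linv_eq_iff split: if_splits)
qed

lemma q_child_eps:
  assumes w: "good \<omega>" and x: "s # t # x \<in> G"
  shows "\<epsilon> * q \<omega> (s # t # x) \<le> q \<omega> (t # x)"
proof -
  have "s \<in> S" "t # x \<in> G" using x by (auto simp: Cons_Gset)
  then have "\<epsilon> * q \<omega> (s # t # x) \<le> \<omega> (t # x) s * q \<omega> (s # t # x)"
    using goodD(1)[OF w] by (intro mult_right_mono) (auto simp: less_imp_le)
  then show ?thesis using q_child[OF assms] by simp
qed

text \<open>The probability of descending from \<open>u @ w\<close> to \<open>w\<close> in at most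
  \<open>n\<close> steps: the part \<open>u\<close> has to be used up.\<close>

definition fn :: "(letter list \<Rightarrow> letter \<Rightarrow> real) \<Rightarrow> nat \<Rightarrow> letter list \<Rightarrow> letter list \<Rightarrow> real" where
  "fn \<omega> n u w = qp \<omega> (u @ w) (hitn n u)"

lemma fn_bounds [simp]: "0 \<le> fn \<omega> n u w" "fn \<omega> n u w \<le> 1"
  by (simp_all add: fn_def)

lemma fn_Nil [simp]: "fn \<omega> n [] w = 1"
proof -
  have "hitn n [] = UNIV" by (auto simp: hitn_def intro!: exI[of _ 0])
  then show ?thesis by (simp add: fn_def)
qed

lemma fn_0: "u \<noteq> [] \<Longrightarrow> fn \<omega> 0 u w = 0"
proof -
  assume "u \<noteq> []"
  then have "hitn 0 u = {}" by (auto simp: hitn_def)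
  then show ?thesis by (simp add: fn_def qp_def)
qed

lemma fn_Suc:
  assumes w: "good \<omega>" and x: "u @ w \<in> G" and u: "u \<noteq> []"
  shows "fn \<omega> (Suc n) u w = (\<Sum>s\<in>S. \<omega> (u @ w) s * fn \<omega> n (lmul s u) w)"
  unfolding fn_def qp_first_step[OF w x hitn_sets] hitn_Suc[OF u] lmul_append[OF u] by simp

lemma fn_mono_Suc:
  assumes w: "good \<omega>" and x: "u @ w \<in> G"
  shows "fn \<omega> n u w \<le> fn \<omega> (Suc n) u w"
  unfolding fn_def
proof (rule qp_mono)
  show "\<And>\<sigma>. \<sigma> \<in> hitn n u \<Longrightarrow> \<sigma> \<in> hitn (Suc n) u" by (auto simp: hitn_def intro: le_SucI)
qed (use w x in \<open>auto simp: good_def\<close>)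

text \<open>On a tree the way down from \<open>u1 @ u2 @ w\<close> to \<open>w\<close> passes
  through \<open>u2 @ w\<close>. Granting both descents the full horizon only enlarges the right
  side, and lets the induction over the first step close without a strong Markov property.\<close>

lemma fn_product:
  assumes w: "good \<omega>"
  shows "u1 @ u2 @ w \<in> G \<Longrightarrow> fn \<omega> n (u1 @ u2) w \<le> fn \<omega> n u1 (u2 @ w) * fn \<omega> n u2 w"
proof (induction n arbitrary: u1)
  case 0
  then show ?case by (cases "u1 = []") (auto simp: fn_0)
next
  case (Suc n)
  show ?case
  proof (cases "u1 = []")
    case False
    have g: "(u1 @ u2) @ w \<in> G" "u1 @ (u2 @ w) \<in> G" using Suc.prems by auto
    have g2: "u2 @ w \<in> G" using Gset_suffix[OF g(2)] by simp
    have "fn \<omega> (Suc n) (u1 @ u2) w = (\<Sum>s\<in>S. \<omega> (u1 @ u2 @ w) s * fn \<omega> n (lmul s u1 @ u2) w)"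
      using fn_Suc[OF w g(1)] False by (simp add: lmul_append)
    also have "\<dots> \<le> (\<Sum>s\<in>S. \<omega> (u1 @ u2 @ w) s * (fn \<omega> n (lmul s u1) (u2 @ w) * fn \<omega> n u2 w))"
    proof (rule sum_mono)
      fix s assume s: "s \<in> S"
      have "lmul s u1 @ u2 @ w \<in> G" using lmul_Gset[OF s g(2)] False by (simp add: lmul_append)
      then show "\<omega> (u1 @ u2 @ w) s * fn \<omega> n (lmul s u1 @ u2) w \<le> \<omega> (u1 @ u2 @ w) s * (fn \<omega> n (lmul s u1) (u2 @ w) * fn \<omega> n u2 w)"
        by (intro mult_left_mono Suc.IH goodD(2)[OF w g(2) s])
    qed
    also have "\<dots> = fn \<omega> (Suc n) u1 (u2 @ w) * fn \<omega> n u2 w"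
      using fn_Suc[OF w g(2) False] by (simp add: sum_distrib_right mult.assoc)
    also have "\<dots> \<le> fn \<omega> (Suc n) u1 (u2 @ w) * fn \<omega> (Suc n) u2 w"
      by (intro mult_left_mono fn_mono_Suc[OF w g2]) simp
    finally show ?thesis .
  qed simp
qed

lemma fn_le_q:
  assumes w: "good \<omega>" and x: "t # w \<in> G"
  shows "fn \<omega> n [t] w \<le> 1 - q \<omega> (t # w)"
proof -
  have we: "\<omega> \<in> space E" using w by (simp add: good_def)
  let ?X = "{U. steps \<omega> (t # w) U \<in> hitn n [t]}" and ?Y = "{U. steps \<omega> (t # w) U \<in> stay t}"
  have "measure unif_seq ?X + measure unif_seq ?Y = measure unif_seq (?X \<union> ?Y)"
  proof (rule us.finite_measure_Union[symmetric])
    show "?X \<inter> ?Y = {}" by (auto simp: hitn_def stay_def)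
  qed (use steps_vimage_sets[OF x we hitn_sets[of n "[t]"]] steps_vimage_sets[OF x we stay_sets[of t]] in auto)
  also have "\<dots> \<le> 1" by simp
  finally show ?thesis by (simp add: fn_def q_def qp_def)
qed

text \<open>A step to the child \<open>s # x\<close> followed by a stay in its cone forever
  precludes a return to \<open>x\<close>.\<close>

lemma visits_first_le:
  assumes w: "good \<omega>" and x: "s # x \<in> G"
  shows "qp \<omega> x (visits x x n 1) \<le> 1 - \<epsilon> * q \<omega> (s # x)"
proof -
  have we: "\<omega> \<in> space E" using w by (simp add: good_def)
  have xg: "x \<in> G" and s: "s \<in> S" using x by (auto simp: Gset_def dest: reduced_ConsD)
  have sx: "lmul s x = s # x" using x by (cases x) (auto simp: Cons_Gset)
  let ?D = "{\<sigma>. shd \<sigma> = s \<and> stl \<sigma> \<in> stay s}"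
  have Dm: "?D \<in> sets SS"
    using stake_sdrop_sets[OF stay_sets[of s], of "\<lambda>\<pi>. \<pi> = [s]" 1] by simp
  have dis: "visits x x n 1 \<inter> ?D = {}"
  proof (rule ccontr)
    assume "\<not> ?thesis"
    then obtain \<sigma> where a: "\<sigma> \<in> visits x x n 1" "shd \<sigma> = s" "stl \<sigma> \<in> stay s" by auto
    have "{m \<in> {1..n}. run x (stake m \<sigma>) = x} \<noteq> {}"
    proof
      assume e: "{m \<in> {1..n}. run x (stake m \<sigma>) = x} = {}"
      show False using a(1) unfolding visits_def mem_Collect_eq e by simp
    qed
    then obtain m where m: "1 \<le> m" "run x (stake m \<sigma>) = x" by auto
    then obtain m' where m': "m = Suc m'" by (cases m) auto
    have "run ([s] @ x) (stake m' (stl \<sigma>)) = run [s] (stake m' (stl \<sigma>)) @ x"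
      by (rule run_stake_app_base) (use a(3) in \<open>simp add: stay_def\<close>)
    then have "run x (stake m \<sigma>) = run [s] (stake m' (stl \<sigma>)) @ x" using m' a(2) sx by simp
    then show False using m(2) a(3) by (simp add: stay_def)
  qed
  have "measure unif_seq {U. steps \<omega> x U \<in> visits x x n 1} + measure unif_seq {U. steps \<omega> x U \<in> ?D}
     = measure unif_seq ({U. steps \<omega> x U \<in> visits x x n 1} \<union> {U. steps \<omega> x U \<in> ?D})"
    by (rule us.finite_measure_Union[symmetric])
      (use steps_vimage_sets[OF xg we visits_sets] steps_vimage_sets[OF xg we Dm] dis in auto)
  also have "\<dots> \<le> 1" by simp
  finally have "qp \<omega> x (visits x x n 1) + qp \<omega> x ?D \<le> 1" by (simp add: qp_def)
  moreover have "qp \<omega> x ?D = \<omega> x s * q \<omega> (s # x)"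
    using qp_Cons[OF w xg s stay_sets[of s]] by (simp add: sx q_def)
  moreover have "\<epsilon> * q \<omega> (s # x) \<le> \<omega> x s * q \<omega> (s # x)"
    using goodD(1)[OF w xg s] by (intro mult_right_mono) auto
  ultimately show ?thesis by simp
qed

text \<open>In a fixed environment the walk starts afresh at each visit, so every further visit
  costs a factor \<open>c\<close>. The induction runs over the horizon for all starting points
  \<open>z\<close>; the factors are collected when the first step hits \<open>x\<close>.\<close>

lemma visits_geometric:
  assumes w: "good \<omega>" and x: "x \<in> G" and c: "\<And>n. qp \<omega> x (visits x x n 1) \<le> c" "0 \<le> c"
  shows "z \<in> G \<Longrightarrow> qp \<omega> z (visits x z n (Suc y)) \<le> c ^ y * qp \<omega> z (visits x z n 1)"
proof (induction n arbitrary: z y)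
  case 0
  have "visits x z 0 (Suc y) = {}" by (auto simp: visits_def)
  then show ?case using c by (simp add: qp_def)
next
  case (Suc n)
  have vis: "{\<sigma>. s ## \<sigma> \<in> visits x z (Suc n) y'} = (if lmul s z = x then visits x x n (y' - 1) else visits x (lmul s z) n y')" for s y'
    unfolding visits_def mem_Collect_eq card_visits_Suc by auto
  have "qp \<omega> z (visits x z (Suc n) (Suc y)) = (\<Sum>s\<in>S. \<omega> z s * qp \<omega> (lmul s z) (if lmul s z = x then visits x x n y else visits x (lmul s z) n (Suc y)))"
    using qp_first_step[OF w Suc.prems visits_sets[of x z "Suc n" "Suc y"]] by (simp only: vis diff_Suc_1)
  also have "\<dots> \<le> (\<Sum>s\<in>S. \<omega> z s * (c ^ y * qp \<omega> (lmul s z) (if lmul s z = x then visits x x n 0 else visits x (lmul s z) n 1)))"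
  proof (rule sum_mono, rule mult_left_mono)
    fix s assume s: "s \<in> S"
    show "0 \<le> \<omega> z s" using goodD(2)[OF w Suc.prems s] .
    have l: "lmul s z \<in> G" using lmul_Gset[OF s Suc.prems] .
    show "qp \<omega> (lmul s z) (if lmul s z = x then visits x x n y else visits x (lmul s z) n (Suc y))
      \<le> c ^ y * qp \<omega> (lmul s z) (if lmul s z = x then visits x x n 0 else visits x (lmul s z) n 1)"
    proof (cases "lmul s z = x")
      case True
      have u: "visits x x n 0 = UNIV" by (auto simp: visits_def)
      have "qp \<omega> x (visits x x n y) \<le> c ^ y"
      proof (cases y)
        case (Suc y')
        have "qp \<omega> x (visits x x n (Suc y')) \<le> c ^ y' * qp \<omega> x (visits x x n 1)" by (rule Suc.IH[OF x])
        also have "\<dots> \<le> c ^ y' * c" using c by (intro mult_left_mono) auto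
        finally show ?thesis using Suc by (simp add: mult.commute)
      qed simp
      then show ?thesis using True u by simp
    next
      case False
      then show ?thesis using Suc.IH[OF l] by simp
    qed
  qed
  also have "\<dots> = c ^ y * (\<Sum>s\<in>S. \<omega> z s * qp \<omega> (lmul s z) (if lmul s z = x then visits x x n 0 else visits x (lmul s z) n 1))"
    by (simp add: sum_distrib_left mult.left_commute)
  also have "(\<Sum>s\<in>S. \<omega> z s * qp \<omega> (lmul s z) (if lmul s z = x then visits x x n 0 else visits x (lmul s z) n 1)) = qp \<omega> z (visits x z (Suc n) 1)"
    using qp_first_step[OF w Suc.prems visits_sets[of x z "Suc n" 1]] by (simp only: vis diff_self_eq_0)
  finally show ?case .
qed

lemma visits_le:
  assumes w: "good \<omega>" and x: "s # x \<in> G"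
  shows "qp \<omega> x (visits x x n y) \<le> (1 - \<epsilon> * q \<omega> (s # x)) ^ y"
proof (cases y)
  case (Suc y')
  have xg: "x \<in> G" using x by (auto simp: Gset_def dest: reduced_ConsD)
  let ?c = "1 - \<epsilon> * q \<omega> (s # x)"
  have "qp \<omega> x (visits x x n (Suc y')) \<le> ?c ^ y' * qp \<omega> x (visits x x n 1)"
    by (rule visits_geometric[OF w xg visits_first_le[OF w x] _ xg]) (rule q_pow_bounds)
  also have "\<dots> \<le> ?c ^ y' * ?c"
    by (intro mult_left_mono visits_first_le[OF w x] q_pow_bounds)
  finally show ?thesis using Suc by (simp add: mult.commute)
qed simp

text \<open>A path that starts at height at most \<open>h\<close> and reaches \<open>h\<close>
  before its return stands at some time at a word of length exactly \<open>h\<close>, since heights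
  change by one; from there the descent has probability at most \<open>H\<close>.\<close>

lemma retn_le:
  assumes w: "good \<omega>" and H: "0 \<le> H" "\<And>u' n. length u' = h \<Longrightarrow> last u' = t \<Longrightarrow> u' @ w \<in> G \<Longrightarrow> fn \<omega> n u' w \<le> H"
  shows "u @ w \<in> G \<Longrightarrow> last u = t \<Longrightarrow> u \<noteq> [] \<Longrightarrow> length u \<le> h \<Longrightarrow> qp \<omega> (u @ w) (retn h n u) \<le> H"
proof (induction n arbitrary: u)
  case 0
  then have "retn h 0 u = {}" by (auto simp: retn_def)
  then show ?case using H by (simp add: qp_def)
next
  case (Suc n)
  have we: "\<omega> \<in> space E" using w by (simp add: good_def)
  show ?case
  proof (cases "length u = h")
    case True
    have "qp \<omega> (u @ w) (retn h (Suc n) u) \<le> fn \<omega> (Suc n) u w"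
      unfolding fn_def
    proof (rule qp_mono)
      show "\<And>\<sigma>. \<sigma> \<in> retn h (Suc n) u \<Longrightarrow> \<sigma> \<in> hitn (Suc n) u" by (auto simp: retn_def hitn_def)
    qed (use Suc.prems we in auto)
    also have "\<dots> \<le> H" by (rule H(2)) (use True Suc.prems in auto)
    finally show ?thesis .
  next
    case False
    have "qp \<omega> (u @ w) (retn h (Suc n) u) = (\<Sum>s\<in>S. \<omega> (u @ w) s * qp \<omega> (lmul s u @ w) {\<sigma>. s ## \<sigma> \<in> retn h (Suc n) u})"
      using qp_first_step[OF w Suc.prems(1) retn_sets] Suc.prems(3) by (simp add: lmul_append)
    also have "\<dots> \<le> (\<Sum>s\<in>S. \<omega> (u @ w) s * H)"
    proof (rule sum_mono, rule mult_left_mono)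
      fix s assume s: "s \<in> S"
      show "0 \<le> \<omega> (u @ w) s" using goodD(2)[OF w Suc.prems(1) s] .
      have g: "lmul s u @ w \<in> G" using lmul_Gset[OF s Suc.prems(1)] Suc.prems(3) by (simp add: lmul_append)
      \<comment> \<open>A path that used up \<open>u\<close> in its first step would have returned
        without reaching height \<open>h\<close>.\<close>
      have sub: "\<sigma> \<in> retn h n (lmul s u) \<and> lmul s u \<noteq> []" if "s ## \<sigma> \<in> retn h (Suc n) u" for \<sigma>
      proof -
        from that obtain m' m where m: "m' \<le> Suc n" "run u (stake m' (s ## \<sigma>)) = []" "\<forall>i<m'. run u (stake i (s ## \<sigma>)) \<noteq> []"
          "m \<le> m'" "h \<le> length (run u (stake m (s ## \<sigma>)))"
          by (auto simp: retn_def)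
        obtain k' where k': "m' = Suc k'" using m(2) Suc.prems(3) by (cases m') auto
        obtain k where k: "m = Suc k" using m(5) False Suc.prems(4) by (cases m) auto
        have r: "\<forall>i<k'. run (lmul s u) (stake i \<sigma>) \<noteq> []" using m(3) k' by (auto dest: spec[of _ "Suc _"])
        have "lmul s u \<noteq> []"
        proof
          assume e: "lmul s u = []"
          then have "k' = 0" using r by (cases k') auto
          then have "k = 0" using m(4) k k' by simp
          then show False using m(5) k e Suc.prems(3,4) by simp
        qed
        moreover have "\<sigma> \<in> retn h n (lmul s u)"
        proof -
          have "\<exists>i\<le>k'. h \<le> length (run (lmul s u) (stake i \<sigma>))" using m k k' by (intro exI[of _ k]) simp
          then show ?thesis unfolding retn_def using m k' r by (intro CollectI exI[of _ k']) simp
        qed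
        ultimately show ?thesis by simp
      qed
      show "qp \<omega> (lmul s u @ w) {\<sigma>. s ## \<sigma> \<in> retn h (Suc n) u} \<le> H"
      proof (cases "lmul s u = []")
        case True
        then have "{\<sigma>. s ## \<sigma> \<in> retn h (Suc n) u} = {}" using sub by auto
        then show ?thesis using H by (simp add: qp_def)
      next
        case nz: False
        have "length (lmul s u) \<le> h" using length_lmul_le[of s u] False Suc.prems(4) by simp
        then have "qp \<omega> (lmul s u @ w) (retn h n (lmul s u)) \<le> H"
          by (intro Suc.IH[OF g]) (use Suc.prems nz in \<open>auto simp: last_lmul\<close>)
        moreover have "qp \<omega> (lmul s u @ w) {\<sigma>. s ## \<sigma> \<in> retn h (Suc n) u} \<le> qp \<omega> (lmul s u @ w) (retn h n (lmul s u))"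
          by (rule qp_mono[OF g we]) (use sub in auto)
        ultimately show ?thesis by simp
      qed
    qed
    also have "\<dots> = H" using goodD(3)[OF w Suc.prems(1)] by (simp add: sum_distrib_right[symmetric])
    finally show ?thesis .
  qed
qed

text \<open>A way on from a vertex of type \<open>t\<close> other than the one through
  \<open>t'\<close>; it exists by \<open>S_avoid2\<close>.\<close>

definition sib :: "letter \<Rightarrow> letter \<Rightarrow> letter" where
  "sib t t' = (SOME c. c \<in> S \<and> c \<noteq> linv t \<and> c \<noteq> t')"

lemma sib: "sib t t' \<in> S" "sib t t' \<noteq> linv t" "sib t t' \<noteq> t'"
  using someI_ex[of "\<lambda>c. c \<in> S \<and> c \<noteq> linv t \<and> c \<noteq> t'"] S_avoid2[of "linv t" t'] unfolding sib_def by blast+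

text \<open>Dominates the \<open>p\<close>-th power of all probabilities to return from height \<open>h\<close>: on the way back
  along a line the walk gets, at each level, the chance to escape through a branch off the line.\<close>

primrec Rec :: "nat \<Rightarrow> nat \<Rightarrow> (letter list \<Rightarrow> letter \<Rightarrow> real) \<Rightarrow> letter \<Rightarrow> letter list \<Rightarrow> real" where
  "Rec p 0 \<omega> t w = 1"
| "Rec p (Suc h) \<omega> t w = (\<Sum>t'\<in>S - {linv t}. (1 - \<epsilon> * q \<omega> (sib t t' # t # w)) ^ p * Rec p h \<omega> t' (t # w))"

lemma Rec_nonneg: "0 \<le> Rec p h \<omega> t w"
  by (induction h arbitrary: t w) (auto intro!: sum_nonneg mult_nonneg_nonneg)

text \<open>The line is peeled off from its base. At each vertex below the top the descent must not
  be lost to the branch \<open>sib\<close>, which gives the factor in \<open>Rec\<close>; the sum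
  over all \<open>t'\<close> contains the term that follows the line. The top vertex is estimated by
  1, hence the height \<open>length u - 1\<close>.\<close>

lemma fn_le_Rec:
  assumes w: "good \<omega>"
  shows "u @ w \<in> G \<Longrightarrow> u \<noteq> [] \<Longrightarrow> last u = t \<Longrightarrow> fn \<omega> n u w ^ p \<le> Rec p (length u - 1) \<omega> t w"
proof (induction u arbitrary: t w rule: rev_induct)
  case (snoc t0 u)
  show ?case
  proof (cases "u = []")
    case True
    then show ?thesis by (simp add: power_le_one)
  next
    case False
    let ?t' = "last u"
    have g: "u @ t # w \<in> G" and t0: "t0 = t" using snoc.prems by auto
    obtain u' where u': "u = u' @ [?t']" using False by (metis append_butlast_last_id)
    have "?t' # t # w \<in> G" using Gset_suffix[of u' "?t' # t # w" k r] g u' by (metis append.assoc append_Cons append_Nil)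
    then have t': "?t' \<in> S - {linv t}" and tw: "t # w \<in> G" by (auto simp: Cons_Gset)
    have sg: "sib t ?t' # t # w \<in> G" using tw sib[of t ?t'] by (intro child_Gset)
    have "fn \<omega> n (u @ [t]) w \<le> fn \<omega> n u ([t] @ w) * fn \<omega> n [t] w"
      by (rule fn_product[OF w]) (use g in simp)
    also have "\<dots> \<le> fn \<omega> n u (t # w) * (1 - \<epsilon> * q \<omega> (sib t ?t' # t # w))"
      using fn_le_q[OF w tw, of n] q_child_eps[OF w sg] by (auto intro!: mult_left_mono)
    finally have "fn \<omega> n (u @ [t]) w ^ p \<le> (fn \<omega> n u (t # w) * (1 - \<epsilon> * q \<omega> (sib t ?t' # t # w))) ^ p"
      by (rule power_mono) simp
    also have "\<dots> = (1 - \<epsilon> * q \<omega> (sib t ?t' # t # w)) ^ p * fn \<omega> n u (t # w) ^ p"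
      by (simp add: power_mult_distrib)
    also have "\<dots> \<le> (1 - \<epsilon> * q \<omega> (sib t ?t' # t # w)) ^ p * Rec p (length u - 1) \<omega> ?t' (t # w)"
      by (intro mult_left_mono snoc.IH g False) auto
    also have "\<dots> \<le> (\<Sum>t'\<in>S - {linv t}. (1 - \<epsilon> * q \<omega> (sib t t' # t # w)) ^ p * Rec p (length u - 1) \<omega> t' (t # w))"
      by (rule member_le_sum[OF t']) (auto intro!: mult_nonneg_nonneg Rec_nonneg)
    also have "\<dots> = Rec p (length (u @ [t0]) - 1) \<omega> t w"
      using False by (cases "length u") auto
    finally show ?thesis using t0 by simp
  qed
qed simp

lemma Rec_measurable [measurable]: "t # w \<in> G \<Longrightarrow> Rec p h \<in> {f. (\<lambda>\<omega>. f \<omega> t w) \<in> borel_measurable E}"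
proof (induction h arbitrary: t w)
  case (Suc h)
  have "(\<lambda>\<omega>. (1 - \<epsilon> * q \<omega> (sib t t' # t # w)) ^ p * Rec p h \<omega> t' (t # w)) \<in> borel_measurable E" if "t' \<in> S - {linv t}" for t'
  proof -
    have "t' # t # w \<in> G" "sib t t' # t # w \<in> G" using Suc.prems that sib[of t t'] by (auto intro!: child_Gset)
    then show ?thesis using Suc.IH[of t' "t # w"] by (auto intro!: borel_measurable_times borel_measurable_power borel_measurable_diff q_measurable)
  qed
  then show ?case by (auto intro!: borel_measurable_sum)
qed simp

lemma Rec_le: "Rec p h \<omega> t w \<le> real (card S) ^ h"
proof (induction h arbitrary: t w)
  case (Suc h)
  have "Rec p (Suc h) \<omega> t w \<le> (\<Sum>t'\<in>S - {linv t}. 1 * real (card S) ^ h)"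
    unfolding Rec.simps by (intro sum_mono mult_mono Suc.IH Rec_nonneg) auto
  also have "\<dots> \<le> real (card S) * real (card S) ^ h"
    by (auto intro!: mult_right_mono card_mono)
  finally show ?case by simp
qed simp

lemma Rec_integrable: "t # w \<in> G \<Longrightarrow> integrable E (\<lambda>\<omega>. Rec p h \<omega> t w)"
  by (rule env.integrable_const_bound[where B="real (card S) ^ h"])
    (use Rec_measurable[of t w p h] Rec_le Rec_nonneg in \<open>auto simp: abs_of_nonneg\<close>)

lemma dep_Rec: "t # w \<in> G \<Longrightarrow> dep (cone t w) (\<lambda>\<omega>. Rec p h \<omega> t w)"
proof (induction h arbitrary: t w)
  case 0
  then show ?case by (simp add: dep_def)
next
  case (Suc h)
  show ?case unfolding dep_def
  proof (intro ballI impI)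
    fix \<omega> \<omega>' assume a: "\<omega> \<in> space E" "\<omega>' \<in> space E" "\<forall>x\<in>cone t w. \<omega> x = \<omega>' x"
    have "(1 - \<epsilon> * q \<omega> (sib t t' # t # w)) ^ p * Rec p h \<omega> t' (t # w) = (1 - \<epsilon> * q \<omega>' (sib t t' # t # w)) ^ p * Rec p h \<omega>' t' (t # w)" if "t' \<in> S - {linv t}" for t'
    proof -
      have g: "t' # t # w \<in> G" "sib t t' # t # w \<in> G" using Suc.prems that sib[of t t'] by (auto intro!: child_Gset)
      have 1: "Rec p h \<omega> t' (t # w) = Rec p h \<omega>' t' (t # w)"
        by (rule depD[OF Suc.IH[OF g(1)] a(1,2)]) (use a(3) cone_child[OF g(1)] in auto)
      have 2: "q \<omega> (sib t t' # t # w) = q \<omega>' (sib t t' # t # w)"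
        by (rule depD[OF dep_q[of "sib t t'" "t # w" "\<lambda>x. x"] a(1,2)]) (use sib[of t t'] a(3) cone_child[OF g(2)] in auto)
      show ?thesis using 1 2 by simp
    qed
    then show "Rec p (Suc h) \<omega> t w = Rec p (Suc h) \<omega>' t w" by simp
  qed
qed

lemma q_pow_integrable: "x \<in> G \<Longrightarrow> integrable E (\<lambda>\<omega>. (1 - \<epsilon> * q \<omega> x) ^ y)"
  by (rule env.integrable_const_bound[where B=1])
    (auto simp: abs_of_nonneg intro!: borel_measurable_power borel_measurable_diff borel_measurable_times q_measurable)

lemma q_pow_translate:
  assumes "t # w \<in> G"
  shows "(\<integral>\<omega>. (1 - \<epsilon> * q \<omega> (t # w)) ^ y \<partial>E) = (\<integral>\<omega>. (1 - \<epsilon> * q \<omega> [t]) ^ y \<partial>E)"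
  by (rule q_translate[OF assms, of "\<lambda>x. (1 - \<epsilon> * x) ^ y"]) simp

text \<open>The branches \<open>sib t t'\<close> and \<open>t'\<close> carry independent
  environments, so the expectation factorises level by level. A large power \<open>p\<close> will
  make \<theta> small enough to beat \<open>card S\<close>, which bounds the number of
  continuations.\<close>

lemma Rec_expectation:
  assumes \<theta>: "\<And>t. t \<in> S \<Longrightarrow> (\<integral>\<omega>. (1 - \<epsilon> * q \<omega> [t]) ^ p \<partial>E) \<le> \<theta>" "0 \<le> \<theta>"
  shows "t # w \<in> G \<Longrightarrow> (\<integral>\<omega>. Rec p h \<omega> t w \<partial>E) \<le> (real (card S) * \<theta>) ^ h"
proof (induction h arbitrary: t w)
  case 0
  then show ?case by simp
next
  case (Suc h)
  have one: "(\<integral>\<omega>. (1 - \<epsilon> * q \<omega> (sib t t' # t # w)) ^ p * Rec p h \<omega> t' (t # w) \<partial>E) \<le> \<theta> * (real (card S) * \<theta>) ^ h"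
    and int: "integrable E (\<lambda>\<omega>. (1 - \<epsilon> * q \<omega> (sib t t' # t # w)) ^ p * Rec p h \<omega> t' (t # w))"
    if t': "t' \<in> S - {linv t}" for t'
  proof -
    have g: "t' # t # w \<in> G" "sib t t' # t # w \<in> G" using Suc.prems t' sib[of t t'] by (auto intro!: child_Gset)
    have "(\<integral>\<omega>. (1 - \<epsilon> * q \<omega> (sib t t' # t # w)) ^ p * Rec p h \<omega> t' (t # w) \<partial>E)
       = (\<integral>\<omega>. (1 - \<epsilon> * q \<omega> (sib t t' # t # w)) ^ p \<partial>E) * (\<integral>\<omega>. Rec p h \<omega> t' (t # w) \<partial>E)"
    proof (rule dep_indep[where V="cone (sib t t') (t # w)" and W="cone t' (t # w)"])
      show "cone (sib t t') (t # w) \<inter> cone t' (t # w) = {}" using sib[of t t'] by (intro cone_disjoint)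
      show "dep (cone (sib t t') (t # w)) (\<lambda>\<omega>. (1 - \<epsilon> * q \<omega> (sib t t' # t # w)) ^ p)"
        by (rule dep_q[of _ _ "\<lambda>x. (1 - \<epsilon> * x) ^ p"]) (rule sib)
    qed (use g cone_subset dep_Rec Rec_integrable Rec_measurable[of t' "t # w" p h] q_pow_integrable in auto)
    also have "\<dots> \<le> \<theta> * (real (card S) * \<theta>) ^ h"
      unfolding q_pow_translate[OF g(2)]
      by (intro mult_mono \<theta> Suc.IH g sib integral_nonneg_AE) (auto simp: Rec_nonneg)
    finally show "(\<integral>\<omega>. (1 - \<epsilon> * q \<omega> (sib t t' # t # w)) ^ p * Rec p h \<omega> t' (t # w) \<partial>E) \<le> \<theta> * (real (card S) * \<theta>) ^ h" .
    show "integrable E (\<lambda>\<omega>. (1 - \<epsilon> * q \<omega> (sib t t' # t # w)) ^ p * Rec p h \<omega> t' (t # w))"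
    proof (rule env.integrable_const_bound[where B="1 * real (card S) ^ h"])
      show "AE \<omega> in E. norm ((1 - \<epsilon> * q \<omega> (sib t t' # t # w)) ^ p * Rec p h \<omega> t' (t # w)) \<le> 1 * real (card S) ^ h"
      proof (rule AE_I2)
        fix \<omega>
        have "0 \<le> (1 - \<epsilon> * q \<omega> (sib t t' # t # w)) ^ p * Rec p h \<omega> t' (t # w)"
          by (intro mult_nonneg_nonneg Rec_nonneg q_pow_bounds)
        moreover have "(1 - \<epsilon> * q \<omega> (sib t t' # t # w)) ^ p * Rec p h \<omega> t' (t # w) \<le> 1 * real (card S) ^ h"
          by (intro mult_mono Rec_le Rec_nonneg q_pow_bounds) simp
        ultimately show "norm ((1 - \<epsilon> * q \<omega> (sib t t' # t # w)) ^ p * Rec p h \<omega> t' (t # w)) \<le> 1 * real (card S) ^ h"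
          by simp
      qed
    qed (use g Rec_measurable[of t' "t # w" p h] in \<open>auto intro!: borel_measurable_times borel_measurable_power borel_measurable_diff q_measurable\<close>)
  qed
  have "(\<integral>\<omega>. Rec p (Suc h) \<omega> t w \<partial>E) = (\<Sum>t'\<in>S - {linv t}. \<integral>\<omega>. (1 - \<epsilon> * q \<omega> (sib t t' # t # w)) ^ p * Rec p h \<omega> t' (t # w) \<partial>E)"
    unfolding Rec.simps by (rule Bochner_Integration.integral_sum) (rule int)
  also have "\<dots> \<le> (\<Sum>t'\<in>S - {linv t}. \<theta> * (real (card S) * \<theta>) ^ h)"
    by (rule sum_mono) (rule one)
  also have "\<dots> \<le> real (card S) * (\<theta> * (real (card S) * \<theta>) ^ h)"
    using \<theta>(2) by (auto intro!: mult_right_mono card_mono)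
  finally show ?case by (simp add: mult_ac)
qed

end

section \<open>Escape probabilities\<close>

lemma exp_neg_le: assumes "0 < (z::real)" shows "exp (- z) \<le> fact n / z ^ n"
proof -
  have "z ^ n / fact n = (\<Sum>i\<in>{n}. z ^ i / fact i)" by simp
  also have "\<dots> \<le> (\<Sum>i. z ^ i / fact i)"
    using summable_exp_generic[of z] assms by (intro sum_le_suminf) (auto simp: divide_inverse mult.commute)
  also have "\<dots> = exp z" by (simp add: exp_def divide_inverse mult.commute)
  finally have "z ^ n / fact n \<le> exp z" .
  then have "z ^ n \<le> exp z * fact n" by (simp add: field_simps)
  then show ?thesis using assms by (simp add: exp_minus field_simps)
qed

section \<open>Positive speed yields positive escape probabilities\<close>

locale rwre_speed = rwre +
  fixes v :: real
  assumes v_pos: "v > 0"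
    and speed: "AE z in annealed k r \<mu>. (\<lambda>n. real (length (walk k r (fst z) (snd z) n)) / real n) \<longlonglongrightarrow> v"
begin

lemma run_fun_measurable: "(\<lambda>\<sigma>. f (stake n \<sigma>) :: real) \<in> borel_measurable SS"
  by (rule measurable_compose[OF stake_measurable_SS]) simp

lemma lim_sets: "{\<sigma>. (\<lambda>n. f n (stake n \<sigma>) :: real) \<longlonglongrightarrow> c} \<in> sets SS"
proof -
  have "Measurable.pred SS (\<lambda>\<sigma>. (\<lambda>n. f n (stake n \<sigma>) :: real) \<longlonglongrightarrow> c)"
    by (rule measurable_limit2) (rule run_fun_measurable, simp)
  then show ?thesis by (simp add: pred_def)
qed

lemma speed_Aw: "AE \<sigma> in Aw []. (\<lambda>n. real (length (run [] (stake n \<sigma>))) / real n) \<longlonglongrightarrow> v"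
  unfolding Aw_def
proof (subst AE_distr_iff[OF steps_measurable])
  show "AE z in E \<Otimes>\<^sub>M unif_seq. (\<lambda>n. real (length (run [] (stake n (steps (fst z) [] (snd z))))) / real n) \<longlonglongrightarrow> v"
    using speed unfolding annealed_def run_steps gwalk_Nil .
  show "{\<sigma> \<in> space SS. (\<lambda>n. real (length (run [] (stake n \<sigma>))) / real n) \<longlonglongrightarrow> v} \<in> sets SS"
    using lim_sets[of "\<lambda>n \<pi>. real (length (run [] \<pi>)) / real n" v] by simp
qed simp

lemma eventually_large:
  assumes "(\<lambda>n. real (length (X n :: letter list)) / real n) \<longlonglongrightarrow> v"
  shows "\<exists>N. \<forall>n>N. h \<le> length (X n)"
proof -
  have "eventually (\<lambda>n. v / 2 < real (length (X n)) / real n) sequentially"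
    using assms v_pos by (intro order_tendstoD) auto
  moreover have "eventually (\<lambda>n. real h * 2 / v < real n) sequentially"
    by (simp add: filterlim_real_sequentially[unfolded filterlim_at_top_dense])
  ultimately have "eventually (\<lambda>n. h \<le> length (X n)) sequentially"
    using eventually_gt_at_top[of 0]
  proof eventually_elim
    case (elim n)
    then have "v / 2 * real n < real (length (X n))" "real h * 2 < v * real n"
      using v_pos by (simp_all add: field_simps)
    then have "real h < real (length (X n))" by simp
    then show ?case by simp
  qed
  then obtain N where "\<forall>n\<ge>N. h \<le> length (X n)" by (auto simp: eventually_sequentially)
  then show ?thesis by (intro exI[of _ N]) auto
qed

definition esc :: "letter \<Rightarrow> real" where
  "esc t = measure (Aw [t]) (stay t)"

lemma esc_eq: "t \<in> S \<Longrightarrow> esc t = (\<integral>\<omega>. q \<omega> [t] \<partial>E)"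
  unfolding esc_def q_def by (simp add: Aw_eq)

lemma q_integrable: "x \<in> G \<Longrightarrow> integrable E (\<lambda>\<omega>. q \<omega> x)"
  by (simp add: q_def qp_integrable)

text \<open>By positive speed the walk visits the root a last time. After that it stays forever in
  the cone of the letter it picks; if no letter had a positive escape probability, almost surely no
  time could be such a last visit.\<close>

lemma ex_escape: "\<exists>t\<in>S. 0 < esc t"
proof (rule ccontr)
  assume "\<not> ?thesis"
  then have z: "esc t = 0" if "t \<in> S" for t
    using that by (force simp: esc_def measure_le_0_iff not_less)
  let ?D = "{\<sigma>. \<forall>n>0. run [] (stake n \<sigma>) \<noteq> []}"
  have Dm: "?D \<in> sets SS"
  proof -
    have "?D = (\<Inter>n\<in>{0<..}. {\<sigma>. run [] (stake n \<sigma>) \<noteq> []})" by auto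
    moreover have "{\<sigma>. run [] (stake n \<sigma>) \<noteq> []} \<in> sets SS" for n
      using stake_pred_sets[of "\<lambda>\<pi>. run [] \<pi> \<noteq> []" n] by simp
    ultimately show ?thesis by auto
  qed
  have Ds: "{\<sigma>. s ## \<sigma> \<in> ?D} = stay s" for s
  proof (intro set_eqI iffI)
    fix \<sigma> assume a: "\<sigma> \<in> {\<sigma>. s ## \<sigma> \<in> ?D}"
    have "run [s] (stake n \<sigma>) \<noteq> []" for n using a by (auto dest: spec[of _ "Suc n"])
    then show "\<sigma> \<in> stay s" by (simp add: stay_def)
  next
    fix \<sigma> assume a: "\<sigma> \<in> stay s"
    have "run [] (stake n (s ## \<sigma>)) \<noteq> []" if "0 < n" for n
      using that a by (cases n) (auto simp: stay_def)
    then show "\<sigma> \<in> {\<sigma>. s ## \<sigma> \<in> ?D}" by simp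
  qed
  have "AE \<omega> in E. \<forall>t\<in>S. q \<omega> [t] = 0"
  proof (rule AE_finite_allI)
    fix t assume t: "t \<in> S"
    have "(\<integral>\<omega>. q \<omega> [t] \<partial>E) = 0" using z[OF t] esc_eq[OF t] by simp
    then show "AE \<omega> in E. q \<omega> [t] = 0"
      using integral_nonneg_eq_0_iff_AE[OF q_integrable[of "[t]"]] t by simp
  qed simp
  then have q0: "AE \<omega> in E. qp \<omega> [] ?D = 0"
    using AE_good
  proof eventually_elim
    case (elim \<omega>)
    then show ?case
      using qp_first_step[OF elim(2) Nil_Gset Dm] unfolding Ds by (simp add: q_def)
  qed
  interpret A: prob_space "Aw []" by (rule prob_space_Aw) simp
  have N: "AE \<sigma> in Aw []. \<not> (run [] (stake N \<sigma>) = [] \<and> sdrop N \<sigma> \<in> ?D)" for N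
  proof -
    let ?P = "\<lambda>\<pi>. length \<pi> = N \<and> run [] \<pi> = []"
    let ?Z = "{\<sigma>. \<exists>n. first_at ?P (stake n \<sigma>) \<and> sdrop n \<sigma> \<in> (\<lambda>_. ?D) (stake n \<sigma>)}"
    have "measure (Aw []) ?Z \<le> 0 * measure (Aw []) {\<sigma>. \<exists>n. ?P (stake n \<sigma>)}"
    proof (rule first_le[OF _ Dm])
      fix \<pi> assume p: "set \<pi> \<subseteq> S" "first_at ?P \<pi>"
      have "measure (Aw []) {\<sigma>. stake (length \<pi>) \<sigma> = \<pi> \<and> sdrop (length \<pi>) \<sigma> \<in> ?D} = (\<integral>\<omega>. wt \<omega> [] \<pi> * qp \<omega> [] ?D \<partial>E)"
        using Aw_prefix[OF _ p(1) Dm, of "[]"] p(2) by (simp add: first_at_def)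
      also have "\<dots> = 0"
        by (rule integral_eq_zero_AE) (use q0 in \<open>eventually_elim, simp\<close>)
      finally show "measure (Aw []) {\<sigma>. stake (length \<pi>) \<sigma> = \<pi> \<and> sdrop (length \<pi>) \<sigma> \<in> ?D} \<le> 0 * measure (Aw []) {\<sigma>. stake (length \<pi>) \<sigma> = \<pi>}"
        by simp
    qed auto
    then have z: "measure (Aw []) ?Z = 0" by (simp add: measure_le_0_iff)
    have Zm: "?Z \<in> sets (Aw [])" using first_set_sets[of "\<lambda>_. ?D" ?P, OF Dm] by simp
    have "AE \<sigma> in Aw []. \<sigma> \<notin> ?Z"
      using z Zm by (simp add: A.prob_eq_0)
    then show ?thesis
    proof eventually_elim
      case (elim \<sigma>)
      show ?case
      proof
        assume a: "run [] (stake N \<sigma>) = [] \<and> sdrop N \<sigma> \<in> ?D"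
        have "first_at ?P (stake N \<sigma>)" using a by (auto simp: first_at_def)
        then show False using elim a by blast
      qed
    qed
  qed
  have "AE \<sigma> in Aw []. \<forall>N. \<not> (run [] (stake N \<sigma>) = [] \<and> sdrop N \<sigma> \<in> ?D)"
    using N by (simp add: AE_all_countable)
  then have "AE \<sigma> in Aw []. False"
    using speed_Aw
  proof eventually_elim
    case (elim \<sigma>)
    obtain N where N: "\<And>n. n > N \<Longrightarrow> 1 \<le> length (run [] (stake n \<sigma>))"
      using eventually_large[OF elim(2), of 1] by blast
    \<comment> \<open>The maximum of this set is the last visit to the root; time 0 makes the set
      nonempty.\<close>
    let ?M = "{n. n \<le> N \<and> run [] (stake n \<sigma>) = []}"
    have fin: "finite ?M" and ne: "?M \<noteq> {}" by (auto intro!: exI[of _ 0])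
    have M: "Max ?M \<in> ?M" using Max_in[OF fin ne] .
    have "run [] (stake n (sdrop (Max ?M) \<sigma>)) \<noteq> []" if "n > 0" for n
    proof
      assume "run [] (stake n (sdrop (Max ?M) \<sigma>)) = []"
      then have e: "run [] (stake (Max ?M + n) \<sigma>) = []" using M by (simp add: stake_add_run)
      then have "Max ?M + n \<le> N" using N[of "Max ?M + n"] by (cases "Max ?M + n > N") auto
      then have "Max ?M + n \<in> ?M" using e by simp
      then have "Max ?M + n \<le> Max ?M" using Max_ge[OF fin] by blast
      then show False using that by simp
    qed
    then have "sdrop (Max ?M) \<sigma> \<in> ?D" by simp
    then show ?case using elim(1) M by blast
  qed
  then show False by simp
qed

text \<open>From \<open>t'\<close> two steps lead to the cone of a letter \<open>t\<close> with
  positive escape probability, each at a cost of \<epsilon>. The intermediate letter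
  \<open>s\<close> prevents cancellation even if \<open>t\<close> is the inverse of
  \<open>t'\<close>.\<close>

lemma esc_pos: assumes t': "t' \<in> S" shows "0 < esc t'"
proof -
  obtain t where t: "t \<in> S" "0 < esc t" using ex_escape by blast
  obtain s where s: "s \<in> S" "s \<noteq> linv t'" "s \<noteq> linv t" using S_avoid2 by blast
  have g1: "s # t' # [] \<in> G" by (rule child_Gset[OF _ s(1,2)]) (use t' in simp)
  have "t \<noteq> linv s" using s(3) linv_eq_iff by metis
  have g: "t # s # t' # [] \<in> G" by (rule child_Gset[OF g1 t(1) \<open>t \<noteq> linv s\<close>])
  have "\<epsilon> ^ 2 * esc t = (\<integral>\<omega>. \<epsilon> ^ 2 * q \<omega> (t # s # t' # []) \<partial>E)"
    using q_translate[OF g, of "\<lambda>x. x"] esc_eq[OF t(1)] by simp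
  also have "\<dots> \<le> (\<integral>\<omega>. q \<omega> (t' # []) \<partial>E)"
  proof (rule integral_mono_AE)
    show "AE \<omega> in E. \<epsilon> ^ 2 * q \<omega> (t # s # t' # []) \<le> q \<omega> (t' # [])"
      using AE_good
    proof eventually_elim
      case (elim \<omega>)
      have "\<epsilon> * (\<epsilon> * q \<omega> (t # s # t' # [])) \<le> \<epsilon> * q \<omega> (s # t' # [])"
        using q_child_eps[OF elim g] eps_pos by (intro mult_left_mono) auto
      also have "\<dots> \<le> q \<omega> (t' # [])" by (rule q_child_eps[OF elim g1])
      finally show ?case by (simp add: power2_eq_square mult.assoc)
    qed
  qed (use g t' in \<open>auto intro!: q_integrable integrable_mult_right\<close>)
  finally have "\<epsilon> ^ 2 * esc t \<le> esc t'" using esc_eq[OF t'] by simp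
  moreover have "0 < \<epsilon> ^ 2 * esc t" using eps_pos t by simp
  ultimately show ?thesis by simp
qed

definition \<beta> :: real where "\<beta> = Min (esc ` S)"

lemma beta: "0 < \<beta>" "t \<in> S \<Longrightarrow> \<beta> \<le> esc t" "\<beta> \<le> 1"
proof -
  show "0 < \<beta>" unfolding \<beta>_def using S_nonempty esc_pos by (subst Min_gr_iff) auto
  show le: "t \<in> S \<Longrightarrow> \<beta> \<le> esc t" for t unfolding \<beta>_def by (rule Min_le) auto
  obtain t where t: "t \<in> S" using S_nonempty by blast
  interpret prob_space "Aw [t]" by (rule prob_space_Aw) (use t in simp)
  show "\<beta> \<le> 1" using le[OF t] prob_le_1[of "stay t"] unfolding esc_def by linarith
qed

text \<open>Distribution function of the quenched escape probability from a cone of type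
  \<open>t\<close>; its decay at 0 controls the negative moments.\<close>

definition pq :: "letter \<Rightarrow> real \<Rightarrow> real" where
  "pq t u = (\<integral>\<omega>. indicat_real {..u} (q \<omega> [t]) \<partial>E)"

lemma ind_integrable: "x \<in> G \<Longrightarrow> integrable E (\<lambda>\<omega>. indicat_real {..u::real} (q \<omega> x) :: real)"
  by (rule env.integrable_const_bound[where B=1]) (auto intro!: measurable_compose[OF q_measurable])

lemma pq_bounds: "t \<in> S \<Longrightarrow> 0 \<le> pq t u" "t \<in> S \<Longrightarrow> pq t u \<le> 1"
proof -
  show "t \<in> S \<Longrightarrow> 0 \<le> pq t u" unfolding pq_def by (rule integral_nonneg_AE) auto
  assume t: "t \<in> S"
  have "pq t u \<le> (\<integral>\<omega>. 1 \<partial>E)" unfolding pq_def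
    by (rule integral_mono[OF ind_integrable]) (use t in \<open>auto simp: indicator_def\<close>)
  then show "pq t u \<le> 1" by (simp add: env.prob_space)
qed

lemma pq_mono: "t \<in> S \<Longrightarrow> u \<le> u' \<Longrightarrow> pq t u \<le> pq t u'"
  unfolding pq_def by (rule integral_mono[OF ind_integrable ind_integrable]) (auto simp: indicator_def)

text \<open>A small escape probability at a vertex forces small escape probabilities in two disjoint branches,
  which are independent. Iterating this bounds all negative moments.\<close>

lemma pq_square:
  assumes le: "\<And>t. t \<in> S \<Longrightarrow> pq t u \<le> c" and t: "t \<in> S"
  shows "pq t (\<epsilon> * u) \<le> c ^ 2"
proof -
  \<comment> \<open>The choice of \<open>?b\<close> excludes \<open>?a\<close>, so these are two
    distinct children and their cones are disjoint.\<close>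
  let ?a = "sib t t" let ?b = "sib t ?a"
  have g: "?a # t # [] \<in> G" "?b # t # [] \<in> G" using t sib[of t t] sib[of t ?a] by (auto intro!: child_Gset)
  have tr: "(\<integral>\<omega>. indicat_real {..u} (q \<omega> (c # t # [])) \<partial>E) = pq c u" if "c # t # [] \<in> G" for c
    unfolding pq_def by (rule q_translate[OF that]) simp
  have "pq t (\<epsilon> * u) \<le> (\<integral>\<omega>. indicat_real {..u} (q \<omega> (?a # t # [])) * indicat_real {..u} (q \<omega> (?b # t # [])) \<partial>E)"
    unfolding pq_def
  proof (rule integral_mono_AE)
    show "AE \<omega> in E. indicat_real {..\<epsilon> * u} (q \<omega> [t]) \<le> (indicat_real {..u} (q \<omega> (?a # t # [])) * indicat_real {..u} (q \<omega> (?b # t # [])) :: real)"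
      using AE_good
    proof eventually_elim
      case (elim \<omega>)
      show ?case
      proof (cases "q \<omega> [t] \<le> \<epsilon> * u")
        case True
        then have "\<epsilon> * q \<omega> (?a # t # []) \<le> \<epsilon> * u" "\<epsilon> * q \<omega> (?b # t # []) \<le> \<epsilon> * u"
          using q_child_eps[OF elim g(1)] q_child_eps[OF elim g(2)] by auto
        then show ?thesis using eps_pos True by simp
      qed (simp add: indicator_def)
    qed
    show "integrable E (\<lambda>\<omega>. indicat_real {..u} (q \<omega> (?a # t # [])) * indicat_real {..u} (q \<omega> (?b # t # [])) :: real)"
      by (rule env.integrable_const_bound[where B=1])
        (use g in \<open>auto simp: indicator_def intro!: borel_measurable_times measurable_compose[OF q_measurable]\<close>)
  qed (use t in \<open>auto intro: ind_integrable\<close>)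
  also have "\<dots> = (\<integral>\<omega>. indicat_real {..u} (q \<omega> (?a # t # [])) \<partial>E) * (\<integral>\<omega>. indicat_real {..u} (q \<omega> (?b # t # [])) \<partial>E)"
  proof (rule dep_indep[where V="cone ?a [t]" and W="cone ?b [t]"])
    show "cone ?a [t] \<inter> cone ?b [t] = {}" using sib[of t ?a] by (intro cone_disjoint) auto
    show "dep (cone ?a [t]) (\<lambda>\<omega>. indicat_real {..u} (q \<omega> (?a # t # [])))"
      by (rule dep_q[of _ _ "indicat_real {..u}"]) (rule sib)
    show "dep (cone ?b [t]) (\<lambda>\<omega>. indicat_real {..u} (q \<omega> (?b # t # [])))"
      by (rule dep_q[of _ _ "indicat_real {..u}"]) (rule sib)
  qed (use g cone_subset in \<open>auto intro!: ind_integrable measurable_compose[OF q_measurable]\<close>)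
  also have "\<dots> = pq ?a u * pq ?b u" using tr g by simp
  also have "\<dots> \<le> c * c"
    using le[OF sib(1)] pq_bounds(1)[OF sib(1)] le[OF t] pq_bounds(1)[OF t, of u] by (intro mult_mono) auto
  finally show ?thesis by (simp add: power2_eq_square)
qed

text \<open>The largest atom \<open>z\<close> at 0 satisfies \<open>z \<le> z ^ 2\<close>, hence is
  0 or at least 1; the latter would make some \<open>esc t\<close> zero.\<close>

lemma pq_0: "t \<in> S \<Longrightarrow> pq t 0 = 0"
proof -
  define z where "z = Max ((\<lambda>t. pq t 0) ` S)"
  have le: "pq t 0 \<le> z" if "t \<in> S" for t unfolding z_def by (rule Max_ge) (use that in auto)
  have "z \<in> (\<lambda>t. pq t 0) ` S" unfolding z_def by (rule Max_in) (use S_nonempty in auto)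
  then obtain t0 where t0: "t0 \<in> S" "z = pq t0 0" by auto
  have "z \<le> z ^ 2" using pq_square[OF le t0(1)] t0 by simp
  moreover have "z < 1"
  proof (rule ccontr)
    assume "\<not> z < 1"
    then have e: "(\<integral>\<omega>. indicat_real {..0} (q \<omega> [t0]) \<partial>E) = 1" using pq_bounds[OF t0(1), of 0] t0 unfolding pq_def by simp
    have "esc t0 \<le> (\<integral>\<omega>. 1 - indicat_real {..0} (q \<omega> [t0]) \<partial>E)"
      unfolding esc_eq[OF t0(1)]
    proof (rule integral_mono)
      show "integrable E (\<lambda>\<omega>. 1 - indicat_real {..0} (q \<omega> [t0]))"
        by (intro Bochner_Integration.integrable_diff ind_integrable) (use t0 in auto)
      show "q \<omega> [t0] \<le> 1 - indicat_real {..0} (q \<omega> [t0])" for \<omega> by (auto simp: indicator_def)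
    qed (use t0 in \<open>auto intro: q_integrable\<close>)
    also have "\<dots> = 0" using e ind_integrable[of "[t0]" 0] t0 by (simp add: env.prob_space)
    finally show False using esc_pos[OF t0(1)] by simp
  qed
  moreover have "0 \<le> z" using pq_bounds(1)[OF t0(1)] t0 by simp
  ultimately have "z = 0"
  proof -
    have "z * (1 - z) \<le> 0" using \<open>z \<le> z ^ 2\<close> by (simp add: power2_eq_square algebra_simps)
    then show ?thesis using \<open>z < 1\<close> \<open>0 \<le> z\<close> by (simp add: mult_le_0_iff)
  qed
  then show "t \<in> S \<Longrightarrow> pq t 0 = 0" using le[of t] pq_bounds(1)[of t 0] by simp
qed

lemma pq_tendsto: assumes t: "t \<in> S" shows "(\<lambda>n. pq t (1 / real (Suc n))) \<longlonglongrightarrow> 0"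
proof -
  have "(\<lambda>n. \<integral>\<omega>. indicat_real {..1 / real (Suc n)} (q \<omega> [t]) \<partial>E) \<longlonglongrightarrow> (\<integral>\<omega>. indicat_real {..0} (q \<omega> [t]) \<partial>E)"
  proof (rule integral_dominated_convergence[where w="\<lambda>_. 1"])
    show "AE \<omega> in E. (\<lambda>n. indicat_real {..1 / real (Suc n)} (q \<omega> [t]) :: real) \<longlonglongrightarrow> indicat_real {..0} (q \<omega> [t])"
    proof (rule AE_I2)
      fix \<omega>
      show "(\<lambda>n. indicat_real {..1 / real (Suc n)} (q \<omega> [t]) :: real) \<longlonglongrightarrow> indicat_real {..0} (q \<omega> [t])"
      proof (cases "q \<omega> [t] = 0")
        case False
        then have "0 < q \<omega> [t]" using q_bounds(1)[of \<omega> "[t]"] by linarith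
        then have "eventually (\<lambda>n. 1 / real (Suc n) < q \<omega> [t]) sequentially"
          by (intro order_tendstoD(2)[OF LIMSEQ_inverse_real_of_nat[unfolded inverse_eq_divide]])
        then have "eventually (\<lambda>n. (indicat_real {..1 / real (Suc n)} (q \<omega> [t]) :: real) = 0) sequentially"
          by eventually_elim (simp add: indicator_def)
        then show ?thesis using False q_bounds(1)[of \<omega> "[t]"] \<open>0 < q \<omega> [t]\<close>
          by (intro tendsto_eventually) (simp add: indicator_def)
      qed simp
    qed
  qed (use t in \<open>auto intro!: measurable_compose[OF q_measurable] simp: indicator_def\<close>)
  then show ?thesis using pq_0[OF t] unfolding pq_def by simp
qed

text \<open>Each factor \<epsilon> in the argument squares the bound; of this growth one more power
  of \<open>c\<close> per step is kept.\<close>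

lemma pq_iterate:
  assumes "\<And>t. t \<in> S \<Longrightarrow> pq t u \<le> c" "0 \<le> c" "c \<le> 1"
  shows "t \<in> S \<Longrightarrow> pq t (\<epsilon> ^ h * u) \<le> c ^ Suc h"
proof (induction h arbitrary: t)
  case 0
  then show ?case using assms(1) by simp
next
  case (Suc h)
  have "pq t (\<epsilon> * (\<epsilon> ^ h * u)) \<le> (c ^ Suc h) ^ 2" by (rule pq_square[OF Suc.IH Suc.prems])
  also have "\<dots> = c ^ (2 * Suc h)" by (metis power_mult mult.commute)
  also have "\<dots> \<le> c ^ Suc (Suc h)" by (rule power_decreasing) (use assms in auto)
  finally show ?case by (simp add: mult.assoc)
qed

text \<open>With \<open>u0\<close> so small that \<open>pq t u0 < \<epsilon> ^ m\<close>, the bound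
  gains a factor \<open>\<epsilon> ^ m\<close> whenever \<open>u\<close> shrinks by the factor
  \<epsilon>; this is decay like \<open>u ^ m\<close>.\<close>

lemma pq_poly: "\<exists>C>0. \<forall>t\<in>S. \<forall>u>0. pq t u \<le> C * u ^ m"
proof -
  have em: "0 < \<epsilon> ^ m" "\<epsilon> ^ m \<le> 1" using eps_pos eps_lt_1 by (auto intro: power_le_one)
  have "eventually (\<lambda>n. \<forall>t\<in>S. pq t (1 / real (Suc n)) < \<epsilon> ^ m) sequentially"
    by (rule eventually_ball_finite) (use order_tendstoD(2)[OF pq_tendsto em(1)] in auto)
  then obtain n where n: "\<And>t. t \<in> S \<Longrightarrow> pq t (1 / real (Suc n)) < \<epsilon> ^ m"
    by (auto simp: eventually_sequentially)
  define u0 where "u0 = 1 / real (Suc n)"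
  have u0: "0 < u0" by (simp add: u0_def)
  have it: "pq t (\<epsilon> ^ h * u0) \<le> (\<epsilon> ^ m) ^ Suc h" if "t \<in> S" for t h
    by (rule pq_iterate[OF _ _ _ that]) (use n em in \<open>auto simp: u0_def less_imp_le\<close>)
  have "pq t u \<le> (1 / u0) ^ m * u ^ m" if t: "t \<in> S" and u: "0 < u" for t u
  proof (cases "u0 \<le> u")
    case True
    have "pq t u \<le> 1" by (rule pq_bounds(2)[OF t])
    also have "1 \<le> (u / u0) ^ m" using True u0 by (intro one_le_power) simp
    finally show ?thesis by (simp add: power_divide)
  next
    case False
    have "\<exists>j. \<epsilon> ^ j < u / u0" using real_arch_pow_inv[of "u / u0" \<epsilon>] u u0 eps_lt_1 by simp
    then have L: "\<epsilon> ^ (LEAST j. \<epsilon> ^ j < u / u0) < u / u0" by (rule LeastI_ex)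
    \<comment> \<open>Since \<open>j = Suc h\<close> is least, \<open>u\<close> lies between
      \<open>\<epsilon> ^ Suc h * u0\<close> and \<open>\<epsilon> ^ h * u0\<close>.\<close>
    define j where "j = (LEAST j. \<epsilon> ^ j < u / u0)"
    have "j \<noteq> 0" using L False u0 unfolding j_def[symmetric] by (intro notI) (simp add: field_simps)
    then obtain h where h: "j = Suc h" by (cases j) auto
    have nl: "u / u0 \<le> \<epsilon> ^ h" using not_less_Least[of h "\<lambda>j. \<epsilon> ^ j < u / u0"] h unfolding j_def by simp
    have "pq t u \<le> pq t (\<epsilon> ^ h * u0)" using nl u0 by (intro pq_mono[OF t]) (simp add: field_simps)
    also have "\<dots> \<le> (\<epsilon> ^ m) ^ Suc h" by (rule it[OF t])
    also have "\<dots> = (\<epsilon> ^ Suc h) ^ m" by (metis power_mult mult.commute)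
    also have "\<dots> \<le> (u / u0) ^ m" using L h eps_pos unfolding j_def[symmetric] by (intro power_mono) auto
    finally show ?thesis by (simp add: power_divide)
  qed
  then show ?thesis using u0 by (intro exI[of _ "(1 / u0) ^ m"]) auto
qed

text \<open>The range of \<open>q\<close> is split at \<open>1 / sqrt y\<close>. The lower part has
  probability at most a multiple of \<open>(1 / sqrt y) ^ (2 * m)\<close>; on the upper part the
  integrand is at most \<open>exp (- (\<epsilon> * sqrt y))\<close>, which is smaller than any
  power.\<close>

lemma q_moment: "\<exists>C>0. \<forall>t\<in>S. \<forall>y>0. (\<integral>\<omega>. (1 - \<epsilon> * q \<omega> [t]) ^ y \<partial>E) \<le> C / real y ^ m"
proof -
  obtain C where C: "C > 0" "\<And>t u. t \<in> S \<Longrightarrow> u > 0 \<Longrightarrow> pq t u \<le> C * u ^ (2 * m)"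
    using pq_poly[of "2 * m"] by blast
  let ?C = "C + fact (2 * m) / \<epsilon> ^ (2 * m)"
  have "(\<integral>\<omega>. (1 - \<epsilon> * q \<omega> [t]) ^ y \<partial>E) \<le> ?C / real y ^ m" if t: "t \<in> S" and y: "y > 0" for t y
  proof -
    let ?u = "1 / sqrt (real y)"
    have yp: "0 < sqrt (real y)" using y by simp
    have sq: "sqrt (real y) ^ (2 * m) = real y ^ m" using y by (simp add: power_mult)
    have "(\<integral>\<omega>. (1 - \<epsilon> * q \<omega> [t]) ^ y \<partial>E) \<le> (\<integral>\<omega>. indicat_real {..?u} (q \<omega> [t]) + exp (- (\<epsilon> * sqrt (real y))) \<partial>E)"
    proof (rule integral_mono)
      fix \<omega>
      show "(1 - \<epsilon> * q \<omega> [t]) ^ y \<le> indicat_real {..?u} (q \<omega> [t]) + exp (- (\<epsilon> * sqrt (real y)))"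
      proof (cases "q \<omega> [t] \<le> ?u")
        case True
        then show ?thesis using q_pow_bounds(2)[of \<omega> "[t]" y] by (simp add: add_increasing2)
      next
        case False
        have "(1 - \<epsilon> * q \<omega> [t]) ^ y \<le> (exp (- (\<epsilon> * q \<omega> [t]))) ^ y"
          using exp_ge_add_one_self[of "- (\<epsilon> * q \<omega> [t])"] by (intro power_mono q_pow_bounds) simp
        also have "\<dots> = exp (- (\<epsilon> * q \<omega> [t] * real y))" by (simp add: exp_of_nat_mult[symmetric] mult.commute)
        also have "\<epsilon> * (?u * real y) \<le> \<epsilon> * (q \<omega> [t] * real y)"
          using False eps_pos by (intro mult_left_mono mult_right_mono) auto
        then have "exp (- (\<epsilon> * q \<omega> [t] * real y)) \<le> exp (- (\<epsilon> * ?u * real y))"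
          by (simp only: mult.assoc exp_le_cancel_iff neg_le_iff_le)
        also have "?u * real y = sqrt (real y)" using y by (simp add: real_div_sqrt)
        then have "\<epsilon> * ?u * real y = \<epsilon> * sqrt (real y)" by (simp only: mult.assoc)
        finally show ?thesis using False by simp
      qed
    qed (use t in \<open>auto intro!: q_pow_integrable ind_integrable Bochner_Integration.integrable_add\<close>)
    also have "\<dots> = pq t ?u + exp (- (\<epsilon> * sqrt (real y)))"
      using ind_integrable[of "[t]"] t by (simp add: pq_def env.prob_space)
    also have "\<dots> \<le> C * ?u ^ (2 * m) + fact (2 * m) / (\<epsilon> * sqrt (real y)) ^ (2 * m)"
      using C(2)[OF t, of ?u] exp_neg_le[of "\<epsilon> * sqrt (real y)" "2 * m"] yp eps_pos by (intro add_mono) auto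
    also have "\<dots> = ?C / real y ^ m"
      by (simp add: power_divide power_mult_distrib sq add_divide_distrib)
    finally show ?thesis .
  qed
  moreover have "0 < ?C" using C eps_pos by (intro add_pos_pos) auto
  ultimately show ?thesis by blast
qed

text \<open>\<open>p\<close> is so large that \<open>Rec\<close> shrinks in mean by
  \<open>card S * \<theta> = 1 / 4\<close> per level, and \<open>c\<close> is the
  \<open>p\<close>-th root of 1/2. By Markov's inequality \<open>Rec\<close> exceeds
  \<open>(1 / 2) ^ (h - 1)\<close> with probability at most
  \<open>2 ^ (h - 1) * (1 / 4) ^ (h - 1)\<close>; otherwise each descent from height
  \<open>h\<close> has probability at most \<open>c ^ (h - 1)\<close>.\<close>

lemma ret_decay: "\<exists>c<1. 0 < c \<and> (\<forall>t\<in>S. \<forall>h>0. \<forall>n. measure (Aw [t]) (retn h n [t]) \<le> 2 * c ^ (h - 1))"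
proof -
  let ?d = "real (card S)"
  have d: "0 < ?d" using card_Sgen[of k r] d3 by simp
  obtain C where C: "C > 0" "\<And>t y. t \<in> S \<Longrightarrow> y > 0 \<Longrightarrow> (\<integral>\<omega>. (1 - \<epsilon> * q \<omega> [t]) ^ y \<partial>E) \<le> C / real y ^ 1"
    using q_moment[of 1] by blast
  obtain p where p: "real p > max 1 (4 * ?d * C)" using reals_Archimedean2 by blast
  then have p0: "p > 0" by simp
  define \<theta> where "\<theta> = 1 / (4 * ?d)"
  have th: "(\<integral>\<omega>. (1 - \<epsilon> * q \<omega> [t]) ^ p \<partial>E) \<le> \<theta>" if "t \<in> S" for t
  proof -
    have "C / real p \<le> \<theta>" using p d C p0 by (simp add: \<theta>_def field_simps)
    then show ?thesis using C(2)[OF that p0] by simp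
  qed
  have th0: "0 \<le> \<theta>" "?d * \<theta> = 1 / 4" using d by (auto simp: \<theta>_def)
  define c where "c = root p (1 / 2)"
  have c: "0 < c" "c < 1" "c ^ p = 1 / 2" using p0 by (auto simp: c_def)
  have c2: "1 / 2 \<le> c"
  proof -
    have "c ^ p \<le> c ^ 1" by (rule power_decreasing) (use p0 c in auto)
    then show ?thesis using c(3) by simp
  qed
  have "measure (Aw [t]) (retn h n [t]) \<le> 2 * c ^ (h - 1)" if t: "t \<in> S" and h: "h > 0" for t h n
  proof -
    let ?k = "h - 1"
    have tg: "[t] \<in> G" using t by simp
    have lk: "(c ^ ?k) ^ p = (1 / 2) ^ ?k" using c(3) by (metis power_mult mult.commute)
    have "measure (Aw [t]) (retn h n [t]) = (\<integral>\<omega>. qp \<omega> [t] (retn h n [t]) \<partial>E)"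
      by (rule Aw_eq[OF tg retn_sets])
    also have "\<dots> \<le> (\<integral>\<omega>. c ^ ?k + 2 ^ ?k * Rec p ?k \<omega> t [] \<partial>E)"
    proof (rule integral_mono_AE)
      show "AE \<omega> in E. qp \<omega> [t] (retn h n [t]) \<le> c ^ ?k + 2 ^ ?k * Rec p ?k \<omega> t []"
        using AE_good
      proof eventually_elim
        case (elim \<omega>)
        show ?case
        proof (cases "Rec p ?k \<omega> t [] \<le> (c ^ ?k) ^ p")
          case True
          have "qp \<omega> ([t] @ []) (retn h n [t]) \<le> c ^ ?k"
          proof (rule retn_le[OF elim, of _ _ t])
            fix u' n assume u: "length u' = h" "last u' = t" "u' @ [] \<in> G"
            have "fn \<omega> n u' [] ^ p \<le> Rec p ?k \<omega> t []"
              using fn_le_Rec[OF elim u(3) _ u(2), of n p] u(1) h by auto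
            then have "fn \<omega> n u' [] ^ p \<le> (c ^ ?k) ^ p" using True by simp
            then show "fn \<omega> n u' [] \<le> c ^ ?k"
              using power_mono_iff[of "fn \<omega> n u' []" "c ^ ?k" p] c p0 by simp
          qed (use c t h in auto)
          then show ?thesis using Rec_nonneg[of p ?k \<omega> t "[]"] by (simp add: add_increasing2)
        next
          case False
          then have "1 \<le> 2 ^ ?k * Rec p ?k \<omega> t []" unfolding lk by (simp add: power_divide field_simps)
          then show ?thesis using qp_le_1[of \<omega> "[t]" "retn h n [t]"] c(1) zero_le_power[of c ?k] by linarith
        qed
      qed
    qed (use tg in \<open>auto intro!: qp_integrable Rec_integrable Bochner_Integration.integrable_add\<close>)
    also have "\<dots> = c ^ ?k + 2 ^ ?k * (\<integral>\<omega>. Rec p ?k \<omega> t [] \<partial>E)"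
      using Rec_integrable[of t "[]" p ?k] tg by (simp add: env.prob_space)
    also have "\<dots> \<le> c ^ ?k + 2 ^ ?k * (1 / 4) ^ ?k"
      using Rec_expectation[OF th th0(1), where t=t and w="[]" and h="?k"] tg th0(2) by (simp del: power_divide)
    also have "2 ^ ?k * (1 / 4) ^ ?k = ((1 / 2) ^ ?k :: real)" by (simp add: power_mult_distrib[symmetric])
    also have "c ^ ?k + (1 / 2) ^ ?k \<le> 2 * c ^ ?k" using power_mono[OF c2, of ?k] by simp
    finally show ?thesis by simp
  qed
  then show ?thesis using c by blast
qed

end

section \<open>Exploration of the levels of the tree\<close>

definition lev :: "letter list \<Rightarrow> nat \<Rightarrow> letter list \<Rightarrow> letter list set" where
  "lev x i \<pi> = {y. length y = i \<and> (\<exists>m\<le>length \<pi>. run x (take m \<pi>) = y)}"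

lemma finite_lev [simp]: "finite (lev x i \<pi>)"
proof -
  have "lev x i \<pi> \<subseteq> (\<lambda>m. run x (take m \<pi>)) ` {..length \<pi>}" by (auto simp: lev_def)
  then show ?thesis by (rule finite_subset) simp
qed

lemma lev_snoc: "lev x i (\<pi> @ [s]) = lev x i \<pi> \<union> (if length (run x (\<pi> @ [s])) = i then {run x (\<pi> @ [s])} else {})"
proof (intro set_eqI iffI)
  fix y assume "y \<in> lev x i (\<pi> @ [s])"
  then obtain m where m: "length y = i" "m \<le> Suc (length \<pi>)" "run x (take m (\<pi> @ [s])) = y" by (auto simp: lev_def)
  then show "y \<in> lev x i \<pi> \<union> (if length (run x (\<pi> @ [s])) = i then {run x (\<pi> @ [s])} else {})"
  proof (cases "m = Suc (length \<pi>)")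
    case False
    then have "m \<le> length \<pi>" "run x (take m \<pi>) = y" using m by auto
    then show ?thesis using m(1) unfolding lev_def by blast
  qed (use m in auto)
next
  fix y assume "y \<in> lev x i \<pi> \<union> (if length (run x (\<pi> @ [s])) = i then {run x (\<pi> @ [s])} else {})"
  then consider "y \<in> lev x i \<pi>" | "length y = i" "y = run x (\<pi> @ [s])" by (auto split: if_splits)
  then show "y \<in> lev x i (\<pi> @ [s])"
  proof cases
    case 1
    then obtain m where "length y = i" "m \<le> length \<pi>" "run x (take m \<pi>) = y" by (auto simp: lev_def)
    then show ?thesis by (auto simp: lev_def intro!: exI[of _ m])
  next
    case 2
    then show ?thesis by (auto simp: lev_def intro!: exI[of _ "Suc (length \<pi>)"])
  qed
qed

lemma lev_stake: "lev x i (stake n \<sigma>) = {y. length y = i \<and> (\<exists>m\<le>n. run x (stake m \<sigma>) = y)}"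
proof -
  have "take m (stake n \<sigma>) = stake m \<sigma>" if "m \<le> n" for m using that by (simp add: take_stake min_def)
  then show ?thesis by (auto simp: lev_def)
qed

lemma lev_stake_mono: "m \<le> n \<Longrightarrow> lev x i (stake m \<sigma>) \<subseteq> lev x i (stake n \<sigma>)"
  unfolding lev_stake by (auto intro: order_trans)

lemma suffix_same_length: "suffix x y \<Longrightarrow> length x = length y \<Longrightarrow> x = y"
  by (auto simp: suffix_def)

text \<open>At the discovery of the \<open>j\<close>-th vertex of level \<open>i\<close> this vertex
  is new. A path on a tree enters a cone through its root, so the whole cone below the new vertex is
  unvisited before.\<close>

lemma first_lev:
  assumes f: "first_at (\<lambda>\<pi>. j \<le> card (lev x i \<pi>)) \<pi>" and j: "1 \<le> j" and i: "1 \<le> i" "length x \<le> i"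
  shows "run x \<pi> \<noteq> []" "length (run x \<pi>) = i" "m < length \<pi> \<Longrightarrow> \<not> suffix (run x \<pi>) (run x (take m \<pi>))" "card (lev x i \<pi>) \<le> j"
proof -
  have "length (run x \<pi>) = i \<and> (\<forall>m<length \<pi>. \<not> suffix (run x \<pi>) (run x (take m \<pi>))) \<and> card (lev x i \<pi>) \<le> j"
  proof (cases \<pi> rule: rev_cases)
    case Nil
    have e: "lev x i [] = (if length x = i then {x} else {})" by (auto simp: lev_def)
    show ?thesis using f j unfolding first_at_def Nil e by (auto split: if_splits)
  next
    case (snoc \<rho> s)
    have nj: "\<not> j \<le> card (lev x i \<rho>)" using f unfolding first_at_def snoc by (auto dest: spec[of _ "length \<rho>"])
    have jj: "j \<le> card (lev x i (\<rho> @ [s]))" using f unfolding first_at_def snoc by simp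
    let ?x = "run x (\<rho> @ [s])"
    have len: "length ?x = i"
      using nj jj unfolding lev_snoc by (auto split: if_splits)
    have new: "?x \<notin> lev x i \<rho>"
      using nj jj len unfolding lev_snoc by (auto simp: insert_absorb)
    have "\<not> suffix ?x (run x (take m \<rho>))" if "m \<le> length \<rho>" for m
      using that
    proof (induction m)
      case 0
      show ?case
      proof
        assume "suffix ?x (run x (take 0 \<rho>))"
        then have "suffix ?x x" by simp
        moreover have "length ?x = length x" using suffix_length_le[OF calculation] len i(2) by simp
        ultimately have "?x = x" by (rule suffix_same_length)
        then show False using new len by (auto simp: lev_def intro: exI[of _ 0])
      qed
    next
      case (Suc m)
      then have "\<not> suffix ?x (run x (take m \<rho>))" by simp
      moreover have "run x (take (Suc m) \<rho>) \<noteq> ?x" using new len Suc.prems by (auto simp: lev_def)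
      ultimately show ?case using suffix_enter[of ?x "run x (take m \<rho>)" "\<rho> ! m"] Suc.prems by (auto simp: run_take_Suc)
    qed
    moreover have "card (lev x i (\<rho> @ [s])) \<le> j"
      using nj unfolding lev_snoc by (auto simp: card_insert_if)
    ultimately show ?thesis using len unfolding snoc by auto
  qed
  then show "run x \<pi> \<noteq> []" "length (run x \<pi>) = i" "m < length \<pi> \<Longrightarrow> \<not> suffix (run x \<pi>) (run x (take m \<pi>))" "card (lev x i \<pi>) \<le> j"
    using i by auto
qed

text \<open>Counting: at most \<open>a\<close> vertices on each of \<open>h\<close> levels, each visited at most \<open>y\<close> times.\<close>

lemma visit_count:
  assumes bnd: "\<And>m. m \<le> n \<Longrightarrow> 1 \<le> length (run x (stake m \<sigma>)) \<and> length (run x (stake m \<sigma>)) < h"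
    and K: "\<And>i. 1 \<le> i \<Longrightarrow> i < h \<Longrightarrow> card (lev x i (stake n \<sigma>)) \<le> a"
    and N: "\<And>i j n'. 1 \<le> i \<Longrightarrow> i < h \<Longrightarrow> 1 \<le> j \<Longrightarrow> j \<le> a \<Longrightarrow> first_at (\<lambda>\<pi>. j \<le> card (lev x i \<pi>)) (stake n' \<sigma>)
        \<Longrightarrow> sdrop n' \<sigma> \<notin> visits (run x (stake n' \<sigma>)) (run x (stake n' \<sigma>)) n y"
  shows "n < h * a * y"
proof -
  let ?X = "\<lambda>m. run x (stake m \<sigma>)"
  let ?R = "?X ` {..n}"
  have one: "card {m \<in> {..n}. ?X m = z} \<le> y" if z: "z \<in> ?R" for z
  proof -
    obtain m0 where m0: "m0 \<le> n" "?X m0 = z" using z by auto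
    define n' where "n' = (LEAST m. ?X m = z)"
    have n': "?X n' = z" unfolding n'_def by (rule LeastI[of _ m0]) (rule m0)
    have n'le: "n' \<le> n" using Least_le[of "\<lambda>m. ?X m = z" m0] m0 unfolding n'_def by simp
    have before: "?X m \<noteq> z" if "m < n'" for m using not_less_Least[of m "\<lambda>m. ?X m = z"] that unfolding n'_def by blast
    let ?i = "length z"
    have i: "1 \<le> ?i" "?i < h" using bnd[OF n'le] n' by auto
    \<comment> \<open>The rank of \<open>z\<close> in the order of discovery on its level: level and
      rank together address the vertex.\<close>
    let ?j = "card (lev x ?i (stake n' \<sigma>))"
    have zin: "z \<in> lev x ?i (stake n' \<sigma>)" using n' unfolding lev_stake by auto
    then have j1: "1 \<le> ?j" by (metis One_nat_def Suc_leI card_gt_0_iff empty_iff finite_lev)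
    have ja: "?j \<le> a" using card_mono[OF finite_lev lev_stake_mono[OF n'le, of x ?i \<sigma>]] K[OF i] by simp
    have "first_at (\<lambda>\<pi>. ?j \<le> card (lev x ?i \<pi>)) (stake n' \<sigma>)"
      unfolding first_at_def
    proof (intro conjI allI impI)
      fix m assume m: "m < length (stake n' \<sigma>)"
      have "z \<notin> lev x ?i (stake m \<sigma>)" using before m unfolding lev_stake by auto
      then have "lev x ?i (stake m \<sigma>) \<subset> lev x ?i (stake n' \<sigma>)"
        using lev_stake_mono[of m n' x ?i \<sigma>] m zin by auto
      then have "card (lev x ?i (stake m \<sigma>)) < ?j" by (intro psubset_card_mono) auto
      then show "\<not> ?j \<le> card (lev x ?i (take m (stake n' \<sigma>)))" using m by (simp add: take_stake min_def)
    qed simp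
    \<comment> \<open>Fewer than \<open>y\<close> returns, hence at most \<open>y\<close> visits
      once the first one is counted.\<close>
    from N[OF i j1 ja this] have nv: "\<not> y \<le> card {m \<in> {1..n}. run z (stake m (sdrop n' \<sigma>)) = z}"
      unfolding n' visits_def by simp
    have "{m \<in> {..n}. ?X m = z} \<subseteq> insert n' ((\<lambda>m. n' + m) ` {m \<in> {1..n}. run z (stake m (sdrop n' \<sigma>)) = z})"
    proof
      fix m assume m: "m \<in> {m \<in> {..n}. ?X m = z}"
      show "m \<in> insert n' ((\<lambda>m. n' + m) ` {m \<in> {1..n}. run z (stake m (sdrop n' \<sigma>)) = z})"
      proof (cases "m = n'")
        case False
        then have gt: "n' < m" using before[of m] m by (cases "m < n'") auto
        have "run z (stake (m - n') (sdrop n' \<sigma>)) = ?X (n' + (m - n'))"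
          using n' by (simp only: stake_add_run)
        then have "run z (stake (m - n') (sdrop n' \<sigma>)) = z" using gt m by simp
        then show ?thesis using gt m by (intro insertI2 image_eqI[of _ _ "m - n'"]) auto
      qed simp
    qed
    then have "card {m \<in> {..n}. ?X m = z} \<le> card (insert n' ((\<lambda>m. n' + m) ` {m \<in> {1..n}. run z (stake m (sdrop n' \<sigma>)) = z}))"
      by (intro card_mono) auto
    also have "\<dots> \<le> Suc (card ((\<lambda>m. n' + m) ` {m \<in> {1..n}. run z (stake m (sdrop n' \<sigma>)) = z}))"
      by (rule card_insert_le_m1) auto
    also have "\<dots> \<le> Suc (card {m \<in> {1..n}. run z (stake m (sdrop n' \<sigma>)) = z})"
      by (intro Suc_le_mono[THEN iffD2] card_image_le) auto
    also have "\<dots> \<le> y" using nv by simp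
    finally show ?thesis .
  qed
  have "?R \<subseteq> (\<Union>i\<in>{1..<h}. lev x i (stake n \<sigma>))"
  proof
    fix z assume "z \<in> ?R"
    then obtain m where "m \<le> n" "z = ?X m" by auto
    then show "z \<in> (\<Union>i\<in>{1..<h}. lev x i (stake n \<sigma>))"
      using bnd[of m] by (intro UN_I[of "length z"]) (auto simp: lev_stake)
  qed
  then have "card ?R \<le> card (\<Union>i\<in>{1..<h}. lev x i (stake n \<sigma>))" by (intro card_mono) auto
  also have "\<dots> \<le> (\<Sum>i\<in>{1..<h}. card (lev x i (stake n \<sigma>)))" by (rule card_UN_le) simp
  also have "\<dots> \<le> (\<Sum>i\<in>{1..<h}. a)" using K by (intro sum_mono) auto
  also have "\<dots> \<le> h * a" by simp
  finally have R: "card ?R \<le> h * a" .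
  have "Suc n = card {..n}" by simp
  also have "{..n} = (\<Union>z\<in>?R. {m \<in> {..n}. ?X m = z})" by auto
  also have "card \<dots> \<le> (\<Sum>z\<in>?R. card {m \<in> {..n}. ?X m = z})" by (rule card_UN_le) simp
  also have "\<dots> \<le> (\<Sum>z\<in>?R. y)" by (rule sum_mono) (rule one)
  also have "\<dots> \<le> h * a * y" using R by simp
  finally show ?thesis by simp
qed

context rwre_speed
begin

lemma fresh_first_lev:
  assumes "first_at (\<lambda>\<pi>. j \<le> card (lev x i \<pi>)) \<pi>" "1 \<le> j" "1 \<le> i" "length x \<le> i"
  shows "fresh x \<pi>"
  using first_lev[OF assms] by (auto simp: fresh_def)

lemma hd_run_S: "x \<in> G \<Longrightarrow> set \<pi> \<subseteq> S \<Longrightarrow> run x \<pi> \<noteq> [] \<Longrightarrow> hd (run x \<pi>) \<in> S"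
  using run_Gset[of \<pi> k r x] by (cases "run x \<pi>") (auto simp: Gset_def)

text \<open>At the discovery of a vertex of level \<open>i\<close> its cone is fresh, so with
  probability at least \<beta> the walk stays in it forever; the root is the only vertex of level
  \<open>i\<close> in that cone, and no other one is found.\<close>

lemma lev_geometric:
  assumes x: "x \<in> G" "length x \<le> 1" and i: "1 \<le> i"
  shows "measure (Aw x) {\<sigma>. \<exists>n. Suc j \<le> card (lev x i (stake n \<sigma>))} \<le> (1 - \<beta>) ^ j"
proof (induction j)
  case 0
  interpret A: prob_space "Aw x" by (rule prob_space_Aw[OF x(1)])
  show ?case by simp
next
  case (Suc j)
  interpret A: prob_space "Aw x" by (rule prob_space_Aw[OF x(1)])
  let ?P = "\<lambda>j \<pi>. j \<le> card (lev x i \<pi>)"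
  let ?E = "\<lambda>j. {\<sigma>. \<exists>n. ?P j (stake n \<sigma>)}"
  let ?Z = "{\<sigma>. \<exists>n. first_at (?P (Suc j)) (stake n \<sigma>) \<and> sdrop n \<sigma> \<in> (\<lambda>\<pi>. stay (hd (run x \<pi>))) (stake n \<sigma>)}"
  have lx: "length x \<le> i" using x i by simp
  have Em: "?E j \<in> sets (Aw x)" for j using ex_stake_sets[of "?P j"] by simp
  have Zm: "?Z \<in> sets (Aw x)" using first_set_sets[of "\<lambda>\<pi>. stay (hd (run x \<pi>))" "?P (Suc j)"] by simp
  have "\<beta> * measure (Aw x) (?E (Suc j)) \<le> measure (Aw x) ?Z"
  proof (rule first_ge[OF x(1)])
    fix \<pi> assume p: "set \<pi> \<subseteq> S" "first_at (?P (Suc j)) \<pi>"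
    have fr: "fresh x \<pi>" using fresh_first_lev[OF p(2) _ i lx] by simp
    have "hd (run x \<pi>) \<in> S" using hd_run_S[OF x(1) p(1)] fr by (simp add: fresh_def)
    then have "measure (Aw x) {\<sigma>. stake (length \<pi>) \<sigma> = \<pi>} * \<beta> \<le> measure (Aw x) {\<sigma>. stake (length \<pi>) \<sigma> = \<pi>} * esc (hd (run x \<pi>))"
      using beta by (intro mult_left_mono) auto
    then show "\<beta> * measure (Aw x) {\<sigma>. stake (length \<pi>) \<sigma> = \<pi>}
      \<le> measure (Aw x) {\<sigma>. stake (length \<pi>) \<sigma> = \<pi> \<and> sdrop (length \<pi>) \<sigma> \<in> stay (hd (run x \<pi>))}"
      unfolding Aw_fresh[OF x(1) p(1) fr stay_sets stay_local] by (simp add: mult.commute esc_def)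
  qed (use beta in auto)
  moreover have "?E (Suc (Suc j)) \<subseteq> ?E (Suc j)" by (auto intro: Suc_leD)
  moreover have "?E (Suc (Suc j)) \<inter> ?Z = {}"
  proof (rule ccontr)
    assume "\<not> ?thesis"
    then obtain \<sigma> m n where m: "Suc (Suc j) \<le> card (lev x i (stake m \<sigma>))"
      and n: "first_at (?P (Suc j)) (stake n \<sigma>)" "sdrop n \<sigma> \<in> stay (hd (run x (stake n \<sigma>)))"
      by auto
    note fl = first_lev[OF n(1) _ i lx, simplified]
    let ?x = "run x (stake n \<sigma>)"
    have xe: "?x = hd ?x # tl ?x" using fl(1) by simp
    have suf: "suffix ?x (run ?x (stake l (sdrop n \<sigma>)))" for l
      using stay_suffix_iff[OF xe] n(2) by blast
    have "lev x i (stake m \<sigma>) \<subseteq> lev x i (stake n \<sigma>)"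
    proof
      fix z assume "z \<in> lev x i (stake m \<sigma>)"
      then obtain l where l: "length z = i" "run x (stake l \<sigma>) = z" unfolding lev_stake by auto
      show "z \<in> lev x i (stake n \<sigma>)"
      proof (cases "l \<le> n")
        case True
        then show ?thesis using l unfolding lev_stake by auto
      next
        case False
        have "run x (stake (n + (l - n)) \<sigma>) = run ?x (stake (l - n) (sdrop n \<sigma>))" by (rule stake_add_run)
        then have "z = run ?x (stake (l - n) (sdrop n \<sigma>))" using False l by simp
        then have "suffix ?x z" using suf by simp
        then have "?x = z" using suffix_same_length fl(2) l(1) by metis
        then show ?thesis using l(1) unfolding lev_stake by auto
      qed
    qed
    then have "card (lev x i (stake m \<sigma>)) \<le> card (lev x i (stake n \<sigma>))" by (intro card_mono) auto
    then show False using fl(4) m by simp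
  qed
  ultimately have "measure (Aw x) (?E (Suc (Suc j))) + \<beta> * measure (Aw x) (?E (Suc j)) \<le> measure (Aw x) (?E (Suc j))"
  proof -
    assume b: "\<beta> * measure (Aw x) (?E (Suc j)) \<le> measure (Aw x) ?Z" and sub: "?E (Suc (Suc j)) \<subseteq> ?E (Suc j)" and dis: "?E (Suc (Suc j)) \<inter> ?Z = {}"
    have zs: "?Z \<subseteq> ?E (Suc j)" by (auto simp: first_at_def)
    have "measure (Aw x) (?E (Suc (Suc j))) + measure (Aw x) ?Z = measure (Aw x) (?E (Suc (Suc j)) \<union> ?Z)"
      by (rule A.finite_measure_Union[symmetric, OF Em Zm dis])
    also have "\<dots> \<le> measure (Aw x) (?E (Suc j))"
      by (rule A.finite_measure_mono[OF _ Em]) (use sub zs in blast)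
    finally show ?thesis using b by simp
  qed
  then have "measure (Aw x) (?E (Suc (Suc j))) \<le> (1 - \<beta>) * measure (Aw x) (?E (Suc j))" by (simp add: algebra_simps)
  also have "\<dots> \<le> (1 - \<beta>) * (1 - \<beta>) ^ j" using Suc beta by (intro mult_left_mono) auto
  finally show ?case by simp
qed

text \<open>The walk may leave the cone between two visits, so this event is not local and
  \<open>Aw_fresh\<close> does not apply. The quenched geometric bound involves only the escape
  probability of one child, which lies in the fresh cone; it is independent of the path, and the
  integral factorises.\<close>

lemma lev_visits:
  assumes x: "x \<in> G" "length x \<le> 1" and i: "1 \<le> i" and j: "1 \<le> j"
    and c: "\<And>t. t \<in> S \<Longrightarrow> (\<integral>\<omega>. (1 - \<epsilon> * q \<omega> [t]) ^ y \<partial>E) \<le> c" "0 \<le> c"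
  shows "measure (Aw x) {\<sigma>. \<exists>n'. first_at (\<lambda>\<pi>. j \<le> card (lev x i \<pi>)) (stake n' \<sigma>) \<and> sdrop n' \<sigma> \<in> visits (run x (stake n' \<sigma>)) (run x (stake n' \<sigma>)) n y} \<le> c"
proof -
  interpret A: prob_space "Aw x" by (rule prob_space_Aw[OF x(1)])
  let ?P = "\<lambda>\<pi>. j \<le> card (lev x i \<pi>)"
  have lx: "length x \<le> i" using x i by simp
  have "measure (Aw x) {\<sigma>. \<exists>n'. first_at ?P (stake n' \<sigma>) \<and> sdrop n' \<sigma> \<in> (\<lambda>\<pi>. visits (run x \<pi>) (run x \<pi>) n y) (stake n' \<sigma>)} \<le> c * measure (Aw x) {\<sigma>. \<exists>n. ?P (stake n \<sigma>)}"
  proof (rule first_le[OF x(1) visits_sets c(2)])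
    fix \<pi> assume p: "set \<pi> \<subseteq> S" "first_at ?P \<pi>"
    have fr: "fresh x \<pi>" by (rule fresh_first_lev[OF p(2) j i lx])
    then obtain t w where tw: "run x \<pi> = t # w" by (cases "run x \<pi>") (auto simp: fresh_def)
    have g: "t # w \<in> G" using run_Gset[OF p(1) x(1)] tw by simp
    let ?s = "sib t t"
    have gs: "?s # t # w \<in> G" by (rule child_Gset[OF g sib(1,2)])
    have "measure (Aw x) {\<sigma>. stake (length \<pi>) \<sigma> = \<pi> \<and> sdrop (length \<pi>) \<sigma> \<in> visits (run x \<pi>) (run x \<pi>) n y}
       = (\<integral>\<omega>. wt \<omega> x \<pi> * qp \<omega> (t # w) (visits (t # w) (t # w) n y) \<partial>E)"
      unfolding tw[symmetric] by (rule Aw_prefix[OF x(1) p(1) visits_sets])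
    also have "\<dots> \<le> (\<integral>\<omega>. wt \<omega> x \<pi> * (1 - \<epsilon> * q \<omega> (?s # t # w)) ^ y \<partial>E)"
    proof (rule integral_mono_AE)
      show "AE \<omega> in E. wt \<omega> x \<pi> * qp \<omega> (t # w) (visits (t # w) (t # w) n y) \<le> wt \<omega> x \<pi> * (1 - \<epsilon> * q \<omega> (?s # t # w)) ^ y"
        using AE_good by eventually_elim (intro mult_left_mono visits_le[OF _ gs] wt_bounds(2)[OF _ x(1) p(1)])
      show "integrable E (\<lambda>\<omega>. wt \<omega> x \<pi> * qp \<omega> (t # w) (visits (t # w) (t # w) n y))"
        by (rule env.integrable_const_bound[where B=1])
          (use AE_good wt_bounds[OF _ x(1) p(1)] x(1) p(1) g in \<open>auto elim!: eventually_mono simp: abs_mult abs_of_nonneg intro!: mult_le_one borel_measurable_times wt_measurable qp_measurable\<close>)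
      show "integrable E (\<lambda>\<omega>. wt \<omega> x \<pi> * (1 - \<epsilon> * q \<omega> (?s # t # w)) ^ y)"
        by (rule env.integrable_const_bound[where B=1])
          (use AE_good wt_bounds[OF _ x(1) p(1)] x(1) p(1) gs in \<open>auto elim!: eventually_mono simp: abs_mult abs_of_nonneg intro!: mult_le_one borel_measurable_times wt_measurable borel_measurable_power borel_measurable_diff q_measurable\<close>)
    qed
    also have "\<dots> = (\<integral>\<omega>. wt \<omega> x \<pi> \<partial>E) * (\<integral>\<omega>. (1 - \<epsilon> * q \<omega> (?s # t # w)) ^ y \<partial>E)"
    proof (rule fresh_factor[OF x(1) p(1) fr tw])
      have "dep (cone ?s (t # w)) (\<lambda>\<omega>. (1 - \<epsilon> * q \<omega> (?s # t # w)) ^ y)"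
        by (rule dep_q[of _ _ "\<lambda>x. (1 - \<epsilon> * x) ^ y"]) (rule sib)
      then show "dep (cone t w) (\<lambda>\<omega>. (1 - \<epsilon> * q \<omega> (?s # t # w)) ^ y)"
        by (rule dep_mono) (rule cone_child[OF gs])
    qed (use gs q_pow_integrable in auto)
    also have "\<dots> \<le> (\<integral>\<omega>. wt \<omega> x \<pi> \<partial>E) * c"
      unfolding q_pow_translate[OF gs] using AE_good
      by (intro mult_left_mono c sib integral_nonneg_AE) (auto elim!: eventually_mono intro: wt_bounds(2)[OF _ x(1) p(1)])
    finally show "measure (Aw x) {\<sigma>. stake (length \<pi>) \<sigma> = \<pi> \<and> sdrop (length \<pi>) \<sigma> \<in> visits (run x \<pi>) (run x \<pi>) n y} \<le> c * measure (Aw x) {\<sigma>. stake (length \<pi>) \<sigma> = \<pi>}"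
      unfolding Aw_stake[OF x(1) p(1)] by (simp add: mult.commute)
  qed
  also have "\<dots> \<le> c * 1" using c(2) by (intro mult_left_mono) auto
  finally show ?thesis by simp
qed

text \<open>Union bound over the levels below \<open>h\<close>: some level has more than
  \<open>a\<close> visited vertices, or one of its first \<open>a\<close> vertices sees
  \<open>y\<close> returns. Excluding both, \<open>visit_count\<close> contradicts the length of the
  stay.\<close>

lemma slow_tail:
  assumes x: "x \<in> G" "length x \<le> 1"
    and c: "\<And>t. t \<in> S \<Longrightarrow> (\<integral>\<omega>. (1 - \<epsilon> * q \<omega> [t]) ^ y \<partial>E) \<le> c" "0 \<le> c"
    and n: "h * a * y \<le> n"
  shows "measure (Aw x) {\<sigma>. \<forall>m\<le>n. 1 \<le> length (run x (stake m \<sigma>)) \<and> length (run x (stake m \<sigma>)) < h}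
     \<le> real h * ((1 - \<beta>) ^ a + real a * c)"
proof -
  interpret A: prob_space "Aw x" by (rule prob_space_Aw[OF x(1)])
  let ?P = "\<lambda>i j \<pi>. j \<le> card (lev x i \<pi>)"
  let ?E = "\<lambda>i. {\<sigma>. \<exists>n. ?P i (Suc a) (stake n \<sigma>)}"
  let ?V = "\<lambda>i j. {\<sigma>. \<exists>n'. first_at (?P i j) (stake n' \<sigma>) \<and> sdrop n' \<sigma> \<in> visits (run x (stake n' \<sigma>)) (run x (stake n' \<sigma>)) n y}"
  have Em: "?E i \<in> sets (Aw x)" for i using ex_stake_sets[of "?P i (Suc a)"] by simp
  have Vm: "?V i j \<in> sets (Aw x)" for i j
    using first_set_sets[of "\<lambda>\<pi>. visits (run x \<pi>) (run x \<pi>) n y" "?P i j"] by simp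
  have "{\<sigma>. \<forall>m\<le>n. 1 \<le> length (run x (stake m \<sigma>)) \<and> length (run x (stake m \<sigma>)) < h} \<subseteq> (\<Union>i\<in>{1..<h}. ?E i \<union> (\<Union>j\<in>{1..a}. ?V i j))"
  proof (rule ccontr)
    assume "\<not> ?thesis"
    then obtain \<sigma> where s: "\<And>m. m \<le> n \<Longrightarrow> 1 \<le> length (run x (stake m \<sigma>)) \<and> length (run x (stake m \<sigma>)) < h"
      and ns: "\<sigma> \<notin> (\<Union>i\<in>{1..<h}. ?E i \<union> (\<Union>j\<in>{1..a}. ?V i j))" by blast
    have "n < h * a * y"
    proof (rule visit_count[OF s])
      fix i :: nat assume "1 \<le> i" "i < h"
      then have "\<sigma> \<notin> ?E i" using ns by auto
      then show "card (lev x i (stake n \<sigma>)) \<le> a" by (simp add: not_less_eq_eq)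
    next
      fix i j n' :: nat assume "1 \<le> i" "i < h" "1 \<le> j" "j \<le> a" "first_at (?P i j) (stake n' \<sigma>)"
      moreover have "\<sigma> \<notin> ?V i j" using ns calculation by auto
      ultimately show "sdrop n' \<sigma> \<notin> visits (run x (stake n' \<sigma>)) (run x (stake n' \<sigma>)) n y" by blast
    qed
    then show False using n by simp
  qed
  then have "measure (Aw x) {\<sigma>. \<forall>m\<le>n. 1 \<le> length (run x (stake m \<sigma>)) \<and> length (run x (stake m \<sigma>)) < h}
     \<le> measure (Aw x) (\<Union>i\<in>{1..<h}. ?E i \<union> (\<Union>j\<in>{1..a}. ?V i j))"
    by (rule A.finite_measure_mono) (use Em Vm in \<open>auto intro!: sets.finite_UN\<close>)
  also have "\<dots> \<le> (\<Sum>i\<in>{1..<h}. measure (Aw x) (?E i \<union> (\<Union>j\<in>{1..a}. ?V i j)))"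
    by (rule A.finite_measure_subadditive_finite) (use Em Vm in \<open>auto intro!: sets.finite_UN\<close>)
  also have "\<dots> \<le> (\<Sum>i\<in>{1..<h}. (1 - \<beta>) ^ a + real a * c)"
  proof (rule sum_mono)
    fix i assume i: "i \<in> {1..<h}"
    have "measure (Aw x) (?E i \<union> (\<Union>j\<in>{1..a}. ?V i j)) \<le> measure (Aw x) (?E i) + measure (Aw x) (\<Union>j\<in>{1..a}. ?V i j)"
      by (rule measure_Un_le) (use Em Vm in \<open>auto intro!: sets.finite_UN\<close>)
    also have "measure (Aw x) (\<Union>j\<in>{1..a}. ?V i j) \<le> (\<Sum>j\<in>{1..a}. measure (Aw x) (?V i j))"
      by (rule A.finite_measure_subadditive_finite) (use Vm in auto)
    also have "\<dots> \<le> (\<Sum>j\<in>{1..a}. c)"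
      by (rule sum_mono, rule lev_visits[OF x _ _ c]) (use i in auto)
    finally show "measure (Aw x) (?E i \<union> (\<Union>j\<in>{1..a}. ?V i j)) \<le> (1 - \<beta>) ^ a + real a * c"
      using lev_geometric[OF x, of i a] i by simp
  qed
  also have "\<dots> = real (h - 1) * ((1 - \<beta>) ^ a + real a * c)" by simp
  also have "\<dots> \<le> real h * ((1 - \<beta>) ^ a + real a * c)"
    using beta c(2) by (intro mult_right_mono) auto
  finally show ?thesis .
qed

end

section \<open>Regeneration times\<close>

context rwre
begin

definition s0 :: letter where
  "s0 = (SOME s. s \<in> S)"

lemma s0_S [simp]: "s0 \<in> S"
  unfolding s0_def using S_nonempty by (simp add: some_in_eq)

definition Reg :: "letter list \<Rightarrow> letter stream \<Rightarrow> nat \<Rightarrow> bool" where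
  "Reg x \<sigma> n \<longleftrightarrow> fresh x (stake n \<sigma>) \<and> hd (run x (stake n \<sigma>)) = s0 \<and> sdrop n \<sigma> \<in> stay s0"

lemma Reg_sets: "{\<sigma>. Reg x \<sigma> n} \<in> sets SS"
  using stake_sdrop_sets[OF stay_sets[of s0], of "\<lambda>\<pi>. fresh x \<pi> \<and> hd (run x \<pi>) = s0" n] by (simp add: Reg_def conj_assoc)

text \<open>A connecting letter that leads from a vertex of type \<open>t\<close> to one of type
  \<open>s0\<close> in two steps; it cancels with neither.\<close>

definition sp :: "letter \<Rightarrow> letter" where
  "sp t = sib t (linv s0)"

lemma sp: "sp t \<in> S" "sp t \<noteq> linv t" "s0 \<noteq> linv (sp t)" "sp t \<noteq> linv s0"
  using sib[of t "linv s0"] by (auto simp: sp_def) (metis linv_linv)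

text \<open>A successful attempt to regenerate, made from a vertex of type \<open>t\<close> on a
  level reached for the first time; the regeneration takes place two steps later.\<close>

definition Succ :: "letter \<Rightarrow> letter stream set" where
  "Succ t = {\<sigma>. stake 2 \<sigma> = [sp t, s0] \<and> sdrop 2 \<sigma> \<in> stay s0}"

lemma Succ_sets [simp]: "Succ t \<in> sets SS"
  using stake_sdrop_sets[OF stay_sets[of s0], of "\<lambda>\<pi>. \<pi> = [sp t, s0]" 2] by (simp add: Succ_def)

lemma stream_split2: "stake 2 \<sigma> = [a, b] \<Longrightarrow> \<sigma> = a ## b ## sdrop 2 \<sigma>"
proof -
  assume "stake 2 \<sigma> = [a, b]"
  then show ?thesis using stake_sdrop[of 2 \<sigma>] by simp
qed

lemma Succ_local: "cone_local t (Succ t)"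
proof (rule cone_local_subset_stay, rule subsetI)
  fix \<sigma> assume a: "\<sigma> \<in> Succ t"
  then have "s0 ## sdrop 2 \<sigma> \<in> stay (sp t)" using stay_Cons[of s0 "sp t"] sp by (simp add: Succ_def)
  then have "sp t ## s0 ## sdrop 2 \<sigma> \<in> stay t" using stay_Cons[of "sp t" t] sp by simp
  then show "\<sigma> \<in> stay t" using stream_split2[of \<sigma> "sp t" s0] a by (simp add: Succ_def)
qed

end

text \<open>Success of an attempt as far as the finite path \<open>\<rho>\<close> can tell.\<close>

definition okp :: "letter \<Rightarrow> letter \<Rightarrow> letter list \<Rightarrow> bool" where
  "okp s s' \<rho> \<longleftrightarrow> take 2 \<rho> = [s, s'] \<and> (\<forall>m\<le>length \<rho> - 2. run [s'] (take m (drop 2 \<rho>)) \<noteq> [])"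

definition hits :: "letter list \<Rightarrow> nat \<Rightarrow> letter list \<Rightarrow> bool" where
  "hits x l \<pi> \<longleftrightarrow> l \<le> length (run x \<pi>)"

lemma first_hits:
  assumes f: "first_at (hits x l) \<pi>" and l: "length x < l"
  shows "length (run x \<pi>) = l" "run x \<pi> \<noteq> []" "m < length \<pi> \<Longrightarrow> length (run x (take m \<pi>)) < l" "l \<le> length \<pi> + length x"
proof -
  show "m < length \<pi> \<Longrightarrow> length (run x (take m \<pi>)) < l" for m
    using f by (auto simp: first_at_def hits_def not_le)
  show "length (run x \<pi>) = l"
  proof (cases \<pi> rule: rev_cases)
    case Nil
    then show ?thesis using f l by (simp add: first_at_def hits_def)
  next
    case (snoc \<rho> s)
    then have "length (run x \<rho>) < l" using f by (auto simp: first_at_def hits_def not_le dest: spec[of _ "length \<rho>"])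
    then have "length (run x \<pi>) \<le> l" using length_lmul_le[of s "run x \<rho>"] by (simp add: snoc run_snoc)
    then show ?thesis using f by (simp add: first_at_def hits_def)
  qed
  then show "run x \<pi> \<noteq> []" "l \<le> length \<pi> + length x" using l length_run_le[of x \<pi>] by auto
qed

context rwre_speed
begin

lemma Succ_prob:
  assumes t: "t \<in> S"
  shows "\<epsilon> ^ 2 * \<beta> \<le> measure (Aw [t]) (Succ t)"
proof -
  have g1: "sp t # t # [] \<in> G" by (rule child_Gset[OF _ sp(1,2)]) (use t in simp)
  have g: "s0 # sp t # t # [] \<in> G" by (rule child_Gset[OF g1 s0_S sp(3)])
  have run2: "run [t] [sp t, s0] = s0 # sp t # t # []"
    using sp[of t] by (auto simp: linv_eq_iff) (metis linv_linv)+
  have "\<epsilon> ^ 2 * \<beta> \<le> \<epsilon> ^ 2 * esc s0" using beta by (intro mult_left_mono) auto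
  also have "\<dots> = (\<integral>\<omega>. \<epsilon> ^ 2 * q \<omega> (s0 # sp t # t # []) \<partial>E)"
    using q_translate[OF g, of "\<lambda>x. x"] esc_eq[OF s0_S] by simp
  also have "\<dots> \<le> (\<integral>\<omega>. wt \<omega> [t] [sp t, s0] * qp \<omega> (run [t] [sp t, s0]) (stay s0) \<partial>E)"
  proof (rule integral_mono_AE)
    show "AE \<omega> in E. \<epsilon> ^ 2 * q \<omega> (s0 # sp t # t # []) \<le> wt \<omega> [t] [sp t, s0] * qp \<omega> (run [t] [sp t, s0]) (stay s0)"
      using AE_good
    proof eventually_elim
      case (elim \<omega>)
      have "\<epsilon> ^ 2 \<le> wt \<omega> [t] [sp t, s0]"
        using wt_bounds(1)[OF elim, of "[t]" "[sp t, s0]"] t sp(1)[of t] by (simp del: wt.simps add: numeral_2_eq_2)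
      moreover have "0 \<le> wt \<omega> [t] [sp t, s0]"
        using wt_bounds(2)[OF elim, of "[t]" "[sp t, s0]"] t sp(1)[of t] by (simp del: wt.simps)
      ultimately show ?case unfolding run2 q_def list.sel
        by (intro mult_mono) (use eps_pos in \<open>auto simp del: wt.simps\<close>)
    qed
    show "integrable E (\<lambda>\<omega>. \<epsilon> ^ 2 * q \<omega> (s0 # sp t # t # []))"
      by (intro integrable_mult_right q_integrable g)
    show "integrable E (\<lambda>\<omega>. wt \<omega> [t] [sp t, s0] * qp \<omega> (run [t] [sp t, s0]) (stay s0))"
      unfolding run2
    proof (rule env.integrable_const_bound[where B=1])
      show "AE \<omega> in E. norm (wt \<omega> [t] [sp t, s0] * qp \<omega> (s0 # sp t # t # []) (stay s0)) \<le> 1"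
        using AE_good
      proof eventually_elim
        case (elim \<omega>)
        have "0 \<le> wt \<omega> [t] [sp t, s0]" "wt \<omega> [t] [sp t, s0] \<le> 1"
          using wt_bounds(2,3)[OF elim, of "[t]" "[sp t, s0]"] t sp(1)[of t] by auto
        then show ?case by (simp add: abs_mult mult_le_one del: wt.simps)
      qed
    qed (use t sp(1)[of t] g in \<open>auto intro!: borel_measurable_times wt_measurable qp_measurable simp del: wt.simps\<close>)
  qed
  also have "\<dots> = measure (Aw [t]) {\<sigma>. stake (length [sp t, s0]) \<sigma> = [sp t, s0] \<and> sdrop (length [sp t, s0]) \<sigma> \<in> stay s0}"
    by (rule Aw_prefix[symmetric]) (use t sp(1)[of t] in auto)
  also have "{\<sigma>. stake (length [sp t, s0]) \<sigma> = [sp t, s0] \<and> sdrop (length [sp t, s0]) \<sigma> \<in> stay s0} = Succ t"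
    by (simp add: Succ_def numeral_2_eq_2)
  finally show ?thesis .
qed

definition \<delta> :: real where "\<delta> = \<epsilon> ^ 2 * \<beta>"

lemma delta: "0 < \<delta>" "\<delta> < 1"
proof -
  show "0 < \<delta>" using eps_pos beta by (simp add: \<delta>_def)
  have "\<epsilon> ^ 2 < 1" using eps_pos eps_lt_1 by (simp add: power_less_one_iff)
  then have "\<epsilon> ^ 2 * \<beta> < 1 * 1" using beta by (intro mult_less_le_imp_less) auto
  then show "\<delta> < 1" by (simp add: \<delta>_def)
qed

lemma fresh_first_hits: "first_at (hits x l) \<pi> \<Longrightarrow> length x < l \<Longrightarrow> fresh x \<pi>"
  using first_hits[of x l \<pi>] by (force simp: fresh_def dest: suffix_length_le)

text \<open>When level \<open>l\<close> is reached for the first time, a word of length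
  \<open>l + 2\<close> is longer than everything visited so far, so its cone is fresh.\<close>

lemma Succ_Reg:
  assumes f: "first_at (hits x l) (stake n \<sigma>)" and l: "length x < l" and s: "sdrop n \<sigma> \<in> Succ (hd (run x (stake n \<sigma>)))"
  shows "Reg x \<sigma> (n + 2)"
proof -
  note fh = first_hits[OF f l]
  obtain t w where tw: "run x (stake n \<sigma>) = t # w" using fh(2) by (cases "run x (stake n \<sigma>)") auto
  have st: "stake 2 (sdrop n \<sigma>) = [sp t, s0]" "sdrop 2 (sdrop n \<sigma>) \<in> stay s0" using s tw by (auto simp: Succ_def)
  have r1: "lmul (sp t) (t # w) = sp t # t # w" "lmul s0 (sp t # t # w) = s0 # sp t # t # w"
    using sp[of t] by (auto simp: linv_eq_iff) (metis linv_linv)+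
  have r2: "run x (stake (n + 2) \<sigma>) = s0 # sp t # t # w"
    unfolding stake_add_run tw st(1) by (simp add: r1 del: lmul.simps)
  have r3: "run x (stake (n + 1) \<sigma>) = sp t # t # w"
    using st(1) unfolding stake_add_run tw by (simp add: r1 numeral_2_eq_2 del: lmul.simps)
  have "\<not> suffix (s0 # sp t # t # w) (run x (take m (stake (n + 2) \<sigma>)))" if m: "m < n + 2" for m
  proof -
    have "min m (n + 2) = m" using m by simp
    then have tk: "take m (stake (n + 2) \<sigma>) = stake m \<sigma>" by (simp only: take_stake)
    consider "m < n" | "m = n" | "m = n + 1" using m by linarith
    then have "length (run x (stake m \<sigma>)) < length (s0 # sp t # t # w)"
    proof cases
      case 1
      then have "length (run x (stake m \<sigma>)) < l" using fh(3)[of m] by (simp add: take_stake min_def)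
      then show ?thesis using fh(1) tw by simp
    qed (use tw r3 in auto)
    then show ?thesis unfolding tk by (auto dest: suffix_length_le)
  qed
  then have "fresh x (stake (n + 2) \<sigma>)" unfolding fresh_def r2 by simp
  then show ?thesis unfolding Reg_def r2 using st(2) by simp
qed

definition ret :: "nat \<Rightarrow> letter stream set" where
  "ret h = (\<Union>n. retn h n [s0])"

lemma ret_sets [simp]: "ret h \<in> sets SS"
  by (auto simp: ret_def)

text \<open>Whether a return takes place, and from which height, is settled at the moment of exit
  from the cone.\<close>

lemma ret_local: "cone_local s0 (ret h)"
  unfolding cone_local_def
proof (intro allI impI)
  fix \<sigma> \<sigma>' assume a: "\<forall>n. (\<forall>m<n. run [s0] (stake m \<sigma>) \<noteq> []) \<longrightarrow> stake n \<sigma> = stake n \<sigma>'" and "\<sigma> \<in> ret h"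
  then obtain m' m where m: "run [s0] (stake m' \<sigma>) = []" "\<forall>i<m'. run [s0] (stake i \<sigma>) \<noteq> []" "m \<le> m'" "h \<le> length (run [s0] (stake m \<sigma>))"
    unfolding ret_def retn_def by blast
  have e: "stake i \<sigma>' = stake i \<sigma>" if "i \<le> m'" for i
    using stake_le_eq[of m' \<sigma>' \<sigma> i] a[rule_format, of m'] m(2) that by simp
  have "\<exists>i\<le>m'. h \<le> length (run [s0] (stake i \<sigma>'))" using m e by (intro exI[of _ m]) simp
  then have "\<sigma>' \<in> retn h m' [s0]" unfolding retn_def using m e by (intro CollectI exI[of _ m']) simp
  then show "\<sigma>' \<in> ret h" unfolding ret_def by blast
qed

lemma ret_prob:
  assumes "\<And>n. measure (Aw [s0]) (retn h n [s0]) \<le> c"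
  shows "measure (Aw [s0]) (ret h) \<le> c"
proof -
  interpret A: prob_space "Aw [s0]" by (rule prob_space_Aw) simp
  have "(\<lambda>n. measure (Aw [s0]) (retn h n [s0])) \<longlonglongrightarrow> measure (Aw [s0]) (\<Union>n. retn h n [s0])"
  proof (rule A.finite_Lim_measure_incseq)
    show "range (\<lambda>n. retn h n [s0]) \<subseteq> sets (Aw [s0])" by (simp add: image_subset_iff)
    show "incseq (\<lambda>n. retn h n [s0])" unfolding incseq_def retn_def by (auto intro: order_trans)
  qed
  then show ?thesis unfolding ret_def using assms by (intro LIMSEQ_le_const2) auto
qed

section \<open>Attempts to regenerate at separated levels\<close>

context
  fixes x :: "letter list" and l0 L :: nat
  assumes x: "x \<in> G" "length x \<le> 1" and l0: "2 \<le> l0" and L: "3 \<le> L"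
begin

definition ll :: "nat \<Rightarrow> nat" where "ll j = l0 + j * L"

lemma ll: "length x < ll j" "j \<le> j' \<Longrightarrow> ll j \<le> ll j'" "ll (Suc j) = ll j + L"
  using x(2) l0 by (auto simp: ll_def)

text \<open>An attempt is declared failed if this is visible when the next level
  \<open>ll (Suc j)\<close> is reached; so the outcome is known before the next attempt starts. An
  attempt that fails later requires a return after a climb of at least \<open>L - 1\<close> levels,
  which is left to \<open>ret (L - 1)\<close>.\<close>

definition bad :: "nat \<Rightarrow> letter list \<Rightarrow> bool" where
  "bad j \<pi> \<longleftrightarrow> (\<exists>a b. a \<le> b \<and> b \<le> length \<pi> \<and> first_at (hits x (ll j)) (take a \<pi>) \<and> first_at (hits x (ll (Suc j))) (take b \<pi>)
     \<and> \<not> okp (sp (hd (run x (take a \<pi>)))) s0 (drop a (take b \<pi>)))"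

definition trial :: "nat \<Rightarrow> letter list \<Rightarrow> bool" where
  "trial j \<pi> \<longleftrightarrow> hits x (ll j) \<pi> \<and> (\<forall>i<j. bad i \<pi>)"

text \<open>The earlier failures are all decided no later than level \<open>ll j\<close> is hit, so
  the extra condition does not delay the stopping time.\<close>

lemma first_trial:
  assumes "first_at (trial j) \<pi>"
  shows "first_at (hits x (ll j)) \<pi>"
  unfolding first_at_def
proof (intro conjI allI impI notI)
  show "hits x (ll j) \<pi>" using assms by (simp add: first_at_def trial_def)
  fix m assume m: "m < length \<pi>" and h: "hits x (ll j) (take m \<pi>)"
  have "bad i (take m \<pi>)" if i: "i < j" for i
  proof -
    have "bad i \<pi>" using assms i by (simp add: first_at_def trial_def)
    then obtain a b where ab: "a \<le> b" "b \<le> length \<pi>" "first_at (hits x (ll i)) (take a \<pi>)" "first_at (hits x (ll (Suc i))) (take b \<pi>)"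
      "\<not> okp (sp (hd (run x (take a \<pi>)))) s0 (drop a (take b \<pi>))" unfolding bad_def by blast
    have "b \<le> m"
    proof (rule ccontr)
      assume "\<not> b \<le> m"
      then have "\<not> hits x (ll (Suc i)) (take m (take b \<pi>))" using ab(2,4) unfolding first_at_def by auto
      then have "\<not> hits x (ll (Suc i)) (take m \<pi>)" using \<open>\<not> b \<le> m\<close> by (simp add: min_def)
      then show False using h ll(2)[of "Suc i" j] i by (simp add: hits_def)
    qed
    then show ?thesis unfolding bad_def using ab m
      by (intro exI[of _ a] exI[of _ b]) (simp add: min_def)
  qed
  then have "trial j (take m \<pi>)" using h by (simp add: trial_def)
  then show False using assms m by (simp add: first_at_def)
qed

text \<open>Each attempt starts in a fresh cone, hence succeeds with probability at least \<delta>
  whatever happened before, and success excludes \<open>bad\<close>.\<close>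

lemma trials_fail: "measure (Aw x) {\<sigma>. \<exists>n. trial j (stake n \<sigma>)} \<le> (1 - \<delta>) ^ j"
proof (induction j)
  case 0
  interpret A: prob_space "Aw x" by (rule prob_space_Aw[OF x(1)])
  show ?case by simp
next
  case (Suc j)
  interpret A: prob_space "Aw x" by (rule prob_space_Aw[OF x(1)])
  let ?E = "\<lambda>j. {\<sigma>. \<exists>n. trial j (stake n \<sigma>)}"
  let ?Z = "{\<sigma>. \<exists>n. first_at (trial j) (stake n \<sigma>) \<and> sdrop n \<sigma> \<in> (\<lambda>\<pi>. Succ (hd (run x \<pi>))) (stake n \<sigma>)}"
  have Em: "?E j \<in> sets (Aw x)" for j using ex_stake_sets[of "trial j"] by simp
  have Zm: "?Z \<in> sets (Aw x)" using first_set_sets[of "\<lambda>\<pi>. Succ (hd (run x \<pi>))" "trial j"] by simp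
  have b: "\<delta> * measure (Aw x) (?E j) \<le> measure (Aw x) ?Z"
  proof (rule first_ge[OF x(1)])
    fix \<pi> assume p: "set \<pi> \<subseteq> S" "first_at (trial j) \<pi>"
    have fr: "fresh x \<pi>" using fresh_first_hits[OF first_trial[OF p(2)] ll(1)] .
    have "hd (run x \<pi>) \<in> S" using hd_run_S[OF x(1) p(1)] fr by (simp add: fresh_def)
    then have "measure (Aw x) {\<sigma>. stake (length \<pi>) \<sigma> = \<pi>} * \<delta> \<le> measure (Aw x) {\<sigma>. stake (length \<pi>) \<sigma> = \<pi>} * measure (Aw [hd (run x \<pi>)]) (Succ (hd (run x \<pi>)))"
      using Succ_prob by (intro mult_left_mono) (auto simp: \<delta>_def)
    then show "\<delta> * measure (Aw x) {\<sigma>. stake (length \<pi>) \<sigma> = \<pi>}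
      \<le> measure (Aw x) {\<sigma>. stake (length \<pi>) \<sigma> = \<pi> \<and> sdrop (length \<pi>) \<sigma> \<in> Succ (hd (run x \<pi>))}"
      unfolding Aw_fresh[OF x(1) p(1) fr Succ_sets Succ_local] by (simp add: mult.commute)
  qed (use delta in auto)
  have sub: "?E (Suc j) \<subseteq> ?E j"
    unfolding trial_def hits_def using ll(2)[of j "Suc j"] by (auto intro: order_trans)
  have dis: "?E (Suc j) \<inter> ?Z = {}"
  proof (rule ccontr)
    assume "\<not> ?thesis"
    then obtain \<sigma> m n where m: "trial (Suc j) (stake m \<sigma>)"
      and n: "first_at (trial j) (stake n \<sigma>)" "sdrop n \<sigma> \<in> Succ (hd (run x (stake n \<sigma>)))" by auto
    from m obtain a b where ab: "a \<le> b" "b \<le> m" "first_at (hits x (ll j)) (stake a \<sigma>)" "first_at (hits x (ll (Suc j))) (stake b \<sigma>)"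
      "\<not> okp (sp (hd (run x (stake a \<sigma>)))) s0 (drop a (stake b \<sigma>))"
      unfolding trial_def bad_def by (auto simp: take_stake min_def dest!: spec[of _ j])
    have an: "a = n" using first_at_unique[OF ab(3) first_trial[OF n(1)]] .
    let ?\<tau> = "sdrop n \<sigma>"
    have bn: "stake b \<sigma> = stake n \<sigma> @ stake (b - n) ?\<tau>" using ab(1) an by (simp add: stake_add)
    have dr: "drop a (stake b \<sigma>) = stake (b - n) ?\<tau>" by (simp add: drop_stake an)
    \<comment> \<open>Heights grow by at most one per step, so \<open>3 \<le> L\<close> leaves room
      for the two prescribed letters before the next level is reached.\<close>
    have "length (run x (stake b \<sigma>)) \<le> length (run x (stake n \<sigma>)) + (b - n)"
      unfolding bn run_append using length_run_le[of "run x (stake n \<sigma>)" "stake (b - n) ?\<tau>"] by simp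
    then have bl: "3 \<le> b - n"
      using first_hits(1)[OF ab(3) ll(1)] first_hits(1)[OF ab(4) ll(1)] ll(3)[of j] L an by simp
    let ?t = "hd (run x (stake n \<sigma>))"
    have s2: "stake 2 ?\<tau> = [sp ?t, s0]" "sdrop 2 ?\<tau> \<in> stay s0" using n(2) by (auto simp: Succ_def)
    have "b - n = 2 + (b - n - 2)" using bl by simp
    then have "stake (b - n) ?\<tau> = stake (2 + (b - n - 2)) ?\<tau>" by (simp only:)
    also have "\<dots> = stake 2 ?\<tau> @ stake (b - n - 2) (sdrop 2 ?\<tau>)" by (simp only: stake_add)
    finally have "okp (sp ?t) s0 (stake (b - n) ?\<tau>)"
      unfolding okp_def using s2 by (auto simp: take_stake min_def stay_def simp del: stake_add)
    then show False using ab(5) dr an by simp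
  qed
  have zs: "?Z \<subseteq> ?E j" by (auto simp: first_at_def)
  have "measure (Aw x) (?E (Suc j)) + measure (Aw x) ?Z = measure (Aw x) (?E (Suc j) \<union> ?Z)"
    by (rule A.finite_measure_Union[symmetric, OF Em Zm dis])
  also have "\<dots> \<le> measure (Aw x) (?E j)"
    by (rule A.finite_measure_mono[OF _ Em]) (use sub zs in blast)
  finally have "measure (Aw x) (?E (Suc j)) \<le> (1 - \<delta>) * measure (Aw x) (?E j)" using b by (simp add: algebra_simps)
  also have "\<dots> \<le> (1 - \<delta>) * (1 - \<delta>) ^ j" using Suc delta by (intro mult_left_mono) auto
  finally show ?case by simp
qed

text \<open>The moment at which an attempt at level \<open>ll j\<close> has made its two prescribed
  steps. The cone entered then is fresh, so a later failure is bounded by the annealed probability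
  of \<open>ret\<close>.\<close>

definition late :: "nat \<Rightarrow> letter list \<Rightarrow> bool" where
  "late j \<rho> \<longleftrightarrow> (\<exists>\<pi>. \<rho> = \<pi> @ [sp (hd (run x \<pi>)), s0] \<and> first_at (hits x (ll j)) \<pi>)"

lemma late_prob:
  assumes c: "measure (Aw [s0]) (ret (L - 1)) \<le> c" "0 \<le> c"
  shows "measure (Aw x) {\<sigma>. \<exists>n. first_at (late j) (stake n \<sigma>) \<and> sdrop n \<sigma> \<in> ret (L - 1)} \<le> c"
proof -
  interpret A: prob_space "Aw x" by (rule prob_space_Aw[OF x(1)])
  have "measure (Aw x) {\<sigma>. \<exists>n. first_at (late j) (stake n \<sigma>) \<and> sdrop n \<sigma> \<in> (\<lambda>_. ret (L - 1)) (stake n \<sigma>)} \<le> c * measure (Aw x) {\<sigma>. \<exists>n. late j (stake n \<sigma>)}"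
  proof (rule first_le[OF x(1) ret_sets c(2)])
    fix \<rho> assume p: "set \<rho> \<subseteq> S" "first_at (late j) \<rho>"
    then obtain \<pi> where pi: "\<rho> = \<pi> @ [sp (hd (run x \<pi>)), s0]" "first_at (hits x (ll j)) \<pi>"
      by (auto simp: first_at_def late_def)
    note fh = first_hits[OF pi(2) ll(1)]
    obtain t w where tw: "run x \<pi> = t # w" using fh(2) by (cases "run x \<pi>") auto
    have r1: "lmul (sp t) (t # w) = sp t # t # w" "lmul s0 (sp t # t # w) = s0 # sp t # t # w"
      using sp[of t] by (auto simp: linv_eq_iff) (metis linv_linv)+
    have r2: "run x \<rho> = s0 # sp t # t # w" unfolding pi(1) run_append tw by (simp add: r1 del: lmul.simps)
    have "\<not> suffix (s0 # sp t # t # w) (run x (take m \<rho>))" if m: "m < length \<rho>" for m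
    proof -
      consider "m < length \<pi>" | "m = length \<pi>" | "m = Suc (length \<pi>)" using m pi(1) by force
      then have "length (run x (take m \<rho>)) < length (s0 # sp t # t # w)"
      proof cases
        case 1
        then show ?thesis using fh(3)[OF 1] fh(1) tw pi(1) by simp
      next
        case 2
        then show ?thesis using tw pi(1) by simp
      next
        case 3
        then have "take m \<rho> = \<pi> @ [sp t]" using pi(1) tw by simp
        then show ?thesis using tw by (simp add: run_append r1 del: lmul.simps)
      qed
      then show ?thesis by (auto dest: suffix_length_le)
    qed
    then have fr: "fresh x \<rho>" unfolding fresh_def r2 by simp
    have h: "hd (run x \<rho>) = s0" unfolding r2 by simp
    have e: "measure (Aw x) {\<sigma>. stake (length \<rho>) \<sigma> = \<rho> \<and> sdrop (length \<rho>) \<sigma> \<in> ret (L - 1)}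
       = measure (Aw x) {\<sigma>. stake (length \<rho>) \<sigma> = \<rho>} * measure (Aw [s0]) (ret (L - 1))"
      using Aw_fresh[OF x(1) p(1) fr ret_sets, of "L - 1"] ret_local[of "L - 1"] unfolding h by blast
    show "measure (Aw x) {\<sigma>. stake (length \<rho>) \<sigma> = \<rho> \<and> sdrop (length \<rho>) \<sigma> \<in> ret (L - 1)} \<le> c * measure (Aw x) {\<sigma>. stake (length \<rho>) \<sigma> = \<rho>}"
      unfolding e using mult_left_mono[OF c(1), of "measure (Aw x) {\<sigma>. stake (length \<rho>) \<sigma> = \<rho>}"]
      by (simp only: mult.commute measure_nonneg)
  qed
  also have "\<dots> \<le> c * 1" using c(2) by (intro mult_left_mono) auto
  finally show ?thesis by simp
qed

text \<open>If not all \<open>J\<close> attempts are \<open>bad\<close>, then during one of them the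
  walk is still in its cone when the next level is reached. Either it stays there, which is a
  regeneration in the excluded range of times, or it returns from relative height at least
  \<open>L - 1\<close>.\<close>

lemma no_reg_bound:
  assumes c: "measure (Aw [s0]) (ret (L - 1)) \<le> c" "0 \<le> c"
  shows "measure (Aw x) {\<sigma>. \<exists>n. ll J \<le> length (run x (stake n \<sigma>)) \<and> (\<forall>m\<le>n. l0 - 1 \<le> m \<longrightarrow> \<not> Reg x \<sigma> m)} \<le> (1 - \<delta>) ^ J + real J * c"
proof -
  interpret A: prob_space "Aw x" by (rule prob_space_Aw[OF x(1)])
  let ?E = "{\<sigma>. \<exists>n. trial J (stake n \<sigma>)}"
  let ?R = "\<lambda>j. {\<sigma>. \<exists>n. first_at (late j) (stake n \<sigma>) \<and> sdrop n \<sigma> \<in> ret (L - 1)}"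
  have Em: "?E \<in> sets (Aw x)" using ex_stake_sets[of "trial J"] by simp
  have Rm: "?R j \<in> sets (Aw x)" for j using first_set_sets[of "\<lambda>_. ret (L - 1)" "late j"] by simp
  have "{\<sigma>. \<exists>n. ll J \<le> length (run x (stake n \<sigma>)) \<and> (\<forall>m\<le>n. l0 - 1 \<le> m \<longrightarrow> \<not> Reg x \<sigma> m)} \<subseteq> ?E \<union> (\<Union>j\<in>{..<J}. ?R j)"
  proof
    fix \<sigma> assume "\<sigma> \<in> {\<sigma>. \<exists>n. ll J \<le> length (run x (stake n \<sigma>)) \<and> (\<forall>m\<le>n. l0 - 1 \<le> m \<longrightarrow> \<not> Reg x \<sigma> m)}"
    then obtain n where n: "ll J \<le> length (run x (stake n \<sigma>))" "\<And>m. m \<le> n \<Longrightarrow> l0 - 1 \<le> m \<Longrightarrow> \<not> Reg x \<sigma> m" by auto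
    have ex: "\<exists>a\<le>n. first_at (hits x (ll i)) (stake a \<sigma>)" if i: "i \<le> J" for i
    proof -
      have hn: "hits x (ll i) (stake n \<sigma>)" using n(1) ll(2)[OF i] by (simp add: hits_def)
      then obtain a where a: "first_at (hits x (ll i)) (stake a \<sigma>)" using ex_first_at[of "hits x (ll i)" \<sigma>] by blast
      have "a \<le> n"
      proof (rule ccontr)
        assume "\<not> a \<le> n"
        then show False using a hn unfolding first_at_def by (auto simp: take_stake min_def dest!: spec[of _ n])
      qed
      then show ?thesis using a by blast
    qed
    show "\<sigma> \<in> ?E \<union> (\<Union>j\<in>{..<J}. ?R j)"
    proof (cases "trial J (stake n \<sigma>)")
      case False
      then obtain i where i: "i < J" "\<not> bad i (stake n \<sigma>)" using n(1) by (auto simp: trial_def hits_def)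
      obtain a where a: "a \<le> n" "first_at (hits x (ll i)) (stake a \<sigma>)" using ex[of i] i by auto
      obtain b where b: "b \<le> n" "first_at (hits x (ll (Suc i))) (stake b \<sigma>)" using ex[of "Suc i"] i by auto
      note fa = first_hits[OF a(2) ll(1)] and fb = first_hits[OF b(2) ll(1)]
      have ab: "a < b"
      proof (rule ccontr)
        assume nb: "\<not> a < b"
        then have "b = a \<or> length (run x (stake b \<sigma>)) < ll i"
          by (cases "b < a") (use nb fa(3)[of b] in \<open>auto simp: take_stake min_def\<close>)
        then show False using fa(1) fb(1) ll(3)[of i] L by auto
      qed
      let ?\<tau> = "sdrop a \<sigma>" let ?t = "hd (run x (stake a \<sigma>))"
      have bn: "stake b \<sigma> = stake a \<sigma> @ stake (b - a) ?\<tau>" using ab by (simp add: stake_add)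
      have ok: "okp (sp ?t) s0 (stake (b - a) ?\<tau>)"
      proof -
        have "okp (sp ?t) s0 (drop a (take b (stake n \<sigma>)))"
          using i(2) a b ab unfolding bad_def by (auto simp: take_stake min_def)
        then show ?thesis using b(1) by (simp add: take_stake min_def drop_stake)
      qed
      have "length (run x (stake b \<sigma>)) \<le> length (run x (stake a \<sigma>)) + (b - a)"
        unfolding bn run_append using length_run_le[of "run x (stake a \<sigma>)" "stake (b - a) ?\<tau>"] by simp
      then have bl: "3 \<le> b - a" using fa(1) fb(1) ll(3)[of i] L by simp
      have s2: "stake 2 ?\<tau> = [sp ?t, s0]" using ok bl by (simp add: okp_def take_stake min_def)
      have dr: "drop 2 (stake (b - a) ?\<tau>) = stake (b - a - 2) (sdrop 2 ?\<tau>)" by (simp add: drop_stake)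
      let ?\<rho> = "sdrop 2 ?\<tau>"
      have nz: "run [s0] (stake m ?\<rho>) \<noteq> []" if "m \<le> b - a - 2" for m
        using ok that unfolding okp_def dr by (auto simp: take_stake min_def dest!: conjunct2)
      show ?thesis
      proof (cases "?\<rho> \<in> stay s0")
        case True
        have "Reg x \<sigma> (a + 2)" by (rule Succ_Reg[OF a(2) ll(1)]) (use True s2 in \<open>simp add: Succ_def\<close>)
        moreover have "a + 2 \<le> n" using bl b(1) by simp
        \<comment> \<open>A walk starting at height at most 1 does not reach level \<open>l0\<close>
          before time \<open>l0 - 1\<close>; in this way \<open>l0\<close> bounds the regeneration
          time from below.\<close>
        moreover have "l0 - 1 \<le> a + 2" using fa(4) x(2) by (simp add: ll_def)
        ultimately show ?thesis using n(2) by blast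
      next
        case False
        let ?m' = "LEAST m. run [s0] (stake m ?\<rho>) = []"
        have ex0: "\<exists>m. run [s0] (stake m ?\<rho>) = []" using False by (auto simp: stay_def)
        have m': "run [s0] (stake ?m' ?\<rho>) = []" by (rule LeastI_ex[OF ex0])
        have lt: "run [s0] (stake m ?\<rho>) \<noteq> []" if "m < ?m'" for m using not_less_Least[OF that] .
        let ?m = "b - a - 2"
        have mm: "?m < ?m'" using nz[of ?m'] m' by (cases "?m' \<le> ?m") auto
        obtain t w where tw: "run x (stake a \<sigma>) = t # w" using fa(2) by (cases "run x (stake a \<sigma>)") auto
        have r1: "lmul (sp t) (t # w) = sp t # t # w" "lmul s0 (sp t # t # w) = s0 # sp t # t # w"
          using sp[of t] by (auto simp: linv_eq_iff) (metis linv_linv)+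
        have "b - a = 2 + ?m" using bl by simp
        then have "stake (b - a) ?\<tau> = stake (2 + ?m) ?\<tau>" by (simp only:)
        also have "\<dots> = [sp t, s0] @ stake ?m ?\<rho>" using s2 tw by (simp only: stake_add[symmetric] list.sel)
        finally have "run x (stake b \<sigma>) = run ([s0] @ (sp t # t # w)) (stake ?m ?\<rho>)"
          unfolding bn run_append tw by (simp add: r1 del: lmul.simps)
        also have "\<dots> = run [s0] (stake ?m ?\<rho>) @ (sp t # t # w)"
          by (rule run_stake_app_base) (use nz in auto)
        \<comment> \<open>At time \<open>b\<close> the height is \<open>ll i + L\<close>, of which
          the base \<open>sp t # t # w\<close> takes \<open>ll i + 1\<close> letters.\<close>
        finally have "L - 1 \<le> length (run [s0] (stake ?m ?\<rho>))"
          using fa(1) fb(1) tw ll(3)[of i] by simp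
        then have "\<exists>m\<le>?m'. L - 1 \<le> length (run [s0] (stake m ?\<rho>))" using mm by (intro exI[of _ ?m]) simp
        then have "?\<rho> \<in> retn (L - 1) ?m' [s0]" unfolding retn_def using m' lt by blast
        then have re: "sdrop (a + 2) \<sigma> \<in> ret (L - 1)" unfolding ret_def by (auto simp: add.commute)
        have st2: "stake (a + 2) \<sigma> = stake a \<sigma> @ [sp ?t, s0]" using s2 by (metis stake_add)
        have late1: "late i (stake (a + 2) \<sigma>)" unfolding late_def using st2 a(2) by blast
        have "first_at (late i) (stake (a + 2) \<sigma>)"
          unfolding first_at_def
        proof (intro conjI allI impI notI)
          show "late i (stake (a + 2) \<sigma>)" by (rule late1)
          fix m assume m: "m < length (stake (a + 2) \<sigma>)" and lt: "late i (take m (stake (a + 2) \<sigma>))"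
          have "min m (a + 2) = m" using m by simp
          then have "late i (stake m \<sigma>)" using lt by (simp only: take_stake)
          then obtain \<pi> where pi: "stake m \<sigma> = \<pi> @ [sp (hd (run x \<pi>)), s0]" "first_at (hits x (ll i)) \<pi>"
            unfolding late_def by blast
          have lm: "m = length \<pi> + 2" using arg_cong[OF pi(1), of length] by simp
          have "\<pi> = take (length \<pi>) (stake m \<sigma>)" unfolding pi(1) by simp
          moreover have "min (length \<pi>) m = length \<pi>" using lm by simp
          ultimately have "\<pi> = stake (length \<pi>) \<sigma>" by (metis take_stake)
          then have "length \<pi> = a" using first_at_unique[OF _ a(2), of "length \<pi>"] pi(2) by simp
          then show False using lm m by simp
        qed
        then show ?thesis using re i(1) by blast
      qed
    qed auto
  qed
  then have "measure (Aw x) {\<sigma>. \<exists>n. ll J \<le> length (run x (stake n \<sigma>)) \<and> (\<forall>m\<le>n. l0 - 1 \<le> m \<longrightarrow> \<not> Reg x \<sigma> m)} \<le> measure (Aw x) (?E \<union> (\<Union>j\<in>{..<J}. ?R j))"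
    by (rule A.finite_measure_mono) (use Em Rm in auto)
  also have "\<dots> \<le> measure (Aw x) ?E + measure (Aw x) (\<Union>j\<in>{..<J}. ?R j)"
    by (rule measure_Un_le) (use Em Rm in auto)
  also have "measure (Aw x) (\<Union>j\<in>{..<J}. ?R j) \<le> (\<Sum>j\<in>{..<J}. measure (Aw x) (?R j))"
    by (rule A.finite_measure_subadditive_finite) (use Rm in auto)
  also have "\<dots> \<le> (\<Sum>j\<in>{..<J}. c)"
    by (rule sum_mono) (rule late_prob[OF c])
  finally show ?thesis using trials_fail[of J] by simp
qed

end

end

lemma geom_le_poly:
  fixes c :: real
  assumes "0 < c" "c < 1"
  shows "\<exists>C>0. \<forall>a>0. c ^ a \<le> C / real a ^ p"
proof -
  let ?l = "- ln c"
  have l: "0 < ?l" using assms by simp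
  have "c ^ a \<le> (fact p / ?l ^ p) / real a ^ p" if a: "a > 0" for a
  proof -
    have "c ^ a = exp (ln c) ^ a" using assms by simp
    also have "\<dots> = exp (real a * ln c)" by (rule exp_of_nat_mult[symmetric])
    also have "\<dots> = exp (- (?l * real a))" by (simp add: mult.commute)
    also have "\<dots> \<le> fact p / (?l * real a) ^ p" using l a by (intro exp_neg_le mult_pos_pos) auto
    finally show ?thesis by (simp only: power_mult_distrib divide_divide_eq_left)
  qed
  then show ?thesis using l by (intro exI[of _ "fact p / ?l ^ p"]) auto
qed

context rwre_speed
begin

section \<open>Existence of regenerations and tail of the first one\<close>

lemma notReg_sets: "{\<sigma>. P \<longrightarrow> \<not> Reg x \<sigma> m} \<in> sets SS"
proof (cases P)
  case True
  then have "{\<sigma>. P \<longrightarrow> \<not> Reg x \<sigma> m} = space SS - {\<sigma>. Reg x \<sigma> m}" by auto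
  then show ?thesis using Reg_sets[of x m] by (metis sets.compl_sets)
qed simp

lemma ret_tail: "\<exists>c<1. 0 < c \<and> (\<forall>h>0. measure (Aw [s0]) (ret h) \<le> 2 * c ^ (h - 1))"
proof -
  obtain c where c: "c < 1" "0 < c" "\<And>t h n. t \<in> S \<Longrightarrow> h > 0 \<Longrightarrow> measure (Aw [t]) (retn h n [t]) \<le> 2 * c ^ (h - 1)"
    using ret_decay by blast
  then show ?thesis by (intro exI[of _ c]) (auto intro!: ret_prob)
qed

text \<open>A walk of unbounded height makes any number of attempts. In \<open>no_reg_bound\<close>
  first the spacing tends to infinity, which removes the late returns, then the number
  \<open>J\<close> of attempts; the starting level \<open>N + 2\<close> puts the regeneration after
  time \<open>N\<close>.\<close>

lemma Reg_infinite:
  assumes tr: "AE \<sigma> in Aw x. \<forall>h. \<exists>n. h \<le> length (run x (stake n \<sigma>))" and x: "x \<in> G" "length x \<le> 1"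
  shows "AE \<sigma> in Aw x. \<forall>N. \<exists>m\<ge>N. Reg x \<sigma> m"
proof -
  interpret A: prob_space "Aw x" by (rule prob_space_Aw[OF x(1)])
  obtain c where c: "c < 1" "0 < c" "\<And>h. h > 0 \<Longrightarrow> measure (Aw [s0]) (ret h) \<le> 2 * c ^ (h - 1)"
    using ret_tail by blast
  have "AE \<sigma> in Aw x. \<exists>m\<ge>N. Reg x \<sigma> m" for N
  proof -
    let ?B = "{\<sigma>. \<forall>m\<ge>N + 1. \<not> Reg x \<sigma> m}"
    have Bm: "?B \<in> sets (Aw x)"
    proof -
      have "?B = space SS - (\<Union>m\<in>{N + 1..}. {\<sigma>. Reg x \<sigma> m})" by auto
      moreover have "(\<Union>m\<in>{N + 1..}. {\<sigma>. Reg x \<sigma> m}) \<in> sets SS" using Reg_sets by auto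
      ultimately show ?thesis by (metis sets.compl_sets sets_Aw)
    qed
    have le: "measure (Aw x) ?B \<le> (1 - \<delta>) ^ J + real J * (2 * c ^ (L + 1))" for J L
    proof -
      let ?X = "{\<sigma>. \<exists>n. ll (N + 2) (L + 3) J \<le> length (run x (stake n \<sigma>)) \<and> (\<forall>m\<le>n. N + 2 - 1 \<le> m \<longrightarrow> \<not> Reg x \<sigma> m)}"
      have Xm: "?X \<in> sets (Aw x)"
      proof -
        have "?X = (\<Union>n. {\<sigma>. ll (N + 2) (L + 3) J \<le> length (run x (stake n \<sigma>))} \<inter> (\<Inter>m\<in>{..n}. {\<sigma>. N + 2 - 1 \<le> m \<longrightarrow> \<not> Reg x \<sigma> m}))" by auto
        moreover have "{\<sigma>. ll (N + 2) (L + 3) J \<le> length (run x (stake n \<sigma>))} \<in> sets SS" for n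
          using stake_pred_sets[of "\<lambda>\<pi>. ll (N + 2) (L + 3) J \<le> length (run x \<pi>)" n] by simp
        moreover have "{\<sigma>. N + 2 - 1 \<le> m \<longrightarrow> \<not> Reg x \<sigma> m} \<in> sets SS" for m by (rule notReg_sets)
        ultimately show ?thesis by (auto intro!: sets.finite_INT sets.countable_UN sets.Int)
      qed
      have "measure (Aw x) ?B \<le> measure (Aw x) ?X"
        by (rule A.finite_measure_mono_AE[OF _ Xm]) (use tr in \<open>eventually_elim, auto\<close>)
      also have "\<dots> \<le> (1 - \<delta>) ^ J + real J * (2 * c ^ (L + 1))"
        by (rule no_reg_bound[OF x]) (use c(3)[of "L + 2"] c in auto)
      finally show ?thesis .
    qed
    have "measure (Aw x) ?B \<le> (1 - \<delta>) ^ J" for J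
    proof (rule LIMSEQ_le_const)
      have "(\<lambda>L. c ^ (L + 1)) \<longlonglongrightarrow> 0" using LIMSEQ_realpow_zero[of c] c by (intro LIMSEQ_ignore_initial_segment) auto
      then have "(\<lambda>L. (1 - \<delta>) ^ J + real J * (2 * c ^ (L + 1))) \<longlonglongrightarrow> (1 - \<delta>) ^ J + real J * (2 * 0)"
        by (intro tendsto_add tendsto_mult tendsto_const)
      then show "(\<lambda>L. (1 - \<delta>) ^ J + real J * (2 * c ^ (L + 1))) \<longlonglongrightarrow> (1 - \<delta>) ^ J" by simp
    qed (use le in auto)
    moreover have "(\<lambda>J. (1 - \<delta>) ^ J) \<longlonglongrightarrow> 0" using LIMSEQ_realpow_zero[of "1 - \<delta>"] delta by auto
    ultimately have "measure (Aw x) ?B \<le> 0" by (intro LIMSEQ_le_const[of _ 0]) auto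
    then have "measure (Aw x) ?B = 0" by (simp add: measure_le_0_iff)
    then have "AE \<sigma> in Aw x. \<sigma> \<notin> ?B" using A.prob_eq_0[OF Bm] by simp
    then show ?thesis by eventually_elim (auto intro: Suc_leD)
  qed
  then show ?thesis by (simp add: AE_all_countable)
qed

definition noreg :: "nat \<Rightarrow> letter stream set" where
  "noreg n = {\<sigma> \<in> stay s0. \<forall>m\<le>n. 0 < m \<longrightarrow> \<not> Reg [s0] \<sigma> m}"

lemma noreg_sets [measurable]: "noreg n \<in> sets SS"
proof -
  have "noreg n = stay s0 \<inter> (\<Inter>m\<in>{..n}. {\<sigma>. 0 < m \<longrightarrow> \<not> Reg [s0] \<sigma> m})" by (auto simp: noreg_def)
  moreover have "{\<sigma>. 0 < m \<longrightarrow> \<not> Reg [s0] \<sigma> m} \<in> sets SS" for m by (rule notReg_sets)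
  ultimately show ?thesis by (auto intro!: sets.finite_INT)
qed

text \<open>Either the walk keeps below the level \<open>2 + J * L\<close> up to time
  \<open>n\<close>, which is covered by \<open>slow_tail\<close>, or it reaches that level and has
  gone through \<open>J\<close> attempts without a regeneration.\<close>

lemma noreg_bound:
  assumes c: "measure (Aw [s0]) (ret (L - 1)) \<le> c" "0 \<le> c" and L: "3 \<le> L"
    and d: "\<And>t. t \<in> S \<Longrightarrow> (\<integral>\<omega>. (1 - \<epsilon> * q \<omega> [t]) ^ y \<partial>E) \<le> d" "0 \<le> d"
    and n: "(2 + J * L) * a * y \<le> n"
  shows "measure (Aw [s0]) (noreg n) \<le> real (2 + J * L) * ((1 - \<beta>) ^ a + real a * d) + ((1 - \<delta>) ^ J + real J * c)"
proof -
  have x: "[s0] \<in> G" "length [s0] \<le> 1" by auto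
  interpret A: prob_space "Aw [s0]" by (rule prob_space_Aw) simp
  let ?h = "2 + J * L"
  let ?X = "{\<sigma>. \<exists>n. ll 2 L J \<le> length (run [s0] (stake n \<sigma>)) \<and> (\<forall>m\<le>n. 2 - 1 \<le> m \<longrightarrow> \<not> Reg [s0] \<sigma> m)}"
  let ?Y = "{\<sigma>. \<forall>m\<le>n. 1 \<le> length (run [s0] (stake m \<sigma>)) \<and> length (run [s0] (stake m \<sigma>)) < ?h}"
  have Ym: "?Y \<in> sets SS"
  proof -
    have "?Y = (\<Inter>m\<in>{..n}. {\<sigma>. 1 \<le> length (run [s0] (stake m \<sigma>)) \<and> length (run [s0] (stake m \<sigma>)) < ?h})" by auto
    moreover have "{\<sigma>. 1 \<le> length (run [s0] (stake m \<sigma>)) \<and> length (run [s0] (stake m \<sigma>)) < ?h} \<in> sets SS" for m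
      using stake_pred_sets[of "\<lambda>\<pi>. 1 \<le> length (run [s0] \<pi>) \<and> length (run [s0] \<pi>) < ?h" m] by simp
    ultimately show ?thesis by (auto intro!: sets.finite_INT)
  qed
  have Xm: "?X \<in> sets SS"
  proof -
    have "?X = (\<Union>n. {\<sigma>. ll 2 L J \<le> length (run [s0] (stake n \<sigma>))} \<inter> (\<Inter>m\<in>{..n}. {\<sigma>. 2 - 1 \<le> m \<longrightarrow> \<not> Reg [s0] \<sigma> m}))" by auto
    moreover have "{\<sigma>. ll 2 L J \<le> length (run [s0] (stake n \<sigma>))} \<in> sets SS" for n
      using stake_pred_sets[of "\<lambda>\<pi>. ll 2 L J \<le> length (run [s0] \<pi>)" n] by simp
    moreover have "{\<sigma>. 2 - 1 \<le> m \<longrightarrow> \<not> Reg [s0] \<sigma> m} \<in> sets SS" for m by (rule notReg_sets)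
    ultimately show ?thesis by (auto intro!: sets.finite_INT sets.countable_UN sets.Int)
  qed
  have "noreg n \<subseteq> ?Y \<union> ?X"
  proof
    fix \<sigma> assume s: "\<sigma> \<in> noreg n"
    show "\<sigma> \<in> ?Y \<union> ?X"
    proof (cases "\<exists>m\<le>n. ?h \<le> length (run [s0] (stake m \<sigma>))")
      case True
      then obtain m where "m \<le> n" "ll 2 L J \<le> length (run [s0] (stake m \<sigma>))" using ll_def[OF x _ L, of 2 J] by auto
      then have "\<sigma> \<in> ?X" using s by (auto simp: noreg_def intro!: exI[of _ m])
      then show ?thesis by simp
    next
      case False
      have "1 \<le> length (run [s0] (stake m \<sigma>))" for m using s by (simp add: noreg_def stay_def Suc_le_eq)
      then have "\<sigma> \<in> ?Y" using False by (intro CollectI allI impI conjI) (auto simp: not_le[symmetric] simp del: not_le)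
      then show ?thesis by simp
    qed
  qed
  then have "measure (Aw [s0]) (noreg n) \<le> measure (Aw [s0]) (?Y \<union> ?X)"
    by (rule A.finite_measure_mono) (use Xm Ym in auto)
  also have "\<dots> \<le> measure (Aw [s0]) ?Y + measure (Aw [s0]) ?X"
    by (rule measure_Un_le) (use Xm Ym in auto)
  also have "measure (Aw [s0]) ?Y \<le> real ?h * ((1 - \<beta>) ^ a + real a * d)"
    by (rule slow_tail[OF x d n])
  also have "measure (Aw [s0]) ?X \<le> (1 - \<delta>) ^ J + real J * c"
    by (rule no_reg_bound[OF x _ L c]) simp
  finally show ?thesis by simp
qed

text \<open>On the scale \<open>a\<close> there are \<open>a\<close> attempts with spacing
  \<open>a\<close>, hence about \<open>a ^ 2\<close> levels, with \<open>a\<close> vertices each and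
  \<open>a ^ 5\<close> visits to each: \<open>n\<close> is of order \<open>a ^ 8\<close>. The
  seventh moment gives \<open>a ^ 2 * a / (a ^ 5) ^ 7 = 1 / a ^ 32\<close>, and the geometric terms
  are brought to the same order, which is \<open>1 / n ^ 4\<close>.\<close>

lemma noreg_tail: "\<exists>C>0. \<forall>n>0. measure (Aw [s0]) (noreg n) \<le> C / real n ^ 4"
proof -
  interpret A: prob_space "Aw [s0]" by (rule prob_space_Aw) simp
  obtain c where c: "c < 1" "0 < c" "\<And>h. h > 0 \<Longrightarrow> measure (Aw [s0]) (ret h) \<le> 2 * c ^ (h - 1)"
    using ret_tail by blast
  obtain C1 where C1: "C1 > 0" "\<And>t y. t \<in> S \<Longrightarrow> y > 0 \<Longrightarrow> (\<integral>\<omega>. (1 - \<epsilon> * q \<omega> [t]) ^ y \<partial>E) \<le> C1 / real y ^ 7"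
    using q_moment[of 7] by blast
  \<comment> \<open>\<beta> may be 1, while \<open>geom_le_poly\<close> asks for a positive base;
    halving \<beta> avoids this.\<close>
  have b: "0 < 1 - \<beta> / 2" "1 - \<beta> / 2 < 1" using beta by auto
  obtain C2 where C2: "C2 > 0" "\<And>a. a > 0 \<Longrightarrow> (1 - \<beta> / 2) ^ a \<le> C2 / real a ^ 34" using geom_le_poly[OF b] by blast
  obtain C3 where C3: "C3 > 0" "\<And>a. a > 0 \<Longrightarrow> c ^ a \<le> C3 / real a ^ 33" using geom_le_poly[OF c(2,1)] by blast
  have dd: "0 < 1 - \<delta>" "1 - \<delta> < 1" using delta by auto
  obtain C4 where C4: "C4 > 0" "\<And>a. a > 0 \<Longrightarrow> (1 - \<delta>) ^ a \<le> C4 / real a ^ 32" using geom_le_poly[OF dd] by blast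
  define K where "K = 3 * (C2 + C1) + (C4 + 2 * (C3 / c ^ 2))"
  have K0: "0 < K" unfolding K_def using C1 C2 C3 C4 c by (intro add_pos_pos mult_pos_pos divide_pos_pos) auto
  have main: "measure (Aw [s0]) (noreg n) \<le> K / real a ^ 32" if a: "3 \<le> a" and n: "3 * a ^ 8 \<le> n" for a n :: nat
  proof -
    let ?a = "real a"
    have a0: "0 < ?a" "1 \<le> ?a" using a by auto
    have h3: "real (2 + a * a) \<le> 3 * ?a ^ 2" using a0 one_le_power[of ?a 2] by (simp add: power2_eq_square)
    have "2 + a * a \<le> 3 * a ^ 2"
      using h3 by (metis (mono_tags, lifting) of_nat_le_iff of_nat_mult of_nat_numeral of_nat_power)
    then have "(2 + a * a) * a * a ^ 5 \<le> 3 * a ^ 2 * a * a ^ 5" by (intro mult_le_mono1)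
    also have "\<dots> = 3 * a ^ 8" by (simp add: power_numeral_reduce)
    finally have hn: "(2 + a * a) * a * a ^ 5 \<le> n" using n by simp
    have r: "measure (Aw [s0]) (ret (a - 1)) \<le> 2 * c ^ (a - 2)" using c(3)[of "a - 1"] a by (simp add: numeral_2_eq_2)
    have "measure (Aw [s0]) (noreg n) \<le> real (2 + a * a) * ((1 - \<beta>) ^ a + ?a * (C1 / real (a ^ 5) ^ 7)) + ((1 - \<delta>) ^ a + ?a * (2 * c ^ (a - 2)))"
    proof (rule noreg_bound[OF r _ a _ _ hn])
      show "(\<integral>\<omega>. (1 - \<epsilon> * q \<omega> [t]) ^ (a ^ 5) \<partial>E) \<le> C1 / real (a ^ 5) ^ 7" if "t \<in> S" for t
        by (rule C1(2)[OF that]) (use a in simp)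
    qed (use c C1 a in auto)
    also have "\<dots> \<le> 3 * ?a ^ 2 * (C2 / ?a ^ 34 + C1 / ?a ^ 34) + (C4 / ?a ^ 32 + ?a * (2 * (C3 / c ^ 2 / ?a ^ 33)))"
    proof (intro add_mono mult_mono h3)
      have "(1 - \<beta>) ^ a \<le> (1 - \<beta> / 2) ^ a" using beta by (intro power_mono) auto
      then show "(1 - \<beta>) ^ a \<le> C2 / ?a ^ 34" using C2(2)[of a] a by simp
      show "?a * (C1 / real (a ^ 5) ^ 7) \<le> C1 / ?a ^ 34"
      proof -
        have "real (a ^ 5) ^ 7 = ?a * ?a ^ 34" by (simp add: power_mult[symmetric] power_numeral_reduce)
        then show ?thesis using a0 by simp
      qed
      show "(1 - \<delta>) ^ a \<le> C4 / ?a ^ 32" using C4(2)[of a] a by simp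
      have "a - 2 + 2 = a" using a by simp
      then have "c ^ a = c ^ (a - 2) * c ^ 2" by (metis power_add)
      then have "c ^ (a - 2) = c ^ a / c ^ 2" using c by simp
      also have "\<dots> \<le> (C3 / ?a ^ 33) / c ^ 2" using C3(2)[of a] a c by (intro divide_right_mono) auto
      finally show "c ^ (a - 2) \<le> C3 / c ^ 2 / ?a ^ 33" by (simp add: mult.commute)
    qed (use beta C1 C2 a0 c in auto)
    also have "\<dots> = K / ?a ^ 32"
    proof -
      have e1: "?a ^ 34 = ?a ^ 2 * ?a ^ 32" and e2: "?a ^ 33 = ?a * ?a ^ 32" by (simp_all add: power_numeral_reduce)
      have "3 * x * (C2 / (x * y) + C1 / (x * y)) = 3 * (C2 + C1) / y" if "x \<noteq> 0" "y \<noteq> 0" for x y :: real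
        using that by (simp add: field_simps)
      moreover have "?a ^ 2 \<noteq> 0" "?a ^ 32 \<noteq> 0" using a0 by auto
      ultimately have "3 * ?a ^ 2 * (C2 / ?a ^ 34 + C1 / ?a ^ 34) = 3 * (C2 + C1) / ?a ^ 32"
        unfolding e1 by blast
      moreover have "?a * (2 * (C3 / c ^ 2 / ?a ^ 33)) = 2 * (C3 / c ^ 2) / ?a ^ 32"
        unfolding e2 using a0 by simp
      ultimately show ?thesis by (simp add: K_def add_divide_distrib)
    qed
    finally show ?thesis .
  qed
  \<comment> \<open>The first summand comes from \<open>n < 3 * (2 * a) ^ 8\<close> for the largest
    \<open>a\<close> with \<open>3 * a ^ 8 \<le> n\<close>; the second covers the \<open>n\<close>
    below \<open>3 * 3 ^ 8\<close> by the trivial bound 1.\<close>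
  define M where "M = K * (3 * 2 ^ 8) ^ 4 + real (3 * 3 ^ 8) ^ 4"
  have "measure (Aw [s0]) (noreg n) \<le> M / real n ^ 4" if n: "n > 0" for n
  proof (cases "3 * 3 ^ 8 \<le> n")
    case False
    have "measure (Aw [s0]) (noreg n) \<le> 1" by simp
    also have "real n ^ 4 \<le> real (3 * 3 ^ 8) ^ 4" using False by (intro power_mono) auto
    then have "real n ^ 4 \<le> M" using K0 unfolding M_def by (simp add: add_increasing)
    then have "1 \<le> M / real n ^ 4" using n by simp
    finally show ?thesis by simp
  next
    case True
    let ?A = "{a. 3 * a ^ 8 \<le> n}"
    have fin: "finite ?A"
    proof (rule finite_subset)
      show "?A \<subseteq> {..n}"
      proof
        fix a assume "a \<in> ?A"
        moreover have "a \<le> 3 * a ^ 8" by (cases "a = 0") (auto intro: order_trans[OF self_le_power[of a 8]])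
        ultimately show "a \<in> {..n}" by auto
      qed
    qed simp
    have in3: "3 \<in> ?A" using True by simp
    define a where "a = Max ?A"
    have "?A \<noteq> {}" using in3 by blast
    then have a: "a \<in> ?A" "3 \<le> a" unfolding a_def using Max_in[OF fin] Max_ge[OF fin in3] by blast+
    have "Suc a \<notin> ?A" using Max_ge[OF fin, of "Suc a"] unfolding a_def by auto
    then have "n < 3 * (Suc a) ^ 8" by simp
    also have "\<dots> \<le> 3 * (2 * a) ^ 8" using a(2) by (intro mult_le_mono2 power_mono) auto
    finally have "real n \<le> 3 * 2 ^ 8 * real a ^ 8"
      by (metis (mono_tags, lifting) less_imp_le mult.assoc of_nat_le_iff of_nat_mult of_nat_numeral of_nat_power power_mult_distrib)
    then have "real n ^ 4 \<le> (3 * 2 ^ 8 * real a ^ 8) ^ 4" by (intro power_mono) auto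
    also have "\<dots> = (3 * 2 ^ 8) ^ 4 * real a ^ 32" by (simp add: power_mult_distrib power_mult[symmetric])
    finally have le: "real n ^ 4 \<le> (3 * 2 ^ 8) ^ 4 * real a ^ 32" .
    have "measure (Aw [s0]) (noreg n) \<le> K / real a ^ 32" using main[of a n] a by simp
    also have "\<dots> \<le> K * (3 * 2 ^ 8) ^ 4 / real n ^ 4"
      using le K0 n a(2) mult_left_mono[OF le, of K] by (simp add: divide_simps)
    also have "\<dots> \<le> M / real n ^ 4" unfolding M_def by (intro divide_right_mono) auto
    finally show ?thesis .
  qed
  moreover have "0 < M" unfolding M_def using K0 by (intro add_pos_pos) auto
  ultimately show ?thesis by blast
qed

end

section \<open>Renewal structures and their central limit theorem\<close>

text \<open>\<open>X\<close> has countably many values, so independence on single values sums up to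
  independence on sets.\<close>

lemma (in prob_space) indep_countable_prod:
  fixes X :: "'a \<Rightarrow> 'b::countable"
  assumes X: "X \<in> measurable M (count_space UNIV)" and Z: "Z \<in> measurable M N"
    and eq: "\<And>b D. D \<in> sets N \<Longrightarrow> prob {x \<in> space M. X x = b \<and> Z x \<in> D} = prob {x \<in> space M. X x = b} * prob {x \<in> space M. Z x \<in> D}"
    and D: "D \<in> sets N"
  shows "prob {x \<in> space M. X x \<in> V \<and> Z x \<in> D} = prob {x \<in> space M. X x \<in> V} * prob {x \<in> space M. Z x \<in> D}"
proof -
  let ?Z = "{x \<in> space M. Z x \<in> D}"
  have Zm: "?Z \<in> sets M" using measurable_sets[OF Z D] by (simp add: vimage_def Int_def conj_commute)
  have Xm: "{x \<in> space M. X x = b} \<in> sets M" for b using measurable_sets[OF X, of "{b}"] by (simp add: vimage_def Int_def conj_commute)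
  have XZm: "{x \<in> space M. X x = b \<and> Z x \<in> D} \<in> sets M" for b
  proof -
    have "{x \<in> space M. X x = b \<and> Z x \<in> D} = {x \<in> space M. X x = b} \<inter> ?Z" by auto
    then show ?thesis using Xm Zm by auto
  qed
  have 1: "emeasure M {x \<in> space M. X x \<in> V} = (\<integral>\<^sup>+b. emeasure M {x \<in> space M. X x = b} \<partial>count_space V)"
    by (subst emeasure_UN_countable[symmetric]) (use Xm in \<open>auto simp: disjoint_family_on_def intro!: arg_cong[where f="emeasure M"]\<close>)
  have "emeasure M {x \<in> space M. X x \<in> V \<and> Z x \<in> D} = (\<integral>\<^sup>+b. emeasure M {x \<in> space M. X x = b \<and> Z x \<in> D} \<partial>count_space V)"
    by (subst emeasure_UN_countable[symmetric]) (use XZm in \<open>auto simp: disjoint_family_on_def intro!: arg_cong[where f="emeasure M"]\<close>)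
  also have "\<dots> = (\<integral>\<^sup>+b. emeasure M {x \<in> space M. X x = b} * emeasure M ?Z \<partial>count_space V)"
    by (rule nn_integral_cong) (simp add: emeasure_eq_measure eq[OF D] ennreal_mult)
  also have "\<dots> = (\<integral>\<^sup>+b. emeasure M {x \<in> space M. X x = b} \<partial>count_space V) * emeasure M ?Z"
    by (rule nn_integral_multc) simp
  finally show ?thesis unfolding 1[symmetric] by (simp add: emeasure_eq_measure ennreal_mult[symmetric])
qed

lemma (in prob_space) indep_countable_fun:
  fixes X :: "'a \<Rightarrow> 'b::countable" and g :: "'b \<Rightarrow> real" and h :: "'c \<Rightarrow> real"
  assumes X: "X \<in> measurable M (count_space UNIV)" and Z: "Z \<in> measurable M N" and h: "h \<in> borel_measurable N"
    and eq: "\<And>b D. D \<in> sets N \<Longrightarrow> prob {x \<in> space M. X x = b \<and> Z x \<in> D} = prob {x \<in> space M. X x = b} * prob {x \<in> space M. Z x \<in> D}"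
  shows "indep_var borel (\<lambda>x. g (X x)) borel (\<lambda>x. h (Z x))"
proof (subst indep_var_distribution_eq, intro conjI)
  show gX: "random_variable borel (\<lambda>x. g (X x))" by (rule measurable_compose[OF X]) simp
  show hZ: "random_variable borel (\<lambda>x. h (Z x))" by (rule measurable_compose[OF Z h])
  interpret PX: prob_space "distr M borel (\<lambda>x. g (X x))" by (rule prob_space_distr[OF gX])
  interpret PZ: prob_space "distr M borel (\<lambda>x. h (Z x))" by (rule prob_space_distr[OF hZ])
  have XZ: "(\<lambda>x. (g (X x), h (Z x))) \<in> measurable M (borel \<Otimes>\<^sub>M borel)" using gX hZ by simp
  show "distr M borel (\<lambda>x. g (X x)) \<Otimes>\<^sub>M distr M borel (\<lambda>x. h (Z x)) = distr M (borel \<Otimes>\<^sub>M borel) (\<lambda>x. (g (X x), h (Z x)))"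
  proof (rule pair_measure_eqI[OF PX.sigma_finite_measure_axioms PZ.sigma_finite_measure_axioms])
    fix V D assume "V \<in> sets (distr M borel (\<lambda>x. g (X x)))" "D \<in> sets (distr M borel (\<lambda>x. h (Z x)))"
    then have V: "V \<in> sets borel" and D: "D \<in> sets borel" by auto
    have hD: "h -` D \<inter> space N \<in> sets N" using measurable_sets[OF h D] .
    have sp: "Z x \<in> space N" if "x \<in> space M" for x using measurable_space[OF Z that] .
    have "emeasure (distr M (borel \<Otimes>\<^sub>M borel) (\<lambda>x. (g (X x), h (Z x)))) (V \<times> D) = emeasure M {x \<in> space M. X x \<in> g -` V \<and> Z x \<in> h -` D \<inter> space N}"
      using XZ V D sp by (subst emeasure_distr) (auto intro!: arg_cong[where f="emeasure M"])
    also have "\<dots> = emeasure M {x \<in> space M. X x \<in> g -` V} * emeasure M {x \<in> space M. Z x \<in> h -` D \<inter> space N}"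
      using indep_countable_prod[OF X Z eq hD, of "g -` V"] by (simp add: emeasure_eq_measure ennreal_mult[symmetric])
    also have "{x \<in> space M. X x \<in> g -` V} = (\<lambda>x. g (X x)) -` V \<inter> space M" by auto
    also have "{x \<in> space M. Z x \<in> h -` D \<inter> space N} = (\<lambda>x. h (Z x)) -` D \<inter> space M" using sp by auto
    finally show "emeasure (distr M borel (\<lambda>x. g (X x))) V * emeasure (distr M borel (\<lambda>x. h (Z x))) D = emeasure (distr M (borel \<Otimes>\<^sub>M borel) (\<lambda>x. (g (X x), h (Z x)))) (V \<times> D)"
      using gX hZ V D by (simp add: emeasure_distr)
  qed simp
qed

lemma card_nat_between: "finite {j::nat. a \<le> real j \<and> real j \<le> b} \<and> (a \<le> b \<longrightarrow> real (card {j::nat. a \<le> real j \<and> real j \<le> b}) \<le> b - a + 1)"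
proof (intro conjI impI)
  let ?J = "{j::nat. a \<le> real j \<and> real j \<le> b}"
  have sub: "?J \<subseteq> {..nat \<lfloor>b\<rfloor>}" by (auto simp: le_nat_floor)
  then show fin: "finite ?J" by (rule finite_subset) simp
  assume ab: "a \<le> b"
  show "real (card ?J) \<le> b - a + 1"
  proof (cases "?J = {}")
    case False
    let ?l = "Min ?J" and ?u = "Max ?J"
    have lu: "?l \<in> ?J" "?u \<in> ?J" using False fin by (auto intro: Min_in Max_in simp del: mem_Collect_eq)
    have le: "?l \<le> ?u" using Min_le[OF fin lu(2)] .
    have "?J \<subseteq> {?l..?u}" using fin by auto
    then have "card ?J \<le> card {?l..?u}" by (rule card_mono[rotated]) simp
    then have "real (card ?J) \<le> real ?u - real ?l + 1" using le by simp
    then show ?thesis using lu by auto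
  next
    case True
    show ?thesis unfolding True using ab by simp
  qed
qed

text \<open>\<open>renew\<close> says at once that the remainder \<open>nxt x\<close> has the law
  \<open>M\<close> again and that it is independent of the first segment. As segments form a
  countable type, single values suffice.\<close>

locale renewal = prob_space M for M :: "'a measure" +
  fixes seg :: "'a \<Rightarrow> 'b::countable" and nxt :: "'a \<Rightarrow> 'a"
  assumes seg_measurable: "seg \<in> measurable M (count_space UNIV)"
    and nxt_measurable: "nxt \<in> measurable M M"
    and renew: "\<And>b D. D \<in> sets M \<Longrightarrow> prob {x \<in> space M. seg x = b \<and> nxt x \<in> D} = prob {x \<in> space M. seg x = b} * prob D"
begin

lemma iter_measurable: "(nxt ^^ n) \<in> measurable M M"
proof (induction n)
  case (Suc n)
  then show ?case using measurable_compose[OF Suc nxt_measurable] by (simp add: comp_def)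
qed simp

lemma seg_sets: "{x \<in> space M. seg x = b} \<in> sets M"
  using measurable_sets[OF seg_measurable, of "{b}"] by (simp add: vimage_def Int_def conj_commute)

lemma prob_nxt: assumes D: "D \<in> sets M" shows "prob {x \<in> space M. nxt x \<in> D} = prob D"
proof -
  have m: "{x \<in> space M. seg x = b \<and> nxt x \<in> D} \<in> sets M" for b
  proof -
    have "{x \<in> space M. seg x = b \<and> nxt x \<in> D} = {x \<in> space M. seg x = b} \<inter> (nxt -` D \<inter> space M)" by auto
    then show ?thesis using seg_sets measurable_sets[OF nxt_measurable D] by auto
  qed
  have "emeasure M {x \<in> space M. nxt x \<in> D} = emeasure M (\<Union>b\<in>UNIV. {x \<in> space M. seg x = b \<and> nxt x \<in> D})"
    by (rule arg_cong[where f="emeasure M"]) auto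
  also have "\<dots> = (\<integral>\<^sup>+b. emeasure M {x \<in> space M. seg x = b \<and> nxt x \<in> D} \<partial>count_space UNIV)"
    by (rule emeasure_UN_countable) (use m in \<open>auto simp: disjoint_family_on_def\<close>)
  also have "\<dots> = (\<integral>\<^sup>+b. emeasure M {x \<in> space M. seg x = b} * emeasure M D \<partial>count_space UNIV)"
    by (rule nn_integral_cong) (simp add: emeasure_eq_measure renew[OF D] ennreal_mult)
  also have "\<dots> = (\<integral>\<^sup>+b. emeasure M {x \<in> space M. seg x = b} \<partial>count_space UNIV) * emeasure M D"
    by (rule nn_integral_multc) simp
  also have "(\<integral>\<^sup>+b. emeasure M {x \<in> space M. seg x = b} \<partial>count_space UNIV) = emeasure M (\<Union>b\<in>UNIV. {x \<in> space M. seg x = b})"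
    by (rule emeasure_UN_countable[symmetric]) (use seg_sets in \<open>auto simp: disjoint_family_on_def\<close>)
  also have "(\<Union>b\<in>UNIV. {x \<in> space M. seg x = b}) = space M" by auto
  finally show ?thesis by (simp add: emeasure_eq_measure prob_space)
qed

lemma prob_iter: "D \<in> sets M \<Longrightarrow> prob {x \<in> space M. (nxt ^^ n) x \<in> D} = prob D"
proof (induction n arbitrary: D)
  case 0
  then show ?case using sets.sets_into_space by (auto intro!: arg_cong[where f=prob])
next
  case (Suc n)
  have m: "nxt -` D \<inter> space M \<in> sets M" using measurable_sets[OF nxt_measurable Suc.prems] .
  have "{x \<in> space M. (nxt ^^ Suc n) x \<in> D} = {x \<in> space M. (nxt ^^ n) x \<in> nxt -` D \<inter> space M}"
    using measurable_space[OF iter_measurable[of n]] by auto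
  then have "prob {x \<in> space M. (nxt ^^ Suc n) x \<in> D} = prob (nxt -` D \<inter> space M)" using Suc.IH[OF m] by simp
  also have "nxt -` D \<inter> space M = {x \<in> space M. nxt x \<in> D}" by auto
  finally show ?case using prob_nxt[OF Suc.prems] by simp
qed

lemma distr_iter: "distr M M (nxt ^^ n) = M"
proof (rule measure_eqI)
  fix D assume "D \<in> sets (distr M M (nxt ^^ n))"
  then have D: "D \<in> sets M" by simp
  have "emeasure (distr M M (nxt ^^ n)) D = emeasure M ((nxt ^^ n) -` D \<inter> space M)"
    by (rule emeasure_distr[OF iter_measurable D])
  also have "(nxt ^^ n) -` D \<inter> space M = {x \<in> space M. (nxt ^^ n) x \<in> D}" by auto
  finally show "emeasure (distr M M (nxt ^^ n)) D = emeasure M D"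
    using prob_iter[OF D, of n] by (simp add: emeasure_eq_measure)
qed simp

definition segn :: "nat \<Rightarrow> 'a \<Rightarrow> 'b" where
  "segn j x = seg ((nxt ^^ j) x)"

definition segs :: "nat \<Rightarrow> 'a \<Rightarrow> 'b list" where
  "segs n x = map (\<lambda>j. segn j x) [0..<n]"

lemma segn_measurable [measurable]: "segn j \<in> measurable M (count_space UNIV)"
  unfolding segn_def by (rule measurable_compose[OF iter_measurable seg_measurable])

lemma segs_Suc: "segs (Suc n) x = segs n x @ [segn n x]"
  by (simp add: segs_def)

lemma segs_measurable [measurable]: "segs n \<in> measurable M (count_space UNIV)"
proof (induction n)
  case 0
  then show ?case by (simp add: segs_def)
next
  case (Suc n)
  have "(\<lambda>x. segs n x @ [segn n x]) \<in> measurable M (count_space UNIV)"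
    by (rule measurable_compose_countable[OF _ Suc], rule measurable_compose[OF segn_measurable]) simp
  then show ?case by (simp add: segs_Suc)
qed

lemma segs_renew:
  "D \<in> sets M \<Longrightarrow> prob {x \<in> space M. segs n x = bs \<and> (nxt ^^ n) x \<in> D} = prob {x \<in> space M. segs n x = bs} * prob D"
proof (induction n arbitrary: bs D)
  case 0
  show ?case
  proof (cases "bs = []")
    case True
    have "{x \<in> space M. x \<in> D} = D" using sets.sets_into_space[OF 0] by auto
    then show ?thesis using True by (simp add: segs_def prob_space)
  qed (simp add: segs_def)
next
  case (Suc n)
  show ?case
  proof (cases bs rule: rev_cases)
    case Nil
    then show ?thesis by (simp add: segs_Suc)
  next
    case (snoc cs b)
    have m: "{x \<in> space M. seg x = b \<and> nxt x \<in> D'} \<in> sets M" if "D' \<in> sets M" for D'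
    proof -
      have "{x \<in> space M. seg x = b \<and> nxt x \<in> D'} = {x \<in> space M. seg x = b} \<inter> (nxt -` D' \<inter> space M)" by auto
      then show ?thesis using seg_sets measurable_sets[OF nxt_measurable that] by auto
    qed
    have e: "{x \<in> space M. segs (Suc n) x = bs \<and> (nxt ^^ Suc n) x \<in> D'} = {x \<in> space M. segs n x = cs \<and> (nxt ^^ n) x \<in> {x \<in> space M. seg x = b \<and> nxt x \<in> D'}}" for D'
      using measurable_space[OF iter_measurable[of n]] by (auto simp: snoc segs_Suc segn_def)
    have gen: "prob {x \<in> space M. segs (Suc n) x = bs \<and> (nxt ^^ Suc n) x \<in> D'} = prob {x \<in> space M. segs n x = cs} * (prob {x \<in> space M. seg x = b} * prob D')" if "D' \<in> sets M" for D'
      unfolding e Suc.IH[OF m[OF that]] renew[OF that] ..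
    have "{x \<in> space M. segs (Suc n) x = bs} = {x \<in> space M. segs (Suc n) x = bs \<and> (nxt ^^ Suc n) x \<in> space M}"
      using measurable_space[OF iter_measurable[of "Suc n"]] by auto
    then have "prob {x \<in> space M. segs (Suc n) x = bs} = prob {x \<in> space M. segs n x = cs} * prob {x \<in> space M. seg x = b}"
      using gen[OF sets.top] by (simp add: prob_space)
    then show ?thesis using gen[OF Suc.prems] by simp
  qed
qed

lemma segs_indep:
  "D \<in> sets M \<Longrightarrow> prob {x \<in> space M. segs n x = b \<and> (nxt ^^ n) x \<in> D} = prob {x \<in> space M. segs n x = b} * prob {x \<in> space M. (nxt ^^ n) x \<in> D}"
  by (simp add: segs_renew prob_iter)

lemma prob_segn: "prob {x \<in> space M. segn j x \<in> V} = prob {x \<in> space M. seg x \<in> V}"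
proof -
  have m: "{x \<in> space M. seg x \<in> V} \<in> sets M"
    using measurable_sets[OF seg_measurable, of V] by (simp add: vimage_def Int_def conj_commute)
  have "{x \<in> space M. segn j x \<in> V} = {x \<in> space M. (nxt ^^ j) x \<in> {x \<in> space M. seg x \<in> V}}"
    using measurable_space[OF iter_measurable[of j]] by (auto simp: segn_def)
  then show ?thesis using prob_iter[OF m, of j] by simp
qed

lemma prob_segn_all: "prob {x \<in> space M. \<forall>j<n. segn j x \<in> V j} = (\<Prod>j<n. prob {x \<in> space M. seg x \<in> V j})"
proof (induction n)
  case 0
  then show ?case by (simp add: prob_space)
next
  case (Suc n)
  let ?P = "{bs. \<forall>j<n. bs ! j \<in> V j}"
  let ?D = "{x \<in> space M. seg x \<in> V n}"
  have D: "?D \<in> sets M"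
    using measurable_sets[OF seg_measurable, of "V n"] by (simp add: vimage_def Int_def conj_commute)
  have nth: "segs n x ! j = segn j x" if "j < n" for j x using that by (simp add: segs_def)
  have "{x \<in> space M. \<forall>j<Suc n. segn j x \<in> V j} = {x \<in> space M. segs n x \<in> ?P \<and> (nxt ^^ n) x \<in> ?D}"
    using nth measurable_space[OF iter_measurable[of n]] by (auto simp: less_Suc_eq segn_def)
  also have "prob \<dots> = prob {x \<in> space M. segs n x \<in> ?P} * prob {x \<in> space M. (nxt ^^ n) x \<in> ?D}"
    by (rule indep_countable_prod[OF segs_measurable iter_measurable segs_indep D])
  also have "{x \<in> space M. segs n x \<in> ?P} = {x \<in> space M. \<forall>j<n. segn j x \<in> V j}" using nth by auto
  also have "prob {x \<in> space M. (nxt ^^ n) x \<in> ?D} = prob ?D" by (rule prob_iter[OF D])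
  finally show ?case using Suc by simp
qed

lemma indep_segn: "indep_vars (\<lambda>_. count_space UNIV) segn UNIV"
  unfolding indep_vars_def2
proof (intro conjI ballI segn_measurable indep_setsI)
  fix J :: "nat set" and V assume J: "J \<noteq> {}" "finite J" and V: "\<forall>j\<in>J. V j \<in> {segn j -` A \<inter> space M |A. A \<in> sets (count_space UNIV)}"
  then have "\<forall>j\<in>J. \<exists>A. V j = segn j -` A \<inter> space M" by auto
  then obtain A where A: "\<And>j. j \<in> J \<Longrightarrow> V j = segn j -` A j \<inter> space M" by metis
  \<comment> \<open>Indices outside of \<open>J\<close> get the trivial condition
    \<open>UNIV\<close>, which reduces the claim to an initial interval of indices.\<close>
  define A' where "A' j = (if j \<in> J then A j else UNIV)" for j
  define n where "n = Suc (Max J)"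
  have n: "j < n" if "j \<in> J" for j using that J by (simp add: n_def le_imp_less_Suc)
  have "(\<Inter>j\<in>J. V j) = {x \<in> space M. \<forall>j<n. segn j x \<in> A' j}"
    using A J(1) n by (auto simp: A'_def)
  then have "prob (\<Inter>j\<in>J. V j) = (\<Prod>j<n. prob {x \<in> space M. seg x \<in> A' j})" by (simp add: prob_segn_all)
  also have "\<dots> = (\<Prod>j\<in>J. prob {x \<in> space M. seg x \<in> A' j})"
    by (rule prod.mono_neutral_right) (use n in \<open>auto simp: A'_def prob_space\<close>)
  also have "\<dots> = (\<Prod>j\<in>J. prob (V j))"
  proof (rule prod.cong[OF refl])
    fix j assume j: "j \<in> J"
    have "V j = {x \<in> space M. segn j x \<in> A' j}" using A[OF j] j by (auto simp: A'_def)
    then show "prob {x \<in> space M. seg x \<in> A' j} = prob (V j)" by (simp add: prob_segn)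
  qed
  finally show "prob (\<Inter>j\<in>J. V j) = (\<Prod>j\<in>J. prob (V j))" .
qed (use measurable_sets[OF segn_measurable] in auto)

lemma seg_fun_measurable [measurable]: "(\<lambda>x. f (seg x) :: real) \<in> borel_measurable M"
  by (rule measurable_compose[OF seg_measurable]) simp

lemma segn_fun_measurable [measurable]: "(\<lambda>x. f (segn j x) :: real) \<in> borel_measurable M"
  by (rule measurable_compose[OF segn_measurable]) simp

lemma segs_fun_measurable [measurable]: "(\<lambda>x. f (segs j x) :: real) \<in> borel_measurable M"
  by (rule measurable_compose[OF segs_measurable]) simp

lemma integral_segn: "(\<integral>x. f (segn j x) \<partial>M) = (\<integral>x. (f (seg x) :: real) \<partial>M)"
proof -
  have "(\<integral>x. f (seg x) \<partial>M) = (\<integral>x. f (seg x) \<partial>distr M M (nxt ^^ j))" by (simp add: distr_iter)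
  also have "\<dots> = (\<integral>x. f (segn j x) \<partial>M)"
    unfolding segn_def by (rule integral_distr[OF iter_measurable seg_fun_measurable])
  finally show ?thesis by simp
qed

lemma integrable_segn: "integrable M (\<lambda>x. f (seg x) :: real) \<Longrightarrow> integrable M (\<lambda>x. f (segn j x))"
  unfolding segn_def using integrable_distr[OF iter_measurable, of j "\<lambda>x. f (seg x)"] by (simp add: distr_iter)

lemma distr_segn: "distr M borel (\<lambda>x. f (segn j x) :: real) = distr M borel (\<lambda>x. f (seg x))"
proof -
  have "distr M borel (\<lambda>x. f (seg x)) = distr (distr M M (nxt ^^ j)) borel (\<lambda>x. f (seg x))" by (simp add: distr_iter)
  also have "\<dots> = distr M borel (\<lambda>x. f (segn j x))"
    by (subst distr_distr[OF seg_fun_measurable iter_measurable]) (simp add: comp_def segn_def)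
  finally show ?thesis by simp
qed

text \<open>Segment \<open>n\<close> is the first segment of the remainder after \<open>n\<close>
  segments, and that remainder is independent of them.\<close>

lemma predictable_product:
  assumes g: "integrable M (\<lambda>x. g (segs n x) :: real)" and f: "integrable M (\<lambda>x. f (seg x) :: real)"
  shows "(\<integral>x. g (segs n x) * f (segn n x) \<partial>M) = (\<integral>x. g (segs n x) \<partial>M) * (\<integral>x. f (seg x) \<partial>M)"
    and "integrable M (\<lambda>x. g (segs n x) * f (segn n x))"
proof -
  have i: "indep_var borel (\<lambda>x. g (segs n x)) borel (\<lambda>x. f (segn n x))"
    unfolding segn_def by (rule indep_countable_fun[OF segs_measurable iter_measurable seg_fun_measurable segs_indep])
  show "(\<integral>x. g (segs n x) * f (segn n x) \<partial>M) = (\<integral>x. g (segs n x) \<partial>M) * (\<integral>x. f (seg x) \<partial>M)"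
    using indep_var_lebesgue_integral[OF i g integrable_segn[OF f]] by (simp add: integral_segn)
  show "integrable M (\<lambda>x. g (segs n x) * f (segn n x))"
    by (rule indep_var_integrable[OF i g integrable_segn[OF f]])
qed

text \<open>The increments are orthogonal, because \<open>c j\<close> only depends on the segments before the \<open>j\<close>-th.\<close>

lemma predictable_square:
  fixes c :: "nat \<Rightarrow> 'b list \<Rightarrow> real" and f :: "'b \<Rightarrow> real"
  assumes c: "\<And>j bs. \<bar>c j bs\<bar> \<le> 1" and f: "integrable M (\<lambda>x. f (seg x))" "integrable M (\<lambda>x. (f (seg x))\<^sup>2)" "(\<integral>x. f (seg x) \<partial>M) = 0"
  shows "integrable M (\<lambda>x. (\<Sum>j<n. c j (segs j x) * f (segn j x))\<^sup>2) \<and>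
    (\<integral>x. (\<Sum>j<n. c j (segs j x) * f (segn j x))\<^sup>2 \<partial>M) = (\<integral>x. (f (seg x))\<^sup>2 \<partial>M) * (\<Sum>j<n. \<integral>x. (c j (segs j x))\<^sup>2 \<partial>M)"
proof (induction n)
  case 0
  then show ?case by simp
next
  case (Suc n)
  define G where "G bs = (\<Sum>j<n. c j (take j bs) * f (bs ! j))" for bs
  have G: "(\<Sum>j<n. c j (segs j x) * f (segn j x)) = G (segs n x)" for x
    unfolding G_def by (rule sum.cong) (auto simp: segs_def take_map)
  have G2: "integrable M (\<lambda>x. (G (segs n x))\<^sup>2)" using Suc G by simp
  have Gi: "integrable M (\<lambda>x. G (segs n x))" by (rule square_integrable_imp_integrable[OF _ G2]) simp
  have cb: "(c n bs)\<^sup>2 \<le> 1" for bs using c[of n bs] abs_square_le_1 by auto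
  have ci: "integrable M (\<lambda>x. (c n (segs n x))\<^sup>2)"
    by (rule integrable_const_bound[where B=1]) (use cb in \<open>auto intro: segs_fun_measurable[of "\<lambda>bs. (c n bs)\<^sup>2"]\<close>)
  have gc: "integrable M (\<lambda>x. 2 * G (segs n x) * c n (segs n x))"
  proof (rule Bochner_Integration.integrable_bound[OF integrable_mult_right[OF Gi, of 2]])
    show "AE x in M. norm (2 * G (segs n x) * c n (segs n x)) \<le> norm (2 * G (segs n x))"
      using c by (intro AE_I2) (simp add: abs_mult mult_left_le)
  qed (rule segs_fun_measurable[of "\<lambda>bs. 2 * G bs * c n bs"])
  have sq: "(\<Sum>j<Suc n. c j (segs j x) * f (segn j x))\<^sup>2 = (G (segs n x))\<^sup>2 + (2 * G (segs n x) * c n (segs n x)) * f (segn n x) + (c n (segs n x))\<^sup>2 * (f (segn n x))\<^sup>2" for x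
    unfolding sum.lessThan_Suc G by (simp add: power2_sum power_mult_distrib mult_ac)
  note p1 = predictable_product[of "\<lambda>bs. 2 * G bs * c n bs" n f, OF gc f(1)]
  note p2 = predictable_product[of "\<lambda>bs. (c n bs)\<^sup>2" n "\<lambda>b. (f b)\<^sup>2", OF ci f(2)]
  have "(\<integral>x. (\<Sum>j<Suc n. c j (segs j x) * f (segn j x))\<^sup>2 \<partial>M) = (\<integral>x. (G (segs n x))\<^sup>2 \<partial>M) + 0 + (\<integral>x. (c n (segs n x))\<^sup>2 \<partial>M) * (\<integral>x. (f (seg x))\<^sup>2 \<partial>M)"
    unfolding sq using G2 p1 p2 f(3) by simp
  moreover have "integrable M (\<lambda>x. (\<Sum>j<Suc n. c j (segs j x) * f (segn j x))\<^sup>2)"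
    unfolding sq using G2 p1 p2 by simp
  moreover have "(\<integral>x. (G (segs n x))\<^sup>2 \<partial>M) = (\<integral>x. (f (seg x))\<^sup>2 \<partial>M) * (\<Sum>j<n. \<integral>x. (c j (segs j x))\<^sup>2 \<partial>M)"
    using Suc G by simp
  ultimately show ?case by (simp add: algebra_simps)
qed

text \<open>Chebyshev's inequality; the variance of the sum is \<open>predictable_square\<close>
  with all coefficients 1.\<close>

lemma weak_law:
  assumes f: "integrable M (\<lambda>x. f (seg x))" "integrable M (\<lambda>x. (f (seg x))\<^sup>2)" and d: "0 < d"
  shows "prob {x \<in> space M. d \<le> \<bar>(\<Sum>j<n. f (segn j x)) - real n * (\<integral>x. f (seg x) \<partial>M)\<bar>} \<le> real n * variance (\<lambda>x. f (seg x)) / d\<^sup>2"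
proof -
  let ?m = "\<integral>x. f (seg x) \<partial>M"
  let ?g = "\<lambda>b. f b - ?m"
  have g: "integrable M (\<lambda>x. ?g (seg x))" "(\<integral>x. ?g (seg x) \<partial>M) = 0" using f by (auto simp: prob_space)
  have g2: "integrable M (\<lambda>x. (?g (seg x))\<^sup>2)"
    using f by (simp add: power2_diff)
  have ps: "integrable M (\<lambda>x. (\<Sum>j<n. (1::real) * ?g (segn j x))\<^sup>2) \<and> (\<integral>x. (\<Sum>j<n. 1 * ?g (segn j x))\<^sup>2 \<partial>M) = (\<integral>x. (?g (seg x))\<^sup>2 \<partial>M) * (\<Sum>j<n. \<integral>x. 1\<^sup>2 \<partial>M)"
    by (rule predictable_square[of "\<lambda>_ _. 1", OF _ g(1) g2 g(2)]) simp
  have e: "(\<Sum>j<n. f (segn j x)) - real n * ?m = (\<Sum>j<n. ?g (segn j x))" for x by (simp add: sum_subtractf)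
  have m: "(\<lambda>x. \<Sum>j<n. ?g (segn j x)) \<in> borel_measurable M" by measurable
  have "prob {x \<in> space M. d\<^sup>2 \<le> (\<Sum>j<n. ?g (segn j x))\<^sup>2} \<le> (\<integral>x. (\<Sum>j<n. ?g (segn j x))\<^sup>2 \<partial>M) / d\<^sup>2"
    by (rule integral_Markov_inequality_measure[where A="{}", of _ _ , simplified]) (use ps d in auto)
  moreover have "{x \<in> space M. d\<^sup>2 \<le> (\<Sum>j<n. ?g (segn j x))\<^sup>2} = {x \<in> space M. d \<le> \<bar>(\<Sum>j<n. f (segn j x)) - real n * ?m\<bar>}"
    unfolding e using d abs_le_square_iff[of d] by auto
  ultimately show ?thesis using ps by (simp add: prob_space mult.commute)
qed

end

lemma asymp_div: "0 < m \<Longrightarrow> filterlim (\<lambda>n. real n / m) at_top sequentially"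
  by real_asymp

lemma asymp_sub: "(\<lambda>n. c - 1 / real n) \<longlonglongrightarrow> c"
  by real_asymp

lemma asymp_powr: "eventually (\<lambda>n. c \<le> real n powr (3/4)) sequentially"
  by real_asymp

text \<open>The window has half-width \<open>n powr (3/4)\<close>: negligible against
  \<open>n\<close>, as the first summand requires, and large against \<open>sqrt n\<close>, as the
  Chebyshev term requires.\<close>

lemma asymp_window:
  "0 < \<eta> \<Longrightarrow> (\<lambda>n. w * ((2 * real n powr (3/4) + 1) + (real n + 1) * (real n * s / (real n powr (3/4))\<^sup>2)) / (\<eta>\<^sup>2 * real n)) \<longlonglongrightarrow> 0"
  by real_asymp

locale renewal_reward = renewal M seg nxt for M :: "'a measure" and seg :: "'a \<Rightarrow> 'b::countable" and nxt +
  fixes T :: "'b \<Rightarrow> nat" and Y :: "'b \<Rightarrow> real" and K C :: real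
  assumes T_pos: "\<And>b. 1 \<le> T b"
    and T_tail: "\<And>n. 0 < n \<Longrightarrow> prob {x \<in> space M. n < T (seg x)} \<le> C / real n ^ 4" and C_pos: "0 < C"
    and Y_le: "\<And>b. \<bar>Y b\<bar> \<le> K * real (T b)"
begin

lemma T_square_sum: "(real t)\<^sup>2 = (\<Sum>n<t. 2 * real n + 1)"
  by (induction t) (auto simp: power2_eq_square algebra_simps)

text \<open>The square \<open>t ^ 2\<close> is the sum of \<open>2 * n + 1\<close> over
  \<open>n < t\<close>, so the second moment is a sum of tails with these weights; its terms are of
  order \<open>1 / n ^ 3\<close>.\<close>

lemma T_sq: "integrable M (\<lambda>x. (real (T (seg x)))\<^sup>2)"
proof (rule integrableI_nonneg)
  let ?C = "32 * (C + 1)"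
  let ?I = "\<lambda>n x. ennreal ((2 * real n + 1) * indicator {x \<in> space M. n < T (seg x)} x)"
  have Tm: "{x \<in> space M. n < T (seg x)} \<in> sets M" for n
    using measurable_sets[OF seg_measurable, of "{b. n < T b}"] by (simp add: vimage_def Int_def conj_commute)
  have "ennreal ((real (T (seg x)))\<^sup>2) = (\<Sum>n. ?I n x)" if x: "x \<in> space M" for x
  proof -
    have "(\<Sum>n. ?I n x) = (\<Sum>n<T (seg x). ?I n x)"
      by (rule suminf_finite) (auto simp: indicator_def)
    also have "\<dots> = (\<Sum>n<T (seg x). ennreal (2 * real n + 1))"
      by (rule sum.cong) (use x in \<open>auto simp: indicator_def\<close>)
    also have "\<dots> = ennreal (\<Sum>n<T (seg x). 2 * real n + 1)" by (rule sum_ennreal) simp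
    finally show ?thesis unfolding T_square_sum by simp
  qed
  then have "(\<integral>\<^sup>+x. ennreal ((real (T (seg x)))\<^sup>2) \<partial>M) = (\<integral>\<^sup>+x. (\<Sum>n. ?I n x) \<partial>M)"
    by (rule nn_integral_cong)
  also have "\<dots> = (\<Sum>n. \<integral>\<^sup>+x. ?I n x \<partial>M)"
    by (rule nn_integral_suminf) (use Tm in auto)
  also have "\<dots> = (\<Sum>n. ennreal ((2 * real n + 1) * prob {x \<in> space M. n < T (seg x)}))"
  proof (rule arg_cong[where f=suminf], rule ext)
    fix n
    have "(\<integral>\<^sup>+x. ?I n x \<partial>M) = (\<integral>\<^sup>+x. ennreal (2 * real n + 1) * indicator {x \<in> space M. n < T (seg x)} x \<partial>M)"
      by (rule nn_integral_cong) (auto simp: indicator_def)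
    also have "\<dots> = ennreal (2 * real n + 1) * emeasure M {x \<in> space M. n < T (seg x)}"
      using Tm by (rule nn_integral_cmult_indicator)
    finally show "(\<integral>\<^sup>+x. ?I n x \<partial>M) = ennreal ((2 * real n + 1) * prob {x \<in> space M. n < T (seg x)})"
      by (simp add: emeasure_eq_measure ennreal_mult)
  qed
  also have "\<dots> \<le> (\<Sum>n. ennreal (?C * inverse (real (n + 1) ^ 3)))"
  proof (rule suminf_le)
    fix n
    have "(2 * real n + 1) * prob {x \<in> space M. n < T (seg x)} \<le> ?C * inverse (real (n + 1) ^ 3)"
    proof (cases "n = 0")
      case True
      have "(2 * real n + 1) * prob {x \<in> space M. n < T (seg x)} \<le> 1 * 1" using True by (intro mult_mono) auto
      also have "\<dots> \<le> ?C * inverse (real (n + 1) ^ 3)" using True C_pos by simp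
      finally show ?thesis .
    next
      case False
      then have n: "0 < n" by simp
      have "real (n + 1) ^ 4 \<le> (2 * real n) ^ 4" using n by (intro power_mono) auto
      then have "C / real n ^ 4 \<le> 16 * C / real (n + 1) ^ 4"
        using C_pos n by (simp add: power_mult_distrib divide_simps)
      then have "prob {x \<in> space M. n < T (seg x)} \<le> 16 * C / real (n + 1) ^ 4" using T_tail[OF n] by simp
      then have "(2 * real n + 1) * prob {x \<in> space M. n < T (seg x)} \<le> (2 * real (n + 1)) * (16 * C / real (n + 1) ^ 4)"
        using C_pos by (intro mult_mono) auto
      also have "\<dots> = 32 * C * inverse (real (n + 1) ^ 3)" by (simp add: divide_simps power_numeral_reduce)
      also have "\<dots> \<le> ?C * inverse (real (n + 1) ^ 3)" by (intro mult_right_mono) auto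
      finally show ?thesis .
    qed
    then show "ennreal ((2 * real n + 1) * prob {x \<in> space M. n < T (seg x)}) \<le> ennreal (?C * inverse (real (n + 1) ^ 3))"
      by (rule ennreal_leI)
  qed auto
  also have "\<dots> < \<infinity>"
  proof -
    have "summable (\<lambda>n. inverse (real n ^ 3))" by (rule inverse_power_summable) simp
    then have "summable (\<lambda>n. inverse (real (n + 1) ^ 3))" by (subst (asm) summable_Suc_iff[symmetric]) simp
    then have "summable (\<lambda>n. ?C * inverse (real (n + 1) ^ 3))" by (rule summable_mult)
    then have "(\<Sum>n. ennreal (?C * inverse (real (n + 1) ^ 3))) = ennreal (\<Sum>n. ?C * inverse (real (n + 1) ^ 3))"
      using C_pos by (intro suminf_ennreal2) auto
    then show ?thesis by simp
  qed
  finally show "(\<integral>\<^sup>+x. ennreal ((real (T (seg x)))\<^sup>2) \<partial>M) < \<infinity>" .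
qed auto

lemma T_int: "integrable M (\<lambda>x. real (T (seg x)))"
  by (rule square_integrable_imp_integrable[OF _ T_sq]) simp

lemma Y_sq: "integrable M (\<lambda>x. (Y (seg x))\<^sup>2)"
proof (rule Bochner_Integration.integrable_bound[OF integrable_mult_right[OF T_sq, of "K\<^sup>2"]])
  show "AE x in M. norm ((Y (seg x))\<^sup>2) \<le> norm (K\<^sup>2 * (real (T (seg x)))\<^sup>2)"
  proof (rule AE_I2)
    fix x
    have "\<bar>Y (seg x)\<bar>\<^sup>2 \<le> (K * real (T (seg x)))\<^sup>2" by (rule power_mono[OF Y_le]) simp
    then show "norm ((Y (seg x))\<^sup>2) \<le> norm (K\<^sup>2 * (real (T (seg x)))\<^sup>2)" by (simp add: power_mult_distrib)
  qed
qed (rule seg_fun_measurable)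

lemma Y_int: "integrable M (\<lambda>x. Y (seg x))"
  by (rule square_integrable_imp_integrable[OF _ Y_sq]) simp

definition mT :: real where "mT = (\<integral>x. real (T (seg x)) \<partial>M)"
definition vY :: real where "vY = (\<integral>x. (Y (seg x))\<^sup>2 \<partial>M)"

lemma mT_ge: "1 \<le> mT"
proof -
  have "(\<integral>x. 1 \<partial>M) \<le> mT" unfolding mT_def
    by (rule integral_mono[OF _ T_int]) (use T_pos in \<open>auto simp: Suc_le_eq less_imp_le\<close>)
  then show ?thesis by (simp add: prob_space)
qed

definition rho :: "nat \<Rightarrow> 'a \<Rightarrow> nat" where "rho k x = (\<Sum>j<k. T (segn j x))"
definition W :: "nat \<Rightarrow> 'a \<Rightarrow> real" where "W k x = (\<Sum>j<k. Y (segn j x))"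

text \<open>\<open>N n\<close> is the index of the first renewal strictly after time \<open>n\<close>.\<close>

definition N :: "nat \<Rightarrow> 'a \<Rightarrow> nat" where "N n x = card {j. j \<le> n \<and> rho j x \<le> n}"

lemma rho_Suc: "rho (Suc k) x = rho k x + T (segn k x)" by (simp add: rho_def)

lemma rho_less: "rho k x < rho (Suc k) x" using T_pos[of "segn k x"] by (simp add: rho_Suc)

lemma rho_mono: "i \<le> j \<Longrightarrow> rho i x \<le> rho j x"
  by (rule lift_Suc_mono_le[of "\<lambda>k. rho k x"]) (rule less_imp_le[OF rho_less])

lemma rho_ge: "k \<le> rho k x"
proof (induction k)
  case (Suc k)
  then show ?case using rho_less[of k x] by simp
qed simp

lemma N_set: "{j. j \<le> n \<and> rho j x \<le> n} = {..<N n x}"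
proof -
  let ?A = "{j. j \<le> n \<and> rho j x \<le> n}"
  have fin: "finite ?A" by (rule finite_subset[of _ "{..n}"]) auto
  have "?A \<noteq> {}" by (auto simp: rho_def intro!: exI[of _ 0])
  then have M: "Max ?A \<in> ?A" using Max_in[OF fin] by blast
  have "?A = {..Max ?A}"
  proof (intro set_eqI iffI)
    fix j assume "j \<in> {..Max ?A}"
    then show "j \<in> ?A" using M rho_mono[of j "Max ?A" x] by auto
  next
    fix j assume "j \<in> ?A"
    then show "j \<in> {..Max ?A}" using Max_ge[OF fin] by simp
  qed
  then obtain u where u: "?A = {..<Suc u}" by (metis lessThan_Suc_atMost)
  then have "N n x = Suc u" unfolding N_def by (metis card_lessThan)
  then show ?thesis unfolding u by (rule arg_cong[where f=lessThan, symmetric])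
qed

lemma N_props: "1 \<le> N n x" "N n x \<le> Suc n" "rho (N n x - 1) x \<le> n" "n < rho (N n x) x"
proof -
  have "0 \<in> {j. j \<le> n \<and> rho j x \<le> n}" by (simp add: rho_def)
  then show N1: "1 \<le> N n x" unfolding N_set by auto
  have "{..<N n x} \<subseteq> {..n}" unfolding N_set[symmetric] by auto
  then have "card {..<N n x} \<le> card {..n}" by (rule card_mono[rotated]) simp
  then show "N n x \<le> Suc n" by simp
  have "N n x - 1 \<in> {..<N n x}" using N1 by simp
  then show "rho (N n x - 1) x \<le> n" unfolding N_set[symmetric] by simp
  have "N n x \<notin> {..<N n x}" by simp
  then have "\<not> (N n x \<le> n \<and> rho (N n x) x \<le> n)" unfolding N_set[symmetric] by simp
  then show "n < rho (N n x) x" using rho_ge[of "N n x" x] by auto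
qed

lemma rho_measurable [measurable]: "(\<lambda>x. real (rho k x)) \<in> borel_measurable M"
  unfolding rho_def of_nat_sum by measurable

lemma W_measurable [measurable]: "W k \<in> borel_measurable M"
  unfolding W_def[abs_def] by measurable

lemma N_measurable: "{x \<in> space M. N n x = k} \<in> sets M"
proof -
  have "N n x = k \<longleftrightarrow> (\<forall>j. (j \<le> n \<and> real (rho j x) \<le> real n) = (j < k))" for x
  proof
    assume "N n x = k"
    then show "\<forall>j. (j \<le> n \<and> real (rho j x) \<le> real n) = (j < k)" using N_set[of n x] by auto
  next
    assume "\<forall>j. (j \<le> n \<and> real (rho j x) \<le> real n) = (j < k)"
    then have "{..<N n x} = {..<k}" unfolding N_set[symmetric] by auto
    then show "N n x = k" by (metis card_lessThan)
  qed
  then have "{x \<in> space M. N n x = k} = {x \<in> space M. \<forall>j. (j \<le> n \<and> real (rho j x) \<le> real n) = (j < k)}" by simp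
  also have "\<dots> \<in> sets M" by measurable
  finally show ?thesis .
qed

lemma WN_measurable [measurable]: "(\<lambda>x. W (N n x) x) \<in> borel_measurable M"
proof -
  have "N n \<in> measurable M (count_space UNIV)"
    by (subst measurable_count_space_eq_countable) (use N_measurable[of n] in \<open>auto simp: vimage_def Int_def conj_commute\<close>)
  then show ?thesis by (rule measurable_compose_countable[rotated]) (rule W_measurable)
qed

text \<open>Union bound over \<open>n + 1\<close> segments: a tail of order 4 at the threshold
  \<open>\<eta> * sqrt n\<close> leaves a sum of order \<open>1 / n\<close>.\<close>

lemma max_T: "0 < \<eta> \<Longrightarrow> (\<lambda>n. prob {x \<in> space M. \<exists>j\<le>n. \<eta> * sqrt (real n) < real (T (segn j x))}) \<longlonglongrightarrow> 0"
proof -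
  assume eta: "0 < \<eta>"
  have m: "{x \<in> space M. \<eta> * sqrt (real n) < real (T (segn j x))} \<in> sets M" for j n by measurable
  have le: "prob {x \<in> space M. \<exists>j\<le>n. \<eta> * sqrt (real n) < real (T (segn j x))} \<le> (real n + 1) * (C / (\<eta> * sqrt (real n) - 1) ^ 4)"
    if n: "1 < \<eta> * sqrt (real n)" for n
  proof -
    \<comment> \<open>\<open>T_tail\<close> speaks of integers; rounding the threshold down costs
      the \<open>- 1\<close> in the bound.\<close>
    define k where "k = nat \<lfloor>\<eta> * sqrt (real n)\<rfloor>"
    have k: "0 < k" "real k \<le> \<eta> * sqrt (real n)" "\<eta> * sqrt (real n) - 1 \<le> real k"
      using n by (auto simp: k_def le_nat_iff)
    have "prob {x \<in> space M. \<exists>j\<le>n. \<eta> * sqrt (real n) < real (T (segn j x))} = prob (\<Union>j\<in>{..n}. {x \<in> space M. \<eta> * sqrt (real n) < real (T (segn j x))})"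
      by (rule arg_cong[where f=prob]) auto
    also have "\<dots> \<le> (\<Sum>j\<in>{..n}. prob {x \<in> space M. \<eta> * sqrt (real n) < real (T (segn j x))})"
      by (rule finite_measure_subadditive_finite) (use m in auto)
    also have "\<dots> \<le> (\<Sum>j\<in>{..n}. C / (\<eta> * sqrt (real n) - 1) ^ 4)"
    proof (rule sum_mono)
      fix j
      have "prob {x \<in> space M. \<eta> * sqrt (real n) < real (T (segn j x))} = prob {x \<in> space M. \<eta> * sqrt (real n) < real (T (seg x))}"
        using prob_segn[of j "{b. \<eta> * sqrt (real n) < real (T b)}"] by simp
      also have "\<dots> \<le> prob {x \<in> space M. k < T (seg x)}"
        using k measurable_sets[OF seg_measurable, of "{b. k < T b}"]
        by (intro finite_measure_mono) (auto simp: vimage_def Int_def conj_commute)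
      also have "\<dots> \<le> C / real k ^ 4" by (rule T_tail[OF k(1)])
      also have "\<dots> \<le> C / (\<eta> * sqrt (real n) - 1) ^ 4"
        using k n C_pos by (intro divide_left_mono power_mono mult_pos_pos zero_less_power) auto
      finally show "prob {x \<in> space M. \<eta> * sqrt (real n) < real (T (segn j x))} \<le> C / (\<eta> * sqrt (real n) - 1) ^ 4" .
    qed
    finally show ?thesis by (simp add: add.commute)
  qed
  have lim: "(\<lambda>n. (real n + 1) * (C / (\<eta> * sqrt (real n) - 1) ^ 4)) \<longlonglongrightarrow> 0" using eta C_pos by real_asymp
  have "eventually (\<lambda>n. 1 < \<eta> * sqrt (real n)) sequentially" using eta by real_asymp
  then have "eventually (\<lambda>n. norm (prob {x \<in> space M. \<exists>j\<le>n. \<eta> * sqrt (real n) < real (T (segn j x))}) \<le> (real n + 1) * (C / (\<eta> * sqrt (real n) - 1) ^ 4)) sequentially"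
    by eventually_elim (use le in simp)
  then show ?thesis by (rule Lim_null_comparison[OF _ lim])
qed

section \<open>Replacing the random number of segments by a deterministic one\<close>

context
  assumes Y0: "(\<integral>x. Y (seg x) \<partial>M) = 0" and vY_pos: "0 < vY"
begin

definition aN :: "nat \<Rightarrow> nat" where "aN n = nat \<lfloor>real n / mT\<rfloor>"

lemma aN: "real (aN n) \<le> real n / mT" "real n / mT < real (aN n) + 1" "aN n \<le> n"
proof -
  show 1: "real (aN n) \<le> real n / mT" "real n / mT < real (aN n) + 1" unfolding aN_def using mT_ge by auto
  have "real n / mT \<le> real n" using mT_ge mult_left_mono[OF mT_ge, of "real n"] by (simp add: divide_le_eq)
  then show "aN n \<le> n" using 1 by linarith
qed

text \<open>Segment \<open>j\<close> is counted in \<open>W (N n)\<close> iff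
  \<open>rho j \<le> n\<close>, which is decided by the segments before \<open>j\<close>; for this
  reason \<open>N n\<close> includes the segment in progress at time \<open>n\<close>. The number
  \<open>aN n\<close> is the deterministic substitute for \<open>N n\<close>.\<close>

definition coef :: "nat \<Rightarrow> nat \<Rightarrow> 'b list \<Rightarrow> real" where
  "coef n j bs = of_bool ((\<Sum>i<length bs. T (bs ! i)) \<le> n) - of_bool (j < aN n)"

lemma coef_segs: "coef n j (segs j x) = of_bool (rho j x \<le> n) - of_bool (j < aN n)"
proof -
  have "(\<Sum>i<length (segs j x). T (segs j x ! i)) = rho j x"
    unfolding rho_def by (rule sum.cong) (auto simp: segs_def)
  then show ?thesis by (simp add: coef_def)
qed

lemma WN_diff: "(\<Sum>j<Suc n. coef n j (segs j x) * Y (segn j x)) = W (N n x) x - W (aN n) x"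
proof -
  have "(\<Sum>j<Suc n. of_bool (rho j x \<le> n) * Y (segn j x)) = (\<Sum>j\<in>{..<Suc n} \<inter> {j. rho j x \<le> n}. Y (segn j x))"
    by (subst sum.inter_restrict, simp, rule sum.cong) (auto simp: of_bool_def)
  also have "{..<Suc n} \<inter> {j. rho j x \<le> n} = {..<N n x}" unfolding N_set[symmetric] by auto
  finally have 1: "(\<Sum>j<Suc n. of_bool (rho j x \<le> n) * Y (segn j x)) = W (N n x) x" by (simp add: W_def)
  have "(\<Sum>j<Suc n. of_bool (j < aN n) * Y (segn j x)) = (\<Sum>j\<in>{..<Suc n} \<inter> {j. j < aN n}. Y (segn j x))"
    by (subst sum.inter_restrict, simp, rule sum.cong) (auto simp: of_bool_def)
  also have "{..<Suc n} \<inter> {j. j < aN n} = {..<aN n}" using aN(3)[of n] by auto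
  finally have 2: "(\<Sum>j<Suc n. of_bool (j < aN n) * Y (segn j x)) = W (aN n) x" by (simp add: W_def)
  show ?thesis unfolding coef_segs left_diff_distrib sum_subtractf 1 2 ..
qed

lemma coef_sq: "(\<integral>x. (coef n j (segs j x))\<^sup>2 \<partial>M) \<le> 1"
proof -
  have le: "(coef n j bs)\<^sup>2 \<le> 1" for bs by (simp add: coef_def of_bool_def power2_eq_square)
  have "(\<integral>x. (coef n j (segs j x))\<^sup>2 \<partial>M) \<le> (\<integral>x. 1 \<partial>M)"
    by (rule integral_mono, rule integrable_const_bound[where B=1])
      (use le in \<open>auto intro: segs_fun_measurable[of "\<lambda>bs. (coef n j bs)\<^sup>2"]\<close>)
  then show ?thesis by (simp add: prob_space)
qed

text \<open>A nonzero coefficient puts \<open>rho j\<close> and its mean \<open>j * mT\<close> on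
  different sides of \<open>n\<close>, so \<open>rho j\<close> deviates from its mean by at least
  the distance of \<open>j * mT\<close> from \<open>n\<close>. Chebyshev's inequality bounds the
  probability of that.\<close>

lemma coef_sq_far:
  assumes d: "mT \<le> d" and far: "d \<le> \<bar>real n - real j * mT\<bar>" and j: "j \<le> n"
  shows "(\<integral>x. (coef n j (segs j x))\<^sup>2 \<partial>M) \<le> real n * variance (\<lambda>x. real (T (seg x))) / d\<^sup>2"
proof -
  have d0: "0 < d" using d mT_ge by simp
  let ?B = "{x \<in> space M. d \<le> \<bar>(\<Sum>i<j. real (T (segn i x))) - real j * mT\<bar>}"
  have Bm: "?B \<in> sets M" by measurable
  have "(\<integral>x. (coef n j (segs j x))\<^sup>2 \<partial>M) \<le> (\<integral>x. indicator ?B x \<partial>M)"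
  proof (rule integral_mono)
    show "integrable M (\<lambda>x. (coef n j (segs j x))\<^sup>2)"
      by (rule integrable_const_bound[where B=1])
        (auto intro: segs_fun_measurable[of "\<lambda>bs. (coef n j bs)\<^sup>2"] simp: coef_def of_bool_def power2_eq_square)
    show "integrable M (indicat_real ?B)"
      by (rule integrable_real_indicator[OF Bm]) (simp add: emeasure_eq_measure)
    fix x assume x: "x \<in> space M"
    show "(coef n j (segs j x))\<^sup>2 \<le> indicator ?B x"
    proof (cases "coef n j (segs j x) = 0")
      case False
      have r: "(\<Sum>i<j. real (T (segn i x))) = real (rho j x)" by (simp add: rho_def)
      have "d \<le> \<bar>real (rho j x) - real j * mT\<bar>"
      proof (cases "j < aN n")
        case True
        then have "n < rho j x" using False unfolding coef_segs by (cases "rho j x \<le> n") auto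
        moreover have "real j * mT \<le> real n"
        proof -
          have "real j \<le> real n / mT" using True aN(1)[of n] by linarith
          then show ?thesis using mT_ge by (simp add: pos_le_divide_eq)
        qed
        ultimately show ?thesis using far by linarith
      next
        case nj: False
        then have "rho j x \<le> n" using False unfolding coef_segs by (cases "rho j x \<le> n") auto
        \<comment> \<open>Rounding in \<open>aN\<close> leaves one index not below
          \<open>aN n\<close> with \<open>j * mT < n\<close>; its distance from \<open>n\<close> is
          less than \<open>mT\<close>, hence less than \<open>d\<close>, and it is excluded by
          \<open>far\<close>.\<close>
        moreover have "real n \<le> real j * mT"
        proof (rule ccontr)
          assume a: "\<not> real n \<le> real j * mT"
          then have "d \<le> real n - real j * mT" using far by simp
          moreover have "real n / mT < real j + 1" using aN(2)[of n] nj by linarith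
          then have "real n < (real j + 1) * mT" using mT_ge by (simp add: pos_divide_less_eq)
          ultimately show False using d by (simp add: algebra_simps)
        qed
        ultimately show ?thesis using far by linarith
      qed
      then have "x \<in> ?B" using x r by simp
      then show ?thesis by (simp add: coef_def of_bool_def power2_eq_square)
    qed (simp add: indicator_def)
  qed
  also have "\<dots> = prob ?B" using Bm by simp
  also have "\<dots> \<le> real j * variance (\<lambda>x. real (T (seg x))) / d\<^sup>2"
    unfolding mT_def using weak_law[of "\<lambda>b. real (T b)" d j, OF T_int T_sq d0] by simp
  also have "\<dots> \<le> real n * variance (\<lambda>x. real (T (seg x))) / d\<^sup>2"
    using j by (intro divide_right_mono mult_right_mono variance_positive) auto
  finally show ?thesis .
qed

text \<open>By orthogonality the second moment of the difference is \<open>vY\<close> times the sum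
  of the mean squared coefficients. At most \<open>2 * d + 1\<close> indices have
  \<open>j * mT\<close> within \<open>d\<close> of \<open>n\<close> and contribute at most 1 each;
  the others are covered by \<open>coef_sq_far\<close>. With \<open>d = n powr (3/4)\<close> the
  total is negligible against \<open>n\<close>.\<close>

lemma WN_close: assumes eta: "0 < \<eta>"
  shows "(\<lambda>n. prob {x \<in> space M. \<eta> * sqrt (real n) \<le> \<bar>W (N n x) x - W (aN n) x\<bar>}) \<longlonglongrightarrow> 0"
proof -
  let ?s = "variance (\<lambda>x. real (T (seg x)))"
  have s0: "0 \<le> ?s" by (rule variance_positive)
  have sum_le: "(\<Sum>j<Suc n. \<integral>x. (coef n j (segs j x))\<^sup>2 \<partial>M) \<le> (2 * d + 1) + (real n + 1) * (real n * ?s / d\<^sup>2)" if d: "mT \<le> d" for n d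
  proof -
    let ?F = "{j. j \<le> n \<and> d \<le> \<bar>real n - real j * mT\<bar>}" and ?G = "{j::nat. (real n - d) / mT \<le> real j \<and> real j \<le> (real n + d) / mT}"
    have m: "0 < mT" using mT_ge by simp
    have G: "finite ?G" "real (card ?G) \<le> (real n + d) / mT - (real n - d) / mT + 1"
      using card_nat_between[of "(real n - d) / mT" "(real n + d) / mT"] d m by (auto simp: divide_right_mono)
    have "(real n + d) / mT - (real n - d) / mT = 2 * d / mT" by (simp add: diff_divide_distrib[symmetric])
    also have "\<dots> \<le> 2 * d" using d mT_ge by (simp add: divide_le_eq mult_left_le)
    finally have cG: "real (card ?G) \<le> 2 * d + 1" using G(2) by simp
    have sub: "{..<Suc n} \<subseteq> ?F \<union> ?G"
      using m by (auto simp: pos_divide_le_eq pos_le_divide_eq abs_le_iff not_le)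
    have finF: "finite ?F" by (rule finite_subset[of _ "{..n}"]) auto
    let ?c = "\<lambda>j. \<integral>x. (coef n j (segs j x))\<^sup>2 \<partial>M"
    have c0: "0 \<le> ?c j" for j by (rule integral_nonneg_AE) simp
    have "(\<Sum>j<Suc n. ?c j) \<le> (\<Sum>j\<in>?F \<union> ?G. ?c j)"
      by (rule sum_mono2) (use sub finF G c0 in auto)
    also have "\<dots> \<le> (\<Sum>j\<in>?F. ?c j) + (\<Sum>j\<in>?G. ?c j)"
      using sum_Un[OF finF G(1), of ?c] sum_nonneg[of "?F \<inter> ?G" ?c] c0 by simp
    also have "\<dots> \<le> (\<Sum>j\<in>?F. real n * ?s / d\<^sup>2) + (\<Sum>j\<in>?G. 1)"
      by (intro add_mono sum_mono coef_sq) (auto intro: coef_sq_far[OF d])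
    also have "\<dots> = real (card ?F) * (real n * ?s / d\<^sup>2) + real (card ?G)" by simp
    also have "real (card ?F) \<le> real n + 1"
    proof -
      have "card ?F \<le> card {..n}" by (rule card_mono) auto
      then show ?thesis by simp
    qed
    then have "real (card ?F) * (real n * ?s / d\<^sup>2) \<le> (real n + 1) * (real n * ?s / d\<^sup>2)"
      using s0 by (intro mult_right_mono) auto
    finally show ?thesis using cG by simp
  qed
  define bnd where "bnd n = vY * ((2 * real n powr (3/4) + 1) + (real n + 1) * (real n * ?s / (real n powr (3/4))\<^sup>2)) / (\<eta>\<^sup>2 * real n)" for n
  have bound: "prob {x \<in> space M. \<eta> * sqrt (real n) \<le> \<bar>W (N n x) x - W (aN n) x\<bar>} \<le> bnd n"
    if n: "0 < n" "mT \<le> real n powr (3/4)" for n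
  proof -
    let ?D = "\<lambda>x. \<Sum>j<Suc n. coef n j (segs j x) * Y (segn j x)"
    have ps: "integrable M (\<lambda>x. (?D x)\<^sup>2) \<and> (\<integral>x. (?D x)\<^sup>2 \<partial>M) = (\<integral>x. (Y (seg x))\<^sup>2 \<partial>M) * (\<Sum>j<Suc n. \<integral>x. (coef n j (segs j x))\<^sup>2 \<partial>M)"
      by (rule predictable_square[OF _ Y_int Y_sq Y0]) (simp add: coef_def of_bool_def)
    have p: "0 < \<eta>\<^sup>2 * real n" using eta n by simp
    have "prob {x \<in> space M. \<eta>\<^sup>2 * real n \<le> (?D x)\<^sup>2} \<le> (\<integral>x. (?D x)\<^sup>2 \<partial>M) / (\<eta>\<^sup>2 * real n)"
      by (rule integral_Markov_inequality_measure[where A="{}", simplified]) (use ps p in auto)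
    also have "\<dots> \<le> bnd n"
      unfolding bnd_def conjunct2[OF ps] vY_def[symmetric]
      by (intro divide_right_mono mult_left_mono sum_le[OF n(2)]) (use vY_pos p in auto)
    also have "{x \<in> space M. \<eta>\<^sup>2 * real n \<le> (?D x)\<^sup>2} = {x \<in> space M. \<eta> * sqrt (real n) \<le> \<bar>W (N n x) x - W (aN n) x\<bar>}"
    proof -
      have "\<eta>\<^sup>2 * real n = (\<eta> * sqrt (real n))\<^sup>2" by (simp add: power_mult_distrib)
      then show ?thesis unfolding WN_diff using eta abs_le_square_iff[of "\<eta> * sqrt (real n)"] by auto
    qed
    finally show ?thesis .
  qed
  have lim: "bnd \<longlonglongrightarrow> 0" unfolding bnd_def by (rule asymp_window[OF eta])
  have "eventually (\<lambda>n. mT \<le> real n powr (3/4)) sequentially" by (rule asymp_powr)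
  then have "eventually (\<lambda>n. norm (prob {x \<in> space M. \<eta> * sqrt (real n) \<le> \<bar>W (N n x) x - W (aN n) x\<bar>}) \<le> bnd n) sequentially"
    using eventually_gt_at_top[of 0] by eventually_elim (use bound in simp)
  then show ?thesis by (rule Lim_null_comparison[OF _ lim])
qed

definition Zn :: "nat \<Rightarrow> 'a \<Rightarrow> real" where
  "Zn k x = W k x / sqrt (real k * vY)"

lemma Zn_measurable [measurable]: "Zn k \<in> borel_measurable M"
  unfolding Zn_def[abs_def] by measurable

lemma Zn_clt: "weak_conv_m (\<lambda>k. distr M borel (Zn k)) std_normal_distribution"
proof -
  have s: "(sqrt vY)\<^sup>2 = vY" using vY_pos by simp
  have "weak_conv_m (\<lambda>n. distr M borel (\<lambda>x. (\<Sum>i<n. Y (segn i x)) / sqrt (real n * (sqrt vY)\<^sup>2))) std_normal_distribution"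
  proof (rule central_limit_theorem_zero_mean[where \<mu>="distr M borel (\<lambda>x. Y (seg x))"])
    show "indep_vars (\<lambda>_. borel) (\<lambda>i x. Y (segn i x)) UNIV"
      by (rule indep_vars_compose2[OF indep_segn]) simp
    show "expectation (\<lambda>x. Y (segn i x)) = 0" for i by (simp add: integral_segn Y0)
    show "0 < sqrt vY" using vY_pos by simp
    show i2: "integrable M (\<lambda>x. (Y (segn i x))\<^sup>2)" for i by (rule integrable_segn[OF Y_sq])
    show "variance (\<lambda>x. Y (segn i x)) = (sqrt vY)\<^sup>2" for i
      unfolding s using integral_segn[of "\<lambda>b. (Y b)\<^sup>2" i] by (simp add: integral_segn Y0 vY_def)
    show "distr M borel (\<lambda>x. Y (segn i x)) = distr M borel (\<lambda>x. Y (seg x))" for i by (rule distr_segn)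
  qed
  then show ?thesis unfolding s by (simp add: Zn_def[abs_def] W_def)
qed

lemma aN_at_top: "filterlim aN at_top sequentially"
proof (rule filterlim_at_top_mono)
  show "filterlim (\<lambda>n. nat \<lfloor>real n / mT\<rfloor>) at_top sequentially"
  proof -
    have "0 < mT" using mT_ge by simp
    then have "filterlim (\<lambda>n. real n / mT) at_top sequentially" by (rule asymp_div)
    then show ?thesis by (intro filterlim_compose[OF filterlim_nat_sequentially] filterlim_compose[OF filterlim_floor_sequentially])
  qed
qed (simp add: aN_def)

lemma aN_ratio: "(\<lambda>n. sqrt (real (aN n) * vY) / sqrt (real n)) \<longlonglongrightarrow> sqrt (vY / mT)"
proof -
  have "(\<lambda>n. real (aN n) / real n) \<longlonglongrightarrow> 1 / mT"
  proof (rule real_tendsto_sandwich)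
    show "eventually (\<lambda>n. 1 / mT - 1 / real n \<le> real (aN n) / real n) sequentially"
      using eventually_gt_at_top[of 0]
    proof eventually_elim
      case (elim n)
      have "real n / mT - 1 \<le> real (aN n)" using aN(2)[of n] by simp
      then have "(real n / mT - 1) / real n \<le> real (aN n) / real n" by (rule divide_right_mono) simp
      then show ?case using elim by (simp add: diff_divide_distrib)
    qed
    show "eventually (\<lambda>n. real (aN n) / real n \<le> 1 / mT) sequentially"
      using eventually_gt_at_top[of 0]
    proof eventually_elim
      case (elim n)
      have "real (aN n) / real n \<le> (real n / mT) / real n" by (rule divide_right_mono[OF aN(1)]) simp
      then show ?case using elim by simp
    qed
    show "(\<lambda>n. 1 / mT - 1 / real n) \<longlonglongrightarrow> 1 / mT" by (rule asymp_sub)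
  qed simp
  then have "(\<lambda>n. sqrt (real (aN n) / real n * vY)) \<longlonglongrightarrow> sqrt (1 / mT * vY)"
    by (intro tendsto_real_sqrt tendsto_mult tendsto_const)
  then show ?thesis by (simp add: real_sqrt_divide real_sqrt_mult)
qed

lemma Zn_sq: "integrable M (\<lambda>x. (Zn k x)\<^sup>2)" "(\<integral>x. (Zn k x)\<^sup>2 \<partial>M) \<le> 1"
proof -
  have ps: "integrable M (\<lambda>x. (W k x)\<^sup>2) \<and> (\<integral>x. (W k x)\<^sup>2 \<partial>M) = vY * real k"
    using predictable_square[of "\<lambda>_ _. 1" Y k, OF _ Y_int Y_sq Y0] by (simp add: W_def vY_def prob_space)
  have e: "(Zn k x)\<^sup>2 = (W k x)\<^sup>2 / (real k * vY)" for x
    using vY_pos by (simp add: Zn_def power_divide)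
  show "integrable M (\<lambda>x. (Zn k x)\<^sup>2)" unfolding e using ps by simp
  show "(\<integral>x. (Zn k x)\<^sup>2 \<partial>M) \<le> 1" unfolding e using ps by simp
qed

text \<open>Stated as closeness in probability to a multiple of \<open>Zn\<close>, whose law
  converges by \<open>Zn_clt\<close>. In this form further errors and a change of measure can be
  added before passing to the limit law.\<close>

theorem renewal_clt:
  assumes eta: "0 < \<eta>"
  shows "(\<lambda>n. prob {x \<in> space M. \<eta> < \<bar>W (N n x) x / sqrt (real n) - sqrt (vY / mT) * Zn (aN n) x\<bar>}) \<longlonglongrightarrow> 0"
proof -
  define c where "c n = sqrt (real (aN n) * vY) / sqrt (real n)" for n
  let ?c = "sqrt (vY / mT)"
  have Wa: "W (aN n) x / sqrt (real n) = c n * Zn (aN n) x" for n x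
  proof (cases "aN n = 0")
    case True
    then show ?thesis by (simp add: W_def Zn_def)
  next
    case False
    then show ?thesis using vY_pos by (simp add: c_def Zn_def)
  qed
  have e2: "0 < \<eta> / 2" using eta by simp
  have le: "prob {x \<in> space M. \<eta> < \<bar>W (N n x) x / sqrt (real n) - ?c * Zn (aN n) x\<bar>}
     \<le> prob {x \<in> space M. (\<eta> / 2) * sqrt (real n) \<le> \<bar>W (N n x) x - W (aN n) x\<bar>} + (c n - ?c)\<^sup>2 / (\<eta> / 2)\<^sup>2" if n: "0 < n" for n
  proof -
    let ?A = "{x \<in> space M. (\<eta> / 2) * sqrt (real n) \<le> \<bar>W (N n x) x - W (aN n) x\<bar>}"
    let ?B = "{x \<in> space M. (\<eta> / 2)\<^sup>2 \<le> ((c n - ?c) * Zn (aN n) x)\<^sup>2}"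
    have Am: "?A \<in> sets M" and Bm: "?B \<in> sets M" by measurable
    have "{x \<in> space M. \<eta> < \<bar>W (N n x) x / sqrt (real n) - ?c * Zn (aN n) x\<bar>} \<subseteq> ?A \<union> ?B"
    proof
      fix x assume x: "x \<in> {x \<in> space M. \<eta> < \<bar>W (N n x) x / sqrt (real n) - ?c * Zn (aN n) x\<bar>}"
      have "W (N n x) x / sqrt (real n) - ?c * Zn (aN n) x = (W (N n x) x - W (aN n) x) / sqrt (real n) + (c n - ?c) * Zn (aN n) x"
        unfolding left_diff_distrib Wa[symmetric] by (simp add: diff_divide_distrib)
      then have "\<eta> < \<bar>(W (N n x) x - W (aN n) x) / sqrt (real n)\<bar> + \<bar>(c n - ?c) * Zn (aN n) x\<bar>"
        using x abs_triangle_ineq[of "(W (N n x) x - W (aN n) x) / sqrt (real n)" "(c n - ?c) * Zn (aN n) x"] by simp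
      then consider "\<eta> / 2 \<le> \<bar>(W (N n x) x - W (aN n) x) / sqrt (real n)\<bar>" | "\<eta> / 2 \<le> \<bar>(c n - ?c) * Zn (aN n) x\<bar>" by linarith
      then show "x \<in> ?A \<union> ?B"
      proof cases
        case 1
        then show ?thesis using x n by (simp add: abs_divide pos_le_divide_eq)
      next
        case 2
        then have "(\<eta> / 2)\<^sup>2 \<le> \<bar>(c n - ?c) * Zn (aN n) x\<bar>\<^sup>2" using eta by (intro power_mono) auto
        then show ?thesis using x by simp
      qed
    qed
    then have "prob {x \<in> space M. \<eta> < \<bar>W (N n x) x / sqrt (real n) - ?c * Zn (aN n) x\<bar>} \<le> prob (?A \<union> ?B)"
      by (rule finite_measure_mono) (use Am Bm in auto)
    also have "\<dots> \<le> prob ?A + prob ?B" by (rule measure_Un_le[OF Am Bm])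
    also have "prob ?B \<le> (\<integral>x. ((c n - ?c) * Zn (aN n) x)\<^sup>2 \<partial>M) / (\<eta> / 2)\<^sup>2"
      by (rule integral_Markov_inequality_measure[where A="{}", simplified]) (use Zn_sq(1) eta in \<open>auto simp: power_mult_distrib\<close>)
    also have "\<dots> \<le> (c n - ?c)\<^sup>2 / (\<eta> / 2)\<^sup>2"
      using Zn_sq[of "aN n"] by (intro divide_right_mono) (auto simp: power_mult_distrib mult_left_le)
    finally show ?thesis by simp
  qed
  have "(\<lambda>n. (c n - ?c)\<^sup>2) \<longlonglongrightarrow> (?c - ?c)\<^sup>2"
    unfolding c_def by (intro tendsto_power tendsto_diff aN_ratio tendsto_const)
  then have "(\<lambda>n. prob {x \<in> space M. (\<eta> / 2) * sqrt (real n) \<le> \<bar>W (N n x) x - W (aN n) x\<bar>} + (c n - ?c)\<^sup>2 / (\<eta> / 2)\<^sup>2) \<longlonglongrightarrow> 0 + 0 / (\<eta> / 2)\<^sup>2"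
    using eta by (intro tendsto_add WN_close[OF e2] tendsto_divide tendsto_const) auto
  then have lim: "(\<lambda>n. prob {x \<in> space M. (\<eta> / 2) * sqrt (real n) \<le> \<bar>W (N n x) x - W (aN n) x\<bar>} + (c n - ?c)\<^sup>2 / (\<eta> / 2)\<^sup>2) \<longlonglongrightarrow> 0"
    by simp
  have "eventually (\<lambda>n. norm (prob {x \<in> space M. \<eta> < \<bar>W (N n x) x / sqrt (real n) - ?c * Zn (aN n) x\<bar>})
     \<le> prob {x \<in> space M. (\<eta> / 2) * sqrt (real n) \<le> \<bar>W (N n x) x - W (aN n) x\<bar>} + (c n - ?c)\<^sup>2 / (\<eta> / 2)\<^sup>2) sequentially"
    using eventually_gt_at_top[of 0] by eventually_elim (use le in simp)
  then show ?thesis by (rule Lim_null_comparison[OF _ lim])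
qed

end

end

section \<open>Renewal structure of the walk\<close>

context rwre_speed
begin

lemma Reg_iff: "Reg x \<sigma> n \<longleftrightarrow> fresh x (stake n \<sigma>) \<and> hd (run x (stake n \<sigma>)) = s0
   \<and> (\<forall>i\<ge>n. suffix (run x (stake n \<sigma>)) (run x (stake i \<sigma>)))"
proof (cases "fresh x (stake n \<sigma>) \<and> hd (run x (stake n \<sigma>)) = s0")
  case True
  then obtain w where w: "run x (stake n \<sigma>) = s0 # w" by (cases "run x (stake n \<sigma>)") (auto simp: fresh_def)
  have "sdrop n \<sigma> \<in> stay s0 \<longleftrightarrow> (\<forall>m. suffix (s0 # w) (run (s0 # w) (stake m (sdrop n \<sigma>))))"
    by (rule stay_suffix_iff) simp
  also have "\<dots> \<longleftrightarrow> (\<forall>m. suffix (s0 # w) (run x (stake (n + m) \<sigma>)))"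
    unfolding stake_add_run w by simp
  also have "\<dots> \<longleftrightarrow> (\<forall>i\<ge>n. suffix (run x (stake n \<sigma>)) (run x (stake i \<sigma>)))"
    unfolding w by (metis le_add1 le_Suc_ex)
  finally show ?thesis using True by (simp add: Reg_def)
qed (auto simp: Reg_def)

text \<open>A time that looks like a regeneration as long as only the path \<open>\<pi>\<close> is
  known.\<close>

definition prereg :: "letter list \<Rightarrow> letter list \<Rightarrow> nat \<Rightarrow> bool" where
  "prereg x \<pi> m \<longleftrightarrow> fresh x (take m \<pi>) \<and> hd (run x (take m \<pi>)) = s0
    \<and> (\<forall>i\<in>{m..length \<pi>}. suffix (run x (take m \<pi>)) (run x (take i \<pi>)))"

definition regpath :: "letter list \<Rightarrow> nat \<Rightarrow> letter list \<Rightarrow> bool" where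
  "regpath x b \<pi> \<longleftrightarrow> b \<le> length \<pi> \<and> fresh x \<pi> \<and> hd (run x \<pi>) = s0 \<and> (\<forall>m. b \<le> m \<longrightarrow> m < length \<pi> \<longrightarrow> \<not> prereg x \<pi> m)"

text \<open>If the walk stays in the cone entered at time \<open>n\<close>, it also stays in every
  cone containing that one; so whether an earlier time is a regeneration is decided by time
  \<open>n\<close>. This splits the event into a condition on the finite path and
  \<open>stay s0\<close> for the rest.\<close>

lemma Reg_first:
  assumes b: "b \<le> n"
  shows "(Reg x \<sigma> n \<and> (\<forall>m. b \<le> m \<longrightarrow> m < n \<longrightarrow> \<not> Reg x \<sigma> m)) \<longleftrightarrow> regpath x b (stake n \<sigma>) \<and> sdrop n \<sigma> \<in> stay s0"
proof -
  have tk: "take m (stake n \<sigma>) = stake m \<sigma>" if "m \<le> n" for m using that by (simp add: take_stake min_def)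
  have pre: "prereg x (stake n \<sigma>) m \<longleftrightarrow> Reg x \<sigma> m" if R: "Reg x \<sigma> n" and m: "m < n" for m
  proof
    assume p: "prereg x (stake n \<sigma>) m"
    have "suffix (run x (stake m \<sigma>)) (run x (stake i \<sigma>))" if i: "m \<le> i" for i
    proof (cases "i \<le> n")
      case True
      have "suffix (run x (take m (stake n \<sigma>))) (run x (take i (stake n \<sigma>)))"
        using p i True unfolding prereg_def by simp
      then show ?thesis using tk[of m] tk[of i] m True by simp
    next
      case False
      have "suffix (run x (take m (stake n \<sigma>))) (run x (take n (stake n \<sigma>)))"
      proof -
        have "\<forall>i\<in>{m..length (stake n \<sigma>)}. suffix (run x (take m (stake n \<sigma>))) (run x (take i (stake n \<sigma>)))"
          using p unfolding prereg_def by blast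
        moreover have "n \<in> {m..length (stake n \<sigma>)}" using m by simp
        ultimately show ?thesis by (rule bspec)
      qed
      then have "suffix (run x (stake m \<sigma>)) (run x (stake n \<sigma>))" using m by (simp only: tk less_imp_le order_refl)
      moreover have "suffix (run x (stake n \<sigma>)) (run x (stake i \<sigma>))" using R False unfolding Reg_iff by auto
      ultimately show ?thesis by (rule suffix_order.trans)
    qed
    then show "Reg x \<sigma> m" using p m tk[of m] unfolding Reg_iff by (auto simp: prereg_def)
  next
    assume "Reg x \<sigma> m"
    then show "prereg x (stake n \<sigma>) m" using m tk unfolding Reg_iff prereg_def by auto
  qed
  show ?thesis
  proof (cases "Reg x \<sigma> n")
    case True
    then show ?thesis using pre[OF True] b by (auto simp: regpath_def Reg_def)
  next
    case False
    then show ?thesis by (auto simp: regpath_def Reg_def)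
  qed
qed

definition Rtime :: "letter list \<Rightarrow> nat \<Rightarrow> letter stream \<Rightarrow> nat" where
  "Rtime x b \<sigma> = (if \<exists>n\<ge>b. Reg x \<sigma> n then LEAST n. b \<le> n \<and> Reg x \<sigma> n else b)"

lemma Rtime_props:
  assumes "\<exists>n\<ge>b. Reg x \<sigma> n"
  shows "b \<le> Rtime x b \<sigma>" "Reg x \<sigma> (Rtime x b \<sigma>)" "b \<le> m \<Longrightarrow> m < Rtime x b \<sigma> \<Longrightarrow> \<not> Reg x \<sigma> m"
proof -
  have e: "Rtime x b \<sigma> = (LEAST n. b \<le> n \<and> Reg x \<sigma> n)" using assms by (simp add: Rtime_def)
  have "b \<le> Rtime x b \<sigma> \<and> Reg x \<sigma> (Rtime x b \<sigma>)" unfolding e by (rule LeastI_ex) (use assms in auto)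
  then show "b \<le> Rtime x b \<sigma>" "Reg x \<sigma> (Rtime x b \<sigma>)" by auto
  show "b \<le> m \<Longrightarrow> m < Rtime x b \<sigma> \<Longrightarrow> \<not> Reg x \<sigma> m" unfolding e using not_less_Least by blast
qed

lemma Rtime_eq:
  assumes "b \<le> n" "Reg x \<sigma> n" "\<And>m. b \<le> m \<Longrightarrow> m < n \<Longrightarrow> \<not> Reg x \<sigma> m"
  shows "Rtime x b \<sigma> = n"
proof -
  have ex: "\<exists>n\<ge>b. Reg x \<sigma> n" using assms by blast
  show ?thesis using Rtime_props[OF ex] assms by (metis not_less_iff_gr_or_eq)
qed

lemma Rtime_ge: "b \<le> Rtime x b \<sigma>"
  using Rtime_props(1)[of b x \<sigma>] by (cases "\<exists>n\<ge>b. Reg x \<sigma> n") (auto simp: Rtime_def)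

lemma Rtime_regpath:
  "(\<exists>n\<ge>b. Reg x \<sigma> n) \<and> stake (Rtime x b \<sigma>) \<sigma> = \<pi> \<longleftrightarrow> regpath x b \<pi> \<and> stake (length \<pi>) \<sigma> = \<pi> \<and> sdrop (length \<pi>) \<sigma> \<in> stay s0"
proof
  assume a: "(\<exists>n\<ge>b. Reg x \<sigma> n) \<and> stake (Rtime x b \<sigma>) \<sigma> = \<pi>"
  then have l: "length \<pi> = Rtime x b \<sigma>" by auto
  note R = Rtime_props[OF conjunct1[OF a]]
  show "regpath x b \<pi> \<and> stake (length \<pi>) \<sigma> = \<pi> \<and> sdrop (length \<pi>) \<sigma> \<in> stay s0"
    using Reg_first[OF R(1), of x \<sigma>] R(2,3) a l by auto
next
  assume a: "regpath x b \<pi> \<and> stake (length \<pi>) \<sigma> = \<pi> \<and> sdrop (length \<pi>) \<sigma> \<in> stay s0"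
  then have b: "b \<le> length \<pi>" by (simp add: regpath_def)
  have R: "Reg x \<sigma> (length \<pi>) \<and> (\<forall>m. b \<le> m \<longrightarrow> m < length \<pi> \<longrightarrow> \<not> Reg x \<sigma> m)"
    using Reg_first[OF b, of x \<sigma>] a by simp
  then have "Rtime x b \<sigma> = length \<pi>" using Rtime_eq[OF b] by blast
  then show "(\<exists>n\<ge>b. Reg x \<sigma> n) \<and> stake (Rtime x b \<sigma>) \<sigma> = \<pi>" using a R b by auto
qed

lemma Reg_measurable [measurable]: "Measurable.pred SS (\<lambda>\<sigma>. Reg x \<sigma> n)"
  using Reg_sets[of x n] by (simp add: pred_def)

lemma Rtime_measurable [measurable]: "Rtime x b \<in> measurable SS (count_space UNIV)"
  unfolding Rtime_def[abs_def] by measurable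

lemma stake_Rtime_measurable: "(\<lambda>\<sigma>. stake (Rtime x b \<sigma>) \<sigma>) \<in> measurable SS (count_space UNIV)"
  by (rule measurable_compose_countable[OF _ Rtime_measurable]) (rule stake_measurable_SS)

lemma sdrop_Rtime_measurable: "(\<lambda>\<sigma>. sdrop (Rtime x b \<sigma>) \<sigma>) \<in> measurable SS SS"
  by (rule measurable_compose_countable[OF _ Rtime_measurable]) (rule measurable_sdrop)

text \<open>The law of the path after a regeneration, as seen from there.\<close>

definition nu :: "letter stream measure" where
  "nu = uniform_measure (Aw [s0]) (stay s0)"

lemma sets_nu [simp]: "sets nu = sets SS" and space_nu [simp]: "space nu = UNIV"
  by (simp_all add: nu_def)

lemma esc_s0: "0 < esc s0" by (rule esc_pos) simp

lemma emeasure_stay: "emeasure (Aw [s0]) (stay s0) = ennreal (esc s0)"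
proof -
  interpret A: prob_space "Aw [s0]" by (rule prob_space_Aw) simp
  show ?thesis by (simp add: A.emeasure_eq_measure esc_def)
qed

lemma prob_space_nu: "prob_space nu"
  unfolding nu_def by (rule prob_space_uniform_measure) (use esc_s0 emeasure_stay in auto)

lemma nu_measure: "D \<in> sets SS \<Longrightarrow> measure nu D = measure (Aw [s0]) (stay s0 \<inter> D) / esc s0"
  unfolding nu_def by (subst measure_uniform_measure) (use esc_s0 emeasure_stay in \<open>auto simp: esc_def\<close>)

lemma AE_nu_stay: "AE \<sigma> in nu. \<sigma> \<in> stay s0"
proof -
  interpret prob_space nu by (rule prob_space_nu)
  have "prob (stay s0) = 1" using esc_s0 by (simp add: nu_measure esc_def)
  then show ?thesis by (simp add: prob_eq_1)
qed

lemma AE_nu_Reg: "AE \<sigma> in nu. \<exists>n\<ge>1. Reg [s0] \<sigma> n"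
proof -
  interpret nu: prob_space nu by (rule prob_space_nu)
  obtain C where C: "C > 0" "\<And>n. n > 0 \<Longrightarrow> measure (Aw [s0]) (noreg n) \<le> C / real n ^ 4" using noreg_tail by blast
  let ?B = "{\<sigma>. \<forall>n. 0 < n \<longrightarrow> \<not> Reg [s0] \<sigma> n}"
  have Bm: "?B \<in> sets SS"
  proof -
    have "?B = (\<Inter>n. {\<sigma>. 0 < n \<longrightarrow> \<not> Reg [s0] \<sigma> n})" by auto
    moreover have "{\<sigma>. 0 < n \<longrightarrow> \<not> Reg [s0] \<sigma> n} \<in> sets SS" for n by (rule notReg_sets)
    ultimately show ?thesis by auto
  qed
  have le: "nu.prob ?B \<le> (C / esc s0) / real n ^ 4" if n: "0 < n" for n
  proof -
    interpret A: prob_space "Aw [s0]" by (rule prob_space_Aw) simp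
    have "measure (Aw [s0]) (stay s0 \<inter> ?B) \<le> measure (Aw [s0]) (noreg n)"
      by (rule A.finite_measure_mono) (auto simp: noreg_def noreg_sets[unfolded noreg_def])
    also have "\<dots> \<le> C / real n ^ 4" by (rule C(2)[OF n])
    finally have "measure (Aw [s0]) (stay s0 \<inter> ?B) / esc s0 \<le> C / real n ^ 4 / esc s0"
      using esc_s0 by (intro divide_right_mono) auto
    then show ?thesis using nu_measure[OF Bm] by (simp add: mult.commute)
  qed
  have "(\<lambda>n. (C / esc s0) / real n ^ 4) \<longlonglongrightarrow> 0"
    using tendsto_divide_0[OF tendsto_const, of "\<lambda>n. real n ^ 4" sequentially "C / esc s0"]
    by (simp add: filterlim_at_top_imp_at_infinity filterlim_pow_at_top filterlim_real_sequentially)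
  then have "nu.prob ?B \<le> 0"
    by (rule LIMSEQ_le_const) (use le in \<open>auto intro!: exI[of _ 1]\<close>)
  then have "nu.prob ?B = 0" by (simp add: measure_le_0_iff)
  then have "AE \<sigma> in nu. \<sigma> \<notin> ?B" using Bm nu.prob_eq_0[of ?B] by simp
  then show ?thesis by eventually_elim (auto simp: Suc_le_eq)
qed

text \<open>On \<open>stay s0\<close> time 0 is itself a regeneration, hence the search for the next
  one starts at time 1.\<close>

definition rseg :: "letter stream \<Rightarrow> letter list" where
  "rseg \<sigma> = stake (Rtime [s0] 1 \<sigma>) \<sigma>"

definition rnxt :: "letter stream \<Rightarrow> letter stream" where
  "rnxt \<sigma> = sdrop (Rtime [s0] 1 \<sigma>) \<sigma>"

definition Om :: "letter stream set" where
  "Om = {\<sigma> \<in> stay s0. \<exists>n\<ge>1. Reg [s0] \<sigma> n}"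

lemma AE_Om: "AE \<sigma> in nu. \<sigma> \<in> Om"
  using AE_nu_stay AE_nu_Reg by eventually_elim (simp add: Om_def)

lemma Om_sets [measurable]: "Om \<in> sets SS"
proof -
  have "Om = stay s0 \<inter> {\<sigma> \<in> space SS. \<exists>n\<ge>1. Reg [s0] \<sigma> n}" by (auto simp: Om_def)
  also have "\<dots> \<in> sets SS" by measurable
  finally show ?thesis .
qed

definition goodseg :: "letter list \<Rightarrow> bool" where
  "goodseg \<eta> \<longleftrightarrow> regpath [s0] 1 \<eta> \<and> (\<forall>m\<le>length \<eta>. run [s0] (take m \<eta>) \<noteq> [])"

text \<open>Membership in \<open>stay s0\<close> splits at the regeneration: before it the condition
  is part of \<open>goodseg\<close>, after it the walk is confined to a smaller cone.\<close>

lemma rseg_iff: "\<sigma> \<in> Om \<and> rseg \<sigma> = \<eta> \<longleftrightarrow> goodseg \<eta> \<and> stake (length \<eta>) \<sigma> = \<eta> \<and> sdrop (length \<eta>) \<sigma> \<in> stay s0"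
proof
  assume a: "\<sigma> \<in> Om \<and> rseg \<sigma> = \<eta>"
  then have r: "regpath [s0] 1 \<eta> \<and> stake (length \<eta>) \<sigma> = \<eta> \<and> sdrop (length \<eta>) \<sigma> \<in> stay s0"
    using Rtime_regpath[of 1 "[s0]" \<sigma> \<eta>] by (simp add: Om_def rseg_def)
  have "run [s0] (take m \<eta>) \<noteq> []" if "m \<le> length \<eta>" for m
  proof -
    have "take m \<eta> = stake m \<sigma>" using r that by (metis min_def take_stake)
    then show ?thesis using a by (simp add: Om_def stay_def)
  qed
  then show "goodseg \<eta> \<and> stake (length \<eta>) \<sigma> = \<eta> \<and> sdrop (length \<eta>) \<sigma> \<in> stay s0" using r by (simp add: goodseg_def)
next
  assume a: "goodseg \<eta> \<and> stake (length \<eta>) \<sigma> = \<eta> \<and> sdrop (length \<eta>) \<sigma> \<in> stay s0"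
  then have r: "(\<exists>n\<ge>1. Reg [s0] \<sigma> n) \<and> rseg \<sigma> = \<eta>"
    using Rtime_regpath[of 1 "[s0]" \<sigma> \<eta>] by (simp add: rseg_def goodseg_def)
  then have R: "Reg [s0] \<sigma> (Rtime [s0] 1 \<sigma>)" and l: "Rtime [s0] 1 \<sigma> = length \<eta>"
    using Rtime_props(2) by (auto simp: rseg_def)
  have "run [s0] (stake n \<sigma>) \<noteq> []" for n
  proof (cases "n \<le> length \<eta>")
    case True
    then have "take n \<eta> = stake n \<sigma>" using a by (metis min_def take_stake)
    then show ?thesis using a True by (metis goodseg_def)
  next
    case False
    then have "suffix (run [s0] (stake (length \<eta>) \<sigma>)) (run [s0] (stake n \<sigma>))" using R unfolding l Reg_iff by simp
    moreover have "run [s0] (stake (length \<eta>) \<sigma>) \<noteq> []" using R unfolding l Reg_def fresh_def by simp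
    ultimately show ?thesis by (auto simp: suffix_def)
  qed
  then show "\<sigma> \<in> Om \<and> rseg \<sigma> = \<eta>" using r by (simp add: Om_def stay_def)
qed

lemma stake_prob_support:
  assumes "x \<in> G" "\<not> set \<pi> \<subseteq> S" "D \<in> sets SS"
  shows "measure (Aw x) {\<sigma>. stake (length \<pi>) \<sigma> = \<pi> \<and> sdrop (length \<pi>) \<sigma> \<in> D} = 0"
proof (rule Aw_support[OF assms(1)])
  fix \<sigma> assume a: "\<sigma> \<in> {\<sigma>. stake (length \<pi>) \<sigma> = \<pi> \<and> sdrop (length \<pi>) \<sigma> \<in> D}" "\<And>n. \<sigma> !! n \<in> S"
  then have "set \<pi> \<subseteq> S" using set_stake_subset[of \<sigma> S "length \<pi>"] by simp
  then show False using assms by simp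
qed (use stake_sdrop_sets[OF assms(3), of "\<lambda>\<rho>. \<rho> = \<pi>"] in simp)

lemma Aw_regen:
  assumes x: "x \<in> G" and r: "regpath x b \<pi>" and D: "D \<in> sets SS"
  shows "measure (Aw x) {\<sigma>. stake (length \<pi>) \<sigma> = \<pi> \<and> sdrop (length \<pi>) \<sigma> \<in> stay s0 \<inter> D}
    = measure (Aw x) {\<sigma>. stake (length \<pi>) \<sigma> = \<pi>} * (esc s0 * measure nu D)"
proof -
  have Dm: "stay s0 \<inter> D \<in> sets SS" using D by auto
  have e: "measure (Aw [s0]) (stay s0 \<inter> D) = esc s0 * measure nu D" using nu_measure[OF D] esc_s0 by simp
  show ?thesis
  proof (cases "set \<pi> \<subseteq> S")
    case True
    have "cone_local (hd (run x \<pi>)) (stay s0 \<inter> D)"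
      using r by (intro cone_local_subset_stay) (auto simp: regpath_def)
    then show ?thesis using Aw_fresh[OF x True _ Dm] r e by (simp add: regpath_def)
  next
    case False
    then show ?thesis using stake_prob_support[OF x False Dm] stake_prob_support[OF x False UNIV_SS] by simp
  qed
qed

lemma rseg_measurable: "rseg \<in> measurable nu (count_space UNIV)"
  unfolding rseg_def[abs_def] measurable_cong_sets[OF sets_nu refl] by (rule stake_Rtime_measurable)

lemma rnxt_measurable: "rnxt \<in> measurable nu nu"
  unfolding rnxt_def[abs_def] measurable_cong_sets[OF sets_nu sets_nu] by (rule sdrop_Rtime_measurable)

text \<open>The factor \<open>esc s0\<close> from the new cone cancels the normalisation of
  \<open>nu\<close>; what remains is the weight of the segment times the law \<open>nu\<close> of
  the remainder.\<close>

lemma nu_seg: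
  assumes D: "D \<in> sets SS"
  shows "measure nu {\<sigma>. rseg \<sigma> = \<eta> \<and> rnxt \<sigma> \<in> D} = (if goodseg \<eta> then measure (Aw [s0]) {\<sigma>. stake (length \<eta>) \<sigma> = \<eta>} else 0) * measure nu D"
proof -
  interpret nu: prob_space nu by (rule prob_space_nu)
  let ?L = "{\<sigma>. rseg \<sigma> = \<eta> \<and> rnxt \<sigma> \<in> D}" and ?R = "{\<sigma>. goodseg \<eta> \<and> stake (length \<eta>) \<sigma> = \<eta> \<and> sdrop (length \<eta>) \<sigma> \<in> stay s0 \<inter> D}"
  have e: "Om \<inter> ?L = ?R"
  proof (intro set_eqI iffI)
    fix \<sigma> assume s: "\<sigma> \<in> Om \<inter> ?L"
    then have l: "Rtime [s0] 1 \<sigma> = length \<eta>" by (auto simp: rseg_def)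
    show "\<sigma> \<in> ?R" using s rseg_iff[of \<sigma> \<eta>] l by (auto simp: rnxt_def)
  next
    fix \<sigma> assume s: "\<sigma> \<in> ?R"
    then have o: "\<sigma> \<in> Om \<and> rseg \<sigma> = \<eta>" using rseg_iff[of \<sigma> \<eta>] by simp
    then have l: "Rtime [s0] 1 \<sigma> = length \<eta>" by (auto simp: rseg_def)
    show "\<sigma> \<in> Om \<inter> ?L" using s o l by (auto simp: rnxt_def)
  qed
  have Lm: "?L \<in> sets nu"
  proof -
    have "?L = (rseg -` {\<eta>} \<inter> space nu) \<inter> (rnxt -` D \<inter> space nu)" by auto
    then show ?thesis using measurable_sets[OF rseg_measurable, of "{\<eta>}"] measurable_sets[OF rnxt_measurable, of D] D by auto
  qed
  have Rm: "?R \<in> sets SS"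
  proof -
    have "?R \<in> sets nu" unfolding e[symmetric] by (rule sets.Int[OF _ Lm]) (simp add: Om_sets)
    then show ?thesis by simp
  qed
  have "measure nu ?L = measure nu ?R"
    by (rule nu.finite_measure_eq_AE) (use AE_Om e Lm Rm in \<open>auto elim!: eventually_mono\<close>)
  also have "\<dots> = measure (Aw [s0]) (stay s0 \<inter> ?R) / esc s0" by (rule nu_measure[OF Rm])
  also have "stay s0 \<inter> ?R = ?R" using e by (auto simp: Om_def)
  finally have 1: "measure nu ?L = measure (Aw [s0]) ?R / esc s0" .
  show ?thesis
  proof (cases "goodseg \<eta>")
    case True
    then have "measure (Aw [s0]) ?R = measure (Aw [s0]) {\<sigma>. stake (length \<eta>) \<sigma> = \<eta>} * (esc s0 * measure nu D)"
      using Aw_regen[of "[s0]" 1 \<eta> D] D by (simp add: goodseg_def)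
    then show ?thesis using 1 True esc_s0 by simp
  next
    case False
    then show ?thesis using 1 by simp
  qed
qed

lemma rseg_length: "length (rseg \<sigma>) = Rtime [s0] 1 \<sigma>" "1 \<le> length (rseg \<sigma>)"
  using Rtime_ge[of 1 "[s0]" \<sigma>] by (simp_all add: rseg_def)

text \<open>The maximum makes the duration positive for every list, as \<open>T_pos\<close> demands;
  the lists \<open>rseg \<sigma>\<close> have length at least 1 anyway.\<close>

definition durT :: "letter list \<Rightarrow> nat" where "durT \<eta> = max 1 (length \<eta>)"
text \<open>The height gained in a segment: 1 is the height of the starting vertex
  \<open>[s0]\<close>.\<close>

definition lvlL :: "letter list \<Rightarrow> real" where "lvlL \<eta> = real (length (run [s0] \<eta>)) - 1"
definition rewY :: "letter list \<Rightarrow> real" where "rewY \<eta> = lvlL \<eta> - v * real (durT \<eta>)"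

lemma durT_rseg: "durT (rseg \<sigma>) = Rtime [s0] 1 \<sigma>"
  using rseg_length[of \<sigma>] by (simp add: durT_def)

lemma rewY_le: "\<bar>rewY \<eta>\<bar> \<le> (1 + v) * real (durT \<eta>)"
proof -
  have "\<bar>lvlL \<eta>\<bar> \<le> real (length \<eta>)"
    using length_run_le[of "[s0]" \<eta>] length_le_run[of "[s0]" \<eta>] by (simp add: lvlL_def abs_le_iff)
  also have "\<dots> \<le> real (durT \<eta>)" by (simp add: durT_def)
  finally have 1: "\<bar>lvlL \<eta>\<bar> \<le> real (durT \<eta>)" .
  have "\<bar>rewY \<eta>\<bar> \<le> \<bar>lvlL \<eta>\<bar> + \<bar>v * real (durT \<eta>)\<bar>" unfolding rewY_def by (rule abs_triangle_ineq4)
  also have "\<bar>v * real (durT \<eta>)\<bar> = v * real (durT \<eta>)" using v_pos by simp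
  finally show ?thesis using 1 by (simp add: algebra_simps)
qed

text \<open>The reward locale takes this constant as a parameter, so the existential in
  \<open>noreg_tail\<close> is turned into a term; dividing by \<open>esc s0\<close> accounts for
  the conditioning in \<open>nu\<close>.\<close>

definition tailC :: real where
  "tailC = (SOME C. 0 < C \<and> (\<forall>n>0. measure (Aw [s0]) (noreg n) \<le> C / real n ^ 4)) / esc s0"

lemma tailC: "0 < tailC" "0 < n \<Longrightarrow> measure (Aw [s0]) (noreg n) / esc s0 \<le> tailC / real n ^ 4"
proof -
  let ?C = "SOME C. 0 < C \<and> (\<forall>n>0. measure (Aw [s0]) (noreg n) \<le> C / real n ^ 4)"
  have C: "0 < ?C \<and> (\<forall>n>0. measure (Aw [s0]) (noreg n) \<le> ?C / real n ^ 4)"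
    using someI_ex[OF noreg_tail[unfolded Bex_def, simplified]] by simp
  show "0 < tailC" using C esc_s0 by (simp add: tailC_def)
  assume "0 < n"
  then have "measure (Aw [s0]) (noreg n) / esc s0 \<le> ?C / real n ^ 4 / esc s0" using C esc_s0 by (intro divide_right_mono) auto
  then show "measure (Aw [s0]) (noreg n) / esc s0 \<le> tailC / real n ^ 4" by (simp add: tailC_def mult.commute)
qed

lemma rw_renewal: "renewal nu rseg rnxt"
proof -
  interpret nu: prob_space nu by (rule prob_space_nu)
  show ?thesis
  proof unfold_locales
    show "rseg \<in> measurable nu (count_space UNIV)" by (rule rseg_measurable)
    show "rnxt \<in> measurable nu nu" by (rule rnxt_measurable)
    fix b D assume "D \<in> sets nu"
    then have D: "D \<in> sets SS" by simp
    have "measure nu {\<sigma>. rseg \<sigma> = b} = (if goodseg b then measure (Aw [s0]) {\<sigma>. stake (length b) \<sigma> = b} else 0)"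
      using nu_seg[OF UNIV_SS, of b] nu.prob_space by simp
    then show "measure nu {x \<in> space nu. rseg x = b \<and> rnxt x \<in> D} = measure nu {x \<in> space nu. rseg x = b} * measure nu D"
      using nu_seg[OF D, of b] by simp
  qed
qed

sublocale ren: renewal_reward nu rseg rnxt durT rewY "1 + v" tailC
proof -
  interpret ren: renewal nu rseg rnxt by (rule rw_renewal)
  show "renewal_reward nu rseg rnxt durT rewY (1 + v) tailC"
  proof unfold_locales
    show "1 \<le> durT b" for b by (simp add: durT_def)
    show "0 < tailC" by (rule tailC)
    show "\<bar>rewY b\<bar> \<le> (1 + v) * real (durT b)" for b by (rule rewY_le)
    fix n :: nat assume n: "0 < n"
    have nm: "noreg n \<in> sets nu" by (simp add: noreg_sets)
    have "measure nu {\<sigma>. n < durT (rseg \<sigma>)} \<le> measure nu (noreg n)"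
    proof (rule ren.finite_measure_mono_AE[OF _ nm])
      show "AE \<sigma> in nu. \<sigma> \<in> {\<sigma>. n < durT (rseg \<sigma>)} \<longrightarrow> \<sigma> \<in> noreg n"
        using AE_Om
      proof eventually_elim
        case (elim \<sigma>)
        then have ex: "\<exists>n\<ge>1. Reg [s0] \<sigma> n" by (simp add: Om_def)
        show ?case using elim Rtime_props(3)[OF ex] unfolding durT_rseg noreg_def Om_def by auto
      qed
    qed
    also have "\<dots> = measure (Aw [s0]) (noreg n) / esc s0"
    proof -
      have "stay s0 \<inter> noreg n = noreg n" by (auto simp: noreg_def)
      then show ?thesis using nu_measure[OF noreg_sets, of n] by simp
    qed
    also have "\<dots> \<le> tailC / real n ^ 4" by (rule tailC(2)[OF n])
    finally show "measure nu {x \<in> space nu. n < durT (rseg x)} \<le> tailC / real n ^ 4" by simp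
  qed
qed

end

section \<open>Slutsky's lemma and scaled normal limits\<close>

text \<open>Comparison of characteristic functions: \<open>iexp\<close> is 1-Lipschitz, so off a set
  of small probability the integrands differ by at most \<open>\<bar>t\<bar> * \<eta>\<close>, and
  on it by at most 2.\<close>

lemma (in prob_space) slutsky:
  fixes X Z :: "nat \<Rightarrow> 'a \<Rightarrow> real"
  assumes X: "\<And>n. X n \<in> borel_measurable M" and Z: "\<And>n. Z n \<in> borel_measurable M"
    and L: "real_distribution L" and conv: "weak_conv_m (\<lambda>n. distr M borel (X n)) L"
    and close: "\<And>\<eta>. 0 < \<eta> \<Longrightarrow> (\<lambda>n. prob {x \<in> space M. \<eta> < \<bar>Z n x - X n x\<bar>}) \<longlonglongrightarrow> 0"
  shows "weak_conv_m (\<lambda>n. distr M borel (Z n)) L"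
proof (rule levy_continuity[OF _ L])
  show "real_distribution (distr M borel (Z n))" for n using Z by simp
  fix t :: real
  have cX: "(\<lambda>n. char (distr M borel (X n)) t) \<longlonglongrightarrow> char L t"
    by (rule levy_continuity1[OF _ L conv]) (use X in simp)
  have ch: "char (distr M borel (V n)) t = (CLINT x|M. iexp (t * V n x))" if "\<And>n. V n \<in> borel_measurable M" for V :: "nat \<Rightarrow> 'a \<Rightarrow> real" and n
    unfolding char_def using that by (subst integral_distr) auto
  have ie: "integrable M (\<lambda>x. iexp (t * V n x))" if "\<And>n. V n \<in> borel_measurable M" for V :: "nat \<Rightarrow> 'a \<Rightarrow> real" and n
    by (rule integrable_const_bound[where B=1]) (use that in auto)
  have lip: "cmod (iexp a - iexp b) \<le> \<bar>a - b\<bar>" for a b :: real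
  proof -
    have "iexp a - iexp b = iexp b * (iexp (a - b) - 1)"
      by (simp add: right_diff_distrib exp_add[symmetric] algebra_simps)
    then have "cmod (iexp a - iexp b) = cmod (iexp (a - b) - 1)" by (simp add: norm_mult)
    also have "\<dots> \<le> \<bar>a - b\<bar>" using iexp_approx1[of "a - b" 0] by simp
    finally show ?thesis .
  qed
  have "(\<lambda>n. char (distr M borel (Z n)) t - char (distr M borel (X n)) t) \<longlonglongrightarrow> 0"
  proof (rule LIMSEQ_I)
    fix r :: real assume r: "0 < r"
    define \<eta> where "\<eta> = r / (2 * (\<bar>t\<bar> + 1))"
    have eta: "0 < \<eta>" "\<bar>t\<bar> * \<eta> < r / 2" using r by (auto simp: \<eta>_def field_simps)
    let ?B = "\<lambda>n. {x \<in> space M. \<eta> < \<bar>Z n x - X n x\<bar>}"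
    have Bm: "?B n \<in> sets M" for n using X Z by measurable
    have le: "cmod (char (distr M borel (Z n)) t - char (distr M borel (X n)) t) \<le> \<bar>t\<bar> * \<eta> + 2 * prob (?B n)" for n
    proof -
      have "char (distr M borel (Z n)) t - char (distr M borel (X n)) t = (CLINT x|M. iexp (t * Z n x) - iexp (t * X n x))"
        using ch[of Z n, OF Z] ch[of X n, OF X] ie[of Z n, OF Z] ie[of X n, OF X] by simp
      then have "cmod (char (distr M borel (Z n)) t - char (distr M borel (X n)) t) \<le> (\<integral>x. cmod (iexp (t * Z n x) - iexp (t * X n x)) \<partial>M)"
        using integral_norm_bound[of M "\<lambda>x. iexp (t * Z n x) - iexp (t * X n x)"] by simp
      also have "\<dots> \<le> (\<integral>x. \<bar>t\<bar> * \<eta> + 2 * indicator (?B n) x \<partial>M)"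
      proof (rule integral_mono)
        show "integrable M (\<lambda>x. cmod (iexp (t * Z n x) - iexp (t * X n x)))"
          using ie[of Z n, OF Z] ie[of X n, OF X] by (intro integrable_norm Bochner_Integration.integrable_diff)
        show "integrable M (\<lambda>x. \<bar>t\<bar> * \<eta> + 2 * indicat_real (?B n) x)"
          using Bm[of n] by (intro Bochner_Integration.integrable_add integrable_mult_right integrable_real_indicator) (auto simp: emeasure_eq_measure)
        fix x assume x: "x \<in> space M"
        show "cmod (iexp (t * Z n x) - iexp (t * X n x)) \<le> \<bar>t\<bar> * \<eta> + 2 * indicator (?B n) x"
        proof (cases "x \<in> ?B n")
          case True
          have "cmod (iexp (t * Z n x) - iexp (t * X n x)) \<le> cmod (iexp (t * Z n x)) + cmod (iexp (t * X n x))"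
            by (rule norm_triangle_ineq4)
          also have "\<dots> = 2" by simp
          also have "2 \<le> \<bar>t\<bar> * \<eta> + 2 * indicator (?B n) x" using True eta by simp
          finally show ?thesis .
        next
          case False
          then have "\<bar>Z n x - X n x\<bar> \<le> \<eta>" using x by auto
          then have "\<bar>t\<bar> * \<bar>Z n x - X n x\<bar> \<le> \<bar>t\<bar> * \<eta>" by (intro mult_left_mono) auto
          then have "\<bar>t * Z n x - t * X n x\<bar> \<le> \<bar>t\<bar> * \<eta>" by (simp add: abs_mult[symmetric] right_diff_distrib)
          then show ?thesis using lip[of "t * Z n x" "t * X n x"] False by simp
        qed
      qed
      also have "\<dots> = \<bar>t\<bar> * \<eta> + 2 * prob (?B n)"
        using Bm[of n] by (simp add: prob_space emeasure_eq_measure)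
      finally show ?thesis .
    qed
    obtain n0 where n0: "\<And>n. n \<ge> n0 \<Longrightarrow> prob (?B n) < r / 4"
      using order_tendstoD(2)[OF close[OF eta(1)], of "r / 4"] r by (auto simp: eventually_sequentially)
    show "\<exists>no. \<forall>n\<ge>no. norm (char (distr M borel (Z n)) t - char (distr M borel (X n)) t - 0) < r"
    proof (intro exI[of _ n0] allI impI)
      fix n assume "n0 \<le> n"
      then have "2 * prob (?B n) < r / 2" using n0[of n] by simp
      then show "norm (char (distr M borel (Z n)) t - char (distr M borel (X n)) t - 0) < r"
        using le[of n] eta(2) by simp
    qed
  qed
  then show "(\<lambda>n. char (distr M borel (Z n)) t) \<longlonglongrightarrow> char L t"
    using tendsto_add[OF _ cX] by fastforce
qed

lemma scaled_normal:
  assumes c: "0 < c"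
  shows "density lborel (normal_density 0 c) = distr std_normal_distribution borel (\<lambda>x. c * x)"
proof -
  interpret std: prob_space std_normal_distribution by (rule prob_space_normal_density) simp
  have "distributed std_normal_distribution lborel (\<lambda>x. x) (normal_density 0 1)"
    unfolding distributed_def by (auto simp: distr_id2)
  then have "distributed std_normal_distribution lborel (\<lambda>x. 0 + c * x) (normal_density (0 + c * 0) (\<bar>c\<bar> * 1))"
    by (rule std.normal_density_affine) (use c in auto)
  then have "distr std_normal_distribution lborel (\<lambda>x. c * x) = density lborel (normal_density 0 c)"
    using c by (simp add: distributed_def)
  moreover have "distr std_normal_distribution lborel (\<lambda>x. c * x) = distr std_normal_distribution borel (\<lambda>x. c * x)"
    by (rule distr_cong) auto
  ultimately show ?thesis by simp
qed

lemma (in prob_space) scaled_clt: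
  assumes V: "\<And>n. V n \<in> borel_measurable M" and conv: "weak_conv_m (\<lambda>n. distr M borel (V n)) std_normal_distribution" and c: "0 < c"
  shows "weak_conv_m (\<lambda>n. distr M borel (\<lambda>x. c * V n x)) (density lborel (normal_density 0 c))"
proof (rule levy_continuity)
  show "real_distribution (distr M borel (\<lambda>x. c * V n x))" for n using V by simp
  interpret std: prob_space std_normal_distribution by (rule prob_space_normal_density) simp
  show "real_distribution (density lborel (normal_density 0 c))"
    unfolding scaled_normal[OF c] by (rule std.real_distribution_distr) simp
  fix t
  have "char (distr std_normal_distribution borel (\<lambda>x. c * x)) t = char (distr std_normal_distribution borel (\<lambda>x. x)) (c * t)"
    unfolding char_def by (simp add: integral_distr mult_ac)
  also have "distr std_normal_distribution borel (\<lambda>x. x) = std_normal_distribution" by (rule distr_id2) simp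
  finally have e: "char (density lborel (normal_density 0 c)) t = char std_normal_distribution (c * t)"
    unfolding scaled_normal[OF c] .
  have e2: "char (distr M borel (\<lambda>x. c * V n x)) t = char (distr M borel (V n)) (c * t)" for n
    unfolding char_def using V by (simp add: integral_distr mult_ac)
  show "(\<lambda>n. char (distr M borel (\<lambda>x. c * V n x)) t) \<longlonglongrightarrow> char (density lborel (normal_density 0 c)) t"
    unfolding e e2 by (rule levy_continuity1[OF _ real_dist_normal_dist conv]) (use V in simp)
qed

lemma weak_conv_m_compose:
  "weak_conv_m \<nu> L \<Longrightarrow> filterlim a at_top sequentially \<Longrightarrow> weak_conv_m (\<lambda>n. \<nu> (a n)) L"
  unfolding weak_conv_m_def weak_conv_def by (auto intro: filterlim_compose)

section \<open>The central limit theorem for the walk\<close>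

context rwre_speed
begin

definition len :: "letter stream \<Rightarrow> nat \<Rightarrow> real" where
  "len \<sigma> n = real (length (run [s0] (stake n \<sigma>)))"

lemma len_0 [simp]: "len \<sigma> 0 = 1" by (simp add: len_def)

lemma len_bounds: "0 \<le> len \<sigma> n" "len \<sigma> n \<le> 1 + real n"
  using length_run_le[of "[s0]" "stake n \<sigma>"] by (simp_all add: len_def)

lemma len_Lipschitz: "\<bar>len \<sigma> (m + n) - len \<sigma> m\<bar> \<le> real n"
  using length_run_le[of "run [s0] (stake m \<sigma>)" "stake n (sdrop m \<sigma>)"] length_le_run[of "run [s0] (stake m \<sigma>)" "stake n (sdrop m \<sigma>)"]
  unfolding len_def stake_add_run by (simp add: abs_le_iff)

lemma regen_len:
  assumes R: "Reg x \<sigma> n"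
  shows "real (length (run x (stake (n + m) \<sigma>))) = real (length (run x (stake n \<sigma>))) - 1 + len (sdrop n \<sigma>) m"
proof -
  obtain w where w: "run x (stake n \<sigma>) = s0 # w" using R by (cases "run x (stake n \<sigma>)") (auto simp: Reg_def fresh_def)
  have "run ([s0] @ w) (stake m (sdrop n \<sigma>)) = run [s0] (stake m (sdrop n \<sigma>)) @ w"
    by (rule run_stake_app_base) (use R in \<open>auto simp: Reg_def stay_def\<close>)
  then show ?thesis unfolding stake_add_run w len_def by simp
qed

lemma len_iter:
  assumes Om: "\<And>j. (rnxt ^^ j) \<sigma> \<in> Om"
  shows "len \<sigma> (ren.rho l \<sigma> + m) = (\<Sum>j<l. lvlL (ren.segn j \<sigma>)) + len ((rnxt ^^ l) \<sigma>) m"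
proof (induction l arbitrary: m)
  case 0
  then show ?case by (simp add: ren.rho_def)
next
  case (Suc l)
  let ?\<tau> = "(rnxt ^^ l) \<sigma>"
  have ex: "\<exists>n\<ge>1. Reg [s0] ?\<tau> n" using Om[of l] by (simp add: Om_def)
  have T: "durT (ren.segn l \<sigma>) = Rtime [s0] 1 ?\<tau>" unfolding ren.segn_def by (rule durT_rseg)
  have "len \<sigma> (ren.rho (Suc l) \<sigma> + m) = len \<sigma> (ren.rho l \<sigma> + (Rtime [s0] 1 ?\<tau> + m))"
    by (simp add: ren.rho_Suc T add.assoc)
  also have "\<dots> = (\<Sum>j<l. lvlL (ren.segn j \<sigma>)) + len ?\<tau> (Rtime [s0] 1 ?\<tau> + m)" by (rule Suc.IH)
  also have "len ?\<tau> (Rtime [s0] 1 ?\<tau> + m) = lvlL (ren.segn l \<sigma>) + len (rnxt ?\<tau>) m"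
    using regen_len[OF Rtime_props(2)[OF ex], of m] by (simp add: len_def lvlL_def ren.segn_def rseg_def rnxt_def)
  finally show ?case by simp
qed

lemma AE_iter_Om: "AE \<sigma> in nu. \<forall>j. (rnxt ^^ j) \<sigma> \<in> Om"
proof (subst AE_all_countable, rule allI)
  fix j
  have "ren.prob Om = 1" using AE_Om ren.prob_eq_1[of Om] by simp
  then have "ren.prob {\<sigma>. (rnxt ^^ j) \<sigma> \<in> Om} = 1" using ren.prob_iter[of Om j] by simp
  moreover have "{\<sigma>. (rnxt ^^ j) \<sigma> \<in> Om} \<in> sets nu"
    using measurable_sets[OF ren.iter_measurable[of j], of Om] by (simp add: vimage_def)
  ultimately show "AE \<sigma> in nu. (rnxt ^^ j) \<sigma> \<in> Om"
    using ren.prob_eq_1[of "{\<sigma>. (rnxt ^^ j) \<sigma> \<in> Om}"] by simp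
qed

lemma W_eq:
  assumes Om: "\<And>j. (rnxt ^^ j) \<sigma> \<in> Om"
  shows "len \<sigma> (ren.rho l \<sigma> + m) = ren.W l \<sigma> + v * real (ren.rho l \<sigma>) + len ((rnxt ^^ l) \<sigma>) m"
proof -
  have "ren.W l \<sigma> = (\<Sum>j<l. lvlL (ren.segn j \<sigma>)) - v * real (ren.rho l \<sigma>)"
    by (simp add: ren.W_def ren.rho_def rewY_def sum_subtractf sum_distrib_left)
  then show ?thesis using len_iter[OF Om, of l m] by simp
qed

text \<open>The index \<open>N n - 1\<close> belongs to the segment in progress at time
  \<open>n\<close>. The height within it, the time spent in it and its full reward, which
  \<open>W (N n)\<close> already contains, are all bounded by multiples of its duration.\<close>

lemma len_approx:
  assumes Om: "\<And>j. (rnxt ^^ j) \<sigma> \<in> Om"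
  shows "\<exists>k\<le>n. \<bar>len \<sigma> n - v * real n - ren.W (ren.N n \<sigma>) \<sigma>\<bar> \<le> (3 + 2 * v) * real (durT (ren.segn k \<sigma>))"
proof (intro exI conjI)
  let ?k = "ren.N n \<sigma> - 1"
  note N = ren.N_props[of n \<sigma>]
  show "?k \<le> n" using N by simp
  have Nk: "ren.N n \<sigma> = Suc ?k" using N(1) by simp
  let ?T = "durT (ren.segn ?k \<sigma>)"
  define m where "m = n - ren.rho ?k \<sigma>"
  have n: "n = ren.rho ?k \<sigma> + m" using N(3) by (simp add: m_def)
  have "n < ren.rho ?k \<sigma> + ?T" using N(4) ren.rho_Suc[of ?k \<sigma>] Nk by simp
  then have mT: "real m \<le> real ?T" "1 \<le> real ?T" using n ren.T_pos[of "ren.segn ?k \<sigma>"] by auto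
  have "ren.W (ren.N n \<sigma>) \<sigma> = ren.W ?k \<sigma> + rewY (ren.segn ?k \<sigma>)"
    by (subst Nk) (simp add: ren.W_def)
  moreover have "len \<sigma> n = ren.W ?k \<sigma> + v * real (ren.rho ?k \<sigma>) + len ((rnxt ^^ ?k) \<sigma>) m"
    using W_eq[OF Om, of ?k m] n by simp
  moreover have "v * real n = v * real (ren.rho ?k \<sigma>) + v * real m"
  proof -
    have "real n = real (ren.rho ?k \<sigma>) + real m" using n by (metis of_nat_add)
    then show ?thesis by (simp only: distrib_left)
  qed
  ultimately have e: "len \<sigma> n - v * real n - ren.W (ren.N n \<sigma>) \<sigma> = len ((rnxt ^^ ?k) \<sigma>) m - v * real m - rewY (ren.segn ?k \<sigma>)"
    by linarith
  have y: "\<bar>rewY (ren.segn ?k \<sigma>)\<bar> \<le> real ?T + v * real ?T" using rewY_le[of "ren.segn ?k \<sigma>"] by (simp add: algebra_simps)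
  have vm: "0 \<le> v * real m" "v * real m \<le> v * real ?T" using v_pos mT by (auto intro: mult_left_mono)
  \<comment> \<open>The height is at most \<open>1 + m\<close>, hence at most twice the duration;
    the reward adds \<open>1 + v\<close> times and the elapsed time \<open>v\<close> times the
    duration.\<close>
  have "\<bar>len ((rnxt ^^ ?k) \<sigma>) m - v * real m - rewY (ren.segn ?k \<sigma>)\<bar> \<le> 3 * real ?T + 2 * (v * real ?T)"
    using len_bounds[of "(rnxt ^^ ?k) \<sigma>" m] y vm mT by linarith
  then show "\<bar>len \<sigma> n - v * real n - ren.W (ren.N n \<sigma>) \<sigma>\<bar> \<le> (3 + 2 * v) * real ?T"
    unfolding e by (simp add: algebra_simps)
qed

section \<open>The walk from the root after its first regeneration\<close>

definition sh :: "letter stream \<Rightarrow> letter stream" where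
  "sh \<sigma> = sdrop (Rtime [] 0 \<sigma>) \<sigma>"

lemma AE_Reg_root: "AE \<sigma> in Aw []. \<exists>n\<ge>0. Reg [] \<sigma> n"
proof -
  have "AE \<sigma> in Aw []. \<forall>h. \<exists>n. h \<le> length (run [] (stake n \<sigma>))"
    using speed_Aw
  proof eventually_elim
    case (elim \<sigma>)
    show ?case
    proof
      fix h
      obtain N where "\<forall>n>N. h \<le> length (run [] (stake n \<sigma>))" using eventually_large[OF elim, of h] by blast
      then show "\<exists>n. h \<le> length (run [] (stake n \<sigma>))" by blast
    qed
  qed
  then have "AE \<sigma> in Aw []. \<forall>N. \<exists>m\<ge>N. Reg [] \<sigma> m" by (rule Reg_infinite) auto
  then show ?thesis by eventually_elim auto
qed

lemma sh_measurable: "sh \<in> measurable (Aw []) nu"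
  unfolding sh_def[abs_def] measurable_cong_sets[OF sets_Aw sets_nu] by (rule sdrop_Rtime_measurable)

text \<open>Summing over the path up to the first regeneration shows that the law of the rest is a
  constant multiple of \<open>nu\<close>; the constant is 1 because both are probability
  measures.\<close>

lemma distr_sh: "distr (Aw []) nu sh = nu"
proof -
  interpret A: prob_space "Aw []" by (rule prob_space_Aw) simp
  let ?X = "\<lambda>D \<pi>. {\<sigma>. stake (length \<pi>) \<sigma> = \<pi> \<and> sdrop (length \<pi>) \<sigma> \<in> stay s0 \<inter> D}"
  have Xm: "?X D \<pi> \<in> sets SS" if "D \<in> sets SS" for D \<pi>
    using stake_sdrop_sets[of "stay s0 \<inter> D" "\<lambda>\<rho>. \<rho> = \<pi>" "length \<pi>"] that by auto
  have main: "emeasure (Aw []) {\<sigma>. sh \<sigma> \<in> D} = (\<integral>\<^sup>+\<pi>. emeasure (Aw []) {\<sigma>. stake (length \<pi>) \<sigma> = \<pi>} * ennreal (esc s0) \<partial>count_space {\<pi>. regpath [] 0 \<pi>}) * emeasure nu D"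
    if D: "D \<in> sets SS" for D
  proof -
    have e: "{\<sigma>. \<exists>n\<ge>0. Reg [] \<sigma> n} \<inter> {\<sigma>. sh \<sigma> \<in> D} = (\<Union>\<pi>\<in>{\<pi>. regpath [] 0 \<pi>}. ?X D \<pi>)"
    proof (intro set_eqI iffI)
      fix \<sigma> assume s: "\<sigma> \<in> {\<sigma>. \<exists>n\<ge>0. Reg [] \<sigma> n} \<inter> {\<sigma>. sh \<sigma> \<in> D}"
      let ?\<pi> = "stake (Rtime [] 0 \<sigma>) \<sigma>"
      have "regpath [] 0 ?\<pi> \<and> stake (length ?\<pi>) \<sigma> = ?\<pi> \<and> sdrop (length ?\<pi>) \<sigma> \<in> stay s0"
        using Rtime_regpath[of 0 "[]" \<sigma> ?\<pi>] s by simp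
      then show "\<sigma> \<in> (\<Union>\<pi>\<in>{\<pi>. regpath [] 0 \<pi>}. ?X D \<pi>)" using s by (intro UN_I[of ?\<pi>]) (auto simp: sh_def)
    next
      fix \<sigma> assume "\<sigma> \<in> (\<Union>\<pi>\<in>{\<pi>. regpath [] 0 \<pi>}. ?X D \<pi>)"
      then obtain \<pi> where p: "regpath [] 0 \<pi>" "stake (length \<pi>) \<sigma> = \<pi>" "sdrop (length \<pi>) \<sigma> \<in> stay s0" "sdrop (length \<pi>) \<sigma> \<in> D" by auto
      then have r: "(\<exists>n\<ge>0. Reg [] \<sigma> n) \<and> stake (Rtime [] 0 \<sigma>) \<sigma> = \<pi>"
        using Rtime_regpath[of 0 "[]" \<sigma> \<pi>] by blast
      then have "Rtime [] 0 \<sigma> = length \<pi>" by auto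
      then show "\<sigma> \<in> {\<sigma>. \<exists>n\<ge>0. Reg [] \<sigma> n} \<inter> {\<sigma>. sh \<sigma> \<in> D}" using r p by (simp add: sh_def)
    qed
    have Sm: "{\<sigma>. sh \<sigma> \<in> D} \<in> sets (Aw [])"
      using measurable_sets[OF sh_measurable, of D] D by (simp add: vimage_def)
    have Um: "(\<Union>\<pi>\<in>{\<pi>. regpath [] 0 \<pi>}. ?X D \<pi>) \<in> sets (Aw [])"
      using Xm[OF D] by (auto intro!: sets.countable_UN')
    have "emeasure (Aw []) {\<sigma>. sh \<sigma> \<in> D} = emeasure (Aw []) (\<Union>\<pi>\<in>{\<pi>. regpath [] 0 \<pi>}. ?X D \<pi>)"
    proof (rule emeasure_eq_AE[OF _ Sm Um])
      show "AE \<sigma> in Aw []. (\<sigma> \<in> {\<sigma>. sh \<sigma> \<in> D}) = (\<sigma> \<in> (\<Union>\<pi>\<in>{\<pi>. regpath [] 0 \<pi>}. ?X D \<pi>))"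
        unfolding e[symmetric] using AE_Reg_root by eventually_elim auto
    qed
    also have "\<dots> = (\<integral>\<^sup>+\<pi>. emeasure (Aw []) (?X D \<pi>) \<partial>count_space {\<pi>. regpath [] 0 \<pi>})"
    proof (rule emeasure_UN_countable)
      show "disjoint_family_on (?X D) {\<pi>. regpath [] 0 \<pi>}"
        unfolding disjoint_family_on_def
      proof (intro ballI impI, rule ccontr)
        fix \<pi> \<rho> assume a: "\<pi> \<in> {\<pi>. regpath [] 0 \<pi>}" "\<rho> \<in> {\<pi>. regpath [] 0 \<pi>}" "\<pi> \<noteq> \<rho>" "?X D \<pi> \<inter> ?X D \<rho> \<noteq> {}"
        then obtain \<sigma> where s: "\<sigma> \<in> ?X D \<pi>" "\<sigma> \<in> ?X D \<rho>" by blast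
        have "stake (Rtime [] 0 \<sigma>) \<sigma> = \<pi>" "stake (Rtime [] 0 \<sigma>) \<sigma> = \<rho>"
          using Rtime_regpath[of 0 "[]" \<sigma> \<pi>] Rtime_regpath[of 0 "[]" \<sigma> \<rho>] s a by auto
        then show False using a(3) by simp
      qed
    qed (use Xm[OF D] in auto)
    also have "\<dots> = (\<integral>\<^sup>+\<pi>. emeasure (Aw []) {\<sigma>. stake (length \<pi>) \<sigma> = \<pi>} * ennreal (esc s0) * emeasure nu D \<partial>count_space {\<pi>. regpath [] 0 \<pi>})"
    proof (rule nn_integral_cong)
      fix \<pi> assume "\<pi> \<in> space (count_space {\<pi>. regpath [] 0 \<pi>})"
      then have r: "regpath [] 0 \<pi>" by simp
      show "emeasure (Aw []) (?X D \<pi>) = emeasure (Aw []) {\<sigma>. stake (length \<pi>) \<sigma> = \<pi>} * ennreal (esc s0) * emeasure nu D"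
        using Aw_regen[OF Nil_Gset r D] esc_s0
        by (simp add: A.emeasure_eq_measure ren.emeasure_eq_measure ennreal_mult[symmetric] mult.assoc)
    qed
    also have "\<dots> = (\<integral>\<^sup>+\<pi>. emeasure (Aw []) {\<sigma>. stake (length \<pi>) \<sigma> = \<pi>} * ennreal (esc s0) \<partial>count_space {\<pi>. regpath [] 0 \<pi>}) * emeasure nu D"
      by (rule nn_integral_multc) simp
    finally show ?thesis .
  qed
  have one: "(\<integral>\<^sup>+\<pi>. emeasure (Aw []) {\<sigma>. stake (length \<pi>) \<sigma> = \<pi>} * ennreal (esc s0) \<partial>count_space {\<pi>. regpath [] 0 \<pi>}) = 1"
    using main[OF UNIV_SS] A.emeasure_space_1 ren.emeasure_space_1 by simp
  show ?thesis
  proof (rule measure_eqI)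
    fix D assume "D \<in> sets (distr (Aw []) nu sh)"
    then have D: "D \<in> sets SS" by simp
    have "emeasure (distr (Aw []) nu sh) D = emeasure (Aw []) {\<sigma>. sh \<sigma> \<in> D}"
      using D by (subst emeasure_distr[OF sh_measurable]) (auto simp: vimage_def)
    then show "emeasure (distr (Aw []) nu sh) D = emeasure nu D" using main[OF D] one by simp
  qed simp
qed

lemma root_len: "\<exists>n\<ge>0. Reg [] \<sigma> n \<Longrightarrow>
  real (length (run [] (stake (Rtime [] 0 \<sigma> + m) \<sigma>))) = real (length (run [] (stake (Rtime [] 0 \<sigma>) \<sigma>))) - 1 + len (sh \<sigma>) m"
  unfolding sh_def by (rule regen_len[OF Rtime_props(2)])

text \<open>For each path, the part after the first regeneration differs from the whole by a fixed
  shift of time and height, which does not affect the speed.\<close>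

lemma speed_nu: "AE \<sigma> in nu. (\<lambda>n. len \<sigma> n / real n) \<longlonglongrightarrow> v"
proof -
  have "AE \<sigma> in Aw []. (\<lambda>n. len (sh \<sigma>) n / real n) \<longlonglongrightarrow> v"
    using speed_Aw AE_Reg_root
  proof eventually_elim
    case (elim \<sigma>)
    let ?\<tau> = "Rtime [] 0 \<sigma>" and ?X = "\<lambda>n. real (length (run [] (stake n \<sigma>)))"
    have "(\<lambda>n. ?X (n + ?\<tau>) / real (n + ?\<tau>)) \<longlonglongrightarrow> v" by (rule LIMSEQ_ignore_initial_segment[OF elim(1)])
    moreover have "(\<lambda>n. (real n + real ?\<tau>) / real n) \<longlonglongrightarrow> 1" by real_asymp
    ultimately have 1: "(\<lambda>n. ?X (n + ?\<tau>) / real (n + ?\<tau>) * ((real n + real ?\<tau>) / real n)) \<longlonglongrightarrow> v * 1" by (rule tendsto_mult)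
    have 2: "(\<lambda>n. (?X ?\<tau> - 1) / real n) \<longlonglongrightarrow> 0" by real_asymp
    have "(\<lambda>n. ?X (n + ?\<tau>) / real (n + ?\<tau>) * ((real n + real ?\<tau>) / real n) - (?X ?\<tau> - 1) / real n) \<longlonglongrightarrow> v * 1 - 0"
      by (rule tendsto_diff[OF 1 2])
    moreover have "eventually (\<lambda>n. ?X (n + ?\<tau>) / real (n + ?\<tau>) * ((real n + real ?\<tau>) / real n) - (?X ?\<tau> - 1) / real n = len (sh \<sigma>) n / real n) sequentially"
      using eventually_gt_at_top[of 0]
    proof eventually_elim
      case (elim n)
      have "?X (n + ?\<tau>) = ?X ?\<tau> - 1 + len (sh \<sigma>) n" using root_len[OF \<open>\<exists>n\<ge>0. Reg [] \<sigma> n\<close>, of n] by (simp add: add.commute)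
      moreover have "?X (n + ?\<tau>) / real (n + ?\<tau>) * ((real n + real ?\<tau>) / real n) = ?X (n + ?\<tau>) / real n"
      proof -
        have "real (n + ?\<tau>) \<noteq> 0" using elim by simp
        then show ?thesis unfolding of_nat_add by simp
      qed
      ultimately show ?case by (simp add: add_divide_distrib diff_divide_distrib)
    qed
    ultimately show ?case by (simp add: tendsto_cong)
  qed
  then have "AE \<sigma> in distr (Aw []) nu sh. (\<lambda>n. len \<sigma> n / real n) \<longlonglongrightarrow> v"
  proof (subst AE_distr_iff[OF sh_measurable])
    show "{\<sigma> \<in> space nu. (\<lambda>n. len \<sigma> n / real n) \<longlonglongrightarrow> v} \<in> sets nu"
      using lim_sets[of "\<lambda>n \<pi>. real (length (run [s0] \<pi>)) / real n" v] by (simp add: len_def)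
  qed
  then show ?thesis unfolding distr_sh .
qed

end

section \<open>Mean and variance of the reward\<close>

context rwre_speed
begin

lemma len_event_sets: "{\<sigma>. P (len \<sigma> n)} \<in> sets SS"
  using stake_pred_sets[of "\<lambda>\<pi>. P (real (length (run [s0] \<pi>)))" n] by (simp add: len_def)

text \<open>Uniformity in \<open>n \<ge> l\<close> permits evaluation of the speed at the random
  time \<open>rho l\<close>, which is at least \<open>l\<close>.\<close>

lemma speed_uniform:
  assumes e: "0 < e"
  shows "(\<lambda>l. measure nu {\<sigma>. \<exists>n\<ge>l. e \<le> \<bar>len \<sigma> n / real n - v\<bar>}) \<longlonglongrightarrow> 0"
proof -
  let ?C = "\<lambda>l. {\<sigma>. \<exists>n\<ge>l. e \<le> \<bar>len \<sigma> n / real n - v\<bar>}"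
  have Cm: "?C l \<in> sets nu" for l
  proof -
    have "?C l = (\<Union>n\<in>{l..}. {\<sigma>. e \<le> \<bar>len \<sigma> n / real n - v\<bar>})" by auto
    then show ?thesis using len_event_sets[of "\<lambda>z. e \<le> \<bar>z / real _ - v\<bar>"] by auto
  qed
  have "(\<lambda>l. measure nu (?C l)) \<longlonglongrightarrow> measure nu (\<Inter>l. ?C l)"
    by (rule ren.finite_Lim_measure_decseq) (use Cm in \<open>auto simp: decseq_def intro: order_trans\<close>)
  moreover have "measure nu (\<Inter>l. ?C l) = 0"
  proof -
    have "AE \<sigma> in nu. \<sigma> \<notin> (\<Inter>l. ?C l)"
      using speed_nu
    proof eventually_elim
      case (elim \<sigma>)
      obtain l where l: "\<And>n. n \<ge> l \<Longrightarrow> norm (len \<sigma> n / real n - v) < e" using LIMSEQ_D[OF elim e] by blast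
      have "\<sigma> \<notin> ?C l"
      proof
        assume "\<sigma> \<in> ?C l"
        then obtain n where "l \<le> n" "e \<le> \<bar>len \<sigma> n / real n - v\<bar>" by auto
        then show False using l[of n] by simp
      qed
      then show ?case by blast
    qed
    moreover have "(\<Inter>l. ?C l) \<in> sets nu" using Cm by auto
    ultimately show ?thesis using ren.prob_eq_0[of "\<Inter>l. ?C l"] by simp
  qed
  ultimately show ?thesis by simp
qed

text \<open>At time \<open>rho l\<close> the height minus \<open>v * rho l\<close> equals
  \<open>W l + 1\<close>. By the speed this is small against \<open>rho l\<close>, which is of order
  \<open>l\<close>; by the weak law \<open>W l\<close> is close to \<open>l\<close> times the mean
  reward. So the mean cannot differ from zero.\<close>

lemma reward_mean: "(\<integral>\<sigma>. rewY (rseg \<sigma>) \<partial>nu) = 0"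
proof (rule ccontr)
  let ?e = "\<integral>\<sigma>. rewY (rseg \<sigma>) \<partial>nu"
  assume ne: "?e \<noteq> 0"
  define d where "d = \<bar>?e\<bar> / 2"
  have d: "0 < d" using ne by (simp add: d_def)
  \<comment> \<open>With this choice \<open>e * rho l\<close> is less than \<open>l * d / 2\<close>
    as soon as \<open>rho l < l * (mT + 1)\<close>.\<close>
  define e where "e = d / (2 * (ren.mT + 1))"
  have mT: "0 < ren.mT + 1" using ren.mT_ge by simp
  have e: "0 < e" "e * (ren.mT + 1) = d / 2" using d mT by (auto simp: e_def field_simps)
  let ?A = "\<lambda>l. {\<sigma> \<in> space nu. real l * d \<le> \<bar>(\<Sum>j<l. rewY (ren.segn j \<sigma>)) - real l * ?e\<bar>}"
  let ?B = "\<lambda>l. {\<sigma> \<in> space nu. real l * 1 \<le> \<bar>(\<Sum>j<l. real (durT (ren.segn j \<sigma>))) - real l * (\<integral>\<sigma>. real (durT (rseg \<sigma>)) \<partial>nu)\<bar>}"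
  let ?C = "\<lambda>l. {\<sigma>. \<exists>n\<ge>l. e \<le> \<bar>len \<sigma> n / real n - v\<bar>}"
  let ?vY = "ren.variance (\<lambda>\<sigma>. rewY (rseg \<sigma>))" and ?vT = "ren.variance (\<lambda>\<sigma>. real (durT (rseg \<sigma>)))"
  have A: "measure nu (?A l) \<le> ?vY / d\<^sup>2 / real l" if l: "0 < l" for l
  proof -
    have "measure nu (?A l) \<le> real l * ?vY / (real l * d)\<^sup>2"
      by (rule ren.weak_law[OF ren.Y_int ren.Y_sq]) (use l d in simp)
    then show ?thesis using l by (simp add: power_mult_distrib power2_eq_square mult_ac)
  qed
  have B: "measure nu (?B l) \<le> ?vT / real l" if l: "0 < l" for l
  proof -
    have "measure nu (?B l) \<le> real l * ?vT / (real l * 1)\<^sup>2"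
      by (rule ren.weak_law[of "\<lambda>b. real (durT b)", OF ren.T_int ren.T_sq]) (use l in simp)
    then show ?thesis using l by (simp add: power2_eq_square)
  qed
  have Am: "?A l \<in> sets nu" for l by measurable
  have Bm: "?B l \<in> sets nu" for l by measurable
  have Cm: "?C l \<in> sets nu" for l
  proof -
    have "?C l = (\<Union>n\<in>{l..}. {\<sigma>. e \<le> \<bar>len \<sigma> n / real n - v\<bar>})" by auto
    then show ?thesis using len_event_sets[of "\<lambda>z. e \<le> \<bar>z / real _ - v\<bar>"] by auto
  qed
  have big: "1 \<le> ?vY / d\<^sup>2 / real l + ?vT / real l + measure nu (?C l)" if l: "0 < l" "2 / d < real l" for l
  proof -
    have ae: "AE \<sigma> in nu. \<sigma> \<in> ?A l \<union> (?B l \<union> ?C l)"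
      using AE_iter_Om
    proof eventually_elim
      case (elim \<sigma>)
      then have Om: "\<And>j. (rnxt ^^ j) \<sigma> \<in> Om" by blast
      show ?case
      proof (rule ccontr)
        assume n: "\<sigma> \<notin> ?A l \<union> (?B l \<union> ?C l)"
        let ?n = "ren.rho l \<sigma>"
        have nl: "l \<le> ?n" by (rule ren.rho_ge)
        then have n0: "0 < real ?n" using l by simp
        have a: "\<bar>ren.W l \<sigma> - real l * ?e\<bar> < real l * d" using n by (simp add: ren.W_def not_le)
        have "\<bar>real ?n - real l * ren.mT\<bar> < real l" using n by (simp add: ren.rho_def ren.mT_def not_le)
        then have b: "real ?n < real l * (ren.mT + 1)" by (simp add: algebra_simps abs_less_iff)
        have "\<bar>len \<sigma> ?n / real ?n - v\<bar> < e"
        proof (rule ccontr)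
          assume "\<not> \<bar>len \<sigma> ?n / real ?n - v\<bar> < e"
          then have "\<sigma> \<in> ?C l" using nl by (intro CollectI exI[of _ ?n]) simp
          then show False using n by blast
        qed
        then have "\<bar>len \<sigma> ?n / real ?n - v\<bar> * real ?n < e * real ?n" using n0 by (rule mult_strict_right_mono)
        also have "\<bar>len \<sigma> ?n / real ?n - v\<bar> * real ?n = \<bar>(len \<sigma> ?n / real ?n - v) * real ?n\<bar>" by (simp add: abs_mult)
        also have "(len \<sigma> ?n / real ?n - v) * real ?n = len \<sigma> ?n - v * real ?n" using n0 by (simp add: left_diff_distrib)
        finally have "\<bar>len \<sigma> ?n - v * real ?n\<bar> < e * real ?n" .
        also have "\<dots> \<le> e * (real l * (ren.mT + 1))" using b e by (intro mult_left_mono) auto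
        also have "\<dots> = real l * (d / 2)" using e(2) by (metis mult.left_commute)
        finally have c: "\<bar>len \<sigma> ?n - v * real ?n\<bar> < real l * (d / 2)" .
        have "len \<sigma> ?n = ren.W l \<sigma> + v * real ?n + 1" using W_eq[OF Om, of l 0] by simp
        then have w: "\<bar>ren.W l \<sigma>\<bar> < real l * (d / 2) + 1" using c by linarith
        \<comment> \<open>The three estimates together give
          \<open>l * (2 * d) < l * d + l * d / 2 + 1\<close>, impossible once
          \<open>2 < l * d\<close>.\<close>
        have "\<bar>real l * ?e\<bar> = real l * (2 * d)" by (simp add: d_def abs_mult)
        then have "real l * (2 * d) < real l * d + (real l * (d / 2) + 1)" using a w by linarith
        then have "real l * d < 2" by (simp add: algebra_simps)
        moreover have "2 < real l * d" using l d by (simp add: pos_divide_less_eq)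
        ultimately show False by simp
      qed
    qed
    have U: "?A l \<union> (?B l \<union> ?C l) \<in> sets nu" by (intro sets.Un Am Bm Cm)
    have "1 = measure nu (?A l \<union> (?B l \<union> ?C l))" using ae ren.prob_eq_1[OF U] by metis
    also have "\<dots> \<le> measure nu (?A l) + measure nu (?B l \<union> ?C l)" by (rule measure_Un_le) (use Am Bm Cm in auto)
    also have "measure nu (?B l \<union> ?C l) \<le> measure nu (?B l) + measure nu (?C l)" by (rule measure_Un_le) (use Bm Cm in auto)
    finally show ?thesis using A[OF l(1)] B[OF l(1)] by linarith
  qed
  have "(\<lambda>l. ?vY / d\<^sup>2 / real l + ?vT / real l + measure nu (?C l)) \<longlonglongrightarrow> 0 + 0 + 0"
    by (intro tendsto_add lim_const_over_n speed_uniform e)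
  then have "eventually (\<lambda>l. ?vY / d\<^sup>2 / real l + ?vT / real l + measure nu (?C l) < 1) sequentially"
    by (intro order_tendstoD(2)) auto
  moreover have "eventually (\<lambda>l. 2 / d < real l) sequentially"
    by (simp add: filterlim_real_sequentially[unfolded filterlim_at_top_dense])
  ultimately have "eventually (\<lambda>l::nat. False) sequentially"
    using eventually_gt_at_top[of 0]
  proof eventually_elim
    case (elim l)
    then show ?case using big[of l] by linarith
  qed
  then show False by simp
qed

lemma seg_prob_pos:
  assumes g: "goodseg \<eta>" and s: "set \<eta> \<subseteq> S"
  shows "0 < measure nu {\<sigma>. rseg \<sigma> = \<eta>}"
proof -
  have "measure nu {\<sigma>. rseg \<sigma> = \<eta>} = measure (Aw [s0]) {\<sigma>. stake (length \<eta>) \<sigma> = \<eta>}"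
    using nu_seg[OF UNIV_SS, of \<eta>] g ren.prob_space by simp
  also have "\<dots> = (\<integral>\<omega>. wt \<omega> [s0] \<eta> \<partial>E)" by (rule Aw_stake) (use s in auto)
  also have "\<epsilon> ^ length \<eta> = (\<integral>\<omega>. \<epsilon> ^ length \<eta> \<partial>E)" by (simp add: env.prob_space)
  then have "\<epsilon> ^ length \<eta> \<le> (\<integral>\<omega>. wt \<omega> [s0] \<eta> \<partial>E)"
  proof (rule ssubst)
    show "(\<integral>\<omega>. \<epsilon> ^ length \<eta> \<partial>E) \<le> (\<integral>\<omega>. wt \<omega> [s0] \<eta> \<partial>E)"
    proof (rule integral_mono_AE)
      show "AE \<omega> in E. \<epsilon> ^ length \<eta> \<le> wt \<omega> [s0] \<eta>"
        using AE_good by eventually_elim (rule wt_bounds(1), use s in auto)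
    qed (use s in \<open>auto intro: wt_integrable\<close>)
  qed
  moreover have "0 < \<epsilon> ^ length \<eta>" using eps_pos by simp
  ultimately show ?thesis by linarith
qed

text \<open>Otherwise the reward of every segment is zero; but there are two segments that climb equally high
  in different times.\<close>

lemma reward_var: "0 < ren.vY"
proof (rule ccontr)
  assume nv: "\<not> 0 < ren.vY"
  obtain a where a: "a \<in> S" "a \<noteq> linv s0" "a \<noteq> s0" using S_avoid2 by blast
  have s0a: "s0 \<noteq> linv a" using a(2) linv_eq_iff by metis
  \<comment> \<open>Both climb from \<open>[s0]\<close> to \<open>[s0, a, s0]\<close>, but
    \<open>?q\<close> first steps to \<open>[a, s0]\<close> and back. No intermediate time looks
    like a regeneration, since \<open>a \<noteq> s0\<close> and the starting vertex is not new. The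
    rewards \<open>2 - 2 * v\<close> and \<open>2 - 4 * v\<close> cannot both vanish.\<close>
  let ?p = "[a, s0]" and ?q = "[a, linv a, a, s0]"
  have l1: "lmul a [s0] = [a, s0]" "lmul s0 [a, s0] = [s0, a, s0]" "lmul (linv a) [a, s0] = [s0]"
    using s0a a(2) by auto
  have rp: "run [s0] [a] = [a, s0]" "run [s0] ?p = [s0, a, s0]" by (simp_all add: l1 del: lmul.simps)
  have rq: "run [s0] [a, linv a] = [s0]" "run [s0] [a, linv a, a] = [a, s0]" "run [s0] ?q = [s0, a, s0]"
    by (simp_all add: l1 del: lmul.simps)
  have nf: "\<not> fresh [s0] [a, linv a]"
    unfolding fresh_def rq by (auto intro!: exI[of _ 0])
  have gp: "goodseg ?p"
  proof -
    have tk: "take m ?p = (if m = 0 then [] else if m = 1 then [a] else ?p)" for m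
      by (cases m; cases "m - 1") (auto simp: numeral_2_eq_2)
    have f: "fresh [s0] ?p" unfolding fresh_def rp(2) tk
      by (auto simp: l1 less_Suc_eq simp del: lmul.simps dest: suffix_length_le)
    have np: "\<not> prereg [s0] ?p m" if "1 \<le> m" "m < 2" for m
    proof -
      have "m = 1" using that by simp
      then show ?thesis unfolding prereg_def tk using a(3) by (simp add: l1 del: lmul.simps)
    qed
    have nz: "run [s0] (take m ?p) \<noteq> []" for m unfolding tk by (simp add: l1 del: lmul.simps)
    show ?thesis unfolding goodseg_def regpath_def using f np nz rp(2) by (auto simp: numeral_2_eq_2)
  qed
  have gq: "goodseg ?q"
  proof -
    have tk: "take m ?q = (if m = 0 then [] else if m = 1 then [a] else if m = 2 then [a, linv a] else if m = 3 then [a, linv a, a] else ?q)" for m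
      by (cases m; cases "m - 1"; cases "m - 2"; cases "m - 3") (auto simp: eval_nat_numeral)
    have f: "fresh [s0] ?q" unfolding fresh_def rq(3) tk
      by (auto simp: l1 simp del: lmul.simps dest: suffix_length_le)
    have np: "\<not> prereg [s0] ?q m" if "1 \<le> m" "m < 4" for m
    proof -
      have "m = 1 \<or> m = 2 \<or> m = 3" using that by arith
      then consider "m = 1" | "m = 2" | "m = 3" by blast
      then show ?thesis
      proof cases
        case 1
        then show ?thesis unfolding prereg_def tk using a(3) by (simp add: l1 del: lmul.simps)
      next
        case 2
        then show ?thesis unfolding prereg_def tk using nf by simp
      next
        case 3
        then show ?thesis unfolding prereg_def tk using a(3) by (simp add: l1 del: lmul.simps)
      qed
    qed
    have nz: "run [s0] (take m ?q) \<noteq> []" for m unfolding tk by (simp add: l1 del: lmul.simps)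
    show ?thesis unfolding goodseg_def regpath_def using f np nz rq(3) by (auto simp: eval_nat_numeral)
  qed
  have "0 \<le> ren.vY" unfolding ren.vY_def by (rule integral_nonneg_AE) simp
  then have "(\<integral>\<sigma>. (rewY (rseg \<sigma>))\<^sup>2 \<partial>nu) = 0" using nv unfolding ren.vY_def by linarith
  then have ae: "AE \<sigma> in nu. rewY (rseg \<sigma>) = 0"
    using integral_nonneg_eq_0_iff_AE[OF ren.Y_sq] by simp
  have z: "rewY \<eta> = 0" if g: "goodseg \<eta>" "set \<eta> \<subseteq> S" for \<eta>
  proof (rule ccontr)
    assume n: "rewY \<eta> \<noteq> 0"
    have m: "{\<sigma>. rseg \<sigma> = \<eta>} \<in> sets nu" using ren.seg_sets[of \<eta>] by simp
    have "AE \<sigma> in nu. \<sigma> \<notin> {\<sigma>. rseg \<sigma> = \<eta>}" using ae by eventually_elim (use n in auto)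
    then have "measure nu {\<sigma>. rseg \<sigma> = \<eta>} = 0" using ren.prob_eq_0[OF m] by simp
    then show False using seg_prob_pos[OF g] by simp
  qed
  have "rewY ?p = 2 - 2 * v" unfolding rewY_def lvlL_def durT_def rp by simp
  moreover have "rewY ?q = 2 - 4 * v" unfolding rewY_def lvlL_def durT_def rq by simp
  moreover have "rewY ?p = 0" "rewY ?q = 0" using z[OF gp] z[OF gq] a(1) by auto
  ultimately show False using v_pos by simp
qed

section \<open>The limit theorem under \<open>nu\<close>, from the root, and for the annealed
  walk\<close>

definition sdev :: real where "sdev = sqrt (ren.vY / ren.mT)"

lemma sdev_pos: "0 < sdev"
  using reward_var ren.mT_ge by (simp add: sdev_def)

definition VZ :: "nat \<Rightarrow> letter stream \<Rightarrow> real" where "VZ n = ren.Zn (ren.aN n)"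

lemma VZ_measurable: "VZ n \<in> borel_measurable nu"
  unfolding VZ_def by (rule ren.Zn_measurable[OF reward_mean reward_var])

lemma VZ_clt: "weak_conv_m (\<lambda>n. distr nu borel (VZ n)) std_normal_distribution"
  unfolding VZ_def
  using weak_conv_m_compose[OF ren.Zn_clt[OF reward_mean reward_var] ren.aN_at_top[OF reward_mean reward_var]] .

lemma close_nu:
  assumes eta: "0 < \<eta>"
  shows "(\<lambda>n. measure nu {\<sigma>. \<eta> < \<bar>(len \<sigma> n - v * real n) / sqrt (real n) - sdev * VZ n \<sigma>\<bar>}) \<longlonglongrightarrow> 0"
proof -
  let ?A = "\<lambda>n. {\<sigma> \<in> space nu. \<eta> / 2 < \<bar>ren.W (ren.N n \<sigma>) \<sigma> / sqrt (real n) - sqrt (ren.vY / ren.mT) * ren.Zn (ren.aN n) \<sigma>\<bar>}"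
  let ?\<eta> = "\<eta> / 2 / (3 + 2 * v)"
  let ?B = "\<lambda>n. {\<sigma> \<in> space nu. \<exists>j\<le>n. ?\<eta> * sqrt (real n) < real (durT (ren.segn j \<sigma>))}"
  have v3: "0 < 3 + 2 * v" using v_pos by simp
  have e: "0 < \<eta> / 2" "0 < ?\<eta>" using eta v3 by auto
  note [measurable] = VZ_measurable ren.WN_measurable
  have Am: "?A n \<in> sets nu" for n using VZ_measurable[of n] unfolding VZ_def by measurable
  have Bm: "?B n \<in> sets nu" for n by measurable
  have le: "measure nu {\<sigma>. \<eta> < \<bar>(len \<sigma> n - v * real n) / sqrt (real n) - sdev * VZ n \<sigma>\<bar>} \<le> measure nu (?A n) + measure nu (?B n)"
    if n: "0 < n" for n
  proof -
    have "measure nu {\<sigma>. \<eta> < \<bar>(len \<sigma> n - v * real n) / sqrt (real n) - sdev * VZ n \<sigma>\<bar>} \<le> measure nu (?A n \<union> ?B n)"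
    proof (rule ren.finite_measure_mono_AE)
      show "AE \<sigma> in nu. \<sigma> \<in> {\<sigma>. \<eta> < \<bar>(len \<sigma> n - v * real n) / sqrt (real n) - sdev * VZ n \<sigma>\<bar>} \<longrightarrow> \<sigma> \<in> ?A n \<union> ?B n"
        using AE_iter_Om
      proof eventually_elim
        case (elim \<sigma>)
        then have Om: "\<And>j. (rnxt ^^ j) \<sigma> \<in> Om" by blast
        obtain j where j: "j \<le> n" "\<bar>len \<sigma> n - v * real n - ren.W (ren.N n \<sigma>) \<sigma>\<bar> \<le> (3 + 2 * v) * real (durT (ren.segn j \<sigma>))"
          using len_approx[OF Om] by blast
        show ?case
        proof (intro impI, rule ccontr)
          assume a: "\<sigma> \<in> {\<sigma>. \<eta> < \<bar>(len \<sigma> n - v * real n) / sqrt (real n) - sdev * VZ n \<sigma>\<bar>}" and nn: "\<sigma> \<notin> ?A n \<union> ?B n"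
          let ?x = "len \<sigma> n - v * real n" and ?w = "ren.W (ren.N n \<sigma>) \<sigma>"
          have 1: "\<bar>?w / sqrt (real n) - sdev * VZ n \<sigma>\<bar> \<le> \<eta> / 2" using nn by (auto simp: sdev_def VZ_def not_less)
          have "real (durT (ren.segn j \<sigma>)) \<le> ?\<eta> * sqrt (real n)" using nn j(1) by (auto simp: not_less)
          then have "(3 + 2 * v) * real (durT (ren.segn j \<sigma>)) \<le> (3 + 2 * v) * (?\<eta> * sqrt (real n))" using v3 by (intro mult_left_mono) auto
          also have "\<dots> = \<eta> / 2 * sqrt (real n)"
          proof -
            have "c * (a / c * b) = a * b" if "c \<noteq> 0" for a b c :: real using that by simp
            then show ?thesis using v3 by (metis less_irrefl)
          qed
          finally have "\<bar>?x - ?w\<bar> \<le> \<eta> / 2 * sqrt (real n)" using j(2) by linarith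
          then have "\<bar>?x - ?w\<bar> / sqrt (real n) \<le> \<eta> / 2" using n by (simp add: pos_divide_le_eq)
          then have "\<bar>?x / sqrt (real n) - ?w / sqrt (real n)\<bar> \<le> \<eta> / 2" by (simp add: diff_divide_distrib[symmetric] abs_divide)
          moreover have "\<eta> < \<bar>?x / sqrt (real n) - sdev * VZ n \<sigma>\<bar>" using a by simp
          ultimately show False using 1 by linarith
        qed
      qed
    qed (use Am Bm in auto)
    also have "\<dots> \<le> measure nu (?A n) + measure nu (?B n)" by (rule measure_Un_le) (use Am Bm in auto)
    finally show ?thesis .
  qed
  have lim: "(\<lambda>n. measure nu (?A n) + measure nu (?B n)) \<longlonglongrightarrow> 0"
    using tendsto_add[OF ren.renewal_clt[OF reward_mean reward_var e(1)] ren.max_T[OF e(2)]] by simp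
  have "eventually (\<lambda>n. norm (measure nu {\<sigma>. \<eta> < \<bar>(len \<sigma> n - v * real n) / sqrt (real n) - sdev * VZ n \<sigma>\<bar>}) \<le> measure nu (?A n) + measure nu (?B n)) sequentially"
    using eventually_gt_at_top[of 0] by eventually_elim (use le in simp)
  then show ?thesis by (rule Lim_null_comparison[OF _ lim])
qed

definition Xn :: "letter stream \<Rightarrow> nat \<Rightarrow> real" where
  "Xn \<sigma> n = real (length (run [] (stake n \<sigma>)))"

lemma Xn_len:
  assumes ex: "\<exists>n\<ge>0. Reg [] \<sigma> n"
  shows "\<bar>Xn \<sigma> n - len (sh \<sigma>) n\<bar> \<le> 2 * real (Rtime [] 0 \<sigma>) + 1"
proof -
  let ?\<tau> = "Rtime [] 0 \<sigma>"
  have Xle: "0 \<le> Xn \<sigma> m" "Xn \<sigma> m \<le> real m" for m using length_run_le[of "[]" "stake m \<sigma>"] by (simp_all add: Xn_def)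
  show ?thesis
  proof (cases "?\<tau> \<le> n")
    case True
    have "Xn \<sigma> (?\<tau> + (n - ?\<tau>)) = Xn \<sigma> ?\<tau> - 1 + len (sh \<sigma>) (n - ?\<tau>)" unfolding Xn_def by (rule root_len[OF ex])
    moreover have "\<bar>len (sh \<sigma>) ((n - ?\<tau>) + ?\<tau>) - len (sh \<sigma>) (n - ?\<tau>)\<bar> \<le> real ?\<tau>" by (rule len_Lipschitz)
    ultimately show ?thesis using True Xle[of ?\<tau>] by simp
  next
    case False
    then show ?thesis using Xle[of n] len_bounds[of "sh \<sigma>" n] by simp
  qed
qed

lemma Xn_measurable: "(\<lambda>\<sigma>. Xn \<sigma> n) \<in> borel_measurable SS"
  unfolding Xn_def by (rule run_fun_measurable)

text \<open>Cutting off the path before the first regeneration changes the height at time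
  \<open>n\<close> by at most a multiple of a finite random time, which vanishes in probability
  after division by \<open>sqrt n\<close>.\<close>

lemma close_root:
  assumes eta: "0 < \<eta>"
  shows "(\<lambda>n. measure (Aw []) {\<sigma> \<in> space (Aw []). \<eta> < \<bar>sqrt (real n) * (Xn \<sigma> n / real n - v) - sdev * VZ n (sh \<sigma>)\<bar>}) \<longlonglongrightarrow> 0"
proof -
  interpret A: prob_space "Aw []" by (rule prob_space_Aw) simp
  let ?A = "\<lambda>n. {\<sigma>. \<eta> / 2 < \<bar>(len \<sigma> n - v * real n) / sqrt (real n) - sdev * VZ n \<sigma>\<bar>}"
  let ?A' = "\<lambda>n. {\<sigma>. sh \<sigma> \<in> ?A n}"
  let ?B = "\<lambda>n. {\<sigma>. \<eta> / 2 * sqrt (real n) < 2 * real (Rtime [] 0 \<sigma>) + 1}"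
  have e: "0 < \<eta> / 2" using eta by simp
  have Am: "?A n \<in> sets nu" for n
  proof -
    have [measurable]: "(\<lambda>\<sigma>. len \<sigma> n) \<in> borel_measurable nu"
      unfolding len_def measurable_cong_sets[OF sets_nu refl] by (rule run_fun_measurable)
    note [measurable] = VZ_measurable
    have "{\<sigma> \<in> space nu. \<eta> / 2 < \<bar>(len \<sigma> n - v * real n) / sqrt (real n) - sdev * VZ n \<sigma>\<bar>} \<in> sets nu" by measurable
    then show ?thesis by simp
  qed
  have A': "?A' n \<in> sets (Aw [])" "measure (Aw []) (?A' n) = measure nu (?A n)" for n
  proof -
    show "?A' n \<in> sets (Aw [])" using measurable_sets[OF sh_measurable Am[of n]] by (simp add: vimage_def)
    have "measure nu (?A n) = measure (distr (Aw []) nu sh) (?A n)" by (simp add: distr_sh)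
    also have "\<dots> = measure (Aw []) (?A' n)" by (subst measure_distr[OF sh_measurable Am]) (simp add: vimage_def)
    finally show "measure (Aw []) (?A' n) = measure nu (?A n)" by simp
  qed
  have Bm: "?B n \<in> sets (Aw [])" for n
  proof -
    have "(\<lambda>\<sigma>. real (Rtime [] 0 \<sigma>)) \<in> borel_measurable SS" by (rule measurable_compose[OF Rtime_measurable]) simp
    note [measurable] = this
    have "{\<sigma> \<in> space SS. \<eta> / 2 * sqrt (real n) < 2 * real (Rtime [] 0 \<sigma>) + 1} \<in> sets SS" by measurable
    then show ?thesis by simp
  qed
  have Blim: "(\<lambda>n. measure (Aw []) (?B n)) \<longlonglongrightarrow> 0"
  proof -
    have "(\<lambda>n. measure (Aw []) (?B n)) \<longlonglongrightarrow> measure (Aw []) (\<Inter>n. ?B n)"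
    proof (rule A.finite_Lim_measure_decseq)
      show "decseq ?B"
        unfolding decseq_def
      proof (intro allI impI subsetI)
        fix m n \<sigma> assume "m \<le> n" "\<sigma> \<in> ?B n"
        moreover have "\<eta> / 2 * sqrt (real m) \<le> \<eta> / 2 * sqrt (real n)" using eta \<open>m \<le> n\<close> by (intro mult_left_mono) auto
        ultimately show "\<sigma> \<in> ?B m" by auto
      qed
    qed (use Bm in auto)
    moreover have "(\<Inter>n. ?B n) = {}"
    proof (rule ccontr)
      assume "(\<Inter>n. ?B n) \<noteq> {}"
      then obtain \<sigma> where s: "\<And>n. \<eta> / 2 * sqrt (real n) < 2 * real (Rtime [] 0 \<sigma>) + 1" by auto
      have "filterlim (\<lambda>n. \<eta> / 2 * sqrt (real n)) at_top sequentially" using eta by real_asymp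
      then have "eventually (\<lambda>n. 2 * real (Rtime [] 0 \<sigma>) + 1 \<le> \<eta> / 2 * sqrt (real n)) sequentially"
        unfolding filterlim_at_top by blast
      then obtain n where "2 * real (Rtime [] 0 \<sigma>) + 1 \<le> \<eta> / 2 * sqrt (real n)" by (auto simp: eventually_sequentially)
      then show False using s[of n] by simp
    qed
    ultimately show ?thesis by simp
  qed
  have le: "measure (Aw []) {\<sigma> \<in> space (Aw []). \<eta> < \<bar>sqrt (real n) * (Xn \<sigma> n / real n - v) - sdev * VZ n (sh \<sigma>)\<bar>} \<le> measure nu (?A n) + measure (Aw []) (?B n)"
    if n: "0 < n" for n
  proof -
    have "measure (Aw []) {\<sigma> \<in> space (Aw []). \<eta> < \<bar>sqrt (real n) * (Xn \<sigma> n / real n - v) - sdev * VZ n (sh \<sigma>)\<bar>} \<le> measure (Aw []) (?A' n \<union> ?B n)"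
    proof (rule A.finite_measure_mono_AE)
      show "AE \<sigma> in Aw []. \<sigma> \<in> {\<sigma> \<in> space (Aw []). \<eta> < \<bar>sqrt (real n) * (Xn \<sigma> n / real n - v) - sdev * VZ n (sh \<sigma>)\<bar>} \<longrightarrow> \<sigma> \<in> ?A' n \<union> ?B n"
        using AE_Reg_root
      proof eventually_elim
        case (elim \<sigma>)
        show ?case
        proof (intro impI, rule ccontr)
          assume a: "\<sigma> \<in> {\<sigma> \<in> space (Aw []). \<eta> < \<bar>sqrt (real n) * (Xn \<sigma> n / real n - v) - sdev * VZ n (sh \<sigma>)\<bar>}" and nn: "\<sigma> \<notin> ?A' n \<union> ?B n"
          let ?l = "len (sh \<sigma>) n" and ?s = "sqrt (real n)"
          have sn: "0 < ?s" "real n = ?s * ?s" using n by auto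
          have eq: "?s * (Xn \<sigma> n / real n - v) = (Xn \<sigma> n - v * real n) / ?s"
            using sn(1) by (subst (1 3) sn(2)) (simp add: field_simps)
          have 1: "\<bar>(?l - v * real n) / ?s - sdev * VZ n (sh \<sigma>)\<bar> \<le> \<eta> / 2" using nn by (auto simp: not_less)
          have "\<bar>Xn \<sigma> n - ?l\<bar> \<le> \<eta> / 2 * ?s" using Xn_len[OF elim, of n] nn by auto
          then have "\<bar>Xn \<sigma> n - ?l\<bar> / ?s \<le> \<eta> / 2" using sn by (simp add: pos_divide_le_eq)
          then have "\<bar>(Xn \<sigma> n - v * real n) / ?s - (?l - v * real n) / ?s\<bar> \<le> \<eta> / 2"
            using sn(1) by (simp add: diff_divide_distrib[symmetric] abs_divide)
          moreover have "\<eta> < \<bar>(Xn \<sigma> n - v * real n) / ?s - sdev * VZ n (sh \<sigma>)\<bar>" using a unfolding mem_Collect_eq eq by blast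
          ultimately show False using 1 by linarith
        qed
      qed
    qed (use A' Bm in auto)
    also have "\<dots> \<le> measure (Aw []) (?A' n) + measure (Aw []) (?B n)" by (rule measure_Un_le) (use A' Bm in auto)
    finally show ?thesis unfolding A'(2) .
  qed
  have lim: "(\<lambda>n. measure nu (?A n) + measure (Aw []) (?B n)) \<longlonglongrightarrow> 0"
    using tendsto_add[OF close_nu[OF e] Blim] by simp
  have "eventually (\<lambda>n. norm (measure (Aw []) {\<sigma> \<in> space (Aw []). \<eta> < \<bar>sqrt (real n) * (Xn \<sigma> n / real n - v) - sdev * VZ n (sh \<sigma>)\<bar>}) \<le> measure nu (?A n) + measure (Aw []) (?B n)) sequentially"
    using eventually_gt_at_top[of 0] by eventually_elim (use le in simp)
  then show ?thesis by (rule Lim_null_comparison[OF _ lim])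
qed

theorem clt_Aw:
  "weak_conv_m (\<lambda>n. distr (Aw []) borel (\<lambda>\<sigma>. sqrt (real n) * (Xn \<sigma> n / real n - v))) (density lborel (normal_density 0 sdev))"
proof -
  interpret A: prob_space "Aw []" by (rule prob_space_Aw) simp
  have Vs: "(\<lambda>\<sigma>. VZ n (sh \<sigma>)) \<in> borel_measurable (Aw [])" for n
    by (rule measurable_compose[OF sh_measurable VZ_measurable])
  have d: "distr (Aw []) borel (\<lambda>\<sigma>. VZ n (sh \<sigma>)) = distr nu borel (VZ n)" for n
  proof -
    have "distr nu borel (VZ n) = distr (distr (Aw []) nu sh) borel (VZ n)" by (simp add: distr_sh)
    also have "\<dots> = distr (Aw []) borel (\<lambda>\<sigma>. VZ n (sh \<sigma>))"
      by (subst distr_distr[OF VZ_measurable sh_measurable]) (simp add: comp_def)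
    finally show ?thesis by simp
  qed
  have conv: "weak_conv_m (\<lambda>n. distr (Aw []) borel (\<lambda>\<sigma>. sdev * VZ n (sh \<sigma>))) (density lborel (normal_density 0 sdev))"
    by (rule A.scaled_clt[OF Vs _ sdev_pos]) (unfold d, rule VZ_clt)
  have Xm: "(\<lambda>\<sigma>. sqrt (real n) * (Xn \<sigma> n / real n - v)) \<in> borel_measurable (Aw [])" for n
  proof -
    have [measurable]: "(\<lambda>\<sigma>. Xn \<sigma> n) \<in> borel_measurable (Aw [])"
      unfolding measurable_cong_sets[OF sets_Aw refl] by (rule Xn_measurable)
    show ?thesis by measurable
  qed
  show ?thesis
  proof (rule A.slutsky[OF _ Xm _ conv])
    show "(\<lambda>\<sigma>. sdev * VZ n (sh \<sigma>)) \<in> borel_measurable (Aw [])" for n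
      using Vs[of n] by measurable
    interpret std: prob_space std_normal_distribution by (rule prob_space_normal_density) simp
    show "real_distribution (density lborel (normal_density 0 sdev))"
      unfolding scaled_normal[OF sdev_pos] by (rule std.real_distribution_distr) simp
  qed (rule close_root)
qed

lemma clt_annealed:
  "weak_conv_m (\<lambda>n. distr (annealed k r \<mu>) borel (\<lambda>z. sqrt (real n) * (real (length (walk k r (fst z) (snd z) n)) / real n - v)))
     (density lborel (normal_density 0 sdev))"
proof -
  have "distr (annealed k r \<mu>) borel (\<lambda>z. sqrt (real n) * (real (length (walk k r (fst z) (snd z) n)) / real n - v))
     = distr (Aw []) borel (\<lambda>\<sigma>. sqrt (real n) * (Xn \<sigma> n / real n - v))" for n
  proof -
    have m: "(\<lambda>\<sigma>. sqrt (real n) * (Xn \<sigma> n / real n - v)) \<in> borel_measurable SS"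
      using Xn_measurable[of n] by measurable
    show ?thesis
      unfolding Aw_def annealed_def
      by (subst distr_distr[OF m steps_measurable[OF Nil_Gset]]) (simp add: comp_def Xn_def run_steps gwalk_Nil)
  qed
  then show ?thesis using clt_Aw by simp
qed

end

theorem theorem2:
  fixes k r :: nat and \<mu> :: "(letter \<Rightarrow> real) measure" and \<epsilon> v :: real
  assumes d3: "2 * k + r \<ge> 3"
    and mu_prob: "prob_space \<mu>"
    and mu_sets: "sets \<mu> = sets (PiM (Sgen k r) (\<lambda>_. borel))"
    and mu_stoch: "AE p in \<mu>. (\<forall>s\<in>Sgen k r. 0 \<le> p s) \<and> (\<Sum>s\<in>Sgen k r. p s) = 1"
    and eps_pos: "\<epsilon> > 0"
    and E2: "AE \<omega> in env_law k r \<mu>. \<forall>s\<in>Sgen k r. \<omega> [] s > \<epsilon>"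
    and v_pos: "v > 0"
    and speed: "AE z in annealed k r \<mu>.
                  (\<lambda>n. real (length (walk k r (fst z) (snd z) n)) / real n) \<longlonglongrightarrow> v"
  shows "\<exists>\<sigma>2 > 0. weak_conv_m
           (\<lambda>n. distr (annealed k r \<mu>) borel
                  (\<lambda>z. sqrt (real n) * (real (length (walk k r (fst z) (snd z) n)) / real n - v)))
           (density lborel (normal_density 0 (sqrt \<sigma>2)))"
proof -
  have mc: "(\<lambda>p. p s) \<in> borel_measurable \<mu>" if "s \<in> Sgen k r" for s
    by (subst measurable_cong_sets[OF mu_sets refl]) (rule measurable_component_singleton[OF that])
  \<comment> \<open>\<open>E2\<close> concerns the environment at the root, whose marginal law is
    \<mu>; ellipticity passes to \<mu> and thereby to every vertex.\<close>
  have dist: "distr (env_law k r \<mu>) \<mu> (\<lambda>\<omega>. \<omega> []) = \<mu>"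
    unfolding env_law_def by (rule distr_PiM_component) (auto intro: mu_prob)
  have cm: "(\<lambda>\<omega>. \<omega> []) \<in> measurable (env_law k r \<mu>) \<mu>"
    unfolding env_law_def by (rule measurable_component_singleton) simp
  have pm: "{p \<in> space \<mu>. \<forall>s\<in>Sgen k r. \<epsilon> < p s} \<in> sets \<mu>"
    using mc by (intro sets.sets_Collect_finite_All) (auto intro: borel_measurable_less)
  have "AE p in distr (env_law k r \<mu>) \<mu> (\<lambda>\<omega>. \<omega> []). \<forall>s\<in>Sgen k r. \<epsilon> < p s"
    by (subst AE_distr_iff[OF cm pm]) (use E2 in simp)
  then have ell: "AE p in \<mu>. \<forall>s\<in>Sgen k r. \<epsilon> < p s" unfolding dist .
  interpret rwre_speed k r \<mu> \<epsilon> v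
    by (intro rwre_speed.intro rwre.intro rwre_speed_axioms.intro) (fact d3 mu_prob mu_sets mu_stoch eps_pos ell v_pos speed)+
  have "sqrt (sdev\<^sup>2) = sdev" using sdev_pos by simp
  then show ?thesis using clt_annealed sdev_pos by (intro exI[of _ "sdev\<^sup>2"]) simp
qed

end
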